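(* Let $0<\alpha<0.3$. For every integer $n\ge1$ and every $\sigma>0$, the interval $\mathtt{CI}_{m,\alpha}$ (constructed in the context) is a $(1-\alpha)$-level confidence interval for the minimum, i.e. $\mathbb P_f(M(f)\in\mathtt{CI}_{m,\alpha})\ge1-\alpha$ for all $f\in\mathcal F$, and its expected length satisfies $$\mathbb E_fL(\mathtt{CI}_{m,\alpha})\le C_{4,\alpha}\,\tilde L_{m,\alpha,n}(\sigma;f)\qquad\text{for all } f\in\mathcal F,$$ where $C_{4,\alpha}$ is a constant depending only on $\alpha$.
   Context: $\Phi$ is the standard normal cdf, $z_\beta=\Phi^{-1}(1-\beta)$ (for a single subscript $\beta\in(0,1)$), $a\wedge b=\min\{a,b\}$. $\mathcal F$ is the collection of convex functions $f:[0,1]\to\mathbb R$ with a unique minimizer $Z(f)=\arg\min_{0\le t\le1}f(t)$; $M(f)=f(Z(f))$ is the minimum value. Nonparametric regression model: one observes $y_i=f(x_i)+\sigma\xi_i$, $i=0,1,\dots,n$, with $x_i=i/n$, $\xi_i$ i.i.d. $N(0,1)$ and $\sigma>0$ known; $\mathbb P_f,\mathbb E_f$ are probability and expectation under $f$ (including auxiliary randomness). $L(CI)$ is the length of an interval $CI$ (possibly $+\infty$). Benchmark: $\tilde L_{m,\alpha,n}(\sigma;f)=\sup_{g\in\mathcal F}\inf_{CI\in\mathcal I_{m,\alpha,n}(\{f,g\})}\mathbb E_fL(CI)$ (the value $+\infty$ is allowed), where $\mathcal I_{m,\alpha,n}(\{f,g\})$ is the collection of confidence intervals based on $y_0,\dots,y_n$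 that contain $M(h)$ with probability at least $1-\alpha$ under $h$, for both $h=f$ and $h=g$. Construction of $\mathtt{CI}_{m,\alpha}$. Data splitting: let $z_{1,0},\dots,z_{1,n},z_{2,0},\dots,z_{2,n}$ be i.i.d. $N(0,1)$, independent of the data. For $i=0,\dots,n$ set $y_{l,i}=y_i+\frac{\sqrt2}{2}\sigma z_{1,i}+\frac{\sqrt6}{2}\sigma z_{2,i}$, $y_{s,i}=y_i+\frac{\sqrt2}{2}\sigma z_{1,i}-\frac{\sqrt6}{2}\sigma z_{2,i}$, $y_{e,i}=y_i-\sqrt2\,\sigma z_{1,i}$; set $y_{l,i}=y_{s,i}=y_{e,i}=+\infty$ for $i\notin\{0,\dots,n\}$. Blocks: let $J=\lfloor\log_2(n+1)\rfloor$. For $0\le j\le J$ the $i$-th block at level $j$ is $\{x_{(i-1)2^{J-j}},\dots,x_{i2^{J-j}-1}\}$. For $u\in\{l,s,e\}$ let $Y_{j,i,u}=\sum_{k=(i-1)2^{J-j}}^{i2^{J-j}-1}y_{u,k}$, which is $+\infty$ whenever the block is not entirely contained in the sample, i.e. whenever $i\notin\{1,\dots,\lfloor(n+1)/2^{J-j}\rfloor\}$. Localization: $\hat i_0=1$ and for $j=1,\dots,J$, $\hat i_j=\arg\min Y_{j,i,l}$ over $\max\{2\hat i_{j-1}-2,1\}\le i\le\min\{2\hat i_{j-1}+1,\lfloor(n+1)/2^{J-j}\rfloor\}$. Stopping: $T_j=\min\{Y_{j,\hat i_j+6,s}-Y_{j,\hat i_j+5,s},\ Y_{j,\hat i_j-6,s}-Y_{j,\hat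 i_j-5,s}\}$ (with $+\infty-x=+\infty$ for all $x\le+\infty$), $\tilde\sigma_j^2=6\cdot2^{J-j}\sigma^2$. Let $\check j=\min\{j\in\{0,\dots,J\}:T_j\le2\tilde\sigma_j\}$ if this set is nonempty and $\check j=\infty$ otherwise; $\hat j=\min\{J,\check j\}$. Constants: $K_\beta=\lceil\log\beta/\log\Phi(-2)\rceil$, $\tilde K_\beta=\max\{4,\,2+\lceil\log_2(2+z_{\beta/3})\rceil\}$, and $S_{k,\beta}$ is the $(1-\beta)$ quantile of the maximum of $k$ i.i.d. $N(0,1)$ variables. Let $j_s=\max\{0,\hat j-K_{\alpha/4}-1\}$, $j_l=\min\{J,\hat j+\tilde K_{\alpha/4}\}$, $$I_{lo}=\max\{1,2^{j_l-j_s}(\hat i_{j_s}-5)\},\qquad I_{hi}=\min\{2^{j_l-j_s}(\hat i_{j_s}+4)+1,\ \lceil(n+1)/2^{J-j_l}\rceil\},$$ $$\hat f_1=\min_{I_{lo}\le i\le I_{hi}}\frac1{2^{J-j_l}}Y_{j_l,i,e},\qquad f_{hi}=\hat f_1+S_{I_{hi}-I_{lo}+1,\alpha/4}\frac{\sqrt3\,\sigma}{\sqrt{2^{J-j_l}}}.$$ If $\hat j+\tilde K_{\alpha/4}\le J$: $f_{lo}=\hat f_1-(z_{\alpha/4}+1)\dfrac{\sqrt3\,\sigma}{\sqrt{2^{J-j_l}}}$. If $\hat j+\tilde K_{\alpha/4}>J$: let $H=S_{I_{hi}-I_{lo}+3,\alpha/8}\sqrt3\,\sigma$, and for indices $i$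 define the linear functions $$v_{l,i}(t)=n(y_{e,i}-y_{e,i-1}-2H)(t-x_i)+y_{e,i}-H,\qquad v_{r,i}(t)=n(y_{e,i+2}-y_{e,i+1}+2H)(t-x_{i+1})+y_{e,i+1}-H.$$ Start with $k_l=I_{lo}-1$, $k_r=I_{hi}-2$. If $I_{lo}=1$, set $h(0)=\min_{t\in[0,1/n]}v_{r,0}(t)$ and $k_l=I_{lo}$. If $I_{hi}-1=n$, set $h(n-1)=\min_{t\in[(n-1)/n,1]}v_{l,n-1}(t)$ and $k_r=I_{hi}-3$. For $i=k_l,\dots,k_r$ set $h(i)=\min_{t\in[x_i,x_{i+1}]}\max\{v_{l,i}(t),v_{r,i}(t)\}$. Then $f_{lo}=\min\{h(i):I_{lo}-1\le i\le I_{hi}-2\}\wedge f_{hi}$. (When $n=1$ the functions $v_{r,0},v_{l,0}$ involve the out-of-range value $+\infty$, and $h(0)$ is read as $-\infty$.) The confidence interval is $\mathtt{CI}_{m,\alpha}=[f_{lo},f_{hi}]$. *)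

theory Defs
  imports "HOL-Probability.Probability"
begin

section \<open>Functions, minimum, normal quantiles\<close>

text \<open>Functions on \<open>[0,1]\<close> are represented by total functions whose values outside \<open>[0,1]\<close>
  play no role.\<close>

definition is_minimizer :: "(real \<Rightarrow> real) \<Rightarrow> real \<Rightarrow> bool" where
  "is_minimizer f t \<longleftrightarrow> t \<in> {0..1} \<and> (\<forall>s\<in>{0..1}. f t \<le> f s)"

definition convex_class :: "(real \<Rightarrow> real) set" where
  "convex_class = {f. convex_on {0..1} f \<and> (\<exists>!t. is_minimizer f t)}"

definition minimizer :: "(real \<Rightarrow> real) \<Rightarrow> real" where
  "minimizer f = (THE t. is_minimizer f t)"

definition minimum_value :: "(real \<Rightarrow> real) \<Rightarrow> real" where
  "minimum_value f = f (minimizer f)"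

definition Phi :: "real \<Rightarrow> real" where
  "Phi = cdf std_normal_distribution"

definition z_upper :: "real \<Rightarrow> real" where
  "z_upper \<beta> = inv Phi (1 - \<beta>)"

definition quantile :: "real measure \<Rightarrow> real \<Rightarrow> real" where
  "quantile D p = Inf {x. p \<le> cdf D x}"

definition S_quantile :: "nat \<Rightarrow> real \<Rightarrow> real" where
  "S_quantile k \<beta> =
     quantile (distr (\<Pi>\<^sub>M i\<in>{..<k}. std_normal_distribution) borel (\<lambda>x. Max (x ` {..<k}))) (1 - \<beta>)"

definition K_const :: "real \<Rightarrow> int" where
  "K_const \<beta> = \<lceil>ln \<beta> / ln (Phi (-2))\<rceil>"

definition Kt_const :: "real \<Rightarrow> int" where
  "Kt_const \<beta> = max 4 (2 + \<lceil>log 2 (2 + z_upper (\<beta> / 3))\<rceil>)"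


section \<open>Regression model and benchmark\<close>

text \<open>Observations are indexed by the integers \<open>0, \<dots>, n\<close>; the type \<open>int\<close> is used because the
  construction below also refers to (out-of-range) negative indices.\<close>

definition design :: "nat \<Rightarrow> int \<Rightarrow> real" where
  "design n i = real_of_int i / real n"

definition noise_law :: "nat \<Rightarrow> (int \<Rightarrow> real) measure" where
  "noise_law n = (\<Pi>\<^sub>M i\<in>{0..int n}. std_normal_distribution)"

definition data_law :: "nat \<Rightarrow> real \<Rightarrow> (real \<Rightarrow> real) \<Rightarrow> (int \<Rightarrow> real) measure" where
  "data_law n \<sigma> f = distr (noise_law n) (\<Pi>\<^sub>M i\<in>{0..int n}. borel)
     (\<lambda>\<xi>. \<lambda>i\<in>{0..int n}. f (design n i) + \<sigma> * \<xi> i)"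

text \<open>The joint law of the data and the two auxiliary noise vectors used for data splitting.\<close>

definition joint_law ::
    "nat \<Rightarrow> real \<Rightarrow> (real \<Rightarrow> real) \<Rightarrow> ((int \<Rightarrow> real) \<times> (int \<Rightarrow> real) \<times> (int \<Rightarrow> real)) measure" where
  "joint_law n \<sigma> f = data_law n \<sigma> f \<Otimes>\<^sub>M (noise_law n \<Otimes>\<^sub>M noise_law n)"

text \<open>A random interval is an interval-valued map for which every event \<open>x \<in> CI\<close> is measurable
  (for interval-valued maps this makes the length measurable as well). Intervals may be open,
  closed or unbounded; their length is their Lebesgue measure, with values in \<open>[0,\<infinity>]\<close>.\<close>

definition random_interval :: "'w measure \<Rightarrow> ('w \<Rightarrow> real set) \<Rightarrow> bool" where
  "random_interval P CI \<longleftrightarrow>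
     (\<forall>\<omega>\<in>space P. is_interval (CI \<omega>)) \<and> (\<forall>x. {\<omega>\<in>space P. x \<in> CI \<omega>} \<in> sets P)"

definition confidence_interval :: "real \<Rightarrow> 'w measure \<Rightarrow> real \<Rightarrow> ('w \<Rightarrow> real set) \<Rightarrow> bool" where
  "confidence_interval \<alpha> P m CI \<longleftrightarrow>
     random_interval P CI \<and> measure P {\<omega>\<in>space P. m \<in> CI \<omega>} \<ge> 1 - \<alpha>"

definition expected_length :: "'w measure \<Rightarrow> ('w \<Rightarrow> real set) \<Rightarrow> ennreal" where
  "expected_length P CI = (\<integral>\<^sup>+\<omega>. emeasure lborel (CI \<omega>) \<partial>P)"

definition CI_class ::
    "real \<Rightarrow> nat \<Rightarrow> real \<Rightarrow> (real \<Rightarrow> real) set \<Rightarrow> ((int \<Rightarrow> real) \<Rightarrow> real set) set" where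
  "CI_class \<alpha> n \<sigma> G =
     {CI. \<forall>h\<in>G. confidence_interval \<alpha> (data_law n \<sigma> h) (minimum_value h) CI}"

definition benchmark :: "real \<Rightarrow> nat \<Rightarrow> real \<Rightarrow> (real \<Rightarrow> real) \<Rightarrow> ennreal" where
  "benchmark \<alpha> n \<sigma> f =
     (SUP g\<in>convex_class. INF CI\<in>CI_class \<alpha> n \<sigma> {f, g}. expected_length (data_law n \<sigma> f) CI)"


section \<open>Data splitting, localization and stopping\<close>

definition copy_l :: "real \<Rightarrow> (int \<Rightarrow> real) \<Rightarrow> (int \<Rightarrow> real) \<Rightarrow> (int \<Rightarrow> real) \<Rightarrow> int \<Rightarrow> real" where
  "copy_l \<sigma> y z1 z2 i = y i + sqrt 2 / 2 * \<sigma> * z1 i + sqrt 6 / 2 * \<sigma> * z2 i"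

definition copy_s :: "real \<Rightarrow> (int \<Rightarrow> real) \<Rightarrow> (int \<Rightarrow> real) \<Rightarrow> (int \<Rightarrow> real) \<Rightarrow> int \<Rightarrow> real" where
  "copy_s \<sigma> y z1 z2 i = y i + sqrt 2 / 2 * \<sigma> * z1 i - sqrt 6 / 2 * \<sigma> * z2 i"

definition copy_e :: "real \<Rightarrow> (int \<Rightarrow> real) \<Rightarrow> (int \<Rightarrow> real) \<Rightarrow> int \<Rightarrow> real" where
  "copy_e \<sigma> y z1 i = y i - sqrt 2 * \<sigma> * z1 i"

definition top_level :: "nat \<Rightarrow> nat" where
  "top_level n = nat \<lfloor>log 2 (real (n + 1))\<rfloor>"

definition extend :: "nat \<Rightarrow> (int \<Rightarrow> real) \<Rightarrow> int \<Rightarrow> ereal" where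
  "extend n u k = (if k \<in> {0..int n} then ereal (u k) else \<infinity>)"

text \<open>No term of the following sum is \<open>-\<infinity>\<close>, so the sum is \<open>\<infinity>\<close> exactly when the block is not
  contained in the sample.\<close>

definition block_sum :: "nat \<Rightarrow> (int \<Rightarrow> real) \<Rightarrow> nat \<Rightarrow> int \<Rightarrow> ereal" where
  "block_sum n u j i =
     (\<Sum>k\<in>{(i - 1) * 2 ^ (top_level n - j)..i * 2 ^ (top_level n - j) - 1}. extend n u k)"

text \<open>Ties in the argmin, which have probability zero, are broken by taking the smallest index.\<close>

definition argmin_index :: "(int \<Rightarrow> ereal) \<Rightarrow> int set \<Rightarrow> int" where
  "argmin_index Y A = Min {i\<in>A. \<forall>k\<in>A. Y i \<le> Y k}"

primrec loc_index :: "nat \<Rightarrow> (int \<Rightarrow> real) \<Rightarrow> nat \<Rightarrow> int" where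
  "loc_index n yl 0 = 1"
| "loc_index n yl (Suc j) =
     argmin_index (block_sum n yl (Suc j))
       {max (2 * loc_index n yl j - 2) 1 ..
        min (2 * loc_index n yl j + 1) \<lfloor>real (n + 1) / 2 ^ (top_level n - Suc j)\<rfloor>}"

text \<open>Subtraction on \<open>ereal\<close> satisfies \<open>\<infinity> - x = \<infinity>\<close> for all \<open>x\<close>, including \<open>x = \<infinity>\<close>.\<close>

definition T_stat :: "nat \<Rightarrow> (int \<Rightarrow> real) \<Rightarrow> (int \<Rightarrow> real) \<Rightarrow> nat \<Rightarrow> ereal" where
  "T_stat n yl ys j =
     (let i = loc_index n yl j; Y = block_sum n ys j
      in min (Y (i + 6) - Y (i + 5)) (Y (i - 6) - Y (i - 5)))"

definition sigma_level :: "nat \<Rightarrow> real \<Rightarrow> nat \<Rightarrow> real" where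
  "sigma_level n \<sigma> j = sqrt (6 * 2 ^ (top_level n - j) * \<sigma>\<^sup>2)"

definition stop_level :: "nat \<Rightarrow> real \<Rightarrow> (int \<Rightarrow> real) \<Rightarrow> (int \<Rightarrow> real) \<Rightarrow> nat" where
  "stop_level n \<sigma> yl ys =
     (let A = {j\<in>{0..top_level n}. T_stat n yl ys j \<le> ereal (2 * sigma_level n \<sigma> j)}
      in if A = {} then top_level n else min (top_level n) (Min A))"


section \<open>The confidence interval for the minimum\<close>

definition v_left :: "nat \<Rightarrow> real \<Rightarrow> (int \<Rightarrow> real) \<Rightarrow> int \<Rightarrow> real \<Rightarrow> real" where
  "v_left n H ye i t = real n * (ye i - ye (i - 1) - 2 * H) * (t - design n i) + ye i - H"

definition v_right :: "nat \<Rightarrow> real \<Rightarrow> (int \<Rightarrow> real) \<Rightarrow> int \<Rightarrow> real \<Rightarrow> real" where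
  "v_right n H ye i t =
     real n * (ye (i + 2) - ye (i + 1) + 2 * H) * (t - design n (i + 1)) + ye (i + 1) - H"

text \<open>The infima below are minima of continuous functions on compact intervals. For \<open>n = 1\<close> the
  two boundary cases coincide, both linear functions would involve \<open>\<infinity>\<close>, and the value is
  \<open>-\<infinity>\<close> by convention.\<close>

definition h_lower :: "nat \<Rightarrow> real \<Rightarrow> (int \<Rightarrow> real) \<Rightarrow> int \<Rightarrow> int \<Rightarrow> int \<Rightarrow> ereal" where
  "h_lower n H ye Ilo Ihi i =
     (if n = 1 then -\<infinity>
      else if Ilo = 1 \<and> i = 0 then (INF t\<in>{0..1 / real n}. ereal (v_right n H ye 0 t))
      else if Ihi - 1 = int n \<and> i = int n - 1
        then (INF t\<in>{(real n - 1) / real n..1}. ereal (v_left n H ye (int n - 1) t))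
      else (INF t\<in>{design n i..design n (i + 1)}.
              ereal (max (v_left n H ye i t) (v_right n H ye i t))))"

definition CI_endpoints ::
    "real \<Rightarrow> nat \<Rightarrow> real \<Rightarrow> (int \<Rightarrow> real) \<Rightarrow> (int \<Rightarrow> real) \<Rightarrow> (int \<Rightarrow> real) \<Rightarrow> ereal \<times> ereal" where
  "CI_endpoints \<alpha> n \<sigma> yl ys ye =
     (let J = top_level n;
          jh = stop_level n \<sigma> yl ys;
          js = nat (max 0 (int jh - K_const (\<alpha> / 4) - 1));
          jl = nat (min (int J) (int jh + Kt_const (\<alpha> / 4)));
          Ilo = max 1 (2 ^ (jl - js) * (loc_index n yl js - 5));
          Ihi = min (2 ^ (jl - js) * (loc_index n yl js + 4) + 1) \<lceil>real (n + 1) / 2 ^ (J - jl)\<rceil>;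
          f1 = Min ((\<lambda>i. ereal (1 / 2 ^ (J - jl)) * block_sum n ye jl i) ` {Ilo..Ihi});
          s = sqrt 3 * \<sigma> / sqrt (2 ^ (J - jl));
          fhi = f1 + ereal (S_quantile (nat (Ihi - Ilo + 1)) (\<alpha> / 4) * s);
          H = S_quantile (nat (Ihi - Ilo + 3)) (\<alpha> / 8) * sqrt 3 * \<sigma>;
          flo = (if int jh + Kt_const (\<alpha> / 4) \<le> int J
                 then f1 - ereal ((z_upper (\<alpha> / 4) + 1) * s)
                 else min (Min (h_lower n H ye Ilo Ihi ` {Ilo - 1..Ihi - 2})) fhi)
      in (flo, fhi))"

definition CI_min ::
    "real \<Rightarrow> nat \<Rightarrow> real \<Rightarrow> (int \<Rightarrow> real) \<times> (int \<Rightarrow> real) \<times> (int \<Rightarrow> real) \<Rightarrow> real set" where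
  "CI_min \<alpha> n \<sigma> = (\<lambda>(y, z1, z2).
     (let (flo, fhi) =
        CI_endpoints \<alpha> n \<sigma> (copy_l \<sigma> y z1 z2) (copy_s \<sigma> y z1 z2) (copy_e \<sigma> y z1)
      in {x. flo \<le> ereal x \<and> ereal x \<le> fhi}))"

end

theory Submission
  imports Defs
begin

text \<open>
  An orthogonal change of coordinates of the Gaussian noise turns the three copies of the data into
  independent ones, so localization, stopping and estimation can be treated conditionally on each other.

  Coverage fails only if (a) the localization has already left the neighbourhood of the minimizer at the
  starting level, which requires that a stopping statistic with nonpositive drift misses its threshold
  \<open>K\<close> times in a row at disjoint blocks, or (b) the procedure stops at a level so coarse that no block
  next to the minimizer has a mean within one standard deviation of the minimum; convexity then forces
  drifts that grow by a factor \<open>2 sqrt 2\<close> per level, and a union bound over the coarse levels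
  converges geometrically, or (c) the noise of the third copy exceeds its quantiles.

  For the length, the benchmark at \<open>f\<close> is bounded below by \<open>\<bar>M(f) - M(g)\<bar> / 5\<close> for every \<open>g\<close> in the
  class whose distance to \<open>f\<close> on the grid is small compared with \<open>\<sigma>\<close>. If \<open>g\<close> is \<open>f\<close> truncated from below
  slightly above its minimum, the admissible height is the rate at the finest level at which the
  sublevel set of \<open>f\<close> is not yet crowded with grid points. Beyond that level \<open>f\<close> is so flat that each
  further stopping statistic falls below its threshold with probability at least one half, whereas the
  rate grows only by \<open>sqrt 2\<close> per level. The uncertainty about \<open>f\<close> between the grid points is matched by
  two more choices of \<open>g\<close>: the truncation at a height below all grid values, and the piecewise linear
  interpolation of \<open>f\<close> on the grid with the chord over one cell removed.
\<close>

section \<open>Standard normal distribution\<close>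

text \<open>The error budget is \<alpha>/4 for a misplaced starting index, \<alpha>/4 for each
  endpoint, and \<alpha>/4 for stopping too early, the last split into 3/16 \<alpha> for the
  localization and \<alpha>/16 for the stopping statistics. The obstacle in the last part is that
  the level to be judged depends on the random stopping level. It is removed by comparing everything
  with one deterministic level, the finest bad one. For the length at the finest levels, the minimum
  of \<open>f\<close> between grid points cannot serve as a reference value. The two ends are
  therefore compared cell by cell: the smaller grid value of a cell bounds the upper end from above
  and the extrapolated minimum from below, up to noise and a multiple of the benchmark. The
  condition \<alpha> < 3/10 enters through the two-point argument: a squared grid distance of at
  most 3/100 \<open>\<sigma>\<^sup>2\<close> changes probabilities by at most 1/5, so an interval
  valid for \<open>f\<close> and \<open>g\<close> contains both minima with probability at least 1 -
  2 \<alpha> - 1/5 > 1/5.\<close>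

interpretation stdN: real_distribution std_normal_distribution
  by (rule real_dist_normal_dist)

lemma Phi_eq: "Phi x = measure std_normal_distribution {..x}"
  by (simp add: Phi_def cdf_def)

lemma measure_std_normal_singleton: "measure std_normal_distribution {x} = 0"
proof -
  have "AE t in lborel. t \<noteq> x" by (rule AE_lborel_singleton)
  then have "AE t in lborel. t \<in> {x} \<longrightarrow> ennreal (std_normal_density t) = 0"
    by eventually_elim auto
  then have "{x} \<in> null_sets std_normal_distribution"
    by (subst null_sets_density_iff) auto
  then show ?thesis unfolding measure_def by (metis enn2real_0 null_setsD1)
qed

lemma isCont_Phi: "isCont Phi x"
  unfolding Phi_def stdN.isCont_cdf by (rule measure_std_normal_singleton)

lemma distr_std_normal_uminus: "distr std_normal_distribution borel (\<lambda>x. - x) = std_normal_distribution"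
proof -
  have "distributed std_normal_distribution lborel (\<lambda>x. x) (normal_density 0 1)"
    unfolding distributed_def by (auto intro!: measure_eqI simp: emeasure_distr)
  from stdN.normal_density_affine[OF this, of "-1" 0]
  have "distributed std_normal_distribution lborel (\<lambda>x. - x) (normal_density 0 1)" by simp
  then have "distr std_normal_distribution lborel (\<lambda>x. - x) = std_normal_distribution"
    by (simp add: distributed_def)
  moreover have "distr std_normal_distribution lborel (\<lambda>x. - x) = distr std_normal_distribution borel (\<lambda>x. - x)"
    by (rule distr_cong) auto
  ultimately show ?thesis by simp
qed

lemma measure_std_normal_atLeast: "measure std_normal_distribution {x..} = Phi (- x)"
proof -
  have "measure std_normal_distribution {x..} = measure (distr std_normal_distribution borel (\<lambda>x. - x)) {x..}"
    by (simp add: distr_std_normal_uminus)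
  also have "\<dots> = measure std_normal_distribution {..-x}"
    by (subst measure_distr) (auto intro!: arg_cong[where f="measure _"])
  finally show ?thesis by (simp add: Phi_eq)
qed

lemma Phi_minus: "Phi (- x) = 1 - Phi x"
proof -
  have "measure std_normal_distribution ({..x} \<union> {x..}) =
    measure std_normal_distribution {..x} + measure std_normal_distribution {x..} - measure std_normal_distribution ({..x} \<inter> {x..})"
    by (rule measure_Un3) (auto simp: fmeasurable_def less_top[symmetric])
  moreover have "{..x} \<union> {x..} = (UNIV::real set)" "{..x} \<inter> {x..} = {x}" by auto
  moreover have "measure std_normal_distribution UNIV = 1" using stdN.prob_space by simp
  ultimately show ?thesis
    by (simp add: measure_std_normal_singleton Phi_eq measure_std_normal_atLeast)
qed

lemma Phi_0: "Phi 0 = 1 / 2" using Phi_minus[of 0] by simp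

lemma measure_std_normal_greaterThan: "measure std_normal_distribution {x<..} = Phi (- x)"
proof -
  have "measure std_normal_distribution (UNIV - {..x}) = 1 - Phi x"
    using stdN.prob_compl[of "{..x}"] by (simp add: Phi_eq)
  moreover have "UNIV - {..x} = {x<..}" by auto
  ultimately show ?thesis by (simp add: Phi_minus)
qed

text \<open>The density is positive, so an interval of probability zero would have Lebesgue measure
  zero.\<close>

lemma Phi_strict_mono: "x < y \<Longrightarrow> Phi x < Phi y"
proof -
  assume xy: "x < y"
  have "measure std_normal_distribution {x<..y} \<noteq> 0"
  proof
    assume "measure std_normal_distribution {x<..y} = 0"
    then have "{x<..y} \<in> null_sets std_normal_distribution"
      by (auto simp: stdN.emeasure_eq_measure)
    then have "AE t in lborel. t \<in> {x<..y} \<longrightarrow> ennreal (std_normal_density t) = 0"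
      by (subst (asm) null_sets_density_iff) auto
    then have "AE t in lborel. t \<notin> {x<..y}"
      by eventually_elim (metis ennreal_eq_0_iff normal_density_pos not_le zero_less_one)
    then have "emeasure lborel {x<..y} = 0"
      by (subst (asm) AE_iff_measurable[of "{x<..y}"]) auto
    then show False using xy by simp
  qed
  then have "0 < measure std_normal_distribution {x<..y}" by (simp add: zero_less_measure_iff)
  also have "\<dots> = Phi y - Phi x"
    unfolding Phi_def using stdN.cdf_diff_eq[of x y] xy by simp
  finally show ?thesis by simp
qed

lemma Phi_mono: "x \<le> y \<Longrightarrow> Phi x \<le> Phi y"
  using Phi_strict_mono[of x y] by (cases "x = y") auto

lemma Phi_nonneg: "0 \<le> Phi x" and Phi_le_1: "Phi x \<le> 1"
  by (auto simp: Phi_eq)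

lemma Phi_pos: "0 < Phi x"
  using Phi_strict_mono[of "x - 1" x] Phi_nonneg[of "x - 1"] by simp

lemma Phi_less_1: "Phi x < 1"
  using Phi_strict_mono[of x "x + 1"] Phi_le_1[of "x + 1"] by simp

text \<open>\<open>z_upper\<close> is defined through \<open>inv\<close>, which is meaningful only
  once \<open>1 - \<beta>\<close> is known to be a value of \<open>Phi\<close>; continuity and the
  limits at both infinities supply this.\<close>

lemma Phi_z_upper:
  assumes "0 < \<beta>" "\<beta> < 1"
  shows "Phi (z_upper \<beta>) = 1 - \<beta>"
proof -
  have "eventually (\<lambda>x. Phi x < 1 - \<beta>) at_bot"
    using order_tendstoD(2)[OF stdN.cdf_lim_at_bot, of "1 - \<beta>"] assms by (simp add: Phi_def)
  then obtain a where a: "Phi a < 1 - \<beta>" by (metis eventually_at_bot_linorder order_refl)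
  have "eventually (\<lambda>x. 1 - \<beta> < Phi x) at_top"
    using order_tendstoD(1)[OF stdN.cdf_lim_at_top_prob, of "1 - \<beta>"] assms by (simp add: Phi_def)
  then obtain b where b: "1 - \<beta> < Phi b" by (metis eventually_at_top_linorder order_refl)
  have "a \<le> b" using a b Phi_mono[of b a] by (smt (verit))
  then have "\<exists>x\<ge>a. x \<le> b \<and> Phi x = 1 - \<beta>"
    using a b by (intro IVT) (auto intro: isCont_Phi)
  then have "1 - \<beta> \<in> range Phi" by (metis rangeI)
  then show ?thesis unfolding z_upper_def by (rule f_inv_into_f)
qed

lemma z_upper_nonneg:
  assumes "0 < \<beta>" "\<beta> \<le> 1 / 2"
  shows "0 \<le> z_upper \<beta>"
proof -
  have "Phi 0 \<le> Phi (z_upper \<beta>)" using assms by (simp add: Phi_0 Phi_z_upper)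
  then show ?thesis by (meson Phi_strict_mono linorder_not_less)
qed

text \<open>After the substitution by \<open>x + h\<close> the density carries, besides
  \<open>exp (- h\<^sup>2 / 2)\<close>, the factor \<open>exp (- h * x)\<close>, which is at most 1
  for \<open>x \<ge> z \<ge> 0\<close>. Keeping \<open>Phi (- z)\<close> on the right preserves a
  factor proportional to \<alpha> when such bounds are summed over levels.\<close>

lemma Phi_tail:
  assumes "0 \<le> z" "0 \<le> h"
  shows "Phi (- (z + h)) \<le> exp (- h\<^sup>2 / 2) * Phi (- z)"
proof -
  have "ennreal (Phi (- (z + h))) = emeasure std_normal_distribution {z + h..}"
    by (simp only: measure_std_normal_atLeast[symmetric] stdN.emeasure_eq_measure)
  also have "\<dots> = (\<integral>\<^sup>+x. std_normal_density x * indicator {z + h..} x \<partial>lborel)"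
    by (subst emeasure_density) (auto simp: indicator_def ennreal_mult'' intro!: nn_integral_cong)
  also have "\<dots> = (\<integral>\<^sup>+x. std_normal_density (h + 1 * x) * indicator {z + h..} (h + 1 * x) \<partial>lborel)"
    by (subst nn_integral_real_affine[where t=h and c=1]) auto
  also have "\<dots> \<le> (\<integral>\<^sup>+x. ennreal (exp (- h\<^sup>2 / 2)) * (std_normal_density x * indicator {z..} x) \<partial>lborel)"
  proof (rule nn_integral_mono)
    fix x :: real
    have "std_normal_density (h + x) \<le> exp (- h\<^sup>2 / 2) * std_normal_density x" if "z \<le> x"
    proof -
      have "0 \<le> h * x" using assms that by simp
      then have "exp (- (h + x)\<^sup>2 / 2) \<le> exp (- h\<^sup>2 / 2 + - x\<^sup>2 / 2)"
        by (simp add: power2_sum field_simps)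
      then show ?thesis by (simp add: std_normal_density_def exp_add[symmetric] divide_right_mono)
    qed
    then show "ennreal (std_normal_density (h + 1 * x) * indicator {z + h..} (h + 1 * x))
      \<le> ennreal (exp (- h\<^sup>2 / 2)) * ennreal (std_normal_density x * indicator {z..} x)"
      by (auto simp: indicator_def ennreal_mult'[symmetric])
  qed
  also have "\<dots> = ennreal (exp (- h\<^sup>2 / 2)) * emeasure std_normal_distribution {z..}"
    by (subst nn_integral_cmult, simp, subst emeasure_density)
       (auto simp: indicator_def ennreal_mult'' intro!: nn_integral_cong arg_cong2[where f="(*)"])
  also have "\<dots> = ennreal (exp (- h\<^sup>2 / 2) * Phi (- z))"
    by (simp add: measure_std_normal_atLeast[symmetric] stdN.emeasure_eq_measure ennreal_mult')
  finally show ?thesis by (simp add: Phi_nonneg)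
qed

lemma distributed_std_normal_linear:
  assumes "a \<noteq> 0" "prob_space M" "X \<in> borel_measurable M" "distr M borel X = std_normal_distribution"
  shows "distributed M lborel (\<lambda>x. a * X x) (normal_density 0 \<bar>a\<bar>)"
proof -
  interpret prob_space M by fact
  have "distr M lborel X = distr M borel X" by (rule distr_cong) auto
  then have "distributed M lborel X (normal_density 0 1)"
    using assms by (simp add: distributed_def)
  from normal_density_affine[OF this, of a 0] show ?thesis using assms by simp
qed

lemma indep_vars_PiM_std:
  assumes "finite I" "I \<noteq> {}"
  shows "prob_space.indep_vars (PiM I (\<lambda>_. std_normal_distribution)) (\<lambda>_. borel) (\<lambda>i x. x i) I"
proof -
  let ?P = "PiM I (\<lambda>_. std_normal_distribution)"
  interpret P: prob_space ?P by (intro prob_space_PiM stdN.prob_space_axioms)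
  have "distr ?P (PiM I (\<lambda>_. borel)) (\<lambda>x. \<lambda>i\<in>I. x i) = distr ?P ?P (\<lambda>x. x)"
    by (intro distr_cong refl sets_PiM_cong) (auto simp: space_PiM)
  moreover have "PiM I (\<lambda>i. distr ?P borel (\<lambda>x. x i)) = ?P"
  proof (intro PiM_cong refl)
    fix i assume i: "i \<in> I"
    have "distr ?P borel (\<lambda>x. x i) = distr ?P std_normal_distribution (\<lambda>x. x i)"
      by (rule distr_cong) auto
    also have "\<dots> = std_normal_distribution"
      using i distr_PiM_component[of I "\<lambda>_. std_normal_distribution" i] stdN.prob_space_axioms by simp
    finally show "distr ?P borel (\<lambda>x. x i) = std_normal_distribution" .
  qed
  ultimately show ?thesis
    by (subst P.indep_vars_iff_distr_eq_PiM') (use assms in auto)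
qed

text \<open>Weighted sums over disjoint index sets are independent, and dividing by the norm of the
  weights makes each of them standard normal. The probabilities for localization, stopping
  statistics and endpoints are all reduced to this.\<close>

lemma gauss_blocks:
  fixes I :: "'i set" and A :: "'j \<Rightarrow> 'i set" and a :: "'j \<Rightarrow> 'i \<Rightarrow> real" and B :: "'j \<Rightarrow> real set"
  assumes fin: "finite I" "finite L"
    and A: "\<And>j. j \<in> L \<Longrightarrow> A j \<subseteq> I" "\<And>j. j \<in> L \<Longrightarrow> A j \<noteq> {}" "disjoint_family_on A L"
    and a: "\<And>j k. j \<in> L \<Longrightarrow> k \<in> A j \<Longrightarrow> a j k \<noteq> 0"
    and B: "\<And>j. j \<in> L \<Longrightarrow> B j \<in> sets borel"
  defines "P \<equiv> PiM I (\<lambda>_. std_normal_distribution)"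
  shows "measure P {x\<in>space P. \<forall>j\<in>L. (\<Sum>k\<in>A j. a j k * x k) / sqrt (\<Sum>k\<in>A j. (a j k)\<^sup>2) \<in> B j}
    = (\<Prod>j\<in>L. measure std_normal_distribution (B j))"
proof (cases "L = {}")
  case True
  interpret P: prob_space P unfolding P_def by (intro prob_space_PiM stdN.prob_space_axioms)
  show ?thesis using True by (simp add: P.prob_space)
next
  case False
  interpret P: prob_space P unfolding P_def by (intro prob_space_PiM stdN.prob_space_axioms)
  have ne: "I \<noteq> {}" using False A by auto
  have X: "P.indep_vars (\<lambda>_. borel) (\<lambda>i x. x i) I"
    unfolding P_def by (rule indep_vars_PiM_std) (use fin ne in auto)
  define Y where "Y j x = (\<Sum>k\<in>A j. a j k * x k) / sqrt (\<Sum>k\<in>A j. (a j k)\<^sup>2)" for j and x :: "'i \<Rightarrow> real"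
  have "P.indep_vars (\<lambda>j. PiM (A j) (\<lambda>_. borel)) (\<lambda>j x. restrict (\<lambda>i. x i) (A j)) L"
    by (rule P.indep_vars_restrict[OF X]) (use A in auto)
  then have "P.indep_vars (\<lambda>_. borel) (\<lambda>j x. Y j (restrict (\<lambda>i. x i) (A j))) L"
    by (rule P.indep_vars_compose2) (auto simp: Y_def)
  then have indY: "P.indep_vars (\<lambda>_. borel) Y L"
    by (subst (asm) P.indep_vars_cong[where Y=Y]) (auto simp: Y_def)
  have std: "measure P (Y j -` B j \<inter> space P) = measure std_normal_distribution (B j)" if j: "j \<in> L" for j
  proof -
    have finA: "finite (A j)" using fin A j finite_subset by blast
    have comp: "distr P borel (\<lambda>x. x i) = std_normal_distribution" if "i \<in> I" for i
    proof -
      have "distr P borel (\<lambda>x. x i) = distr P std_normal_distribution (\<lambda>x. x i)"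
        by (rule distr_cong) auto
      also have "\<dots> = std_normal_distribution"
        using that distr_PiM_component[of I "\<lambda>_. std_normal_distribution" i] stdN.prob_space_axioms
        by (simp add: P_def)
      finally show ?thesis .
    qed
    have mX: "(\<lambda>x. x i) \<in> borel_measurable P" if "i \<in> I" for i
      using that X by (auto simp: P.indep_vars_def)
    have Z: "distributed P lborel (\<lambda>x. \<Sum>k\<in>A j. a j k * x k)
      (normal_density (\<Sum>k\<in>A j. 0) (sqrt (\<Sum>k\<in>A j. \<bar>a j k\<bar>\<^sup>2)))"
    proof (rule P.sum_indep_normal)
      show "P.indep_vars (\<lambda>i. borel) (\<lambda>k x. a j k * x k) (A j)"
        using P.indep_vars_compose2[OF P.indep_vars_subset[OF X A(1)[OF j]], of "\<lambda>k t. a j k * t" "\<lambda>_. borel"]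
        by simp
      show "distributed P lborel (\<lambda>x. a j i * x i) (normal_density 0 \<bar>a j i\<bar>)" if "i \<in> A j" for i
        by (rule distributed_std_normal_linear) (use that a A(1)[OF j] j comp[of i] mX[of i] P.prob_space_axioms in auto)
    qed (use finA A a j in auto)
    have pos: "0 < (\<Sum>k\<in>A j. (a j k)\<^sup>2)"
      by (rule sum_pos) (use finA A a j in auto)
    then have "distributed P lborel (\<lambda>x. ((\<Sum>k\<in>A j. a j k * x k) - 0) / sqrt (\<Sum>k\<in>A j. (a j k)\<^sup>2)) std_normal_density"
      using Z by (subst P.normal_standard_normal_convert[symmetric]) auto
    then have Yd: "distributed P lborel (Y j) std_normal_density" by (simp add: Y_def[abs_def])
    then have "measure std_normal_distribution (B j) = measure (distr P lborel (Y j)) (B j)"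
      by (simp add: distributed_def)
    also have "\<dots> = measure P (Y j -` B j \<inter> space P)"
      by (rule measure_distr) (use Yd B j in \<open>auto simp: distributed_def\<close>)
    finally show ?thesis by simp
  qed
  have "measure P (\<Inter>j\<in>L. Y j -` B j \<inter> space P) = (\<Prod>j\<in>L. measure P (Y j -` B j \<inter> space P))"
    by (rule P.indep_varsD_finite[OF indY]) (use False fin B in auto)
  also have "\<dots> = (\<Prod>j\<in>L. measure std_normal_distribution (B j))"
    by (intro prod.cong refl std)
  also have "(\<Inter>j\<in>L. Y j -` B j \<inter> space P) = {x\<in>space P. \<forall>j\<in>L. Y j x \<in> B j}"
    using False by auto
  finally show ?thesis by (simp add: Y_def)
qed

section \<open>Rotation of Gaussian noise\<close>

text \<open>The standard normal density on the plane depends on the norm only, and the matrix with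
  rows \<open>(c, s)\<close> and \<open>(s, - c)\<close> is orthogonal. The substitution is made in
  one variable at a time, with Jacobian factors \<open>\<bar>1 / c\<bar>\<close> and
  \<open>\<bar>c\<bar>\<close> that cancel; hence the condition \<open>c \<noteq> 0\<close>.\<close>

lemma nn_integral_std_normal_rotation:
  fixes F :: "real \<times> real \<Rightarrow> ennreal" and c s :: real
  assumes [measurable]: "F \<in> borel_measurable (borel \<Otimes>\<^sub>M borel)" and cs: "c\<^sup>2 + s\<^sup>2 = 1" "c \<noteq> 0"
  shows "(\<integral>\<^sup>+x. \<integral>\<^sup>+y. F (c * x + s * y, s * x - c * y) \<partial>std_normal_distribution \<partial>std_normal_distribution) =
    (\<integral>\<^sup>+x. \<integral>\<^sup>+y. F (x, y) \<partial>std_normal_distribution \<partial>std_normal_distribution)"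
proof -
  let ?\<phi> = "\<lambda>x. ennreal (std_normal_density x)"
  have dens: "(\<integral>\<^sup>+x. \<integral>\<^sup>+y. G (x, y) \<partial>std_normal_distribution \<partial>std_normal_distribution) =
    (\<integral>\<^sup>+x. \<integral>\<^sup>+y. ?\<phi> x * ?\<phi> y * G (x, y) \<partial>lborel \<partial>lborel)"
    if [measurable]: "G \<in> borel_measurable (borel \<Otimes>\<^sub>M borel)" for G :: "real \<times> real \<Rightarrow> ennreal"
    by (simp add: nn_integral_density nn_integral_cmult[symmetric] mult.assoc)
  have "(\<integral>\<^sup>+x. \<integral>\<^sup>+y. F (c * x + s * y, s * x - c * y) \<partial>std_normal_distribution \<partial>std_normal_distribution) =
    (\<integral>\<^sup>+x. \<integral>\<^sup>+y. ?\<phi> x * ?\<phi> y * F (c * x + s * y, s * x - c * y) \<partial>lborel \<partial>lborel)"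
    by (subst dens[of "\<lambda>p. F (c * fst p + s * snd p, s * fst p - c * snd p)", simplified]) auto
  also have "\<dots> = (\<integral>\<^sup>+y. \<integral>\<^sup>+x. ?\<phi> x * ?\<phi> y * F (c * x + s * y, s * x - c * y) \<partial>lborel \<partial>lborel)"
    by (rule lborel_pair.Fubini') measurable
  also have "\<dots> = (\<integral>\<^sup>+y. ennreal \<bar>1 / c\<bar> * (\<integral>\<^sup>+u. ?\<phi> (- s * y / c + 1 / c * u) * ?\<phi> y * F (u, (s * u - y) / c) \<partial>lborel) \<partial>lborel)"
  proof (intro nn_integral_cong)
    fix y
    have *: "c * (- s * y / c + 1 / c * u) + s * y = u" for u using cs by (simp add: field_simps)
    have **: "s * (- s * y / c + 1 / c * u) - c * y = (s * u - y) / c" for u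
    proof -
      have "s * (- s * y / c + 1 / c * u) - c * y = (s * u - (c\<^sup>2 + s\<^sup>2) * y) / c"
        using cs(2) by (simp add: field_simps power2_eq_square)
      then show ?thesis using cs by simp
    qed
    show "(\<integral>\<^sup>+x. ?\<phi> x * ?\<phi> y * F (c * x + s * y, s * x - c * y) \<partial>lborel) =
      ennreal \<bar>1 / c\<bar> * (\<integral>\<^sup>+u. ?\<phi> (- s * y / c + 1 / c * u) * ?\<phi> y * F (u, (s * u - y) / c) \<partial>lborel)"
      by (subst nn_integral_real_affine[where c="1 / c" and t="- s * y / c"])
         (use cs * ** in \<open>auto simp del: minus_mult_left\<close>)
  qed
  also have "\<dots> = (\<integral>\<^sup>+y. \<integral>\<^sup>+u. ennreal \<bar>1 / c\<bar> * (?\<phi> (- s * y / c + 1 / c * u) * ?\<phi> y * F (u, (s * u - y) / c)) \<partial>lborel \<partial>lborel)"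
    by (intro nn_integral_cong nn_integral_cmult[symmetric]) measurable
  also have "\<dots> = (\<integral>\<^sup>+u. \<integral>\<^sup>+y. ennreal \<bar>1 / c\<bar> * (?\<phi> (- s * y / c + 1 / c * u) * ?\<phi> y * F (u, (s * u - y) / c)) \<partial>lborel \<partial>lborel)"
    by (rule lborel_pair.Fubini') measurable
  also have "\<dots> = (\<integral>\<^sup>+u. \<integral>\<^sup>+v. ?\<phi> u * ?\<phi> v * F (u, v) \<partial>lborel \<partial>lborel)"
  proof (rule nn_integral_cong)
    fix u
    have 1: "- s * (s * u + - c * v) / c + 1 / c * u = c * u + s * v" for v
    proof -
      have "- s * (s * u + - c * v) / c + 1 / c * u = ((1 - s\<^sup>2) * u + c * s * v) / c"
        using cs(2) by (simp add: field_simps power2_eq_square)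
      also have "1 - s\<^sup>2 = c * c" using cs by (simp add: power2_eq_square)
      finally show ?thesis using cs(2) by (simp add: field_simps)
    qed
    have 2: "(s * u - (s * u + - c * v)) / c = v" for v using cs by simp
    have 3: "?\<phi> (c * u + s * v) * ?\<phi> (s * u + - c * v) = ?\<phi> u * ?\<phi> v" for v
    proof -
      have "(c * u + s * v)\<^sup>2 + (s * u + - c * v)\<^sup>2 = (c\<^sup>2 + s\<^sup>2) * (u\<^sup>2 + v\<^sup>2)"
        by (simp add: power2_eq_square algebra_simps)
      then have "exp (- (c * u + s * v)\<^sup>2 / 2) * exp (- (s * u + - c * v)\<^sup>2 / 2) = exp (- u\<^sup>2 / 2) * exp (- v\<^sup>2 / 2)"
        using cs by (simp add: exp_add[symmetric] field_simps)
      then show ?thesis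
        by (simp add: ennreal_mult'[symmetric] std_normal_density_def)
    qed
    have "(\<integral>\<^sup>+y. ennreal \<bar>1 / c\<bar> * (?\<phi> (- s * y / c + 1 / c * u) * ?\<phi> y * F (u, (s * u - y) / c)) \<partial>lborel) =
      ennreal \<bar>1 / c\<bar> * (\<integral>\<^sup>+y. ?\<phi> (- s * y / c + 1 / c * u) * ?\<phi> y * F (u, (s * u - y) / c) \<partial>lborel)"
      by (intro nn_integral_cmult) measurable
    also have "(\<integral>\<^sup>+y. ?\<phi> (- s * y / c + 1 / c * u) * ?\<phi> y * F (u, (s * u - y) / c) \<partial>lborel) =
      ennreal \<bar>- c\<bar> * (\<integral>\<^sup>+v. ?\<phi> (- s * (s * u + - c * v) / c + 1 / c * u) * ?\<phi> (s * u + - c * v) * F (u, (s * u - (s * u + - c * v)) / c) \<partial>lborel)"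
      by (rule nn_integral_real_affine) (use cs in auto)
    also have "\<dots> = ennreal \<bar>c\<bar> * (\<integral>\<^sup>+v. ?\<phi> u * ?\<phi> v * F (u, v) \<partial>lborel)"
      unfolding 1 2 3 by simp
    also have "ennreal \<bar>1 / c\<bar> * \<dots> = (\<integral>\<^sup>+v. ?\<phi> u * ?\<phi> v * F (u, v) \<partial>lborel)"
      using cs(2) by (simp add: mult.assoc[symmetric] ennreal_mult'[symmetric])
    finally show "(\<integral>\<^sup>+y. ennreal \<bar>1 / c\<bar> * (?\<phi> (- s * y / c + 1 / c * u) * ?\<phi> y * F (u, (s * u - y) / c)) \<partial>lborel) =
      (\<integral>\<^sup>+v. ?\<phi> u * ?\<phi> v * F (u, v) \<partial>lborel)" .
  qed
  also have "\<dots> = (\<integral>\<^sup>+x. \<integral>\<^sup>+y. F (x, y) \<partial>std_normal_distribution \<partial>std_normal_distribution)"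
    by (rule dens[symmetric]) simp
  finally show ?thesis .
qed

lemma prob_space_PiM_std: "prob_space (PiM I (\<lambda>_. std_normal_distribution))"
  by (intro prob_space_PiM stdN.prob_space_axioms)

lemma sets_PiM_std[measurable_cong]: "sets (PiM I (\<lambda>_. std_normal_distribution)) = sets (PiM I (\<lambda>_. borel))"
  by (intro sets_PiM_cong) auto

text \<open>The matrix is symmetric with determinant -1 when
  \<open>c\<^sup>2 + s\<^sup>2 = 1\<close>, so this is a reflection applied to each pair of
  coordinates. Restricting to \<open>I\<close> keeps the result in the space of the product
  measure.\<close>

definition rotate :: "'i set \<Rightarrow> real \<Rightarrow> real \<Rightarrow> ('i \<Rightarrow> real) \<times> ('i \<Rightarrow> real) \<Rightarrow> ('i \<Rightarrow> real) \<times> ('i \<Rightarrow> real)" where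
  "rotate I c s p = (\<lambda>i\<in>I. c * fst p i + s * snd p i, \<lambda>i\<in>I. s * fst p i - c * snd p i)"

lemma measurable_rotate[measurable]:
  "rotate I c s \<in> PiM I (\<lambda>_. borel) \<Otimes>\<^sub>M PiM I (\<lambda>_. borel) \<rightarrow>\<^sub>M PiM I (\<lambda>_. borel) \<Otimes>\<^sub>M PiM I (\<lambda>_. borel)"
  unfolding rotate_def[abs_def] by measurable

text \<open>Products of boxes generate the sigma-algebra and are closed under intersection. On such
  a set the indicator is a product over coordinates, so both integrals factor and the planar case
  applies to each factor.\<close>

lemma distr_rotate_PiM:
  fixes I :: "'i set"
  assumes I: "finite I" and cs: "c\<^sup>2 + s\<^sup>2 = 1" "c \<noteq> 0"
  defines "P \<equiv> PiM I (\<lambda>_. std_normal_distribution)"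
  shows "distr (P \<Otimes>\<^sub>M P) (P \<Otimes>\<^sub>M P) (rotate I c s) = P \<Otimes>\<^sub>M P"
proof -
  interpret P: prob_space P unfolding P_def by (rule prob_space_PiM_std)
  interpret PP: pair_prob_space P P ..
  interpret prod: product_sigma_finite "\<lambda>_::'i. std_normal_distribution" ..
  have [measurable_cong]: "sets P = sets (PiM I (\<lambda>_. borel))" unfolding P_def by (rule sets_PiM_std)
  have sP: "space P = (\<Pi>\<^sub>E i\<in>I. UNIV)" by (simp add: P_def space_PiM)
  define E where "E = {Pi\<^sub>E I A |A. \<forall>i\<in>I. A i \<in> sets (borel :: real measure)}"
  have E: "sets P = sigma_sets (space P) E"
  proof -
    have "sets P = sigma_sets (\<Pi>\<^sub>E i\<in>I. UNIV) (prod_algebra I (\<lambda>_. borel :: real measure))"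
      unfolding P_def sets_PiM_std sets_PiM by simp
    also have "prod_algebra I (\<lambda>_. borel :: real measure) = E"
      unfolding prod_algebra_eq_finite[OF I] E_def Pi_iff by simp
    finally show ?thesis unfolding sP .
  qed
  have E_int: "Pi\<^sub>E I A \<inter> Pi\<^sub>E I B \<in> E" if "\<forall>i\<in>I. A i \<in> sets borel" "\<forall>i\<in>I. B i \<in> sets borel" for A B
    unfolding PiE_Int E_def using that by (auto intro!: exI[of _ "\<lambda>i. A i \<inter> B i"])
  have spE: "space P \<in> E" unfolding E_def sP by (auto intro!: exI[of _ "\<lambda>_. UNIV"])
  have EP: "E \<subseteq> Pow (space P)" using E by (metis sigma_sets_into_sp sigma_sets.Basic Pow_iff subsetI sets.sets_into_space)
  have EPs: "a \<in> sets P" if "a \<in> E" for a using that unfolding E by (rule sigma_sets.Basic)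
  let ?G = "{a \<times> b |a b. a \<in> E \<and> b \<in> E}"
  have G: "sets (P \<Otimes>\<^sub>M P) = sigma_sets (space P \<times> space P) ?G"
  proof -
    have "sets (P \<Otimes>\<^sub>M P) = sets (sigma (space P \<times> space P) ?G)"
      by (rule sets_pair_eq[where Ca="{space P}" and Cb="{space P}"]) (use EP E spE in auto)
    moreover have "?G \<subseteq> Pow (space P \<times> space P)" using EP by blast
    ultimately show ?thesis by simp
  qed
  show ?thesis
  proof (rule measure_eqI_generator_eq[where E="?G" and \<Omega>="space P \<times> space P" and A="\<lambda>_::nat. space P \<times> space P"])
    show "Int_stable ?G"
    proof (rule Int_stableI)
      fix a b assume "a \<in> ?G" "b \<in> ?G"
      then obtain A B C D where a: "a = Pi\<^sub>E I A \<times> Pi\<^sub>E I B" "b = Pi\<^sub>E I C \<times> Pi\<^sub>E I D"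
        "\<forall>i\<in>I. A i \<in> sets borel" "\<forall>i\<in>I. B i \<in> sets borel" "\<forall>i\<in>I. C i \<in> sets borel" "\<forall>i\<in>I. D i \<in> sets borel"
        unfolding E_def by blast
      have "a \<inter> b = (Pi\<^sub>E I A \<inter> Pi\<^sub>E I C) \<times> (Pi\<^sub>E I B \<inter> Pi\<^sub>E I D)"
        unfolding a by (rule Times_Int_Times)
      moreover have "Pi\<^sub>E I A \<inter> Pi\<^sub>E I C \<in> E" by (rule E_int) (fact a)+
      moreover have "Pi\<^sub>E I B \<inter> Pi\<^sub>E I D \<in> E" by (rule E_int) (fact a)+
      ultimately show "a \<inter> b \<in> ?G" by (intro CollectI exI conjI)
    qed
    show "?G \<subseteq> Pow (space P \<times> space P)" using EP by blast
    show "range (\<lambda>_::nat. space P \<times> space P) \<subseteq> ?G" using spE by blast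
    show "emeasure (distr (P \<Otimes>\<^sub>M P) (P \<Otimes>\<^sub>M P) (rotate I c s)) (space P \<times> space P) \<noteq> \<infinity>"
      by (subst emeasure_distr) (auto simp: PP.emeasure_eq_measure)
    fix X assume "X \<in> ?G"
    then obtain A B where X: "X = Pi\<^sub>E I A \<times> Pi\<^sub>E I B" and AB: "\<And>i. i \<in> I \<Longrightarrow> A i \<in> sets borel" "\<And>i. i \<in> I \<Longrightarrow> B i \<in> sets borel"
      by (auto simp: E_def)
    have XP: "X \<in> sets (P \<Otimes>\<^sub>M P)" unfolding X using AB by (intro pair_measureI EPs) (auto simp: E_def)
    define F where "F i p = (indicator (A i) (fst p) * indicator (B i) (snd p) :: ennreal)" for i and p :: "real \<times> real"
    have mF[measurable]: "F i \<in> borel_measurable (borel \<Otimes>\<^sub>M borel)" if "i \<in> I" for i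
      unfolding F_def[abs_def] using AB[OF that] by measurable
    have fub: "(\<integral>\<^sup>+x. \<integral>\<^sup>+y. (\<Prod>i\<in>I. G i (x i, y i)) \<partial>P \<partial>P) =
      (\<Prod>i\<in>I. \<integral>\<^sup>+x. \<integral>\<^sup>+y. G i (x, y) \<partial>std_normal_distribution \<partial>std_normal_distribution)"
      if mG: "\<And>i. i \<in> I \<Longrightarrow> G i \<in> borel_measurable (borel \<Otimes>\<^sub>M borel)" for G :: "'i \<Rightarrow> real \<times> real \<Rightarrow> ennreal"
    proof -
      have "(\<integral>\<^sup>+x. \<integral>\<^sup>+y. (\<Prod>i\<in>I. G i (x i, y i)) \<partial>P \<partial>P) = (\<integral>\<^sup>+x. (\<Prod>i\<in>I. \<integral>\<^sup>+y. G i (x i, y) \<partial>std_normal_distribution) \<partial>P)"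
        unfolding P_def by (intro nn_integral_cong prod.product_nn_integral_prod I)
          (use mG in \<open>auto intro!: measurable_compose[OF _ mG]\<close>)
      also have "\<dots> = (\<Prod>i\<in>I. \<integral>\<^sup>+x. \<integral>\<^sup>+y. G i (x, y) \<partial>std_normal_distribution \<partial>std_normal_distribution)"
        unfolding P_def
      proof (intro prod.product_nn_integral_prod I)
        fix i assume "i \<in> I"
        note [measurable] = mG[OF this]
        show "(\<lambda>x. \<integral>\<^sup>+y. G i (x, y) \<partial>std_normal_distribution) \<in> borel_measurable std_normal_distribution"
          by measurable
      qed
      finally show ?thesis .
    qed
    have ind: "indicator X p = (\<Prod>i\<in>I. F i (fst p i, snd p i))" if "p \<in> space (P \<Otimes>\<^sub>M P)" for p
    proof (cases "p \<in> X")
      case True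
      then show ?thesis unfolding X F_def by (auto simp: PiE_iff indicator_def intro!: prod.neutral[symmetric])
    next
      case False
      have ext: "fst p \<in> extensional I" "snd p \<in> extensional I"
        using that by (auto simp: space_pair_measure sP PiE_def)
      from False obtain i where "i \<in> I" "fst p i \<notin> A i \<or> snd p i \<notin> B i"
        using ext unfolding X by (cases p) (auto simp: PiE_iff)
      then have "(\<Prod>i\<in>I. F i (fst p i, snd p i)) = 0" using I by (auto simp: F_def prod_zero_iff indicator_def intro!: bexI[of _ i])
      then show ?thesis using False by simp
    qed
    have "emeasure (distr (P \<Otimes>\<^sub>M P) (P \<Otimes>\<^sub>M P) (rotate I c s)) X =
      (\<integral>\<^sup>+p. indicator X (rotate I c s p) \<partial>(P \<Otimes>\<^sub>M P))"
      using XP nn_integral_distr[of "rotate I c s" "P \<Otimes>\<^sub>M P" "P \<Otimes>\<^sub>M P" "indicator X"] by simp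
    also have "\<dots> = (\<integral>\<^sup>+x. \<integral>\<^sup>+y. indicator X (rotate I c s (x, y)) \<partial>P \<partial>P)"
      using XP by (subst P.nn_integral_fst[symmetric]) auto
    also have "\<dots> = (\<integral>\<^sup>+x. \<integral>\<^sup>+y. (\<Prod>i\<in>I. F i (c * x i + s * y i, s * x i - c * y i)) \<partial>P \<partial>P)"
    proof (intro nn_integral_cong)
      fix x y assume "x \<in> space P" "y \<in> space P"
      have "rotate I c s (x, y) \<in> space (P \<Otimes>\<^sub>M P)" by (auto simp: space_pair_measure sP rotate_def)
      from ind[OF this] show "indicator X (rotate I c s (x, y)) = (\<Prod>i\<in>I. F i (c * x i + s * y i, s * x i - c * y i))"
        by (simp add: rotate_def)
    qed
    also have "\<dots> = (\<Prod>i\<in>I. \<integral>\<^sup>+x. \<integral>\<^sup>+y. F i (c * x + s * y, s * x - c * y) \<partial>std_normal_distribution \<partial>std_normal_distribution)"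
      by (subst fub[of "\<lambda>i p. F i (c * fst p + s * snd p, s * fst p - c * snd p)", simplified]) auto
    also have "\<dots> = (\<Prod>i\<in>I. \<integral>\<^sup>+x. \<integral>\<^sup>+y. F i (x, y) \<partial>std_normal_distribution \<partial>std_normal_distribution)"
      by (intro prod.cong refl nn_integral_std_normal_rotation mF cs)
    also have "\<dots> = (\<integral>\<^sup>+x. \<integral>\<^sup>+y. (\<Prod>i\<in>I. F i (x i, y i)) \<partial>P \<partial>P)"
      by (rule fub[symmetric]) auto
    also have "\<dots> = (\<integral>\<^sup>+x. \<integral>\<^sup>+y. indicator X (x, y) \<partial>P \<partial>P)"
      by (intro nn_integral_cong) (subst ind, auto simp: space_pair_measure)
    also have "\<dots> = emeasure (P \<Otimes>\<^sub>M P) X"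
      using XP by (subst P.nn_integral_fst) auto
    finally show "emeasure (distr (P \<Otimes>\<^sub>M P) (P \<Otimes>\<^sub>M P) (rotate I c s)) X = emeasure (P \<Otimes>\<^sub>M P) X" .
  qed (simp_all only: G sets_distr UN_constant UNIV_not_empty if_False)
qed

lemma nn_integral_rotate_PiM:
  fixes I :: "'i set"
  assumes I: "finite I" and cs: "c\<^sup>2 + s\<^sup>2 = 1" "c \<noteq> 0"
  defines "P \<equiv> PiM I (\<lambda>_. std_normal_distribution)"
  assumes [measurable]: "F \<in> borel_measurable (P \<Otimes>\<^sub>M P)"
  shows "(\<integral>\<^sup>+x. \<integral>\<^sup>+y. F (rotate I c s (x, y)) \<partial>P \<partial>P) = (\<integral>\<^sup>+x. \<integral>\<^sup>+y. F (x, y) \<partial>P \<partial>P)"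
proof -
  interpret P: prob_space P unfolding P_def by (rule prob_space_PiM_std)
  interpret PP: pair_prob_space P P ..
  have [measurable_cong]: "sets P = sets (PiM I (\<lambda>_. borel))" unfolding P_def by (rule sets_PiM_std)
  have "(\<integral>\<^sup>+x. \<integral>\<^sup>+y. F (x, y) \<partial>P \<partial>P) = (\<integral>\<^sup>+p. F p \<partial>(P \<Otimes>\<^sub>M P))"
    by (rule P.nn_integral_fst) simp
  also have "\<dots> = (\<integral>\<^sup>+p. F p \<partial>distr (P \<Otimes>\<^sub>M P) (P \<Otimes>\<^sub>M P) (rotate I c s))"
    unfolding P_def by (subst distr_rotate_PiM) (use I cs in auto)
  also have "\<dots> = (\<integral>\<^sup>+p. F (rotate I c s p) \<partial>(P \<Otimes>\<^sub>M P))"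
    by (rule nn_integral_distr) measurable
  also have "\<dots> = (\<integral>\<^sup>+x. \<integral>\<^sup>+y. F (rotate I c s (x, y)) \<partial>P \<partial>P)"
    by (rule P.nn_integral_fst[symmetric]) measurable
  finally show ?thesis by simp
qed

text \<open>The factor \<open>sqrt 3\<close> is the noise standard deviation of each copy in units
  of \<sigma>, as 1 + 1/2 + 3/2 = 1 + 2 = 3. Out of range, vectors of the product space have the
  value \<open>undefined\<close>, so a copy is constant there; \<open>\<kappa>\<close> stands for
  that constant.\<close>

definition observe :: "nat \<Rightarrow> real \<Rightarrow> (real \<Rightarrow> real) \<Rightarrow> real \<Rightarrow> (int \<Rightarrow> real) \<Rightarrow> int \<Rightarrow> real" where
  "observe n \<sigma> f \<kappa> w k = (if k \<in> {0..int n} then f (design n k) + sqrt 3 * \<sigma> * w k else \<kappa>)"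

lemma space_noise_law: "space (noise_law n) = PiE {0..int n} (\<lambda>_. UNIV)"
  by (simp add: noise_law_def space_PiM)

lemma sets_noise_law[measurable_cong]: "sets (noise_law n) = sets (PiM {0..int n} (\<lambda>_. borel))"
  unfolding noise_law_def by (rule sets_PiM_std)

lemma prob_space_noise_law: "prob_space (noise_law n)"
  unfolding noise_law_def by (rule prob_space_PiM_std)

lemma sets_data_law[measurable_cong]: "sets (data_law n \<sigma> f) = sets (PiM {0..int n} (\<lambda>_. borel))"
  by (simp add: data_law_def)

lemma joint_law_eq_distr:
  "joint_law n \<sigma> f = distr (noise_law n \<Otimes>\<^sub>M (noise_law n \<Otimes>\<^sub>M noise_law n))
     (PiM {0..int n} (\<lambda>_. borel) \<Otimes>\<^sub>M (noise_law n \<Otimes>\<^sub>M noise_law n))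
     (\<lambda>(x, z). (\<lambda>i\<in>{0..int n}. f (design n i) + \<sigma> * x i, z))"
proof -
  interpret P: prob_space "noise_law n" by (rule prob_space_noise_law)
  interpret PP: pair_prob_space "noise_law n" "noise_law n" ..
  have "joint_law n \<sigma> f = distr (noise_law n) (PiM {0..int n} (\<lambda>_. borel)) (\<lambda>x. \<lambda>i\<in>{0..int n}. f (design n i) + \<sigma> * x i)
    \<Otimes>\<^sub>M distr (noise_law n \<Otimes>\<^sub>M noise_law n) (noise_law n \<Otimes>\<^sub>M noise_law n) (\<lambda>z. z)"
    unfolding joint_law_def data_law_def by (simp add: distr_id2)
  also have "\<dots> = distr (noise_law n \<Otimes>\<^sub>M (noise_law n \<Otimes>\<^sub>M noise_law n))
     (PiM {0..int n} (\<lambda>_. borel) \<Otimes>\<^sub>M (noise_law n \<Otimes>\<^sub>M noise_law n))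
     (\<lambda>(x, z). (\<lambda>i\<in>{0..int n}. f (design n i) + \<sigma> * x i, z))"
    by (rule pair_measure_distr) (auto simp: distr_id2 PP.sigma_finite_measure_axioms)
  finally show ?thesis .
qed

text \<open>The three noise vectors of the split data arise from the original ones by an orthogonal
  transformation, which is a composition of two planar reflections.\<close>

lemma nn_integral_joint_law:
  fixes \<sigma> :: real and f :: "real \<Rightarrow> real" and G :: "(int \<Rightarrow> real) \<Rightarrow> (int \<Rightarrow> real) \<Rightarrow> (int \<Rightarrow> real) \<Rightarrow> ennreal"
  assumes n: "n \<ge> 1"
  defines "P \<equiv> noise_law n"
  defines "u \<equiv> (undefined :: real)"
  defines "\<kappa>l \<equiv> copy_l \<sigma> (\<lambda>_. u) (\<lambda>_. u) (\<lambda>_. u) 0" and "\<kappa>s \<equiv> copy_s \<sigma> (\<lambda>_. u) (\<lambda>_. u) (\<lambda>_. u) 0"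
    and "\<kappa>e \<equiv> copy_e \<sigma> (\<lambda>_. u) (\<lambda>_. u) 0"
  assumes m1: "(\<lambda>(y, z1, z2). G (copy_l \<sigma> y z1 z2) (copy_s \<sigma> y z1 z2) (copy_e \<sigma> y z1))
    \<in> borel_measurable (joint_law n \<sigma> f)"
    and m2: "(\<lambda>(a, b, c). G (observe n \<sigma> f \<kappa>l a) (observe n \<sigma> f \<kappa>s b) (observe n \<sigma> f \<kappa>e c))
    \<in> borel_measurable (P \<Otimes>\<^sub>M (P \<Otimes>\<^sub>M P))"
  shows "(\<integral>\<^sup>+(y, z1, z2). G (copy_l \<sigma> y z1 z2) (copy_s \<sigma> y z1 z2) (copy_e \<sigma> y z1) \<partial>joint_law n \<sigma> f) =
    (\<integral>\<^sup>+a. \<integral>\<^sup>+b. \<integral>\<^sup>+c. G (observe n \<sigma> f \<kappa>l a) (observe n \<sigma> f \<kappa>s b) (observe n \<sigma> f \<kappa>e c) \<partial>P \<partial>P \<partial>P)"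
proof -
  let ?I = "{0..int n}"
  interpret P: prob_space P unfolding P_def by (rule prob_space_noise_law)
  interpret PP: pair_prob_space P P ..
  interpret PPP: pair_prob_space P "P \<Otimes>\<^sub>M P" ..
  have [measurable_cong]: "sets P = sets (PiM ?I (\<lambda>_. borel))" unfolding P_def by (rule sets_noise_law)
  have sP: "space P = PiE ?I (\<lambda>_. UNIV)" unfolding P_def by (rule space_noise_law)
  have P_alt: "P = PiM ?I (\<lambda>_. std_normal_distribution)" by (simp add: P_def noise_law_def)
  define F where "F a b c = G (observe n \<sigma> f \<kappa>l a) (observe n \<sigma> f \<kappa>s b) (observe n \<sigma> f \<kappa>e c)" for a b c
  have mF: "(\<lambda>p. F (fst p) (fst (snd p)) (snd (snd p))) \<in> borel_measurable (P \<Otimes>\<^sub>M (P \<Otimes>\<^sub>M P))"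
    using m2 by (simp add: F_def split_def)
  have mF': "(\<lambda>x. F (g1 x) (g2 x) (g3 x)) \<in> borel_measurable M"
    if "g1 \<in> M \<rightarrow>\<^sub>M P" "g2 \<in> M \<rightarrow>\<^sub>M P" "g3 \<in> M \<rightarrow>\<^sub>M P" for g1 g2 g3 and M :: "'z measure"
    using measurable_compose[OF _ mF, of "\<lambda>x. (g1 x, g2 x, g3 x)" M] that by simp
  \<comment> \<open>The first reflection turns the data noise \<open>x\<close> and \<open>z1\<close>
    into the normalized noise of the third copy and \<open>- (sqrt 2 * x + z1) / sqrt 3\<close>; the
    second mixes the latter with \<open>z2\<close> into the normalized noise of the other two
    copies.\<close>
  define c1 s1 c2 s2 :: real where "c1 = 1 / sqrt 3" and "s1 = - sqrt (2 / 3)" and "c2 = 1 / sqrt 2" and "s2 = - (1 / sqrt 2)"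
  have cs: "c1\<^sup>2 + s1\<^sup>2 = 1" "c1 \<noteq> 0" "c2\<^sup>2 + s2\<^sup>2 = 1" "c2 \<noteq> 0"
    by (auto simp: c1_def s1_def c2_def s2_def power_divide)
  let ?R1 = "rotate ?I c1 s1" and ?R2 = "rotate ?I c2 s2"
  have mR: "rotate ?I c s \<in> P \<Otimes>\<^sub>M P \<rightarrow>\<^sub>M P \<Otimes>\<^sub>M P" for c s
    by measurable
  have mR1: "(\<lambda>x. fst (rotate ?I c s (g1 x, g2 x))) \<in> M \<rightarrow>\<^sub>M P"
    and mR2: "(\<lambda>x. snd (rotate ?I c s (g1 x, g2 x))) \<in> M \<rightarrow>\<^sub>M P"
    if "g1 \<in> M \<rightarrow>\<^sub>M P" "g2 \<in> M \<rightarrow>\<^sub>M P" for g1 g2 c s and M :: "'z measure"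
    using measurable_compose[OF _ mR, of "\<lambda>x. (g1 x, g2 x)" M] that by (auto intro: measurable_fst'' measurable_snd'')
  have "(\<integral>\<^sup>+(y, z1, z2). G (copy_l \<sigma> y z1 z2) (copy_s \<sigma> y z1 z2) (copy_e \<sigma> y z1) \<partial>joint_law n \<sigma> f) =
    (\<integral>\<^sup>+w. (case (case w of (x, z) \<Rightarrow> (\<lambda>i\<in>?I. f (design n i) + \<sigma> * x i, z)) of (y, z1, z2) \<Rightarrow>
      G (copy_l \<sigma> y z1 z2) (copy_s \<sigma> y z1 z2) (copy_e \<sigma> y z1)) \<partial>(P \<Otimes>\<^sub>M (P \<Otimes>\<^sub>M P)))"
    unfolding joint_law_eq_distr P_def
  proof (rule nn_integral_distr)
    show "(\<lambda>(x, z). (\<lambda>i\<in>?I. f (design n i) + \<sigma> * x i, z)) \<in>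
      noise_law n \<Otimes>\<^sub>M noise_law n \<Otimes>\<^sub>M noise_law n \<rightarrow>\<^sub>M (PiM ?I (\<lambda>_. borel)) \<Otimes>\<^sub>M noise_law n \<Otimes>\<^sub>M noise_law n"
      by measurable
  qed (fact m1[unfolded joint_law_eq_distr])
  also have "\<dots> = (\<integral>\<^sup>+w. F (fst (?R2 (snd (snd w), snd (?R1 (fst w, fst (snd w)))))) (snd (?R2 (snd (snd w), snd (?R1 (fst w, fst (snd w))))))
      (fst (?R1 (fst w, fst (snd w)))) \<partial>(P \<Otimes>\<^sub>M (P \<Otimes>\<^sub>M P)))"
  proof (intro nn_integral_cong)
    fix w assume "w \<in> space (P \<Otimes>\<^sub>M (P \<Otimes>\<^sub>M P))"
    then obtain x z1 z2 where w: "w = (x, z1, z2)" and ext: "x \<in> space P" "z1 \<in> space P" "z2 \<in> space P"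
      by (auto simp: space_pair_measure)
    let ?y = "\<lambda>i\<in>?I. f (design n i) + \<sigma> * x i"
    \<comment> \<open>Outside the index set every input is \<open>undefined\<close>, hence the
      copies take the constant values \<open>\<kappa>l\<close>, \<open>\<kappa>s\<close>,
      \<open>\<kappa>e\<close> there.\<close>
    have und: "z1 k = u" "z2 k = u" "?y k = u" if "k \<notin> ?I" for k
      using ext that unfolding u_def sP by (auto simp: PiE_def extensional_def)
    have s3: "sqrt 3 * sqrt (2 / 3) = sqrt 2" by (simp add: real_sqrt_mult[symmetric])
    have s6: "sqrt 6 = sqrt 3 * sqrt 2" by (simp add: real_sqrt_mult[symmetric])
    have r2: "sqrt 2 * sqrt 2 = (2::real)" and r3: "sqrt 3 * sqrt 3 = (3::real)" by auto
    have mix: "sqrt 3 * c2 = sqrt 6 / 2" "sqrt 3 * (s2 * s1) = 1" "sqrt 3 * (s2 * c1) = - (sqrt 2 / 2)"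
    proof -
      have i2: "1 / sqrt 2 = sqrt 2 / (2::real)" by (simp add: field_simps)
      show "sqrt 3 * c2 = sqrt 6 / 2" unfolding c2_def i2 s6 by simp
      have "sqrt 3 * (s2 * s1) = (1 / sqrt 2) * (sqrt 3 * sqrt (2 / 3))" by (simp add: s2_def s1_def)
      then show "sqrt 3 * (s2 * s1) = 1" unfolding s3 by simp
      show "sqrt 3 * (s2 * c1) = - (sqrt 2 / 2)" unfolding s2_def c1_def i2 by simp
    qed
    have mix': "c2 = - s2" by (simp add: c2_def s2_def)
    have mixl: "sqrt 3 * (c2 * Z + s2 * (s1 * X - c1 * Y)) = X + sqrt 2 / 2 * Y + sqrt 6 / 2 * Z" for X Y Z
    proof -
      have "sqrt 3 * (c2 * Z + s2 * (s1 * X - c1 * Y)) = (sqrt 3 * c2) * Z + (sqrt 3 * (s2 * s1)) * X - (sqrt 3 * (s2 * c1)) * Y"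
        by (simp add: algebra_simps)
      then show ?thesis unfolding mix by simp
    qed
    have mixs: "sqrt 3 * (s2 * Z - c2 * (s1 * X - c1 * Y)) = X + sqrt 2 / 2 * Y - sqrt 6 / 2 * Z" for X Y Z
      using mixl[of "- Z" X Y] by (simp add: mix')
    have l: "copy_l \<sigma> ?y z1 z2 = observe n \<sigma> f \<kappa>l (fst (?R2 (z2, snd (?R1 (x, z1)))))"
    proof
      fix k
      show "copy_l \<sigma> ?y z1 z2 k = observe n \<sigma> f \<kappa>l (fst (?R2 (z2, snd (?R1 (x, z1))))) k"
      proof (cases "k \<in> ?I")
        case True
        have "sqrt 3 * (c2 * z2 k + s2 * (s1 * x k - c1 * z1 k)) = x k + sqrt 2 / 2 * z1 k + sqrt 6 / 2 * z2 k"
          by (rule mixl)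
        then have "\<sigma> * (sqrt 3 * (c2 * z2 k + s2 * (s1 * x k - c1 * z1 k))) = \<sigma> * (x k + sqrt 2 / 2 * z1 k + sqrt 6 / 2 * z2 k)"
          by simp
        then show ?thesis using True by (simp add: copy_l_def observe_def rotate_def algebra_simps)
      next
        case False
        show ?thesis unfolding observe_def if_not_P[OF False] copy_l_def \<kappa>l_def und[OF False] ..
      qed
    qed
    have s: "copy_s \<sigma> ?y z1 z2 = observe n \<sigma> f \<kappa>s (snd (?R2 (z2, snd (?R1 (x, z1)))))"
    proof
      fix k
      show "copy_s \<sigma> ?y z1 z2 k = observe n \<sigma> f \<kappa>s (snd (?R2 (z2, snd (?R1 (x, z1))))) k"
      proof (cases "k \<in> ?I")
        case True
        have "sqrt 3 * (s2 * z2 k - c2 * (s1 * x k - c1 * z1 k)) = x k + sqrt 2 / 2 * z1 k - sqrt 6 / 2 * z2 k"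
          by (rule mixs)
        then have "\<sigma> * (sqrt 3 * (s2 * z2 k - c2 * (s1 * x k - c1 * z1 k))) = \<sigma> * (x k + sqrt 2 / 2 * z1 k - sqrt 6 / 2 * z2 k)"
          by simp
        then show ?thesis using True by (simp add: copy_s_def observe_def rotate_def algebra_simps)
      next
        case False
        show ?thesis unfolding observe_def if_not_P[OF False] copy_s_def \<kappa>s_def und[OF False] ..
      qed
    qed
    have e: "copy_e \<sigma> ?y z1 = observe n \<sigma> f \<kappa>e (fst (?R1 (x, z1)))"
    proof
      fix k
      show "copy_e \<sigma> ?y z1 k = observe n \<sigma> f \<kappa>e (fst (?R1 (x, z1))) k"
      proof (cases "k \<in> ?I")
        case True
        have "sqrt 3 * (c1 * x k + s1 * z1 k) = x k - sqrt 2 * z1 k"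
          using s3 by (simp add: c1_def s1_def algebra_simps)
        then have "\<sigma> * (sqrt 3 * (c1 * x k + s1 * z1 k)) = \<sigma> * (x k - sqrt 2 * z1 k)"
          by simp
        then show ?thesis using True by (simp add: copy_e_def observe_def rotate_def algebra_simps)
      next
        case False
        show ?thesis unfolding observe_def if_not_P[OF False] copy_e_def \<kappa>e_def und[OF False] ..
      qed
    qed
    show "(case (case w of (x, z) \<Rightarrow> (\<lambda>i\<in>?I. f (design n i) + \<sigma> * x i, z)) of (y, z1, z2) \<Rightarrow>
      G (copy_l \<sigma> y z1 z2) (copy_s \<sigma> y z1 z2) (copy_e \<sigma> y z1)) =
      F (fst (?R2 (snd (snd w), snd (?R1 (fst w, fst (snd w)))))) (snd (?R2 (snd (snd w), snd (?R1 (fst w, fst (snd w))))))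
      (fst (?R1 (fst w, fst (snd w))))"
      unfolding w F_def by (simp add: l s e)
  qed
  also have "\<dots> = (\<integral>\<^sup>+x. \<integral>\<^sup>+q. F (fst (?R2 (snd q, snd (?R1 (x, fst q))))) (snd (?R2 (snd q, snd (?R1 (x, fst q)))))
      (fst (?R1 (x, fst q))) \<partial>(P \<Otimes>\<^sub>M P) \<partial>P)"
    by (subst PP.nn_integral_fst[symmetric]) ((intro mF' mR1 mR2; measurable), simp)
  also have "\<dots> = (\<integral>\<^sup>+x. \<integral>\<^sup>+y. \<integral>\<^sup>+z. F (fst (?R2 (z, snd (?R1 (x, y))))) (snd (?R2 (z, snd (?R1 (x, y)))))
      (fst (?R1 (x, y))) \<partial>P \<partial>P \<partial>P)"
    by (intro nn_integral_cong, subst P.nn_integral_fst[symmetric]) ((intro mF' mR1 mR2; measurable), simp)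
  also have "\<dots> = (\<integral>\<^sup>+x. \<integral>\<^sup>+y. \<integral>\<^sup>+z. F (fst (?R2 (z, y))) (snd (?R2 (z, y))) x \<partial>P \<partial>P \<partial>P)"
  proof -
    have "(\<lambda>q. F (fst (?R2 (snd q, snd (fst q)))) (snd (?R2 (snd q, snd (fst q)))) (fst (fst q)))
      \<in> borel_measurable ((P \<Otimes>\<^sub>M P) \<Otimes>\<^sub>M P)"
      by (intro mF' mR1 mR2; measurable)
    then have "(\<lambda>p. \<integral>\<^sup>+z. F (fst (?R2 (z, snd p))) (snd (?R2 (z, snd p))) (fst p) \<partial>P) \<in> borel_measurable (P \<Otimes>\<^sub>M P)"
      by (subst P.borel_measurable_nn_integral) (simp_all add: split_def)
    then show ?thesis
      using nn_integral_rotate_PiM[of ?I c1 s1 "\<lambda>p. \<integral>\<^sup>+z. F (fst (?R2 (z, snd p))) (snd (?R2 (z, snd p))) (fst p) \<partial>P"] cs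
      unfolding P_alt[symmetric] by simp
  qed
  also have "\<dots> = (\<integral>\<^sup>+x. \<integral>\<^sup>+z. \<integral>\<^sup>+y. F (fst (?R2 (z, y))) (snd (?R2 (z, y))) x \<partial>P \<partial>P \<partial>P)"
    by (intro nn_integral_cong PP.Fubini') (simp add: split_def, (intro mF' mR1 mR2; measurable))
  also have "\<dots> = (\<integral>\<^sup>+x. \<integral>\<^sup>+a. \<integral>\<^sup>+b. F a b x \<partial>P \<partial>P \<partial>P)"
  proof (rule nn_integral_cong)
    fix x assume x: "x \<in> space P"
    have "(\<lambda>p. F (fst p) (snd p) x) \<in> borel_measurable (P \<Otimes>\<^sub>M P)"
      using x by (intro mF') auto
    then show "(\<integral>\<^sup>+z. \<integral>\<^sup>+y. F (fst (?R2 (z, y))) (snd (?R2 (z, y))) x \<partial>P \<partial>P) = (\<integral>\<^sup>+a. \<integral>\<^sup>+b. F a b x \<partial>P \<partial>P)"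
      using nn_integral_rotate_PiM[of ?I c2 s2 "\<lambda>p. F (fst p) (snd p) x"] cs
      unfolding P_alt[symmetric] by simp
  qed
  also have "\<dots> = (\<integral>\<^sup>+a. \<integral>\<^sup>+x. \<integral>\<^sup>+b. F a b x \<partial>P \<partial>P \<partial>P)"
  proof (rule PP.Fubini')
    have "(\<lambda>q. F (fst (fst q)) (snd q) (snd (fst q))) \<in> borel_measurable ((P \<Otimes>\<^sub>M P) \<Otimes>\<^sub>M P)"
      by (intro mF'; measurable)
    then show "(\<lambda>(a, x). \<integral>\<^sup>+b. F a b x \<partial>P) \<in> borel_measurable (P \<Otimes>\<^sub>M P)"
      unfolding split_def by (subst P.borel_measurable_nn_integral) (simp_all add: split_def)
  qed
  also have "\<dots> = (\<integral>\<^sup>+a. \<integral>\<^sup>+b. \<integral>\<^sup>+x. F a b x \<partial>P \<partial>P \<partial>P)"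
    by (intro nn_integral_cong PP.Fubini') (simp add: split_def, (intro mF'; measurable))
  finally show ?thesis unfolding F_def .
qed

section \<open>Lower bounds for the benchmark\<close>

lemma distr_std_normal_shift:
  "distr std_normal_distribution borel (\<lambda>x. x + \<delta>) =
    density std_normal_distribution (\<lambda>x. ennreal (exp (\<delta> * x - \<delta>\<^sup>2 / 2)))"
proof (rule measure_eqI)
  fix A :: "real set" assume "A \<in> sets (distr std_normal_distribution borel (\<lambda>x. x + \<delta>))"
  then have [measurable]: "A \<in> sets borel" by simp
  have "emeasure (distr std_normal_distribution borel (\<lambda>x. x + \<delta>)) A =
    (\<integral>\<^sup>+x. indicator A (x + \<delta>) \<partial>std_normal_distribution)"
    using nn_integral_distr[of "\<lambda>x. x + \<delta>" std_normal_distribution borel "indicator A"] by simp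
  also have "\<dots> = (\<integral>\<^sup>+x. ennreal (std_normal_density x) * indicator A (x + \<delta>) \<partial>lborel)"
    by (subst nn_integral_density) auto
  also have "\<dots> = (\<integral>\<^sup>+x. ennreal (std_normal_density (- \<delta> + 1 * x)) * indicator A (- \<delta> + 1 * x + \<delta>) \<partial>lborel)"
    by (subst nn_integral_real_affine[where c=1 and t="- \<delta>"]) auto
  also have "\<dots> = (\<integral>\<^sup>+x. ennreal (std_normal_density x) * (ennreal (exp (\<delta> * x - \<delta>\<^sup>2 / 2)) * indicator A x) \<partial>lborel)"
  proof (rule nn_integral_cong)
    fix x
    have "exp (- (x - \<delta>)\<^sup>2 / 2) = exp (- x\<^sup>2 / 2) * exp (\<delta> * x - \<delta>\<^sup>2 / 2)"
      by (simp add: exp_add[symmetric] power2_eq_square field_simps)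
    then have "std_normal_density (- \<delta> + 1 * x) = std_normal_density x * exp (\<delta> * x - \<delta>\<^sup>2 / 2)"
      by (simp add: std_normal_density_def)
    then show "ennreal (std_normal_density (- \<delta> + 1 * x)) * indicator A (- \<delta> + 1 * x + \<delta>) =
      ennreal (std_normal_density x) * (ennreal (exp (\<delta> * x - \<delta>\<^sup>2 / 2)) * indicator A x)"
      by (simp add: ennreal_mult' mult.assoc)
  qed
  also have "\<dots> = emeasure (density std_normal_distribution (\<lambda>x. ennreal (exp (\<delta> * x - \<delta>\<^sup>2 / 2)))) A"
    by (subst emeasure_density, simp, simp, subst nn_integral_density) auto
  finally show "emeasure (distr std_normal_distribution borel (\<lambda>x. x + \<delta>)) A = \<dots>" .
qed simp

lemma has_bochner_integral_std_normal_exp: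
  "has_bochner_integral std_normal_distribution (\<lambda>x. exp (\<delta> * x - \<delta>\<^sup>2 / 2)) 1"
proof (rule has_bochner_integral_nn_integral)
  have "(\<integral>\<^sup>+x. ennreal (exp (\<delta> * x - \<delta>\<^sup>2 / 2)) \<partial>std_normal_distribution) =
    emeasure (density std_normal_distribution (\<lambda>x. ennreal (exp (\<delta> * x - \<delta>\<^sup>2 / 2)))) UNIV"
    by (subst emeasure_density) auto
  also have "\<dots> = emeasure (distr std_normal_distribution borel (\<lambda>x. x + \<delta>)) UNIV"
    by (simp only: distr_std_normal_shift)
  also have "\<dots> = 1" using stdN.emeasure_space_1 by (subst emeasure_distr) auto
  finally show "(\<integral>\<^sup>+x. ennreal (exp (\<delta> * x - \<delta>\<^sup>2 / 2)) \<partial>std_normal_distribution) = ennreal 1" by simp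
qed auto

lemma distr_PiM_std_shift:
  fixes I :: "'i set"
  assumes I: "finite I"
  defines "P \<equiv> PiM I (\<lambda>_. std_normal_distribution)"
  shows "distr P (PiM I (\<lambda>_. borel)) (\<lambda>x. \<lambda>i\<in>I. x i + \<delta> i) =
    density P (\<lambda>x. \<Prod>i\<in>I. ennreal (exp (\<delta> i * x i - (\<delta> i)\<^sup>2 / 2)))" (is "?L = ?R")
proof (rule measure_eqI_PiM_finite[OF I])
  interpret P: prob_space P unfolding P_def by (rule prob_space_PiM_std)
  interpret prod: product_sigma_finite "\<lambda>_::'i. std_normal_distribution" ..
  have [measurable_cong]: "sets P = sets (PiM I (\<lambda>_. borel))" unfolding P_def by (rule sets_PiM_std)
  have sP: "space P = (\<Pi>\<^sub>E i\<in>I. UNIV)" by (simp add: P_def space_PiM)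
  show "sets ?L = sets (PiM I (\<lambda>_. borel))" "sets ?R = sets (PiM I (\<lambda>_. borel))"
    by (simp_all add: P_def sets_PiM_std)
  show "range (\<lambda>_::nat. (\<Pi>\<^sub>E i\<in>I. UNIV)) \<subseteq> prod_algebra I (\<lambda>_. borel :: real measure)"
    using I by (auto intro!: prod_algebraI_finite)
  show "(\<Union>i::nat. (\<Pi>\<^sub>E i\<in>I. UNIV)) = space (PiM I (\<lambda>_. borel :: real measure))"
    by (simp add: space_PiM)
  show "emeasure ?L (\<Pi>\<^sub>E i\<in>I. UNIV) \<noteq> \<infinity>"
    using P.emeasure_finite by (subst emeasure_distr) (use I in \<open>auto simp: top_unique\<close>)
  fix A :: "'i \<Rightarrow> real set" assume A: "\<And>i. i \<in> I \<Longrightarrow> A i \<in> sets borel"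
  have "emeasure ?L (Pi\<^sub>E I A) = emeasure P ((\<lambda>x. \<lambda>i\<in>I. x i + \<delta> i) -` Pi\<^sub>E I A \<inter> space P)"
    using I A by (subst emeasure_distr) auto
  also have "(\<lambda>x. \<lambda>i\<in>I. x i + \<delta> i) -` Pi\<^sub>E I A \<inter> space P = Pi\<^sub>E I (\<lambda>i. (\<lambda>x. x + \<delta> i) -` A i)"
    by (auto simp: sP PiE_iff)
  also have "emeasure P \<dots> = (\<Prod>i\<in>I. emeasure std_normal_distribution ((\<lambda>x. x + \<delta> i) -` A i))"
  proof -
    have "(\<lambda>x. x + \<delta> i) -` A i \<in> sets borel" if "i \<in> I" for i
      using measurable_sets[of "\<lambda>x. x + \<delta> i" borel borel "A i"] A[OF that] by simp
    then show ?thesis unfolding P_def by (subst prod.emeasure_PiM) (use I in auto)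
  qed
  also have "\<dots> = (\<Prod>i\<in>I. \<integral>\<^sup>+x. ennreal (exp (\<delta> i * x - (\<delta> i)\<^sup>2 / 2)) * indicator (A i) x \<partial>std_normal_distribution)"
  proof (intro prod.cong refl)
    fix i assume i: "i \<in> I"
    note [measurable] = A[OF i]
    have "emeasure std_normal_distribution ((\<lambda>x. x + \<delta> i) -` A i) = emeasure (distr std_normal_distribution borel (\<lambda>x. x + \<delta> i)) (A i)"
      by (subst emeasure_distr) auto
    also have "\<dots> = (\<integral>\<^sup>+x. ennreal (exp (\<delta> i * x - (\<delta> i)\<^sup>2 / 2)) * indicator (A i) x \<partial>std_normal_distribution)"
      unfolding distr_std_normal_shift by (subst emeasure_density) auto
    finally show "emeasure std_normal_distribution ((\<lambda>x. x + \<delta> i) -` A i) = \<dots>" .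
  qed
  also have "\<dots> = (\<integral>\<^sup>+x. (\<Prod>i\<in>I. ennreal (exp (\<delta> i * x i - (\<delta> i)\<^sup>2 / 2)) * indicator (A i) (x i)) \<partial>P)"
    unfolding P_def by (rule prod.product_nn_integral_prod[symmetric]) (use I A in auto)
  also have "\<dots> = (\<integral>\<^sup>+x. (\<Prod>i\<in>I. ennreal (exp (\<delta> i * x i - (\<delta> i)\<^sup>2 / 2))) * indicator (Pi\<^sub>E I A) x \<partial>P)"
  proof (rule nn_integral_cong)
    fix x assume x: "x \<in> space P"
    have "(\<Prod>i\<in>I. indicator (A i) (x i)) = (indicator (Pi\<^sub>E I A) x :: ennreal)"
    proof (cases "x \<in> Pi\<^sub>E I A")
      case True
      then show ?thesis by (auto simp: PiE_iff intro!: prod.neutral)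
    next
      case False
      then obtain i where "i \<in> I" "x i \<notin> A i" using x by (auto simp: sP PiE_iff)
      then have "(\<Prod>i\<in>I. indicator (A i) (x i)) = (0 :: ennreal)"
        using I by (auto intro!: prod_zero bexI[of _ i])
      then show ?thesis using False by simp
    qed
    then show "(\<Prod>i\<in>I. ennreal (exp (\<delta> i * x i - (\<delta> i)\<^sup>2 / 2)) * indicator (A i) (x i)) =
      (\<Prod>i\<in>I. ennreal (exp (\<delta> i * x i - (\<delta> i)\<^sup>2 / 2))) * indicator (Pi\<^sub>E I A) x"
      by (simp add: prod.distrib)
  qed
  also have "\<dots> = emeasure ?R (Pi\<^sub>E I A)"
    using I A by (subst emeasure_density) auto
  finally show "emeasure ?L (Pi\<^sub>E I A) = emeasure ?R (Pi\<^sub>E I A)" .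
qed

text \<open>The total variation distance is bounded through the \<open>\<chi>\<^sup>2\<close>-distance; the pointwise bound
  \<open>L - 1 \<le> 1/10 + 5/2 (L - 1)\<^sup>2\<close> replaces the Cauchy-Schwarz inequality.\<close>

lemma measure_shift_PiM_std_le:
  fixes I :: "'i set"
  assumes I: "finite I" and \<delta>: "(\<Sum>i\<in>I. (\<delta> i)\<^sup>2) \<le> 3 / 100"
  defines "P \<equiv> PiM I (\<lambda>_. std_normal_distribution)"
  assumes A: "A \<in> sets (PiM I (\<lambda>_. borel))"
  shows "measure (distr P (PiM I (\<lambda>_. borel)) (\<lambda>x. \<lambda>i\<in>I. x i + \<delta> i)) A \<le> measure P A + 1 / 5"
proof -
  interpret P: prob_space P unfolding P_def by (rule prob_space_PiM_std)
  interpret prod: product_sigma_finite "\<lambda>_::'i. std_normal_distribution" ..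
  have [measurable_cong]: "sets P = sets (PiM I (\<lambda>_. borel))" unfolding P_def by (rule sets_PiM_std)
  note [measurable] = A
  define L where "L x = (\<Prod>i\<in>I. exp (\<delta> i * x i - (\<delta> i)\<^sup>2 / 2))" for x
  have Lnn: "0 \<le> L x" for x unfolding L_def by (intro prod_nonneg) auto
  have L1: "has_bochner_integral P L 1"
  proof -
    have "integrable P L" unfolding P_def L_def
      by (rule prod.product_integrable_prod) (use I has_bochner_integral_std_normal_exp in \<open>auto simp: has_bochner_integral_iff\<close>)
    moreover have "integral\<^sup>L P L = (\<Prod>i\<in>I. 1)" unfolding P_def L_def
      by (subst prod.product_integral_prod) (use I has_bochner_integral_std_normal_exp in \<open>auto simp: has_bochner_integral_iff\<close>)
    ultimately show ?thesis by (simp add: has_bochner_integral_iff)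
  qed
  \<comment> \<open>The squared ratio for the shift \<open>d\<close> is
    \<open>exp (d\<^sup>2)\<close> times the ratio for \<open>2 * d\<close>, whose integral is 1;
    the second moment thus needs no new integral.\<close>
  have sq: "(exp (d * x - d\<^sup>2 / 2))\<^sup>2 = exp (d\<^sup>2) * exp (2 * d * x - (2 * d)\<^sup>2 / 2)" for d x :: real
    by (simp add: exp_add[symmetric] exp_double[symmetric] power2_eq_square field_simps)
  have L2: "has_bochner_integral P (\<lambda>x. (L x)\<^sup>2) (exp (\<Sum>i\<in>I. (\<delta> i)\<^sup>2))"
  proof -
    have h: "has_bochner_integral std_normal_distribution (\<lambda>x. (exp (d * x - d\<^sup>2 / 2))\<^sup>2) (exp (d\<^sup>2))" for d
      unfolding sq using has_bochner_integral_mult_right[OF has_bochner_integral_std_normal_exp[of "2 * d"], of "exp (d\<^sup>2)"]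
      by simp
    have "integrable P (\<lambda>x. (L x)\<^sup>2)" unfolding P_def L_def prod_power_distrib
      by (rule prod.product_integrable_prod) (use I h in \<open>auto simp: has_bochner_integral_iff\<close>)
    moreover have "integral\<^sup>L P (\<lambda>x. (L x)\<^sup>2) = (\<Prod>i\<in>I. exp ((\<delta> i)\<^sup>2))" unfolding P_def L_def prod_power_distrib
      by (subst prod.product_integral_prod) (use I h in \<open>auto simp: has_bochner_integral_iff\<close>)
    ultimately show ?thesis by (simp add: has_bochner_integral_iff exp_sum I)
  qed
  have [measurable]: "L \<in> borel_measurable P" using L1 by (auto simp: has_bochner_integral_iff)
  have e: "emeasure (distr P (PiM I (\<lambda>_. borel)) (\<lambda>x. \<lambda>i\<in>I. x i + \<delta> i)) A = (\<integral>\<^sup>+x. ennreal (L x * indicator A x) \<partial>P)"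
    unfolding distr_PiM_std_shift[OF I, of \<delta>, folded P_def]
    by (subst emeasure_density)
       (auto intro!: nn_integral_cong simp: L_def indicator_def prod_ennreal split: if_splits)
  have intLA: "integrable P (\<lambda>x. L x * indicator A x)"
    using L1 by (intro integrable_mult_indicator[of A P L, simplified mult.commute] integrable_real_mult_indicator)
      (auto simp: has_bochner_integral_iff)
  have "measure (distr P (PiM I (\<lambda>_. borel)) (\<lambda>x. \<lambda>i\<in>I. x i + \<delta> i)) A = (\<integral>x. L x * indicator A x \<partial>P)"
    using e Lnn intLA by (simp add: measure_def nn_integral_eq_integral)
  also have "\<dots> \<le> (\<integral>x. indicator A x + (1 / 10 + 5 / 2 * ((L x)\<^sup>2 - 2 * L x + 1)) \<partial>P)"
  proof (rule integral_mono[OF intLA])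
    show "integrable P (\<lambda>x. indicator A x + (1 / 10 + 5 / 2 * ((L x)\<^sup>2 - 2 * L x + 1)))"
      using L1 L2 by (auto simp: has_bochner_integral_iff P.emeasure_finite less_top[symmetric])
    show "L x * indicator A x \<le> indicator A x + (1 / 10 + 5 / 2 * ((L x)\<^sup>2 - 2 * L x + 1))" for x
    proof -
      have 0: "0 \<le> (L x - 1)\<^sup>2" "0 \<le> (L x - 1 - 1 / 5)\<^sup>2" by simp_all
      show ?thesis using 0 by (cases "x \<in> A") (simp_all add: power2_eq_square field_simps)
    qed
  qed
  also have "\<dots> = measure P A + (1 / 10 + 5 / 2 * (exp (\<Sum>i\<in>I. (\<delta> i)\<^sup>2) - 2 + 1))"
    using L1 L2 by (simp add: has_bochner_integral_iff P.prob_space P.emeasure_finite less_top[symmetric])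
  \<comment> \<open>Since \<open>exp (3 / 100) \<le> 104 / 100\<close>, the excess is at most 1/10 +
    5/2 * 4/100 = 1/5.\<close>
  also have "\<dots> \<le> measure P A + (1 / 10 + 5 / 2 * (104 / 100 - 2 + 1))"
  proof -
    have "exp (\<Sum>i\<in>I. (\<delta> i)\<^sup>2) \<le> exp (3 / 100 :: real)" using \<delta> by simp
    also have "\<dots> \<le> 1 + 3 / 100 + (3 / 100)\<^sup>2" by (rule exp_bound) auto
    finally have "exp (\<Sum>i\<in>I. (\<delta> i)\<^sup>2) \<le> 104 / 100" by (simp add: power2_eq_square)
    then show ?thesis by (intro add_left_mono mult_left_mono diff_right_mono add_right_mono) auto
  qed
  finally show ?thesis by simp
qed

lemma prob_space_data_law: "prob_space (data_law n \<sigma> f)"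
  unfolding data_law_def
  by (rule prob_space.prob_space_distr[OF prob_space_noise_law]) measurable

lemma measure_data_law_le:
  assumes \<sigma>: "\<sigma> > 0" and A: "A \<in> sets (PiM {0..int n} (\<lambda>_. borel))"
    and fg: "(\<Sum>k\<in>{0..int n}. (f (design n k) - g (design n k))\<^sup>2) \<le> 3 / 100 * \<sigma>\<^sup>2"
  shows "measure (data_law n \<sigma> g) A \<le> measure (data_law n \<sigma> f) A + 1 / 5"
proof -
  let ?I = "{0..int n}"
  define \<delta> where "\<delta> k = (g (design n k) - f (design n k)) / \<sigma>" for k
  let ?T = "\<lambda>x. \<lambda>k\<in>?I. f (design n k) + \<sigma> * x k"
  let ?S = "\<lambda>x::int \<Rightarrow> real. \<lambda>k\<in>?I. x k + \<delta> k"
  have mT: "?T \<in> PiM ?I (\<lambda>_. borel) \<rightarrow>\<^sub>M PiM ?I (\<lambda>_. borel)" by measurable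
  have mS: "?S \<in> noise_law n \<rightarrow>\<^sub>M PiM ?I (\<lambda>_. borel)" by measurable
  let ?B = "?T -` A \<inter> space (PiM ?I (\<lambda>_. borel))"
  have B: "?B \<in> sets (PiM ?I (\<lambda>_. borel))" by (rule measurable_sets[OF mT A])
  have sp: "space (PiM ?I (\<lambda>_. borel :: real measure)) = space (noise_law n)" by (simp add: space_noise_law space_PiM)
  have "(\<Sum>k\<in>?I. (\<delta> k)\<^sup>2) = (\<Sum>k\<in>?I. (f (design n k) - g (design n k))\<^sup>2) / \<sigma>\<^sup>2"
    by (simp add: \<delta>_def power_divide power2_commute sum_divide_distrib)
  also have "\<dots> \<le> 3 / 100" using fg \<sigma> by (simp add: field_simps)
  finally have \<delta>: "(\<Sum>k\<in>?I. (\<delta> k)\<^sup>2) \<le> 3 / 100" .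
  have Tg: "(\<lambda>k\<in>?I. g (design n k) + \<sigma> * x k) = ?T (?S x)" for x
    using \<sigma> by (auto simp: \<delta>_def field_simps fun_eq_iff)
  have "data_law n \<sigma> g = distr (distr (noise_law n) (PiM ?I (\<lambda>_. borel)) ?S) (PiM ?I (\<lambda>_. borel)) ?T"
    unfolding data_law_def Tg by (subst distr_distr) (use mT mS in \<open>auto simp: comp_def\<close>)
  then have "measure (data_law n \<sigma> g) A = measure (distr (noise_law n) (PiM ?I (\<lambda>_. borel)) ?S) ?B"
    using mT A by (simp add: measure_distr)
  also have "\<dots> \<le> measure (noise_law n) ?B + 1 / 5"
    unfolding noise_law_def by (rule measure_shift_PiM_std_le) (use \<delta> B in auto)
  also have "measure (noise_law n) ?B = measure (data_law n \<sigma> f) A"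
    unfolding data_law_def using A by (subst measure_distr) (measurable, auto simp: sp)
  finally show ?thesis .
qed

section \<open>The two-point bound for the benchmark\<close>

lemma is_minimizer_minimizer: "f \<in> convex_class \<Longrightarrow> is_minimizer f (minimizer f)"
  unfolding convex_class_def minimizer_def by (blast intro: theI')

lemma minimum_value_eqI:
  assumes "is_minimizer f t" "\<And>s. is_minimizer f s \<Longrightarrow> s = t"
  shows "minimum_value f = f t"
proof -
  have "minimizer f = t" unfolding minimizer_def using assms by (rule the_equality)
  then show ?thesis by (simp add: minimum_value_def)
qed

text \<open>An interval that contains both minima is at least as long as their distance. Coverage
  under \<open>g\<close>, carried over to \<open>f\<close> at a loss of 1/5, and coverage under
  \<open>f\<close> occur together with probability at least 1 - 2 \<alpha> - 1/5, which exceeds 1/5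
  because \<alpha> < 3/10.\<close>

lemma benchmark_ge:
  assumes \<alpha>: "\<alpha> < 3 / 10" and \<sigma>: "\<sigma> > 0" and g: "g \<in> convex_class"
    and fg: "(\<Sum>k\<in>{0..int n}. (f (design n k) - g (design n k))\<^sup>2) \<le> 3 / 100 * \<sigma>\<^sup>2"
  shows "ennreal (1 / 5 * \<bar>minimum_value f - minimum_value g\<bar>) \<le> benchmark \<alpha> n \<sigma> f"
proof -
  let ?P = "data_law n \<sigma> f" and ?Q = "data_law n \<sigma> g"
  let ?a = "minimum_value f" and ?b = "minimum_value g"
  interpret P: prob_space ?P by (rule prob_space_data_law)
  interpret Q: prob_space ?Q by (rule prob_space_data_law)
  have sp: "space ?Q = space ?P" by (simp add: data_law_def)
  have "ennreal (1 / 5 * \<bar>?a - ?b\<bar>) \<le> expected_length ?P CI" if CI: "CI \<in> CI_class \<alpha> n \<sigma> {f, g}" for CI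
  proof -
    have ri: "random_interval ?P CI" "1 - \<alpha> \<le> measure ?P {\<omega>\<in>space ?P. ?a \<in> CI \<omega>}"
      "1 - \<alpha> \<le> measure ?Q {\<omega>\<in>space ?P. ?b \<in> CI \<omega>}"
      using CI by (auto simp: CI_class_def confidence_interval_def sp)
    have m[measurable]: "{\<omega>\<in>space ?P. x \<in> CI \<omega>} \<in> sets ?P" for x
      using ri by (auto simp: random_interval_def)
    have "measure ?Q {\<omega>\<in>space ?P. ?b \<in> CI \<omega>} \<le> measure ?P {\<omega>\<in>space ?P. ?b \<in> CI \<omega>} + 1 / 5"
      by (rule measure_data_law_le) (use m[of ?b] fg \<sigma> in \<open>auto simp: sets_data_law\<close>)
    then have b: "1 - \<alpha> - 1 / 5 \<le> measure ?P {\<omega>\<in>space ?P. ?b \<in> CI \<omega>}" using ri by simp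
    let ?E = "{\<omega>\<in>space ?P. ?a \<in> CI \<omega>} \<inter> {\<omega>\<in>space ?P. ?b \<in> CI \<omega>}"
    have "measure ?P ({\<omega>\<in>space ?P. ?a \<in> CI \<omega>} \<union> {\<omega>\<in>space ?P. ?b \<in> CI \<omega>}) =
      measure ?P {\<omega>\<in>space ?P. ?a \<in> CI \<omega>} + measure ?P {\<omega>\<in>space ?P. ?b \<in> CI \<omega>} - measure ?P ?E"
      by (rule measure_Un3) (auto simp: P.fmeasurable_eq_sets)
    then have E: "1 / 5 \<le> measure ?P ?E"
      using b ri \<alpha> P.prob_le_1[of "{\<omega>\<in>space ?P. ?a \<in> CI \<omega>} \<union> {\<omega>\<in>space ?P. ?b \<in> CI \<omega>}"] by linarith
    have "ennreal (1 / 5 * \<bar>?a - ?b\<bar>) \<le> ennreal (\<bar>?a - ?b\<bar> * measure ?P ?E)"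
      using mult_left_mono[OF E, of "\<bar>?a - ?b\<bar>"] by (intro ennreal_leI) simp
    also have "\<dots> = (\<integral>\<^sup>+\<omega>. ennreal \<bar>?a - ?b\<bar> * indicator ?E \<omega> \<partial>?P)"
      by (subst nn_integral_cmult_indicator) (auto simp: P.emeasure_eq_measure ennreal_mult')
    also have "\<dots> \<le> expected_length ?P CI"
      unfolding expected_length_def
    proof (rule nn_integral_mono)
      fix \<omega> assume \<omega>: "\<omega> \<in> space ?P"
      show "ennreal \<bar>?a - ?b\<bar> * indicator ?E \<omega> \<le> emeasure lborel (CI \<omega>)"
      proof (cases "\<omega> \<in> ?E")
        case True
        have int: "is_interval (CI \<omega>)" using ri \<omega> by (auto simp: random_interval_def)
        have ab: "?a \<in> CI \<omega>" "?b \<in> CI \<omega>" using True by auto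
        have sub: "{min ?a ?b..max ?a ?b} \<subseteq> CI \<omega>"
        proof
          fix x assume "x \<in> {min ?a ?b..max ?a ?b}"
          then show "x \<in> CI \<omega>"
            using mem_is_interval_1_I[OF int ab, of x] mem_is_interval_1_I[OF int ab(2,1), of x]
            by (cases "?a \<le> ?b") auto
        qed
        have "CI \<omega> \<in> sets borel"
          using int by (rule real_interval_borel_measurable)
        then have "emeasure lborel {min ?a ?b..max ?a ?b} \<le> emeasure lborel (CI \<omega>)"
          using sub by (intro emeasure_mono) auto
        moreover have "emeasure lborel {min ?a ?b..max ?a ?b} = ennreal \<bar>?a - ?b\<bar>"
          by (simp add: min_def max_def abs_if)
        ultimately show ?thesis using True by simp
      qed simp
    qed
    finally show ?thesis .
  qed
  then have "ennreal (1 / 5 * \<bar>?a - ?b\<bar>) \<le> (INF CI\<in>CI_class \<alpha> n \<sigma> {f, g}. expected_length ?P CI)"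
    by (rule INF_greatest)
  also have "\<dots> \<le> benchmark \<alpha> n \<sigma> f"
    unfolding benchmark_def by (rule SUP_upper) (rule g)
  finally show ?thesis .
qed

section \<open>Convex alternatives to \<open>f\<close>\<close>

lemma convex_on_chord_mono:
  fixes f :: "real \<Rightarrow> real"
  assumes f: "convex_on S f" and S: "a \<in> S" "b \<in> S" "c \<in> S" "d \<in> S"
    and le: "a < b" "c < d" "a \<le> c" "b \<le> d"
  shows "(f b - f a) / (b - a) \<le> (f d - f c) / (d - c)"
proof -
  have eq: "(u - v) / (x - y) = (v - u) / (y - x)" for u v x y :: real
    by (metis minus_diff_eq minus_divide_divide)
  have 1: "(f b - f a) / (b - a) \<le> (f d - f a) / (d - a)"
  proof (cases "b = d")
    case False
    then have "(f a - f b) / (a - b) \<le> (f a - f d) / (a - d)"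
      using convex_on_slope_le(1)[OF f S(1) S(4), of b] le by simp
    then show ?thesis unfolding eq[of "f a"] .
  qed simp
  have 2: "(f d - f a) / (d - a) \<le> (f d - f c) / (d - c)"
  proof (cases "a = c")
    case False
    then have "(f a - f d) / (a - d) \<le> (f c - f d) / (c - d)"
      using convex_on_slope_le(2)[OF f S(1) S(4), of c] le by simp
    then show ?thesis unfolding eq[of _ "f d"] .
  qed simp
  from 1 2 show ?thesis by (rule order_trans)
qed

lemma convex_on_max:
  fixes f g :: "'a::real_vector \<Rightarrow> real"
  assumes "convex_on S f" "convex_on S g"
  shows "convex_on S (\<lambda>x. max (f x) (g x))"
  unfolding convex_on_def
proof (intro conjI ballI allI impI)
  show "convex S" using assms by (simp add: convex_on_def)
  fix x y and u v :: real
  assume *: "x \<in> S" "y \<in> S" "0 \<le> u" "0 \<le> v" "u + v = 1"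
  have "f (u *\<^sub>R x + v *\<^sub>R y) \<le> u * f x + v * f y" "g (u *\<^sub>R x + v *\<^sub>R y) \<le> u * g x + v * g y"
    using assms * by (auto simp: convex_on_def)
  moreover have "u * f x + v * f y \<le> u * max (f x) (g x) + v * max (f y) (g y)"
    "u * g x + v * g y \<le> u * max (f x) (g x) + v * max (f y) (g y)"
    using * by (auto intro!: add_mono mult_left_mono)
  ultimately show "max (f (u *\<^sub>R x + v *\<^sub>R y)) (g (u *\<^sub>R x + v *\<^sub>R y)) \<le> u * max (f x) (g x) + v * max (f y) (g y)"
    by linarith
qed

lemma convex_on_square_dist:
  fixes z \<eta> :: real
  assumes "0 \<le> \<eta>" "convex S"
  shows "convex_on S (\<lambda>t. \<eta> * (t - z)\<^sup>2)"
  unfolding convex_on_def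
proof (intro conjI ballI allI impI)
  fix x y u v :: real
  assume *: "x \<in> S" "y \<in> S" "0 \<le> u" "0 \<le> v" "u + v = 1"
  have v: "v = 1 - u" using * by simp
  \<comment> \<open>The variance of a two-point distribution: for a parabola the gap in Jensen's
    inequality is explicit.\<close>
  have "u * (x - z)\<^sup>2 + v * (y - z)\<^sup>2 - (u *\<^sub>R x + v *\<^sub>R y - z)\<^sup>2 = u * v * (x - y)\<^sup>2"
    unfolding v by (simp add: power2_eq_square algebra_simps)
  then have "(u *\<^sub>R x + v *\<^sub>R y - z)\<^sup>2 \<le> u * (x - z)\<^sup>2 + v * (y - z)\<^sup>2"
    using * by (smt (verit) mult_nonneg_nonneg zero_le_power2)
  then have "\<eta> * (u *\<^sub>R x + v *\<^sub>R y - z)\<^sup>2 \<le> \<eta> * (u * (x - z)\<^sup>2 + v * (y - z)\<^sup>2)"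
    using assms(1) by (rule mult_left_mono)
  then show "\<eta> * (u *\<^sub>R x + v *\<^sub>R y - z)\<^sup>2 \<le> u * (\<eta> * (x - z)\<^sup>2) + v * (\<eta> * (y - z)\<^sup>2)"
    by (simp add: algebra_simps)
qed (fact assms)

lemma design_mem: "k \<in> {0..int n} \<Longrightarrow> design n k \<in> {0..1}"
  by (cases "n = 0") (auto simp: design_def divide_simps)

text \<open>The small parabola centred at \<open>z\<close> makes \<open>z\<close> the unique minimizer although the
  truncated function may be flat there.\<close>

lemma benchmark_ge_truncation:
  assumes \<alpha>: "\<alpha> < 3 / 10" and \<sigma>: "\<sigma> > 0" and z: "z \<in> {0..1}"
    and g: "convex_on {0..1} g" "g z \<le> w"
    and fg: "2 * (\<Sum>k\<in>{0..int n}. (max (g (design n k)) w - f (design n k))\<^sup>2) \<le> 2 / 100 * \<sigma>\<^sup>2"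
  shows "ennreal (1 / 5 * \<bar>minimum_value f - w\<bar>) \<le> benchmark \<alpha> n \<sigma> f"
proof -
  \<comment> \<open>Over the \<open>n + 1\<close> points the parabola costs at most
    \<open>2 * (n + 1) * \<eta>\<^sup>2 \<le> \<sigma>\<^sup>2 / 200\<close>, which together with
    the 2/100 granted to the truncation stays below the 3/100 of the two-point bound.\<close>
  define \<eta> where "\<eta> = \<sigma> / (20 * (n + 1))"
  have \<eta>: "0 < \<eta>" using \<sigma> by (simp add: \<eta>_def)
  define h where "h t = max (g t) w + \<eta> * (t - z)\<^sup>2" for t
  have conv: "convex_on {0..1} h" unfolding h_def
    by (intro convex_on_add convex_on_max convex_on_square_dist) (use g \<eta> in \<open>auto simp: convex_on_const\<close>)
  have hz: "h z = w" using g by (simp add: h_def)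
  have hw: "w + \<eta> * (t - z)\<^sup>2 \<le> h t" for t by (simp add: h_def)
  have "is_minimizer h z"
    unfolding is_minimizer_def hz using z hw \<eta> by (smt (verit) mult_nonneg_nonneg zero_le_power2)
  moreover have uniq: "s = z" if "is_minimizer h s" for s
  proof (rule ccontr)
    assume "s \<noteq> z"
    then have "0 < \<eta> * (s - z)\<^sup>2" using \<eta> by simp
    moreover have "h s \<le> w" using that z unfolding is_minimizer_def hz[symmetric] by blast
    ultimately show False using hw[of s] by linarith
  qed
  ultimately have "\<exists>!t. is_minimizer h t" and mv: "minimum_value h = w"
    using minimum_value_eqI[of h z] hz by metis+
  then have mem: "h \<in> convex_class" using conv by (simp add: convex_class_def)
  have "(\<Sum>k\<in>{0..int n}. (f (design n k) - h (design n k))\<^sup>2) \<le>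
    (\<Sum>k\<in>{0..int n}. 2 * (max (g (design n k)) w - f (design n k))\<^sup>2 + 2 * \<eta>\<^sup>2)"
  proof (rule sum_mono)
    fix k assume k: "k \<in> {0..int n}"
    define a where "a = max (g (design n k)) w - f (design n k)"
    define b where "b = \<eta> * (design n k - z)\<^sup>2"
    have "\<bar>design n k - z\<bar> \<le> 1" using design_mem[OF k] z by auto
    then have "(design n k - z)\<^sup>2 \<le> 1" by (simp add: abs_square_le_1)
    then have b: "0 \<le> b" "b \<le> \<eta>" using \<eta> by (auto simp: b_def)
    have "(f (design n k) - h (design n k))\<^sup>2 = (a + b)\<^sup>2"
      by (simp add: h_def a_def b_def power2_commute algebra_simps)
    also have "\<dots> \<le> 2 * a\<^sup>2 + 2 * b\<^sup>2"
      using zero_le_power2[of "a - b"] by (simp add: power2_eq_square algebra_simps)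
    also have "b\<^sup>2 \<le> \<eta>\<^sup>2" using b by (intro power_mono)
    finally show "(f (design n k) - h (design n k))\<^sup>2 \<le> 2 * (max (g (design n k)) w - f (design n k))\<^sup>2 + 2 * \<eta>\<^sup>2"
      by (simp add: a_def)
  qed
  also have "\<dots> \<le> 2 / 100 * \<sigma>\<^sup>2 + 2 * real (n + 1) * \<eta>\<^sup>2"
    using fg by (simp add: sum.distrib sum_distrib_left algebra_simps)
  also have "2 * real (n + 1) * \<eta>\<^sup>2 = \<sigma>\<^sup>2 / (200 * real (n + 1))"
    by (simp add: \<eta>_def power2_eq_square divide_simps) (simp add: algebra_simps)
  also have "\<dots> \<le> \<sigma>\<^sup>2 / 200"
    using \<sigma> by (intro divide_left_mono) auto
  finally have "(\<Sum>k\<in>{0..int n}. (f (design n k) - h (design n k))\<^sup>2) \<le> 3 / 100 * \<sigma>\<^sup>2"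
    using zero_le_power2[of \<sigma>] by linarith
  from benchmark_ge[OF \<alpha> \<sigma> mem this] show ?thesis by (simp add: mv)
qed

text \<open>The alternative is \<open>f\<close> itself truncated at
  \<open>minimum_value f + \<epsilon>\<close>: only the counted design points change, each by at
  most \<epsilon>, while the minimum moves by exactly \<epsilon>.\<close>

lemma benchmark_ge_raise:
  assumes \<alpha>: "\<alpha> < 3 / 10" and \<sigma>: "\<sigma> > 0" and f: "f \<in> convex_class" and \<epsilon>: "0 \<le> \<epsilon>"
    and N: "real (card {k\<in>{0..int n}. f (design n k) < minimum_value f + \<epsilon>}) * \<epsilon>\<^sup>2 \<le> \<sigma>\<^sup>2 / 100"
  shows "ennreal (1 / 5 * \<epsilon>) \<le> benchmark \<alpha> n \<sigma> f"
proof -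
  let ?z = "minimizer f" and ?M = "minimum_value f"
  have z: "?z \<in> {0..1}" "\<And>s. s \<in> {0..1} \<Longrightarrow> ?M \<le> f s"
    using is_minimizer_minimizer[OF f] by (auto simp: is_minimizer_def minimum_value_def)
  let ?A = "{k\<in>{0..int n}. f (design n k) < ?M + \<epsilon>}"
  have "(\<Sum>k\<in>{0..int n}. (max (f (design n k)) (?M + \<epsilon>) - f (design n k))\<^sup>2) \<le>
    (\<Sum>k\<in>{0..int n}. if f (design n k) < ?M + \<epsilon> then \<epsilon>\<^sup>2 else 0)"
  proof (rule sum_mono)
    fix k assume k: "k \<in> {0..int n}"
    have "?M \<le> f (design n k)" using z design_mem[OF k] by auto
    then show "(max (f (design n k)) (?M + \<epsilon>) - f (design n k))\<^sup>2 \<le> (if f (design n k) < ?M + \<epsilon> then \<epsilon>\<^sup>2 else 0)"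
      using k by (auto intro!: power_mono)
  qed
  also have "\<dots> = real (card ?A) * \<epsilon>\<^sup>2"
    by (subst sum.inter_filter[symmetric]) auto
  finally have "2 * (\<Sum>k\<in>{0..int n}. (max (f (design n k)) (?M + \<epsilon>) - f (design n k))\<^sup>2) \<le> 2 / 100 * \<sigma>\<^sup>2"
    using N by simp
  from benchmark_ge_truncation[OF \<alpha> \<sigma> z(1) _ _ this] f \<epsilon>
  show ?thesis by (simp add: convex_class_def minimum_value_def)
qed

lemma design_less_iff: "n \<ge> 1 \<Longrightarrow> design n i < design n j \<longleftrightarrow> i < j"
  by (simp add: design_def divide_less_cancel)

lemma design_le_iff: "n \<ge> 1 \<Longrightarrow> design n i \<le> design n j \<longleftrightarrow> i \<le> j"
  by (simp add: design_def divide_le_cancel)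

lemma grid_chord_mono:
  assumes f: "convex_on {0..1} f" and n: "n \<ge> 1"
    and le: "0 \<le> a" "a < b" "c < d" "a \<le> c" "b \<le> d" "d \<le> int n"
  shows "(f (design n b) - f (design n a)) / real_of_int (b - a) \<le> (f (design n d) - f (design n c)) / real_of_int (d - c)"
proof -
  have mem: "design n k \<in> {0..1}" if "0 \<le> k" "k \<le> int n" for k
    by (rule design_mem) (use that in simp)
  have "(f (design n b) - f (design n a)) / (design n b - design n a) \<le> (f (design n d) - f (design n c)) / (design n d - design n c)"
    by (rule convex_on_chord_mono[OF f])
       (use le n in \<open>auto simp: design_less_iff design_le_iff simp del: atLeastAtMost_iff intro!: mem\<close>)
  moreover have "design n b - design n a = real_of_int (b - a) / n" "design n d - design n c = real_of_int (d - c) / n"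
    by (simp_all add: design_def diff_divide_distrib)
  ultimately have "real n * ((f (design n b) - f (design n a)) / real_of_int (b - a)) \<le>
      real n * ((f (design n d) - f (design n c)) / real_of_int (d - c))"
    by (simp add: mult.commute)
  then show ?thesis by (rule mult_left_le_imp_le) (use n in simp)
qed

text \<open>The data determine \<open>f\<close> on the grid only. Dropping the chord over one grid cell from the
  piecewise linear interpolation gives a convex function with the same values on the grid and a
  minimum as low as the extrapolation from the neighbouring cells; at the boundary of \<open>[0,1]\<close> the
  missing chords are replaced by very steep lines.\<close>

lemma benchmark_ge_dip:
  fixes f :: "real \<Rightarrow> real" and i :: int
  assumes \<alpha>: "\<alpha> < 3 / 10" and \<sigma>: "\<sigma> > 0" and f: "f \<in> convex_class" and n: "n \<ge> 1"
    and i: "0 \<le> i" "i < int n" and t: "design n i < t" "t < design n (i + 1)"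
    and vl: "i \<ge> 1 \<Longrightarrow> v_left n 0 (\<lambda>k. f (design n k)) i t \<le> w"
    and vr: "i + 2 \<le> int n \<Longrightarrow> v_right n 0 (\<lambda>k. f (design n k)) i t \<le> w"
    and m: "\<And>k. k \<in> {0..int n} \<Longrightarrow> m \<le> f (design n k)" and w: "w \<le> m"
  shows "ennreal (1 / 10 * (m - w)) \<le> benchmark \<alpha> n \<sigma> f"
proof (cases "minimum_value f \<le> (m + w) / 2")
  \<comment> \<open>If \<open>f\<close> dips at least halfway from the grid values towards
    \<open>w\<close>, raising its minimum by \<open>(m - w) / 2\<close> alters no grid value.
    Otherwise the alternative constructed below has its minimum far enough under that of
    \<open>f\<close>.\<close>
  case True
  have E: "{k\<in>{0..int n}. f (design n k) < minimum_value f + (m - w) / 2} = {}"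
    using m True by (fastforce simp: field_simps)
  show ?thesis
    using benchmark_ge_raise[OF \<alpha> \<sigma> f, of "(m - w) / 2" n] w unfolding E by simp
next
  case False
  have cf: "convex_on {0..1} f" using f by (simp add: convex_class_def)
  define F where "F k = f (design n k)" for k
  have chord: "(F b - F a) / real_of_int (b - a) \<le> (F d - F c) / real_of_int (d - c)"
    if "0 \<le> a" "a < b" "c < d" "a \<le> c" "b \<le> d" "d \<le> int n" for a b c d
    unfolding F_def using grid_chord_mono[OF cf n that] .
  have t01: "0 < t" "t < 1"
  proof -
    show "0 < t" using t i n by (auto simp: design_def intro: le_less_trans[rotated])
    have "design n (i + 1) \<le> design n (int n)" using i n by (simp add: design_le_iff)
    moreover have "design n (int n) = 1" using n by (simp add: design_def)
    ultimately show "t < 1" using t(2) by linarith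
  qed
  define b where "b k = real n * (\<bar>F 0 - F k\<bar> + \<bar>F (int n) - F k\<bar>)" for k
  \<comment> \<open>\<open>B\<close> is the slope of the steep boundary lines: the first two terms
    bring both lines below \<open>w\<close> at \<open>t\<close>, and the terms \<open>b k\<close>
    keep them below every grid value.\<close>
  define B where "B = \<bar>F 0 - w\<bar> / t + \<bar>F (int n) - w\<bar> / (1 - t) + (\<Sum>k\<in>{0..int n}. b k)"
  have b_nonneg: "0 \<le> b k" for k by (simp add: b_def)
  have pos: "0 \<le> \<bar>F 0 - w\<bar> / t" "0 \<le> \<bar>F (int n) - w\<bar> / (1 - t)" "0 \<le> (\<Sum>k\<in>{0..int n}. b k)"
    using t01 b_nonneg by (auto intro!: sum_nonneg)
  then have B1: "\<bar>F 0 - w\<bar> / t \<le> B" and B2: "\<bar>F (int n) - w\<bar> / (1 - t) \<le> B"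
    unfolding B_def by linarith+
  have B3: "b k \<le> B" if "k \<in> {0..int n}" for k
    using member_le_sum[OF that, of b] b_nonneg pos unfolding B_def by auto
  have Bn: "0 \<le> B / n" unfolding B_def using pos by simp
  \<comment> \<open>The indices -1 and \<open>i\<close> both carry the steep line at 0, so the chord
    over cell \<open>i\<close> is absent while the family stays indexed by an interval; index
    \<open>n\<close> carries the steep line at 1.\<close>
  define L where "L k s = (if k = -1 \<or> k = i then F 0 - B * s
     else if k = int n then F (int n) - B * (1 - s)
     else F k + real n * (F (k + 1) - F k) * (s - design n k))" for k s
  define g where "g s = Max ((\<lambda>k. L k s) ` {-1..int n})" for s
  have L_le: "L k s \<le> g s" if "k \<in> {-1..int n}" for k s
    unfolding g_def using that by (intro Max_ge) auto
  have g_le: "g s \<le> c" if "\<And>k. k \<in> {-1..int n} \<Longrightarrow> L k s \<le> c" for s c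
    unfolding g_def using that by (subst Max_le_iff) auto
  have L_affine: "L k (u * x + v * y) = u * L k x + v * L k y" if "u + v = 1" for k u v x y
  proof -
    have v: "v = 1 - u" using that by simp
    show ?thesis unfolding L_def v by (simp add: algebra_simps)
  qed
  have g_convex: "convex_on {0..1} g"
    unfolding convex_on_def
  proof (intro conjI ballI allI impI)
    fix x y u v :: real assume uv: "0 \<le> u" "0 \<le> v" "u + v = 1"
    show "g (u *\<^sub>R x + v *\<^sub>R y) \<le> u * g x + v * g y"
    proof (rule g_le)
      fix k assume k: "k \<in> {-1..int n}"
      have "L k (u *\<^sub>R x + v *\<^sub>R y) = u * L k x + v * L k y" using L_affine[OF uv(3)] by simp
      also have "\<dots> \<le> u * g x + v * g y"
        using uv L_le[OF k] by (intro add_mono mult_left_mono)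
      finally show "L k (u *\<^sub>R x + v *\<^sub>R y) \<le> u * g x + v * g y" .
    qed
  qed simp
  have nd: "real n * (design n a - design n b) = real_of_int (a - b)" for a b
    using n by (simp add: design_def right_diff_distrib)
  have g_grid: "g (design n j) = F j" if j: "j \<in> {0..int n}" for j
  proof (rule antisym)
    have dj: "design n j \<in> {0..1}" using design_mem[OF j] .
    show "g (design n j) \<le> F j"
    proof (rule g_le)
      fix k assume k: "k \<in> {-1..int n}"
      consider "k = -1 \<or> k = i" | "k \<noteq> -1" "k \<noteq> i" "k = int n" | "k \<noteq> -1" "k \<noteq> i" "k \<noteq> int n" by blast
      then show "L k (design n j) \<le> F j"
      proof cases
        case 1
        have "F 0 - F j \<le> B * design n j"
        proof (cases "j = 0")
          case False
          then have "1 \<le> real_of_int j" using j by simp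
          have "F 0 - F j \<le> \<bar>F 0 - F j\<bar> + \<bar>F (int n) - F j\<bar>" by simp
          also have "\<dots> \<le> B / n" using B3[OF j] n by (simp add: b_def field_simps)
          also have "\<dots> \<le> B / n * real_of_int j"
            using mult_left_mono[OF \<open>1 \<le> real_of_int j\<close> Bn] by simp
          finally show ?thesis by (simp add: design_def)
        qed (simp add: design_def)
        then show ?thesis using 1 by (simp add: L_def)
      next
        case 2
        have "F (int n) - F j \<le> B * (1 - design n j)"
        proof (cases "j = int n")
          case False
          then have "1 \<le> real_of_int (int n - j)" using j by simp
          have "F (int n) - F j \<le> \<bar>F 0 - F j\<bar> + \<bar>F (int n) - F j\<bar>" by simp
          also have "\<dots> \<le> B / n" using B3[OF j] n by (simp add: b_def field_simps)
          also have "\<dots> \<le> B / n * real_of_int (int n - j)"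
            using mult_left_mono[OF \<open>1 \<le> real_of_int (int n - j)\<close> Bn] by simp
          also have "\<dots> = B * (1 - design n j)" using n by (simp add: design_def field_simps)
          finally show ?thesis .
        qed (use n in \<open>simp add: design_def\<close>)
        then show ?thesis using 2 by (simp add: L_def)
      next
        case 3
        then have k': "0 \<le> k" "k < int n" using k by auto
        have L: "L k (design n j) = F k + (F (k + 1) - F k) * real_of_int (j - k)"
          using 3 nd[of j k] by (simp add: L_def mult.assoc mult.left_commute[of "real n"])
        consider "j < k" | "j = k" | "j > k" by linarith
        then show ?thesis
        proof cases
          case 1
          have "(F k - F j) / real_of_int (k - j) \<le> (F (k + 1) - F k) / real_of_int (k + 1 - k)"
            by (rule chord) (use 1 k' j in auto)
          then show ?thesis unfolding L using 1 by (simp add: field_simps)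
        next
          case 3
          have "(F (k + 1) - F k) / real_of_int (k + 1 - k) \<le> (F j - F k) / real_of_int (j - k)"
            by (rule chord) (use 3 k' j in auto)
          then show ?thesis unfolding L using 3 by (simp add: field_simps)
        next
          case 2
          then show ?thesis unfolding L by simp
        qed
      qed
    qed
    \<comment> \<open>Each grid value is attained: at both ends by a steep line, in between by the
      chord that starts at \<open>j\<close> or, for \<open>j = i\<close>, by the chord that ends
      there.\<close>
    consider "j = 0" | "j = int n" | "0 < j" "j < int n" "j \<noteq> i" | "0 < j" "j < int n" "j = i"
      using j by fastforce
    then have "\<exists>k\<in>{-1..int n}. L k (design n j) = F j"
    proof cases
      case 1 then show ?thesis by (intro bexI[of _ "-1"]) (auto simp: L_def design_def)
    next
      case 2 then show ?thesis using n i by (intro bexI[of _ "int n"]) (auto simp: L_def design_def)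
    next
      case 3 then show ?thesis by (intro bexI[of _ j]) (auto simp: L_def)
    next
      case 4
      then have "L (j - 1) (design n j) = F (j - 1) + (F j - F (j - 1)) * (real n * (design n j - design n (j - 1)))"
        by (simp add: L_def)
      then show ?thesis unfolding nd using 4 by (intro bexI[of _ "j - 1"]) auto
    qed
    then show "F j \<le> g (design n j)" using L_le by metis
  qed
  have g_t: "g t \<le> w"
  proof (rule g_le)
    fix k assume k: "k \<in> {-1..int n}"
    consider "k = -1 \<or> k = i" | "k \<noteq> -1" "k \<noteq> i" "k = int n" | "0 \<le> k" "k < i" | "i < k" "k < int n" using k by fastforce
    then show "L k t \<le> w"
    proof cases
      case 1
      have "F 0 - w \<le> B * t" using B1 t01 by (simp add: pos_divide_le_eq)
      then show ?thesis using 1 by (simp add: L_def)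
    next
      case 2
      have "F (int n) - w \<le> B * (1 - t)" using B2 t01 by (simp add: pos_divide_le_eq)
      then show ?thesis using 2 by (simp add: L_def)
    next
      case 3
      have "L k t = L k (design n i) + real n * (F (k + 1) - F k) * (t - design n i)"
        using 3 i by (simp add: L_def algebra_simps)
      also have "\<dots> \<le> F i + real n * (F i - F (i - 1)) * (t - design n i)"
      proof (intro add_mono mult_right_mono mult_left_mono)
        show "L k (design n i) \<le> F i" using L_le[OF k, of "design n i"] g_grid[of i] i by simp
        have "(F (k + 1) - F k) / real_of_int (k + 1 - k) \<le> (F i - F (i - 1)) / real_of_int (i - (i - 1))"
          by (rule chord) (use 3 i in auto)
        then show "F (k + 1) - F k \<le> F i - F (i - 1)" by simp
      qed (use t in auto)
      also have "\<dots> \<le> w" using vl 3 by (simp add: v_left_def F_def)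
      finally show ?thesis .
    next
      case 4
      have "L k t = L k (design n (i + 1)) + real n * (F (k + 1) - F k) * (t - design n (i + 1))"
        using 4 i by (simp add: L_def algebra_simps)
      also have "\<dots> \<le> F (i + 1) + real n * (F (i + 2) - F (i + 1)) * (t - design n (i + 1))"
      proof (intro add_mono mult_right_mono_neg mult_left_mono)
        show "L k (design n (i + 1)) \<le> F (i + 1)" using L_le[OF k, of "design n (i + 1)"] g_grid[of "i + 1"] i by simp
        have "(F (i + 2) - F (i + 1)) / real_of_int (i + 2 - (i + 1)) \<le> (F (k + 1) - F k) / real_of_int (k + 1 - k)"
          by (rule chord) (use 4 i in auto)
        then show "F (i + 2) - F (i + 1) \<le> F (k + 1) - F k" by simp
      qed (use t in auto)
      also have "\<dots> \<le> w" using vr 4 by (simp add: v_right_def F_def)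
      finally show ?thesis .
    qed
  qed
  \<comment> \<open>\<open>g\<close> interpolates \<open>f\<close> on the grid and \<open>w\<close>
    lies below all grid values, so truncating at \<open>w\<close> changes none of them.\<close>
  have "(\<Sum>k\<in>{0..int n}. (max (g (design n k)) w - f (design n k))\<^sup>2) = (\<Sum>k\<in>{0..int n}. 0)"
  proof (intro sum.cong refl)
    fix k assume k: "k \<in> {0..int n}"
    show "(max (g (design n k)) w - f (design n k))\<^sup>2 = 0"
      using g_grid[OF k] m[OF k] w by (simp add: F_def)
  qed
  then have "ennreal (1 / 5 * \<bar>minimum_value f - w\<bar>) \<le> benchmark \<alpha> n \<sigma> f"
    using t01 \<sigma> by (intro benchmark_ge_truncation[OF \<alpha> \<sigma> _ g_convex g_t]) auto
  moreover have "1 / 10 * (m - w) \<le> 1 / 5 * \<bar>minimum_value f - w\<bar>" using False by (simp add: abs_if)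
  ultimately show ?thesis by (meson ennreal_leI order_trans)
qed

section \<open>The interval for given stopping level and starting index\<close>

definition start_level :: "real \<Rightarrow> nat \<Rightarrow> nat" where
  "start_level \<alpha> jh = nat (max 0 (int jh - K_const (\<alpha> / 4) - 1))"

definition end_level :: "real \<Rightarrow> nat \<Rightarrow> nat \<Rightarrow> nat" where
  "end_level \<alpha> n jh = nat (min (int (top_level n)) (int jh + Kt_const (\<alpha> / 4)))"

definition window_lo :: "real \<Rightarrow> nat \<Rightarrow> nat \<Rightarrow> int \<Rightarrow> int" where
  "window_lo \<alpha> n jh i = max 1 (2 ^ (end_level \<alpha> n jh - start_level \<alpha> jh) * (i - 5))"

definition window_hi :: "real \<Rightarrow> nat \<Rightarrow> nat \<Rightarrow> int \<Rightarrow> int" where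
  "window_hi \<alpha> n jh i = min (2 ^ (end_level \<alpha> n jh - start_level \<alpha> jh) * (i + 4) + 1)
     \<lceil>real (n + 1) / 2 ^ (top_level n - end_level \<alpha> n jh)\<rceil>"

definition window_card :: "real \<Rightarrow> nat \<Rightarrow> nat \<Rightarrow> int \<Rightarrow> nat \<Rightarrow> nat" where
  "window_card \<alpha> n jh i d = nat (window_hi \<alpha> n jh i - window_lo \<alpha> n jh i + int d)"

definition noise_scale :: "real \<Rightarrow> nat \<Rightarrow> real \<Rightarrow> nat \<Rightarrow> real" where
  "noise_scale \<alpha> n \<sigma> jh = sqrt 3 * \<sigma> / sqrt (2 ^ (top_level n - end_level \<alpha> n jh))"

definition min_average :: "real \<Rightarrow> nat \<Rightarrow> nat \<Rightarrow> int \<Rightarrow> (int \<Rightarrow> real) \<Rightarrow> ereal" where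
  "min_average \<alpha> n jh i ye =
     Min ((\<lambda>k. ereal (1 / 2 ^ (top_level n - end_level \<alpha> n jh)) * block_sum n ye (end_level \<alpha> n jh) k)
       ` {window_lo \<alpha> n jh i..window_hi \<alpha> n jh i})"

definition upper_end :: "real \<Rightarrow> nat \<Rightarrow> real \<Rightarrow> nat \<Rightarrow> int \<Rightarrow> (int \<Rightarrow> real) \<Rightarrow> ereal" where
  "upper_end \<alpha> n \<sigma> jh i ye = min_average \<alpha> n jh i ye +
     ereal (S_quantile (window_card \<alpha> n jh i 1) (\<alpha> / 4) * noise_scale \<alpha> n \<sigma> jh)"

definition fine_margin :: "real \<Rightarrow> nat \<Rightarrow> real \<Rightarrow> nat \<Rightarrow> int \<Rightarrow> real" where
  "fine_margin \<alpha> n \<sigma> jh i = S_quantile (window_card \<alpha> n jh i 3) (\<alpha> / 8) * sqrt 3 * \<sigma>"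

definition lower_end :: "real \<Rightarrow> nat \<Rightarrow> real \<Rightarrow> nat \<Rightarrow> int \<Rightarrow> (int \<Rightarrow> real) \<Rightarrow> ereal" where
  "lower_end \<alpha> n \<sigma> jh i ye =
     (if int jh + Kt_const (\<alpha> / 4) \<le> int (top_level n)
      then min_average \<alpha> n jh i ye - ereal ((z_upper (\<alpha> / 4) + 1) * noise_scale \<alpha> n \<sigma> jh)
      else min (Min (h_lower n (fine_margin \<alpha> n \<sigma> jh i) ye (window_lo \<alpha> n jh i) (window_hi \<alpha> n jh i)
             ` {window_lo \<alpha> n jh i - 1..window_hi \<alpha> n jh i - 2})) (upper_end \<alpha> n \<sigma> jh i ye))"

definition start_index :: "real \<Rightarrow> nat \<Rightarrow> real \<Rightarrow> (int \<Rightarrow> real) \<Rightarrow> (int \<Rightarrow> real) \<Rightarrow> int" where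
  "start_index \<alpha> n \<sigma> yl ys = loc_index n yl (start_level \<alpha> (stop_level n \<sigma> yl ys))"

text \<open>Once the stopping level and the starting index are parameters, the endpoints are
  functions of the third copy alone. The first two copies enter only through these two discrete
  quantities, which is the form needed for conditioning and for measurability.\<close>

lemma CI_endpoints_eq:
  "CI_endpoints \<alpha> n \<sigma> yl ys ye =
    (lower_end \<alpha> n \<sigma> (stop_level n \<sigma> yl ys) (start_index \<alpha> n \<sigma> yl ys) ye,
     upper_end \<alpha> n \<sigma> (stop_level n \<sigma> yl ys) (start_index \<alpha> n \<sigma> yl ys) ye)"
  unfolding CI_endpoints_def Let_def lower_end_def upper_end_def fine_margin_def min_average_def noise_scale_def
    window_card_def window_hi_def window_lo_def end_level_def start_index_def start_level_def
    of_nat_1 of_nat_numeral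
  by (rule refl)

section \<open>Measurability\<close>

lemma measurable_filter_finite:
  assumes "finite A" and [measurable]: "\<And>i. i \<in> A \<Longrightarrow> Measurable.pred M (P i)"
  shows "(\<lambda>\<omega>. {i\<in>A. P i \<omega>}) \<in> M \<rightarrow>\<^sub>M count_space UNIV"
proof -
  have "(\<lambda>\<omega>. {i\<in>A. P i \<omega>}) \<in> M \<rightarrow>\<^sub>M count_space (Pow A)"
  proof (intro measurable_count_space_eq2[THEN iffD2] conjI ballI)
    show "finite (Pow A)" using assms by simp
    fix B assume "B \<in> Pow A"
    then have "(\<lambda>\<omega>. {i\<in>A. P i \<omega>}) -` {B} \<inter> space M = {\<omega>\<in>space M. \<forall>i\<in>A. i \<in> B \<longleftrightarrow> P i \<omega>}" by auto
    also have "\<dots> \<in> sets M" using assms by (intro sets.sets_Collect_finite_All) auto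
    finally show "(\<lambda>\<omega>. {i\<in>A. P i \<omega>}) -` {B} \<inter> space M \<in> sets M" .
  qed auto
  from measurable_compose[OF this, of "\<lambda>B. B" "count_space UNIV"] show ?thesis by simp
qed

lemma measurable_argmin_index:
  assumes "finite A" "\<And>i. i \<in> A \<Longrightarrow> (\<lambda>\<omega>. Y \<omega> i) \<in> borel_measurable M"
  shows "(\<lambda>\<omega>. argmin_index (Y \<omega>) A) \<in> M \<rightarrow>\<^sub>M count_space UNIV"
proof -
  have "Measurable.pred M (\<lambda>\<omega>. \<forall>k\<in>A. Y \<omega> i \<le> Y \<omega> k)" if "i \<in> A" for i
    unfolding pred_def using assms that
    by (intro sets.sets_Collect_finite_All) (auto intro!: borel_measurable_le)
  then have "(\<lambda>\<omega>. {i\<in>A. \<forall>k\<in>A. Y \<omega> i \<le> Y \<omega> k}) \<in> M \<rightarrow>\<^sub>M count_space UNIV"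
    by (rule measurable_filter_finite[OF assms(1)])
  then show ?thesis
    unfolding argmin_index_def
    by (rule measurable_compose) simp
qed

lemma measurable_block_sum:
  assumes "\<And>k. (\<lambda>\<omega>. y \<omega> k) \<in> borel_measurable M"
  shows "(\<lambda>\<omega>. block_sum n (y \<omega>) j i) \<in> borel_measurable M"
  unfolding block_sum_def
proof (rule borel_measurable_ereal_sum)
  fix k show "(\<lambda>\<omega>. extend n (y \<omega>) k) \<in> borel_measurable M"
    unfolding extend_def using assms[of k] by (cases "k \<in> {0..int n}") auto
qed

lemma measurable_loc_index:
  assumes y: "\<And>k. (\<lambda>\<omega>. y \<omega> k) \<in> borel_measurable M"
  shows "(\<lambda>\<omega>. loc_index n (y \<omega>) j) \<in> M \<rightarrow>\<^sub>M count_space UNIV"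
proof (induction j)
  case (Suc j)
  show ?case
    unfolding loc_index.simps
    by (rule measurable_compose_countable[OF _ Suc, where f="\<lambda>i \<omega>. argmin_index (block_sum n (y \<omega>) (Suc j))
       {max (2 * i - 2) 1 .. min (2 * i + 1) \<lfloor>real (n + 1) / 2 ^ (top_level n - Suc j)\<rfloor>}"])
      (intro measurable_argmin_index measurable_block_sum y, simp)
qed simp

lemma measurable_T_stat:
  assumes yl: "\<And>k. (\<lambda>\<omega>. yl \<omega> k) \<in> borel_measurable M" and ys: "\<And>k. (\<lambda>\<omega>. ys \<omega> k) \<in> borel_measurable M"
  shows "(\<lambda>\<omega>. T_stat n (yl \<omega>) (ys \<omega>) j) \<in> borel_measurable M"
  unfolding T_stat_def Let_def
  by (rule measurable_compose_countable[OF _ measurable_loc_index[OF yl], where f="\<lambda>i \<omega>.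
      min (block_sum n (ys \<omega>) j (i + 6) - block_sum n (ys \<omega>) j (i + 5))
          (block_sum n (ys \<omega>) j (i - 6) - block_sum n (ys \<omega>) j (i - 5))"])
     (intro borel_measurable_min borel_measurable_ereal_diff measurable_block_sum ys)

lemma measurable_stop_level:
  assumes yl: "\<And>k. (\<lambda>\<omega>. yl \<omega> k) \<in> borel_measurable M" and ys: "\<And>k. (\<lambda>\<omega>. ys \<omega> k) \<in> borel_measurable M"
  shows "(\<lambda>\<omega>. stop_level n \<sigma> (yl \<omega>) (ys \<omega>)) \<in> M \<rightarrow>\<^sub>M count_space UNIV"
proof -
  note [measurable] = measurable_T_stat[OF yl ys]
  have "(\<lambda>\<omega>. {j\<in>{0..top_level n}. T_stat n (yl \<omega>) (ys \<omega>) j \<le> ereal (2 * sigma_level n \<sigma> j)}) \<in> M \<rightarrow>\<^sub>M count_space UNIV"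
    by (rule measurable_filter_finite) measurable
  then show ?thesis
    unfolding stop_level_def Let_def
    by (rule measurable_compose[where g="\<lambda>A. if A = {} then top_level n else min (top_level n) (Min A)"]) simp
qed

lemma measurable_start_index:
  assumes yl: "\<And>k. (\<lambda>\<omega>. yl \<omega> k) \<in> borel_measurable M" and ys: "\<And>k. (\<lambda>\<omega>. ys \<omega> k) \<in> borel_measurable M"
  shows "(\<lambda>\<omega>. start_index \<alpha> n \<sigma> (yl \<omega>) (ys \<omega>)) \<in> M \<rightarrow>\<^sub>M count_space UNIV"
  unfolding start_index_def
  by (rule measurable_compose_countable[OF measurable_loc_index[OF yl] measurable_stop_level[OF yl ys]])

text \<open>The infima in \<open>h_lower\<close> run over uncountably many points. The rational
  points of the open interval are dense in the closed one, so by continuity a countable infimum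
  replaces them, for which measurability is available.\<close>

lemma INF_eq_INF_rat:
  fixes F :: "real \<Rightarrow> real"
  assumes "a < b" "continuous_on {a..b} F"
  shows "(INF t\<in>{a..b}. ereal (F t)) = (INF t\<in>{a<..<b} \<inter> \<rat>. ereal (F t))"
proof (rule antisym)
  show "(INF t\<in>{a..b}. ereal (F t)) \<le> (INF t\<in>{a<..<b} \<inter> \<rat>. ereal (F t))"
    by (rule INF_superset_mono) auto
  have cl: "closure ({a<..<b} \<inter> \<rat>) = {a..b}"
    using assms(1)
    by (subst closure_open_Int_superset) (auto simp: Rats_closure_real)
  show "(INF t\<in>{a<..<b} \<inter> \<rat>. ereal (F t)) \<le> (INF t\<in>{a..b}. ereal (F t))" (is "?c \<le> _")
  proof (rule INF_greatest)
    fix t assume t: "t \<in> {a..b}"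
    have le: "?c \<le> ereal (F s)" if "s \<in> {a<..<b} \<inter> \<rat>" for s using that by (rule INF_lower)
    show "?c \<le> ereal (F t)"
    proof (cases ?c)
      case (real c)
      have "c \<le> F t"
      proof (rule continuous_ge_on_closure[of "{a<..<b} \<inter> \<rat>" F t c])
        show "continuous_on (closure ({a<..<b} \<inter> \<rat>)) F" unfolding cl by fact
        show "t \<in> closure ({a<..<b} \<inter> \<rat>)" unfolding cl by fact
        show "c \<le> F s" if "s \<in> {a<..<b} \<inter> \<rat>" for s using le[OF that] real by simp
      qed
      then show ?thesis using real by simp
    next
      case PInf
      have "{a<..<b} \<inter> \<rat> \<noteq> {}" using cl assms(1) by (metis atLeastatMost_empty_iff2 closure_empty less_imp_le)
      then show ?thesis using le PInf by fastforce
    qed simp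
  qed
qed

lemma measurable_h_lower:
  assumes n: "n \<ge> 1" and y: "\<And>k. (\<lambda>\<omega>. y \<omega> k) \<in> borel_measurable M"
  shows "(\<lambda>\<omega>. h_lower n H (y \<omega>) a b i) \<in> borel_measurable M"
proof -
  note [measurable] = y
  have c: "countable ({s<..<t} \<inter> \<rat>)" for s t :: real
    by (rule countable_subset[OF _ countable_rat]) auto
  have dn: "design n i < design n (i + 1)" "0 < 1 / real n" "(real n - 1) / real n < 1"
    using n by (auto simp: design_less_iff field_simps)
  have cont: "continuous_on S (\<lambda>t. v_left n H u j t)" "continuous_on S (\<lambda>t. v_right n H u j t)"
    "continuous_on S (\<lambda>t. max (v_left n H u j t) (v_right n H u j t))" for S u j
    unfolding v_left_def v_right_def by (intro continuous_intros)+
  have m: "(\<lambda>\<omega>. v_left n H (y \<omega>) j t) \<in> borel_measurable M" "(\<lambda>\<omega>. v_right n H (y \<omega>) j t) \<in> borel_measurable M" for j t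
    unfolding v_left_def v_right_def by measurable
  note [measurable] = m
  show ?thesis
    unfolding h_lower_def INF_eq_INF_rat[OF dn(1) cont(3)] INF_eq_INF_rat[OF dn(2) cont(2)] INF_eq_INF_rat[OF dn(3) cont(1)]
    by (intro measurable_If borel_measurable_INF c) auto
qed

lemma measurable_min_average:
  assumes y: "\<And>k. (\<lambda>\<omega>. y \<omega> k) \<in> borel_measurable M"
  shows "(\<lambda>\<omega>. min_average \<alpha> n jh i (y \<omega>)) \<in> borel_measurable M"
  unfolding min_average_def
  by (intro borel_measurable_Min borel_measurable_ereal_times measurable_block_sum y) auto

lemma measurable_upper_end:
  assumes y: "\<And>k. (\<lambda>\<omega>. y \<omega> k) \<in> borel_measurable M"
  shows "(\<lambda>\<omega>. upper_end \<alpha> n \<sigma> jh i (y \<omega>)) \<in> borel_measurable M"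
  unfolding upper_end_def
  by (intro borel_measurable_ereal_add measurable_min_average y) auto

lemma measurable_lower_end:
  assumes n: "n \<ge> 1" and y: "\<And>k. (\<lambda>\<omega>. y \<omega> k) \<in> borel_measurable M"
  shows "(\<lambda>\<omega>. lower_end \<alpha> n \<sigma> jh i (y \<omega>)) \<in> borel_measurable M"
  unfolding lower_end_def
  by (intro measurable_If borel_measurable_min borel_measurable_Min measurable_h_lower measurable_upper_end
      borel_measurable_ereal_diff measurable_min_average y n) auto

lemma measurable_CI_endpoints:
  assumes n: "n \<ge> 1" and yl: "\<And>k. (\<lambda>\<omega>. yl \<omega> k) \<in> borel_measurable M"
    and ys: "\<And>k. (\<lambda>\<omega>. ys \<omega> k) \<in> borel_measurable M" and ye: "\<And>k. (\<lambda>\<omega>. ye \<omega> k) \<in> borel_measurable M"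
  shows "(\<lambda>\<omega>. CI_endpoints \<alpha> n \<sigma> (yl \<omega>) (ys \<omega>) (ye \<omega>)) \<in> borel_measurable M"
proof -
  have "(\<lambda>\<omega>. (lower_end \<alpha> n \<sigma> j i (ye \<omega>), upper_end \<alpha> n \<sigma> j i (ye \<omega>))) \<in> borel_measurable M" for j i
    using measurable_lower_end[OF n ye] measurable_upper_end[OF ye]
    by (auto simp: borel_prod[symmetric])
  \<comment> \<open>Level and index take countably many values, so measurability for each fixed
    value suffices; they are substituted one after the other.\<close>
  from measurable_compose_countable[OF this measurable_start_index[OF yl ys]]
  have "(\<lambda>\<omega>. (lower_end \<alpha> n \<sigma> j (start_index \<alpha> n \<sigma> (yl \<omega>) (ys \<omega>)) (ye \<omega>),
    upper_end \<alpha> n \<sigma> j (start_index \<alpha> n \<sigma> (yl \<omega>) (ys \<omega>)) (ye \<omega>))) \<in> borel_measurable M" for j .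
  from measurable_compose_countable[OF this measurable_stop_level[OF yl ys]]
  show ?thesis unfolding CI_endpoints_eq .
qed

section \<open>Blocks and localization\<close>

definition block_size :: "nat \<Rightarrow> nat \<Rightarrow> int" where
  "block_size n j = 2 ^ (top_level n - j)"

definition num_blocks :: "nat \<Rightarrow> nat \<Rightarrow> int" where
  "num_blocks n j = (int n + 1) div block_size n j"

definition block :: "nat \<Rightarrow> nat \<Rightarrow> int \<Rightarrow> int set" where
  "block n j i = {(i - 1) * block_size n j..i * block_size n j - 1}"

text \<open>Real-valued counterpart of \<open>block_sum\<close>; by \<open>block_sum_eq\<close> the
  two agree exactly for blocks inside the sample, where \<open>block_sum\<close> is finite.\<close>

definition bsum :: "nat \<Rightarrow> (int \<Rightarrow> real) \<Rightarrow> nat \<Rightarrow> int \<Rightarrow> real" where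
  "bsum n y j i = (\<Sum>k\<in>block n j i. y k)"

lemma block_size_pos: "0 < block_size n j" and block_size_ge_1: "1 \<le> block_size n j"
  by (simp_all add: block_size_def)

lemma block_size_Suc: "j < top_level n \<Longrightarrow> block_size n j = 2 * block_size n (Suc j)"
  by (simp add: block_size_def power_Suc[symmetric] Suc_diff_Suc del: power_Suc)

lemma block_size_add: "j + d \<le> top_level n \<Longrightarrow> block_size n j = 2 ^ d * block_size n (j + d)"
  by (simp add: block_size_def power_add[symmetric])

lemma block_size_top: "block_size n (top_level n) = 1"
  by (simp add: block_size_def)

lemma real_block_size: "real_of_int (block_size n j) = 2 ^ (top_level n - j)"
  by (simp add: block_size_def)

lemma top_level_bounds: "2 ^ top_level n \<le> n + 1" "n + 1 < 2 * 2 ^ top_level n"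
proof -
  let ?x = "\<lfloor>log 2 (real (n + 1))\<rfloor>"
  have nn: "0 \<le> ?x" by simp
  have le: "real_of_int ?x \<le> log 2 (real (n + 1))" "log 2 (real (n + 1)) < real_of_int ?x + 1" by linarith+
  have "2 powr real_of_int ?x \<le> real (n + 1)"
    by (rule le_log_iff[THEN iffD1, OF _ _ le(1)]) auto
  moreover have "real (n + 1) < 2 powr (real_of_int ?x + 1)"
    by (rule log_less_iff[THEN iffD1, OF _ _ le(2)]) auto
  moreover have "real_of_int ?x = real (top_level n)" using nn by (simp add: top_level_def)
  ultimately have "real (2 ^ top_level n) \<le> real (n + 1)" "real (n + 1) < real (2 * 2 ^ top_level n)"
    by (simp_all add: powr_add powr_realpow)
  then show "2 ^ top_level n \<le> n + 1" "n + 1 < 2 * 2 ^ top_level n"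
    unfolding of_nat_le_iff of_nat_less_iff by auto
qed

lemma block_size_0_bounds: "block_size n 0 \<le> int n + 1" "int n + 1 < 2 * block_size n 0"
  using top_level_bounds[of n] unfolding block_size_def
  by (simp_all flip: of_nat_le_iff[where 'a=int] of_nat_less_iff[where 'a=int])

lemma num_blocks_floor: "\<lfloor>real (n + 1) / 2 ^ (top_level n - j)\<rfloor> = num_blocks n j"
  using floor_divide_of_int_eq[of "int n + 1" "block_size n j", where 'a=real]
  by (simp add: num_blocks_def real_block_size add.commute)

lemma le_num_blocks_iff: "i \<le> num_blocks n j \<longleftrightarrow> i * block_size n j \<le> int n + 1"
proof
  assume "i \<le> num_blocks n j"
  then have "i * block_size n j \<le> num_blocks n j * block_size n j"
    using block_size_pos[of n j] by (intro mult_right_mono) auto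
  also have "\<dots> \<le> int n + 1"
    unfolding num_blocks_def using div_mult_mod_eq[of "int n + 1" "block_size n j"]
      pos_mod_sign[OF block_size_pos, of "int n + 1" n j] by linarith
  finally show "i * block_size n j \<le> int n + 1" .
next
  assume "i * block_size n j \<le> int n + 1"
  then have "i * block_size n j div block_size n j \<le> num_blocks n j"
    unfolding num_blocks_def using block_size_pos[of n j] by (rule zdiv_mono1)
  then show "i \<le> num_blocks n j" using block_size_pos[of n j] by simp
qed

lemma num_blocks_0: "num_blocks n 0 = 1"
  using le_num_blocks_iff[of 1 n 0] le_num_blocks_iff[of 2 n 0] block_size_0_bounds[of n] by simp

lemma num_blocks_Suc:
  assumes "j < top_level n"
  shows "2 * num_blocks n j \<le> num_blocks n (Suc j)" "num_blocks n (Suc j) \<le> 2 * num_blocks n j + 1"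
proof -
  have "num_blocks n j * block_size n j \<le> int n + 1" using le_num_blocks_iff by blast
  then show "2 * num_blocks n j \<le> num_blocks n (Suc j)"
    unfolding le_num_blocks_iff using block_size_Suc[OF assms] by (simp add: algebra_simps)
  have "\<not> (2 * num_blocks n j + 2) * block_size n (Suc j) \<le> int n + 1"
    using le_num_blocks_iff[of "num_blocks n j + 1" n j] block_size_Suc[OF assms] by (simp add: algebra_simps)
  then show "num_blocks n (Suc j) \<le> 2 * num_blocks n j + 1"
    unfolding le_num_blocks_iff[symmetric] by simp
qed

lemma num_blocks_top: "num_blocks n (top_level n) = int n + 1"
  by (simp add: num_blocks_def block_size_top)

lemma finite_block: "finite (block n j i)"
  by (simp add: block_def)

lemma card_block: "card (block n j i) = nat (block_size n j)"
  by (simp add: block_def algebra_simps)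

lemma block_nonempty: "block n j i \<noteq> {}"
  using block_size_pos[of n j] by (simp add: block_def algebra_simps)

lemma block_subset_iff: "block n j i \<subseteq> {0..int n} \<longleftrightarrow> 1 \<le> i \<and> i \<le> num_blocks n j"
proof -
  have ne: "(i - 1) * block_size n j \<le> i * block_size n j - 1"
    using block_size_pos[of n j] by (simp add: algebra_simps)
  have "0 \<le> (i - 1) * block_size n j \<longleftrightarrow> 1 \<le> i"
    using block_size_pos[of n j] by (auto simp: zero_le_mult_iff)
  then show ?thesis
    unfolding block_def le_num_blocks_iff using ne by auto
qed

lemma disjoint_blocks:
  assumes "i < i'" shows "block n j i \<inter> block n j i' = {}"
proof -
  have "i * block_size n j \<le> (i' - 1) * block_size n j"
    using assms block_size_pos[of n j] by (intro mult_right_mono) auto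
  then show ?thesis unfolding block_def by auto
qed

lemma block_sum_eq:
  "block_sum n y j i = (if 1 \<le> i \<and> i \<le> num_blocks n j then ereal (bsum n y j i) else \<infinity>)"
proof (cases "1 \<le> i \<and> i \<le> num_blocks n j")
  case True
  have "block_sum n y j i = (\<Sum>k\<in>block n j i. extend n y k)"
    by (simp add: block_sum_def block_def block_size_def)
  also have "\<dots> = (\<Sum>k\<in>block n j i. ereal (y k))"
    using True block_subset_iff[of n j i] by (intro sum.cong) (auto simp: extend_def)
  finally show ?thesis using True by (simp add: bsum_def)
next
  case False
  then have "\<not> block n j i \<subseteq> {0..int n}" using block_subset_iff by metis
  then obtain k where k: "k \<in> block n j i" "k \<notin> {0..int n}" by blast
  have "block_sum n y j i = (\<Sum>k\<in>block n j i. extend n y k)"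
    by (simp add: block_sum_def block_def block_size_def)
  also have "\<dots> = \<infinity>"
    using k finite_block by (auto simp: sum_Pinfty extend_def)
  finally show ?thesis using False by simp
qed

lemma argmin_index_props:
  assumes "finite A" "A \<noteq> {}"
  shows "argmin_index Y A \<in> A" "\<And>k. k \<in> A \<Longrightarrow> Y (argmin_index Y A) \<le> Y k"
proof -
  let ?B = "{i\<in>A. \<forall>k\<in>A. Y i \<le> Y k}"
  have "Min (Y ` A) \<in> Y ` A" using assms by (intro Min_in) auto
  then obtain i where "i \<in> A" "Min (Y ` A) = Y i" by blast
  moreover from this have "Y i \<le> Y k" if "k \<in> A" for k using that assms by (metis Min_le finite_imageI imageI)
  ultimately have "i \<in> ?B" by blast
  then have "Min ?B \<in> ?B" using assms by (intro Min_in) auto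
  then show "argmin_index Y A \<in> A" "\<And>k. k \<in> A \<Longrightarrow> Y (argmin_index Y A) \<le> Y k"
    unfolding argmin_index_def by auto
qed

lemma loc_index_step:
  assumes "j < top_level n" "1 \<le> loc_index n y j" "loc_index n y j \<le> num_blocks n j"
  defines "C \<equiv> {max (2 * loc_index n y j - 2) 1..min (2 * loc_index n y j + 1) (num_blocks n (Suc j))}"
  shows "loc_index n y (Suc j) \<in> C" "\<And>k. k \<in> C \<Longrightarrow> bsum n y (Suc j) (loc_index n y (Suc j)) \<le> bsum n y (Suc j) k"
proof -
  have C: "finite C" "2 * loc_index n y j - 1 \<in> C"
    using assms num_blocks_Suc(1)[OF assms(1)] by (auto simp: C_def)
  have eq: "loc_index n y (Suc j) = argmin_index (block_sum n y (Suc j)) C"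
    by (simp only: loc_index.simps num_blocks_floor C_def)
  show 1: "loc_index n y (Suc j) \<in> C"
    unfolding eq using C by (intro argmin_index_props) auto
  fix k assume k: "k \<in> C"
  then have "block_sum n y (Suc j) (loc_index n y (Suc j)) \<le> block_sum n y (Suc j) k"
    unfolding eq using C by (intro argmin_index_props) auto
  moreover have "1 \<le> i \<and> i \<le> num_blocks n (Suc j)" if "i \<in> C" for i using that by (auto simp: C_def)
  ultimately show "bsum n y (Suc j) (loc_index n y (Suc j)) \<le> bsum n y (Suc j) k"
    using 1 k by (simp add: block_sum_eq del: loc_index.simps)
qed

lemma loc_index_bounds:
  assumes "j \<le> top_level n"
  shows "1 \<le> loc_index n y j \<and> loc_index n y j \<le> num_blocks n j"
  using assms
proof (induction j)
  case (Suc j)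
  then have "j < top_level n" "1 \<le> loc_index n y j" "loc_index n y j \<le> num_blocks n j" by auto
  from loc_index_step(1)[OF this] show ?case by auto
qed (simp add: num_blocks_0)

lemma loc_index_Suc:
  fixes y :: "int \<Rightarrow> real"
  assumes "j < top_level n"
  defines "C \<equiv> {max (2 * loc_index n y j - 2) 1..min (2 * loc_index n y j + 1) (num_blocks n (Suc j))}"
  shows "loc_index n y (Suc j) \<in> C" "\<And>k. k \<in> C \<Longrightarrow> bsum n y (Suc j) (loc_index n y (Suc j)) \<le> bsum n y (Suc j) k"
  unfolding C_def
  using loc_index_step[OF assms(1), of y] loc_index_bounds[of j n y] assms(1) by (auto simp del: loc_index.simps)

text \<open>The candidates at the next level lie between \<open>2 * i - 2\<close> and
  \<open>2 * i + 1\<close>. These maps have the fixed points 2 and -1, and each iteration doubles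
  the distance to the fixed point.\<close>

lemma loc_index_descendants:
  assumes "j + d \<le> top_level n"
  shows "2 ^ d * (loc_index n y j - 2) + 2 \<le> loc_index n y (j + d)"
    "loc_index n y (j + d) \<le> 2 ^ d * (loc_index n y j + 1) - 1"
proof -
  have "2 ^ d * (loc_index n y j - 2) + 2 \<le> loc_index n y (j + d) \<and> loc_index n y (j + d) \<le> 2 ^ d * (loc_index n y j + 1) - 1"
    using assms
  proof (induction d)
    case (Suc d)
    have "loc_index n y (Suc (j + d)) \<ge> 2 * loc_index n y (j + d) - 2" "loc_index n y (Suc (j + d)) \<le> 2 * loc_index n y (j + d) + 1"
      using loc_index_Suc(1)[of "j + d" n y] Suc.prems by auto
    then show ?case using Suc by (simp add: algebra_simps del: loc_index.simps)
  qed simp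
  then show "2 ^ d * (loc_index n y j - 2) + 2 \<le> loc_index n y (j + d)"
    "loc_index n y (j + d) \<le> 2 ^ d * (loc_index n y j + 1) - 1" by auto
qed

text \<open>The pair of blocks at distance 5 and 6 on one side of the localized block; these pairs are
  disjoint for different levels, so that conditionally on the localization the stopping statistics
  are independent.\<close>

definition side_pair :: "nat \<Rightarrow> (int \<Rightarrow> real) \<Rightarrow> int \<Rightarrow> nat \<Rightarrow> int set" where
  "side_pair n y s j = block n j (loc_index n y j + 6 * s) \<union> block n j (loc_index n y j + 5 * s)"

text \<open>The finer localized block stays so close to the descendants of the coarser one that its
  blocks at distance up to 6 fit between the two coarse pairs: on each side 3 coarse blocks, that is
  \<open>3 * e \<ge> 6\<close> fine ones, have to hold only 5 fine blocks.\<close>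

lemma disjoint_side_pairs:
  assumes j: "j < j'" "j' \<le> top_level n" and s: "s \<in> {-1, 1}" "s' \<in> {-1, 1}"
  shows "side_pair n y s j \<inter> side_pair n y s' j' = {}"
proof -
  define d where "d = j' - j"
  define e :: int where "e = 2 ^ d"
  have d: "j' = j + d" "1 \<le> d" using j by (auto simp: d_def)
  then have e: "2 \<le> e" unfolding e_def by (metis one_le_numeral power_increasing power_one_right)
  let ?i = "loc_index n y j" and ?i' = "loc_index n y j'"
  define m where "m = block_size n j'"
  have m: "0 < m" "block_size n j = e * m"
    using block_size_add[of j d n] block_size_pos d j by (auto simp: m_def e_def)
  have i': "e * (?i - 2) + 2 \<le> ?i'" "?i' \<le> e * (?i + 1) - 1"
    using loc_index_descendants[of j d n y] d j by (auto simp: e_def)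
  have *: "k \<in> {e * (?i - 5) * m..e * (?i + 4) * m - 1}" if k: "k \<in> side_pair n y s' j'" for k
  proof -
    have "k \<in> {(?i' - 7) * m..(?i' + 6) * m - 1}"
      using k s m by (auto simp: side_pair_def block_def m_def[symmetric] algebra_simps)
    moreover have "e * (?i - 5) \<le> ?i' - 7" "?i' + 6 \<le> e * (?i + 4)"
      using i' e by (simp_all add: algebra_simps)
    then have "e * (?i - 5) * m \<le> (?i' - 7) * m" "(?i' + 6) * m \<le> e * (?i + 4) * m"
      using m by (auto intro: mult_right_mono)
    ultimately show ?thesis by auto
  qed
  have **: "k < e * (?i - 5) * m \<or> e * (?i + 4) * m \<le> k" if k: "k \<in> side_pair n y s j" for k
    using k s m e by (auto simp: side_pair_def block_def algebra_simps)
  show ?thesis using * ** by fastforce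
qed

text \<open>A finite bound excludes an outer block outside the sample, for which the difference is
  infinite; the inner block lies between it and the localized block, so it is inside as
  well.\<close>

lemma T_stat_le_cases:
  assumes j: "j \<le> top_level n" and T: "T_stat n yl ys j \<le> ereal t"
  obtains s where "s \<in> {-1, 1}" "1 \<le> loc_index n yl j + 6 * s" "loc_index n yl j + 6 * s \<le> num_blocks n j"
    "bsum n ys j (loc_index n yl j + 6 * s) - bsum n ys j (loc_index n yl j + 5 * s) \<le> t"
proof -
  let ?i = "loc_index n yl j"
  have i: "1 \<le> ?i" "?i \<le> num_blocks n j" using loc_index_bounds[OF j, of yl] by auto
  consider "block_sum n ys j (?i + 6) - block_sum n ys j (?i + 5) \<le> ereal t" |
    "block_sum n ys j (?i - 6) - block_sum n ys j (?i - 5) \<le> ereal t"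
    using T by (auto simp: T_stat_def Let_def min_le_iff_disj)
  then show thesis
  proof cases
    case 1
    then have "?i + 6 \<le> num_blocks n j" using i by (auto simp: block_sum_eq split: if_splits)
    with 1 i show thesis by (intro that[of 1]) (auto simp: block_sum_eq split: if_splits)
  next
    case 2
    then have "1 \<le> ?i - 6" using i by (auto simp: block_sum_eq split: if_splits)
    with 2 i show thesis by (intro that[of "-1"]) (auto simp: block_sum_eq split: if_splits)
  qed
qed

lemma T_stat_le:
  assumes s: "s \<in> {-1, 1}" "1 \<le> loc_index n yl j + 6 * s" "loc_index n yl j + 6 * s \<le> num_blocks n j"
    and j: "j \<le> top_level n"
  shows "T_stat n yl ys j \<le> ereal (bsum n ys j (loc_index n yl j + 6 * s) - bsum n ys j (loc_index n yl j + 5 * s))"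
proof -
  have i: "1 \<le> loc_index n yl j" "loc_index n yl j \<le> num_blocks n j" using loc_index_bounds[OF j, of yl] by auto
  show ?thesis using s i by (auto simp: T_stat_def Let_def block_sum_eq min_le_iff_disj)
qed

lemma stop_level_le: "stop_level n \<sigma> yl ys \<le> top_level n"
  by (simp add: stop_level_def Let_def)

lemma less_stop_levelD:
  assumes "j < stop_level n \<sigma> yl ys"
  shows "\<not> T_stat n yl ys j \<le> ereal (2 * sigma_level n \<sigma> j)"
proof
  let ?A = "{j\<in>{0..top_level n}. T_stat n yl ys j \<le> ereal (2 * sigma_level n \<sigma> j)}"
  assume "T_stat n yl ys j \<le> ereal (2 * sigma_level n \<sigma> j)"
  moreover have "j \<le> top_level n" using assms stop_level_le[of n \<sigma> yl ys] by simp
  ultimately have j: "j \<in> ?A" by simp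
  then have "?A \<noteq> {}" by blast
  then have "stop_level n \<sigma> yl ys = min (top_level n) (Min ?A)"
    unfolding stop_level_def Let_def by (simp only: if_False)
  moreover have "Min ?A \<le> j" using j by (intro Min_le) auto
  ultimately show False using assms by simp
qed

lemma stop_levelD:
  assumes "stop_level n \<sigma> yl ys < top_level n"
  shows "T_stat n yl ys (stop_level n \<sigma> yl ys) \<le> ereal (2 * sigma_level n \<sigma> (stop_level n \<sigma> yl ys))"
proof -
  let ?A = "{j\<in>{0..top_level n}. T_stat n yl ys j \<le> ereal (2 * sigma_level n \<sigma> j)}"
  have ne: "?A \<noteq> {}" using assms by (auto simp: stop_level_def Let_def split: if_splits)
  then have "stop_level n \<sigma> yl ys = min (top_level n) (Min ?A)"
    unfolding stop_level_def Let_def by (simp only: if_False)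
  then have "stop_level n \<sigma> yl ys = Min ?A" using assms by linarith
  moreover have "Min ?A \<in> ?A" using ne by (intro Min_in) auto
  ultimately show ?thesis by simp
qed

text \<open>In this form \<open>sigma_level\<close> is visibly the standard deviation of the
  difference of two disjoint block sums of one copy.\<close>

lemma sigma_level_eq:
  "\<sigma> > 0 \<Longrightarrow> sigma_level n \<sigma> j = sqrt 3 * \<sigma> * sqrt (2 * real_of_int (block_size n j))"
proof -
  assume "\<sigma> > 0"
  have eq: "6 * 2 ^ (top_level n - j) * \<sigma>\<^sup>2 = 3 * \<sigma>\<^sup>2 * (2 * 2 ^ (top_level n - j))" by simp
  then show ?thesis using \<open>\<sigma> > 0\<close> unfolding sigma_level_def eq real_block_size real_sqrt_mult by simp
qed

lemma bsum_observe:
  assumes "1 \<le> i" "i \<le> num_blocks n j"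
  shows "bsum n (observe n \<sigma> f \<kappa> w) j i = bsum n (\<lambda>k. f (design n k)) j i + sqrt 3 * \<sigma> * bsum n w j i"
proof -
  have "bsum n (observe n \<sigma> f \<kappa> w) j i = (\<Sum>k\<in>block n j i. f (design n k) + sqrt 3 * \<sigma> * w k)"
    unfolding bsum_def using assms block_subset_iff[of n j i] by (intro sum.cong) (auto simp: observe_def)
  then show ?thesis by (simp add: bsum_def sum.distrib sum_distrib_left)
qed

section \<open>Probabilities for block sums\<close>

lemma measurable_bsum[measurable]:
  assumes "1 \<le> i" "i \<le> num_blocks n j"
  shows "(\<lambda>w. bsum n w j i) \<in> borel_measurable (noise_law n)"
  unfolding bsum_def
proof (rule borel_measurable_sum)
  fix k assume "k \<in> block n j i"
  then have "k \<in> {0..int n}" using assms block_subset_iff[of n j i] by auto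
  then show "(\<lambda>w. w k) \<in> borel_measurable (noise_law n)" by measurable
qed

lemma bsum_diff_eq:
  fixes n j :: nat and w :: "int \<Rightarrow> real"
  assumes "i \<noteq> i'"
  defines "A \<equiv> block n j i \<union> block n j i'" and "a \<equiv> \<lambda>k. if k \<in> block n j i then 1 else (-1::real)"
  shows "(\<Sum>k\<in>A. a k * w k) = bsum n w j i - bsum n w j i'" "(\<Sum>k\<in>A. (a k)\<^sup>2) = 2 * real_of_int (block_size n j)"
proof -
  have dis: "block n j i \<inter> block n j i' = {}" using disjoint_blocks[of i i' n j] disjoint_blocks[of i' i n j] assms by (cases "i < i'") auto
  have s: "(\<Sum>k\<in>A. g k) = (\<Sum>k\<in>block n j i. g k) + (\<Sum>k\<in>block n j i'. g k)" for g :: "int \<Rightarrow> real"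
    unfolding A_def by (rule sum.union_disjoint) (simp_all add: finite_block dis)
  have n: "k \<notin> block n j i" if "k \<in> block n j i'" for k using dis that by auto
  show "(\<Sum>k\<in>A. a k * w k) = bsum n w j i - bsum n w j i'"
    unfolding s bsum_def a_def by (simp add: n sum_negf cong: sum.cong)
  show "(\<Sum>k\<in>A. (a k)\<^sup>2) = 2 * real_of_int (block_size n j)"
    unfolding s a_def using block_size_pos[of n j] by (simp add: n card_block cong: sum.cong)
qed

lemma prob_bsum_diff_le:
  assumes i: "i \<noteq> i'" "1 \<le> i" "i \<le> num_blocks n j" "1 \<le> i'" "i' \<le> num_blocks n j"
  shows "measure (noise_law n) {w\<in>space (noise_law n). bsum n w j i - bsum n w j i' \<le> t * sqrt (2 * real_of_int (block_size n j))} = Phi t"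
proof -
  let ?A = "block n j i \<union> block n j i'" and ?a = "\<lambda>k. if k \<in> block n j i then 1 else (-1::real)"
  have "measure (noise_law n) {w\<in>space (noise_law n). \<forall>u\<in>{()}. (\<Sum>k\<in>?A. ?a k * w k) / sqrt (\<Sum>k\<in>?A. (?a k)\<^sup>2) \<in> {..t}} =
    (\<Prod>u\<in>{()}. measure std_normal_distribution {..t})"
    unfolding noise_law_def
    by (rule gauss_blocks) (use assms block_nonempty block_subset_iff in \<open>auto simp: disjoint_family_on_def\<close>)
  moreover have "0 < sqrt (2 * real_of_int (block_size n j))" using block_size_pos[of n j] by simp
  ultimately show ?thesis
    unfolding bsum_diff_eq[OF i(1)] by (simp add: Phi_eq divide_le_eq)
qed

text \<open>For fixed \<open>yl\<close> the chosen pairs are disjoint for different levels, so their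
  noise is independent. A miss forces the difference on the chosen side above the threshold, hence
  its normalized noise above \<open>2 - \<tau>\<close>. The lemma is applied with
  \<open>\<tau> = 0\<close> after a misplacement and with \<open>\<tau> = 2\<close> on a flat
  stretch.\<close>

lemma prob_all_T_stat_gt:
  assumes \<sigma>: "\<sigma> > 0" and L: "finite L" "\<And>j. j \<in> L \<Longrightarrow> j \<le> top_level n"
    and s: "\<And>j. j \<in> L \<Longrightarrow> s j \<in> {-1, 1}" "\<And>j. j \<in> L \<Longrightarrow> 1 \<le> loc_index n yl j + 6 * s j"
      "\<And>j. j \<in> L \<Longrightarrow> loc_index n yl j + 6 * s j \<le> num_blocks n j"
    and mean: "\<And>j. j \<in> L \<Longrightarrow> bsum n (\<lambda>k. f (design n k)) j (loc_index n yl j + 6 * s j) -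
      bsum n (\<lambda>k. f (design n k)) j (loc_index n yl j + 5 * s j) \<le> \<tau> * sigma_level n \<sigma> j"
  shows "measure (noise_law n) {w\<in>space (noise_law n). \<forall>j\<in>L. \<not> T_stat n yl (observe n \<sigma> f \<kappa> w) j \<le> ereal (2 * sigma_level n \<sigma> j)}
    \<le> Phi (\<tau> - 2) ^ card L" (is "measure ?P ?E \<le> _")
proof -
  interpret P: prob_space ?P by (rule prob_space_noise_law)
  let ?i = "\<lambda>j. loc_index n yl j + 6 * s j" and ?i' = "\<lambda>j. loc_index n yl j + 5 * s j"
  define A where "A j = block n j (?i j) \<union> block n j (?i' j)" for j
  define a where "a j k = (if k \<in> block n j (?i j) then 1 else (-1::real))" for j k
  have ne: "?i j \<noteq> ?i' j" if "j \<in> L" for j using s(1)[OF that] by auto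
  have rng: "1 \<le> ?i j" "?i j \<le> num_blocks n j" "1 \<le> ?i' j" "?i' j \<le> num_blocks n j" if "j \<in> L" for j
    using s[OF that] loc_index_bounds[OF L(2)[OF that], of yl] by auto
  let ?G = "{w\<in>space ?P. \<forall>j\<in>L. (\<Sum>k\<in>A j. a j k * w k) / sqrt (\<Sum>k\<in>A j. (a j k)\<^sup>2) \<in> {2 - \<tau><..}}"
  have sub: "A j \<subseteq> {0..int n}" if "j \<in> L" for j
    unfolding A_def using rng[OF that] block_subset_iff[of n j] by auto
  have G: "measure ?P ?G = (\<Prod>j\<in>L. measure std_normal_distribution {2 - \<tau><..})"
    unfolding noise_law_def
  proof (rule gauss_blocks)
    show "disjoint_family_on A L"
      unfolding disjoint_family_on_def
    proof (intro ballI impI)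
      fix j j' assume jj: "j \<in> L" "j' \<in> L" "j \<noteq> j'"
      have "A j = side_pair n yl (s j) j" "A j' = side_pair n yl (s j') j'" by (simp_all add: A_def side_pair_def)
      then show "A j \<inter> A j' = {}"
        using disjoint_side_pairs[of j j' n "s j" "s j'" yl] disjoint_side_pairs[of j' j n "s j'" "s j" yl] jj L s
        by (cases "j < j'") auto
    qed
  qed (use L sub in \<open>auto simp: A_def a_def block_nonempty\<close>)
  have "?E \<subseteq> ?G"
  proof
    fix w assume wE: "w \<in> ?E"
    show "w \<in> ?G"
    proof (intro CollectI conjI ballI)
      show "w \<in> space ?P" using wE by simp
    fix j assume j: "j \<in> L"
    have w: "\<not> T_stat n yl (observe n \<sigma> f \<kappa> w) j \<le> ereal (2 * sigma_level n \<sigma> j)" using wE j by simp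
    define r where "r = sqrt (2 * real_of_int (block_size n j))"
    have r: "0 < r" using block_size_pos[of n j] by (simp add: r_def)
    have sl: "sigma_level n \<sigma> j = sqrt 3 * \<sigma> * r" unfolding r_def by (rule sigma_level_eq[OF \<sigma>])
    let ?y = "observe n \<sigma> f \<kappa> w"
    have "\<not> bsum n ?y j (?i j) - bsum n ?y j (?i' j) \<le> 2 * sigma_level n \<sigma> j"
      using w j T_stat_le[of "s j" n yl j ?y] s[OF j] L(2)[OF j] by (metis ereal_less_eq(3) order_trans)
    then have "2 * sigma_level n \<sigma> j < \<tau> * sigma_level n \<sigma> j + sqrt 3 * \<sigma> * (bsum n w j (?i j) - bsum n w j (?i' j))"
      using mean[OF j] unfolding bsum_observe[OF rng(1,2)[OF j]] bsum_observe[OF rng(3,4)[OF j]] by (simp add: algebra_simps)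
    then have "(sqrt 3 * \<sigma>) * ((2 - \<tau>) * r) < (sqrt 3 * \<sigma>) * (bsum n w j (?i j) - bsum n w j (?i' j))"
      unfolding sl by (simp add: algebra_simps)
    then have "(2 - \<tau>) * r < bsum n w j (?i j) - bsum n w j (?i' j)"
      using \<sigma> by (simp add: mult_less_cancel_left_pos)
    then have "2 - \<tau> < (bsum n w j (?i j) - bsum n w j (?i' j)) / r" using r by (simp add: field_simps)
    then show "(\<Sum>k\<in>A j. a j k * w k) / sqrt (\<Sum>k\<in>A j. (a j k)\<^sup>2) \<in> {2 - \<tau><..}"
      unfolding A_def a_def bsum_diff_eq[OF ne[OF j]] r_def by simp
    qed
  qed
  moreover have "?G \<in> sets ?P"
  proof -
    have "(\<lambda>w. w k) \<in> borel_measurable ?P" if "j \<in> L" "k \<in> A j" for j k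
    proof -
      have "k \<in> {0..int n}" using sub[OF that(1)] that(2) by blast
      then show ?thesis by measurable
    qed
    then show ?thesis using L(1)
      by (intro sets.sets_Collect_finite_All) (auto intro!: borel_measurable_sum borel_measurable_less borel_measurable_divide)
  qed
  ultimately have "measure ?P ?E \<le> measure ?P ?G" by (rule P.finite_measure_mono)
  also have "\<dots> = Phi (\<tau> - 2) ^ card L" unfolding G by (simp add: measure_std_normal_greaterThan)
  finally show ?thesis .
qed

section \<open>Block means of a convex function\<close>

locale regression =
  fixes n :: nat and \<sigma> :: real and f :: "real \<Rightarrow> real"
  assumes n: "n \<ge> 1" and \<sigma>: "\<sigma> > 0" and f: "f \<in> convex_class"
begin

abbreviation "J \<equiv> top_level n"
abbreviation "Z \<equiv> minimizer f"
abbreviation "M \<equiv> minimum_value f"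

definition F :: "int \<Rightarrow> real" where "F k = f (design n k)"
definition kstar :: int where "kstar = \<lfloor>real n * Z\<rfloor>"
text \<open>The block of the last grid index that is not to the right of the minimizer. Its number
  can be \<open>num_blocks n j + 1\<close>, when that index lies beyond the last complete
  block.\<close>

definition istar :: "nat \<Rightarrow> int" where "istar j = kstar div block_size n j + 1"

lemma convex_f: "convex_on {0..1} f"
  using f by (simp add: convex_class_def)

lemma Z_mem: "Z \<in> {0..1}" and f_Z: "f Z = M" and M_le: "t \<in> {0..1} \<Longrightarrow> M \<le> f t"
  using is_minimizer_minimizer[OF f] by (auto simp: is_minimizer_def minimum_value_def)

lemma M_le_F: "k \<in> {0..int n} \<Longrightarrow> M \<le> F k"
  unfolding F_def by (intro M_le design_mem)

lemma kstar_bounds: "0 \<le> kstar" "kstar \<le> int n" "real_of_int kstar \<le> real n * Z" "real n * Z < real_of_int kstar + 1"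
proof -
  show "0 \<le> kstar" using Z_mem by (simp add: kstar_def)
  show "real_of_int kstar \<le> real n * Z" "real n * Z < real_of_int kstar + 1"
    unfolding kstar_def by linarith+
  have "real n * Z \<le> real n" using Z_mem by (simp add: mult_left_le)
  then show "kstar \<le> int n" unfolding kstar_def by (simp add: floor_le_iff)
qed

lemma design_eq: "design n k = real_of_int k / n"
  by (simp add: design_def)

lemma design_mem': "0 \<le> k \<Longrightarrow> k \<le> int n \<Longrightarrow> design n k \<in> {0..1}"
  by (rule design_mem) simp

lemma Z_less_design: "kstar < k \<Longrightarrow> Z < design n k"
proof -
  assume "kstar < k"
  then have "real n * Z < real_of_int k" using kstar_bounds(4) by linarith
  then show ?thesis using n by (simp add: design_eq pos_less_divide_eq mult.commute)
qed

lemma design_le_Z: "k \<le> kstar \<Longrightarrow> design n k \<le> Z"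
proof -
  assume "k \<le> kstar"
  then have "real_of_int k \<le> real n * Z" using kstar_bounds(3) by linarith
  then show ?thesis using n by (simp add: design_eq pos_divide_le_eq mult.commute)
qed

text \<open>The chord from the minimizer to \<open>q\<close> has both endpoints no further right
  than the chord from \<open>k\<close> to \<open>k'\<close>, so its slope is no larger. The
  inequality is multiplied out, in units of grid steps.\<close>

lemma chord_right:
  assumes "kstar < k" "k < k'" "k' \<le> int n" "kstar < q" "q \<le> k'"
  shows "real_of_int (k' - k) * (F q - M) \<le> (F k' - F k) * (real_of_int q - real n * Z)"
proof -
  have "(f (design n q) - f Z) / (design n q - Z) \<le> (f (design n k') - f (design n k)) / (design n k' - design n k)"
    using assms Z_mem kstar_bounds n Z_less_design[of q] Z_less_design[of k]
    by (intro convex_on_chord_mono[OF convex_f] design_mem') (auto simp: design_less_iff design_le_iff)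
  moreover have "design n q - Z = (real_of_int q - real n * Z) / n" "design n k' - design n k = real_of_int (k' - k) / n"
    using n by (simp_all add: design_eq field_simps)
  ultimately have "(F q - M) * n / (real_of_int q - real n * Z) \<le> (F k' - F k) * n / real_of_int (k' - k)"
    by (simp add: F_def f_Z)
  moreover have "0 < real_of_int q - real n * Z" using kstar_bounds assms by linarith
  ultimately have "n * (real_of_int (k' - k) * (F q - M)) \<le> n * ((F k' - F k) * (real_of_int q - real n * Z))"
    using assms by (simp add: field_simps)
  then show ?thesis by (rule mult_left_le_imp_le) (use n in simp)
qed

text \<open>Mirror image of \<open>chord_right\<close>. Because \<open>kstar\<close> is a floor,
  \<open>q\<close> may coincide with the minimizer here and make the chord degenerate;
  \<open>F q \<noteq> M\<close> excludes this.\<close>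

lemma chord_left:
  assumes "0 \<le> k'" "k' < k" "k \<le> kstar" "k' \<le> q" "q \<le> kstar" "F q \<noteq> M"
  shows "real_of_int (k - k') * (F q - M) \<le> (F k' - F k) * (real n * Z - real_of_int q)"
proof -
  have "design n q \<noteq> Z" using assms f_Z by (auto simp: F_def)
  then have qZ: "design n q < Z" using design_le_Z[OF assms(5)] by simp
  have "(f (design n k) - f (design n k')) / (design n k - design n k') \<le> (f Z - f (design n q)) / (Z - design n q)"
    using assms Z_mem kstar_bounds n qZ design_le_Z[OF assms(3)]
    by (intro convex_on_chord_mono[OF convex_f] design_mem') (auto simp: design_less_iff design_le_iff)
  moreover have "Z - design n q = (real n * Z - real_of_int q) / n" "design n k - design n k' = real_of_int (k - k') / n"
    using n by (simp_all add: design_eq field_simps)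
  ultimately have "(F k - F k') * n / real_of_int (k - k') \<le> (M - F q) * n / (real n * Z - real_of_int q)"
    by (simp add: F_def f_Z)
  moreover have "0 < real n * Z - real_of_int q" using qZ n by (simp add: design_eq field_simps)
  ultimately have "n * (real_of_int (k - k') * (F q - M)) \<le> n * ((F k' - F k) * (real n * Z - real_of_int q))"
    using assms by (simp add: field_simps)
  then show ?thesis by (rule mult_left_le_imp_le) (use n in simp)
qed

lemma F_mono_right:
  assumes "kstar < k" "k \<le> k'" "k' \<le> int n" shows "F k \<le> F k'"
proof (cases "k = k'")
  case False
  have "0 \<le> real_of_int (k' - k) * (F k - M)"
    using assms M_le_F[of k] kstar_bounds by (intro mult_nonneg_nonneg) auto
  also have "\<dots> \<le> (F k' - F k) * (real_of_int k - real n * Z)"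
    using chord_right[of k k' k] assms False by simp
  finally show ?thesis using kstar_bounds assms by (simp add: zero_le_mult_iff)
qed simp

lemma F_mono_left:
  assumes "0 \<le> k'" "k' \<le> k" "k \<le> kstar" shows "F k \<le> F k'"
proof (cases "k = k' \<or> F k = M")
  case True
  then show ?thesis using M_le_F[of k'] assms kstar_bounds by auto
next
  case False
  then have ne: "F k \<noteq> M" "k' < k" using assms by auto
  have "design n k \<noteq> Z" using ne f_Z by (auto simp: F_def)
  then have "design n k < Z" using design_le_Z[OF assms(3)] by simp
  then have 1: "0 < real n * Z - real_of_int k" using n by (simp add: design_eq field_simps)
  have "0 \<le> real_of_int (k - k') * (F k - M)"
    using assms M_le_F[of k] kstar_bounds by (intro mult_nonneg_nonneg) auto
  also have "\<dots> \<le> (F k' - F k) * (real n * Z - real_of_int k)"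
    using chord_left[of k' k k] assms ne by simp
  finally show ?thesis using 1 by (simp add: zero_le_mult_iff)
qed

lemma istar_pos: "1 \<le> istar j"
  unfolding istar_def using kstar_bounds block_size_pos[of n j] by (simp add: pos_imp_zdiv_nonneg_iff)

lemma istar_bounds: "(istar j - 1) * block_size n j \<le> kstar" "kstar < istar j * block_size n j"
proof -
  have "kstar div block_size n j * block_size n j \<le> kstar"
    using div_mult_mod_eq[of kstar "block_size n j"] pos_mod_sign[OF block_size_pos, of kstar n j]
    by linarith
  then show "(istar j - 1) * block_size n j \<le> kstar" by (simp add: istar_def)
  have "kstar < kstar div block_size n j * block_size n j + block_size n j"
    using div_mult_mod_eq[of kstar "block_size n j"] pos_mod_bound[OF block_size_pos, of kstar n j]
    by linarith
  then show "kstar < istar j * block_size n j" by (simp add: istar_def algebra_simps)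
qed

lemma istar_le: "istar j \<le> num_blocks n j + 1"
proof -
  have "(istar j - 1) * block_size n j \<le> int n + 1" using istar_bounds(1)[of j] kstar_bounds by linarith
  then show ?thesis using le_num_blocks_iff[of "istar j - 1" n j] by simp
qed

lemma istar_descendants:
  assumes "j + d \<le> J"
  shows "2 ^ d * (istar j - 1) + 1 \<le> istar (j + d)" "istar (j + d) \<le> 2 ^ d * istar j"
proof -
  define m where "m = block_size n (j + d)"
  have m: "0 < m" "block_size n j = 2 ^ d * m" using block_size_pos block_size_add[OF assms] by (auto simp: m_def)
  have "2 ^ d * (istar j - 1) * m < istar (j + d) * m"
    using istar_bounds(1)[of j] istar_bounds(2)[of "j + d"] m by (simp add: m_def algebra_simps)
  then show "2 ^ d * (istar j - 1) + 1 \<le> istar (j + d)" using m by simp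
  have "(istar (j + d) - 1) * m < 2 ^ d * istar j * m"
    using istar_bounds(2)[of j] istar_bounds(1)[of "j + d"] m by (simp add: m_def algebra_simps)
  then show "istar (j + d) \<le> 2 ^ d * istar j" using m by simp
qed

lemma istar_Suc: "j < J \<Longrightarrow> istar (Suc j) \<in> {2 * istar j - 1, 2 * istar j}"
  using istar_descendants[of j 1] by auto

lemma istar_0: "istar 0 \<in> {1, 2}"
  using istar_pos[of 0] istar_le[of 0] num_blocks_0[of n] by auto

lemma bsum_diff_shift:
  "bsum n g j i' - bsum n g j i = (\<Sum>k\<in>block n j i. g (k + (i' - i) * block_size n j) - g k)"
proof -
  have "bsum n g j i' = (\<Sum>k\<in>block n j i. g (k + (i' - i) * block_size n j))"
    unfolding bsum_def
    by (rule sum.reindex_bij_witness[where i="\<lambda>k. k + (i' - i) * block_size n j" and j="\<lambda>k. k - (i' - i) * block_size n j"])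
       (auto simp: block_def algebra_simps)
  then show ?thesis by (simp add: bsum_def sum_subtractf)
qed

lemma block_right: "istar j < i \<Longrightarrow> k \<in> block n j i \<Longrightarrow> kstar < k"
proof -
  assume i: "istar j < i" and k: "k \<in> block n j i"
  have "istar j * block_size n j \<le> (i - 1) * block_size n j"
    using i block_size_pos[of n j] by (intro mult_right_mono) auto
  then show "kstar < k" using k istar_bounds(2)[of j] by (auto simp: block_def)
qed

lemma block_left: "i < istar j \<Longrightarrow> k \<in> block n j i \<Longrightarrow> k < kstar"
proof -
  assume i: "i < istar j" and k: "k \<in> block n j i"
  have "i * block_size n j \<le> (istar j - 1) * block_size n j"
    using i block_size_pos[of n j] by (intro mult_right_mono) auto
  then show "k < kstar" using k istar_bounds(1)[of j] by (auto simp: block_def)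
qed

lemma shift_block: "k \<in> block n j i \<Longrightarrow> k + (i' - i) * block_size n j \<in> block n j i'"
  by (auto simp: block_def algebra_simps)

lemma bsum_F_mono_right:
  assumes "istar j < i" "i \<le> i'" "i' \<le> num_blocks n j"
  shows "bsum n F j i \<le> bsum n F j i'"
proof -
  have "0 \<le> (\<Sum>k\<in>block n j i. F (k + (i' - i) * block_size n j) - F k)"
  proof (rule sum_nonneg)
    fix k assume k: "k \<in> block n j i"
    have i': "block n j i' \<subseteq> {0..int n}" using assms istar_pos[of j] by (subst block_subset_iff) auto
    have "0 \<le> (i' - i) * block_size n j" using assms block_size_pos[of n j] by simp
    then show "0 \<le> F (k + (i' - i) * block_size n j) - F k"
      using F_mono_right[of k "k + (i' - i) * block_size n j"] block_right[OF assms(1) k] shift_block[OF k, of i'] i' by auto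
  qed
  then show ?thesis using bsum_diff_shift[of F j i' i] by linarith
qed

lemma bsum_F_mono_left:
  assumes "1 \<le> i'" "i' \<le> i" "i < istar j"
  shows "bsum n F j i \<le> bsum n F j i'"
proof -
  have "0 \<le> (\<Sum>k\<in>block n j i. F (k + (i' - i) * block_size n j) - F k)"
  proof (rule sum_nonneg)
    fix k assume k: "k \<in> block n j i"
    have i': "block n j i' \<subseteq> {0..int n}" using assms istar_le[of j] by (subst block_subset_iff) auto
    have "(i' - i) * block_size n j \<le> 0" using assms block_size_pos[of n j] by (simp add: mult_le_0_iff)
    then show "0 \<le> F (k + (i' - i) * block_size n j) - F k"
      using F_mono_left[of "k + (i' - i) * block_size n j" k] block_left[OF assms(3) k] shift_block[OF k, of i'] i' by auto
  qed
  then show ?thesis using bsum_diff_shift[of F j i' i] by linarith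
qed

text \<open>The threshold is \<open>M\<close> plus one standard deviation of a block mean,
  multiplied by the block size. This standard deviation is the \<open>+ 1\<close> next to
  \<open>z_upper\<close> in \<open>lower_end\<close>: at a level that is not bad,
  \<open>istar\<close> or one of its neighbours pulls the lower end below \<open>M\<close> unless
  the noise exceeds its quantile.\<close>

definition bad :: "nat \<Rightarrow> bool" where
  "bad l \<longleftrightarrow> (\<forall>b\<in>{istar l - 1..istar l + 1}. 1 \<le> b \<longrightarrow> b \<le> num_blocks n l \<longrightarrow>
     real_of_int (block_size n l) * M + sqrt 3 * \<sigma> * sqrt (real_of_int (block_size n l)) < bsum n F l b)"

text \<open>With the slope at a fine level given, passing to the next coarser level multiplies block
  differences by 4 and \<open>sigma_level\<close> by \<open>sqrt 2\<close>, hence their ratio by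
  \<open>2 * sqrt 2\<close>; the exponent \<open>d - 1\<close> absorbs the constant
  \<open>1 / (2 * sqrt 2)\<close>.\<close>

definition growth :: "nat \<Rightarrow> real" where
  "growth d = (2 * sqrt 2) ^ (d - 1)"

lemma growth_scale:
  assumes "j + d \<le> J" "1 \<le> d"
  defines "m \<equiv> real_of_int (block_size n j)" and "ml \<equiv> real_of_int (block_size n (j + d))"
  shows "m * (m * (sqrt 3 * \<sigma> / sqrt ml) / (2 * ml)) = growth d * sigma_level n \<sigma> j"
proof -
  have ml: "0 < ml" unfolding ml_def using block_size_pos[of n "j + d"] by simp
  have m: "m = 2 ^ d * ml" unfolding m_def ml_def using block_size_add[OF assms(1)] by simp
  have sq: "sqrt ml * sqrt ml = ml" using ml by simp
  have s2: "sqrt (2 ^ d) = sqrt 2 ^ d" by (simp add: real_sqrt_power)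
  have four: "(2::real) ^ d * 2 ^ d = (2 * sqrt 2) ^ d * sqrt 2 ^ d"
    unfolding power_mult_distrib[symmetric] mult.assoc by simp
  have dd: "(2 * sqrt 2) ^ d = (2 * sqrt 2) * growth d"
    unfolding growth_def using assms(2) by (cases d) auto
  have "m * (m * (sqrt 3 * \<sigma> / sqrt ml) / (2 * ml)) = 2 ^ d * 2 ^ d * (sqrt 3 * \<sigma>) * (ml / sqrt ml) / 2"
    unfolding m using ml by (simp add: field_simps)
  also have "ml / sqrt ml = sqrt ml" using ml by (simp add: real_div_sqrt)
  also have "2 ^ d * 2 ^ d * (sqrt 3 * \<sigma>) * sqrt ml / 2 = growth d * (sqrt 3 * \<sigma> * (sqrt 2 * (sqrt 2 ^ d * sqrt ml)))"
    unfolding four dd by simp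
  also have "sqrt 3 * \<sigma> * (sqrt 2 * (sqrt 2 ^ d * sqrt ml)) = sigma_level n \<sigma> j"
    unfolding sigma_level_eq[OF \<sigma>] m_def[symmetric] m by (simp add: real_sqrt_mult s2)
  finally show ?thesis .
qed

text \<open>Let \<open>q\<close> be the last point of the block right of \<open>istar\<close> at the
  bad level. There \<open>f\<close> exceeds \<open>M\<close> by one standard deviation of a block
  mean, within two fine blocks of the minimizer, which bounds a slope from below. Convexity keeps
  this slope further right, so every term of the shifted block sum gains at least one coarse block
  length times it.\<close>

lemma bad_diff_right:
  assumes bad: "bad (j + d)" and d: "j + d \<le> J" "1 \<le> d" and i: "istar j < i" "i < i'" "i' \<le> num_blocks n j"
  shows "growth d * sigma_level n \<sigma> j \<le> bsum n F j i' - bsum n F j i"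
proof -
  define l where "l = j + d"
  define m where "m = block_size n j"
  define ml where "ml = block_size n l"
  have m: "0 < m" "0 < ml" "m = 2 ^ d * ml" using block_size_pos block_size_add[OF d(1)] by (auto simp: m_def ml_def l_def)
  have p2: "(2::int) ^ d \<ge> 2" using d(2) by (metis one_le_numeral power_increasing power_one_right)
  then have mm: "2 * ml \<le> m" using m by (simp add: mult_right_mono)
  define q where "q = (istar l + 1) * ml - 1"
  have il: "istar l \<le> 2 ^ d * istar j" using istar_descendants(2)[OF d(1)] by (simp add: l_def)
  then have "istar l * ml \<le> istar j * m" using m by (simp add: mult.assoc[symmetric] mult.commute[of _ "2 ^ d"] mult_right_mono)
  then have q: "q \<le> istar j * m + ml - 1" by (simp add: q_def algebra_simps)
  have im: "(istar j + 1) * m \<le> (i' - 1) * m" using i m by (intro mult_right_mono) auto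
  have i'n: "i' * m \<le> int n + 1" using i(3) le_num_blocks_iff by (simp add: m_def)
  have "q + 1 \<le> istar j * m + ml" using q by linarith
  also have "\<dots> \<le> (istar j + 1) * m" using m(1,2) mm by (simp only: distrib_right)
  also note im
  also have "(i' - 1) * m \<le> i' * m" using m(1) by (intro mult_right_mono) auto
  also note i'n
  finally have qn: "q + 1 \<le> int n + 1" .
  then have lN: "istar l + 1 \<le> num_blocks n l" unfolding le_num_blocks_iff by (simp add: q_def ml_def)
  have qk: "kstar < q" using istar_bounds(2)[of l] m by (simp add: q_def ml_def algebra_simps)
  have "real_of_int ml * M + sqrt 3 * \<sigma> * sqrt (real_of_int ml) < bsum n F l (istar l + 1)"
    using bad lN istar_pos[of l] unfolding bad_def l_def[symmetric] ml_def by auto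
  also have "\<dots> \<le> (\<Sum>k\<in>block n l (istar l + 1). F q)"
    unfolding bsum_def
  proof (rule sum_mono)
    fix k assume k: "k \<in> block n l (istar l + 1)"
    show "F k \<le> F q" by (rule F_mono_right) (use k block_right[OF _ k] qn in \<open>auto simp: block_def q_def ml_def\<close>)
  qed
  also have "\<dots> = real_of_int ml * F q" using m by (simp add: card_block ml_def)
  finally have "sqrt 3 * \<sigma> * sqrt (real_of_int ml) < real_of_int ml * (F q - M)" by (simp add: algebra_simps)
  then have "sqrt 3 * \<sigma> * sqrt (real_of_int ml) / real_of_int ml < F q - M" using m(2) by (simp add: pos_divide_less_eq mult.commute)
  moreover have "sqrt 3 * \<sigma> * sqrt (real_of_int ml) / real_of_int ml = sqrt 3 * \<sigma> / sqrt (real_of_int ml)"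
    using m(2) by (simp add: frac_eq_eq mult.assoc)
  ultimately have v: "sqrt 3 * \<sigma> / sqrt (real_of_int ml) \<le> F q - M" by linarith
  have qZ: "real_of_int q - real n * Z \<le> 2 * real_of_int ml" "0 < real_of_int q - real n * Z"
  proof -
    have "q - kstar \<le> 2 * ml" using istar_bounds(1)[of l] by (simp add: q_def ml_def algebra_simps)
    then have "real_of_int q - real_of_int kstar \<le> 2 * real_of_int ml" by linarith
    then show "real_of_int q - real n * Z \<le> 2 * real_of_int ml" using kstar_bounds by linarith
    show "0 < real_of_int q - real n * Z" using qk kstar_bounds by linarith
  qed
  define sl where "sl = sqrt 3 * \<sigma> / sqrt (real_of_int ml) / (2 * real_of_int ml)"
  have sl0: "0 \<le> sl" unfolding sl_def using \<sigma> m by simp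
  have inc: "real_of_int m * sl \<le> F (k + (i' - i) * m) - F k" if k: "k \<in> block n j i" for k
  proof -
    let ?k' = "k + (i' - i) * m"
    have k': "?k' \<in> block n j i'" using shift_block[OF k] by (simp add: m_def)
    have k'n: "?k' \<le> int n" using k' i'n by (auto simp: block_def m_def)
    have mi: "m \<le> (i' - i) * m" using i m by simp
    have kk: "istar j * m \<le> k"
    proof -
      have "istar j * m \<le> (i - 1) * m" using i m by (intro mult_right_mono) auto
      then show ?thesis using k by (auto simp: block_def m_def)
    qed
    have c: "real_of_int (?k' - k) * (F q - M) \<le> (F ?k' - F k) * (real_of_int q - real n * Z)"
    proof (rule chord_right)
      have "q \<le> k + m" using q kk mm m(1,2) by linarith
      then show "q \<le> ?k'" using mi by linarith
      show "k < ?k'" using mi m(1) by linarith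
    qed (use block_right[OF i(1) k] k'n qk in auto)
    have nn: "0 \<le> F ?k' - F k"
      using F_mono_right[of k ?k'] block_right[OF i(1) k] mi m(1) k'n by auto
    have "real_of_int m * (sqrt 3 * \<sigma> / sqrt (real_of_int ml)) \<le> real_of_int (?k' - k) * (F q - M)"
      using v mi m \<sigma> by (intro mult_mono) (auto simp del: of_int_mult)
    also note c
    also have "(F ?k' - F k) * (real_of_int q - real n * Z) \<le> (F ?k' - F k) * (2 * real_of_int ml)"
      using nn qZ by (intro mult_left_mono) auto
    finally have "real_of_int m * (sqrt 3 * \<sigma> / sqrt (real_of_int ml)) / (2 * real_of_int ml) \<le> F ?k' - F k"
      using m(2) by (subst pos_divide_le_eq) auto
    then show ?thesis unfolding sl_def by (simp only: times_divide_eq_right)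
  qed
  have "growth d * sigma_level n \<sigma> j = (\<Sum>k\<in>block n j i. real_of_int m * sl)"
    using growth_scale[OF d] m by (simp add: card_block m_def[symmetric] ml_def l_def sl_def)
  also have "\<dots> \<le> (\<Sum>k\<in>block n j i. F (k + (i' - i) * m) - F k)"
    by (rule sum_mono) (rule inc)
  also have "\<dots> = bsum n F j i' - bsum n F j i" unfolding bsum_diff_shift m_def ..
  finally show ?thesis .
qed

text \<open>Mirror image of \<open>bad_diff_right\<close> with \<open>q\<close> the first point of
  the block left of \<open>istar\<close>; the positive excess at \<open>q\<close> also yields
  \<open>F q \<noteq> M\<close>, as \<open>chord_left\<close> requires.\<close>

lemma bad_diff_left:
  assumes bad: "bad (j + d)" and d: "j + d \<le> J" "1 \<le> d" and i: "1 \<le> i'" "i' < i" "i < istar j"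
  shows "growth d * sigma_level n \<sigma> j \<le> bsum n F j i' - bsum n F j i"
proof -
  define l where "l = j + d"
  define m where "m = block_size n j"
  define ml where "ml = block_size n l"
  have m: "0 < m" "0 < ml" "m = 2 ^ d * ml" using block_size_pos block_size_add[OF d(1)] by (auto simp: m_def ml_def l_def)
  have p2: "(2::int) ^ d \<ge> 2" using d(2) by (metis one_le_numeral power_increasing power_one_right)
  then have mm: "2 * ml \<le> m" using m by (simp add: mult_right_mono)
  define q where "q = (istar l - 2) * ml"
  have il: "2 ^ d * (istar j - 1) + 1 \<le> istar l" using istar_descendants(1)[OF d(1)] by (simp add: l_def)
  then have "(2 ^ d * (istar j - 1) + 1) * ml \<le> istar l * ml" using m by (intro mult_right_mono) auto
  then have q: "(istar j - 1) * m - ml \<le> q" using m by (simp add: q_def algebra_simps)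
  have "(2::int) * m \<le> (istar j - 1) * m" using i m by (intro mult_right_mono) auto
  then have q0: "0 < q" using q m mm by linarith
  have l2: "2 < istar l" using q0 m by (simp add: q_def zero_less_mult_iff)
  have qk: "q \<le> kstar" using istar_bounds(1)[of l] m by (simp add: q_def ml_def algebra_simps)
  have "real_of_int ml * M + sqrt 3 * \<sigma> * sqrt (real_of_int ml) < bsum n F l (istar l - 1)"
    using bad l2 istar_le[of l] unfolding bad_def l_def[symmetric] ml_def by auto
  also have "\<dots> \<le> (\<Sum>k\<in>block n l (istar l - 1). F q)"
    unfolding bsum_def
  proof (rule sum_mono)
    fix k assume k: "k \<in> block n l (istar l - 1)"
    have "k < kstar" using block_left[OF _ k] by simp
    then show "F k \<le> F q" by (intro F_mono_left) (use k q0 in \<open>auto simp: block_def q_def ml_def\<close>)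
  qed
  also have "\<dots> = real_of_int ml * F q" using m by (simp add: card_block ml_def)
  finally have "sqrt 3 * \<sigma> * sqrt (real_of_int ml) < real_of_int ml * (F q - M)" by (simp add: algebra_simps)
  then have "sqrt 3 * \<sigma> * sqrt (real_of_int ml) / real_of_int ml < F q - M" using m(2) by (simp add: pos_divide_less_eq mult.commute)
  moreover have "sqrt 3 * \<sigma> * sqrt (real_of_int ml) / real_of_int ml = sqrt 3 * \<sigma> / sqrt (real_of_int ml)"
    using m(2) by (simp add: frac_eq_eq mult.assoc)
  ultimately have v: "sqrt 3 * \<sigma> / sqrt (real_of_int ml) < F q - M" by linarith
  moreover have v0: "0 < sqrt 3 * \<sigma> / sqrt (real_of_int ml)" using \<sigma> m by simp
  ultimately have FqM: "F q \<noteq> M" by linarith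
  have qZ: "real n * Z - real_of_int q \<le> 2 * real_of_int ml"
  proof -
    have "kstar + 1 - q \<le> 2 * ml" using istar_bounds(2)[of l] by (simp add: q_def ml_def algebra_simps)
    then have "real_of_int kstar + 1 - real_of_int q \<le> 2 * real_of_int ml" by linarith
    then show "real n * Z - real_of_int q \<le> 2 * real_of_int ml" using kstar_bounds by linarith
  qed
  define sl where "sl = sqrt 3 * \<sigma> / sqrt (real_of_int ml) / (2 * real_of_int ml)"
  have inc: "real_of_int m * sl \<le> F (k + (i' - i) * m) - F k" if k: "k \<in> block n j i" for k
  proof -
    let ?k' = "k + (i' - i) * m"
    have k': "?k' \<in> block n j i'" using shift_block[OF k] by (simp add: m_def)
    have k'0: "0 \<le> ?k'"
    proof -
      have "0 \<le> (i' - 1) * m" using i m by simp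
      then show ?thesis using k' by (auto simp: block_def m_def)
    qed
    have mi: "m \<le> (i - i') * m" using i m by simp
    have mi': "(i' - i) * m = - ((i - i') * m)" by (simp add: algebra_simps)
    have k'q: "?k' \<le> q"
    proof -
      have "i' * m \<le> (istar j - 2) * m" using i m by (intro mult_right_mono) auto
      then have "?k' \<le> (istar j - 2) * m" using k' by (auto simp: block_def m_def)
      also have "(istar j - 2) * m = (istar j - 1) * m - m" by (simp add: algebra_simps)
      also have "\<dots> \<le> q" using q mm m(1,2) by linarith
      finally show ?thesis .
    qed
    have c: "real_of_int (k - ?k') * (F q - M) \<le> (F ?k' - F k) * (real n * Z - real_of_int q)"
      by (rule chord_left) (use block_left[OF i(3) k] mi mi' m(1) k'0 k'q qk FqM in auto)
    have nn: "0 \<le> F ?k' - F k"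
      using F_mono_left[of ?k' k] block_left[OF i(3) k] mi mi' m(1) k'0 by auto
    have "real_of_int m * (sqrt 3 * \<sigma> / sqrt (real_of_int ml)) \<le> real_of_int (k - ?k') * (F q - M)"
    proof (rule mult_mono)
      show "real_of_int m \<le> real_of_int (k - ?k')" using mi mi' by linarith
    qed (use v v0 m(1) mi mi' in auto)
    also note c
    also have "(F ?k' - F k) * (real n * Z - real_of_int q) \<le> (F ?k' - F k) * (2 * real_of_int ml)"
      using nn qZ by (intro mult_left_mono) auto
    finally have "real_of_int m * (sqrt 3 * \<sigma> / sqrt (real_of_int ml)) / (2 * real_of_int ml) \<le> F ?k' - F k"
      using m(2) by (subst pos_divide_le_eq) auto
    then show ?thesis unfolding sl_def by (simp only: times_divide_eq_right)
  qed
  have "growth d * sigma_level n \<sigma> j = (\<Sum>k\<in>block n j i. real_of_int m * sl)"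
    using growth_scale[OF d] m by (simp add: card_block m_def[symmetric] ml_def l_def sl_def)
  also have "\<dots> \<le> (\<Sum>k\<in>block n j i. F (k + (i' - i) * m) - F k)"
    by (rule sum_mono) (rule inc)
  also have "\<dots> = bsum n F j i' - bsum n F j i" unfolding bsum_diff_shift m_def ..
  finally show ?thesis .
qed

end

section \<open>Probability of a wrong localization or stopping level\<close>

lemma K_const_bounds:
  assumes "0 < \<beta>" "\<beta> < 1"
  shows "1 \<le> K_const \<beta>" "Phi (-2) ^ nat (K_const \<beta>) \<le> \<beta>"
proof -
  have l: "ln (Phi (-2)) < 0" "ln \<beta> < 0" using Phi_pos Phi_less_1 assms by auto
  then have "0 < ln \<beta> / ln (Phi (-2))" by (simp add: zero_less_divide_iff)
  then show 1: "1 \<le> K_const \<beta>" unfolding K_const_def by (simp add: one_le_ceiling)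
  have "ln \<beta> / ln (Phi (-2)) \<le> real_of_int (K_const \<beta>)" unfolding K_const_def by (rule le_of_int_ceiling)
  also have "real_of_int (K_const \<beta>) = real (nat (K_const \<beta>))" using 1 by simp
  finally have "real (nat (K_const \<beta>)) * ln (Phi (-2)) \<le> ln \<beta>" using l(1) by (simp only: neg_divide_le_eq)
  then have "ln (Phi (-2) ^ nat (K_const \<beta>)) \<le> ln \<beta>" by (simp only: ln_realpow)
  then show "Phi (-2) ^ nat (K_const \<beta>) \<le> \<beta>" using assms Phi_pos by (simp add: ln_le_cancel_iff)
qed

text \<open>Here \<alpha>/12 is \<beta>/3 for \<beta> = \<alpha>/4. The second bound is what makes
  the drift at distance \<open>Kt_const\<close> from a bad level dominate the normal
  quantile.\<close>

lemma Kt_const_bounds: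
  assumes "0 < \<alpha>" "\<alpha> < 1"
  shows "4 \<le> Kt_const (\<alpha> / 4)" "4 * (2 + z_upper (\<alpha> / 12)) \<le> 2 ^ nat (Kt_const (\<alpha> / 4))"
proof -
  show 4: "4 \<le> Kt_const (\<alpha> / 4)" by (simp add: Kt_const_def)
  have z: "0 \<le> z_upper (\<alpha> / 12)" using assms by (intro z_upper_nonneg) auto
  have "2 + log 2 (2 + z_upper (\<alpha> / 12)) \<le> real_of_int (Kt_const (\<alpha> / 4))"
    unfolding Kt_const_def by (simp add: le_max_iff_disj) linarith
  also have "real_of_int (Kt_const (\<alpha> / 4)) = real (nat (Kt_const (\<alpha> / 4)))" using 4 by simp
  finally have "2 powr (2 + log 2 (2 + z_upper (\<alpha> / 12))) \<le> 2 powr real (nat (Kt_const (\<alpha> / 4)))" by simp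
  then show "4 * (2 + z_upper (\<alpha> / 12)) \<le> 2 ^ nat (Kt_const (\<alpha> / 4))"
    using z by (simp add: powr_add powr_realpow)
qed

context regression
begin

lemma F_fun: "(\<lambda>k. f (design n k)) = F"
  by (simp add: F_def fun_eq_iff)

text \<open>Later candidates stay within a bounded distance of the descendants of the block chosen
  at level \<open>j\<close>, so a localization off by 5 blocks never returns. Distance 7 is what
  places the blocks at distances 5 and 6 towards the minimizer strictly on one side of
  \<open>istar\<close>.\<close>

lemma misplaced_descendants:
  assumes "j + d \<le> J" "1 \<le> d"
  shows "istar j + 5 \<le> loc_index n y j \<Longrightarrow> istar (j + d) + 7 \<le> loc_index n y (j + d)"
    and "loc_index n y j + 5 \<le> istar j \<Longrightarrow> loc_index n y (j + d) + 7 \<le> istar (j + d)"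
proof -
  define e :: int where "e = 2 ^ d"
  have e: "2 \<le> e" unfolding e_def using assms(2) by (metis one_le_numeral power_increasing power_one_right)
  note l = loc_index_descendants[OF assms(1), of y, folded e_def] istar_descendants[OF assms(1), folded e_def]
  show "istar (j + d) + 7 \<le> loc_index n y (j + d)" if "istar j + 5 \<le> loc_index n y j"
  proof -
    have "e * (istar j + 3) \<le> e * (loc_index n y j - 2)" using that e by (intro mult_left_mono) auto
    then show ?thesis using l e by (simp add: algebra_simps)
  qed
  show "loc_index n y (j + d) + 7 \<le> istar (j + d)" if "loc_index n y j + 5 \<le> istar j"
  proof -
    have "e * (loc_index n y j + 1) \<le> e * (istar j - 4)" using that e by (intro mult_left_mono) auto
    then show ?thesis using l e by (simp add: algebra_simps)
  qed
qed

text \<open>The side facing the minimizer is taken. Block sums fall towards the minimizer, so the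
  outer block of the pair has the smaller sum and the drift is nonpositive.\<close>

lemma misplaced_side:
  assumes j: "j \<le> J" and off: "istar j + 7 \<le> loc_index n y j \<or> loc_index n y j + 7 \<le> istar j"
  defines "s \<equiv> if istar j + 7 \<le> loc_index n y j then -1 else (1::int)"
  shows "1 \<le> loc_index n y j + 6 * s" "loc_index n y j + 6 * s \<le> num_blocks n j"
    "bsum n F j (loc_index n y j + 6 * s) \<le> bsum n F j (loc_index n y j + 5 * s)"
proof -
  have l: "1 \<le> loc_index n y j" "loc_index n y j \<le> num_blocks n j" using loc_index_bounds[OF j, of y] by auto
  have i: "1 \<le> istar j" "istar j \<le> num_blocks n j + 1" using istar_pos istar_le by auto
  show "1 \<le> loc_index n y j + 6 * s" "loc_index n y j + 6 * s \<le> num_blocks n j"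
    using l i off by (auto simp: s_def)
  show "bsum n F j (loc_index n y j + 6 * s) \<le> bsum n F j (loc_index n y j + 5 * s)"
  proof (cases "istar j + 7 \<le> loc_index n y j")
    case True
    then show ?thesis using bsum_F_mono_right[of j "loc_index n y j - 6" "loc_index n y j - 5"] l by (simp add: s_def)
  next
    case False
    then show ?thesis using bsum_F_mono_left[of "loc_index n y j + 5" "loc_index n y j + 6" j] l i off by (simp add: s_def)
  qed
qed

lemma measurable_observe: "(\<lambda>w. observe n \<sigma> f \<kappa> w k) \<in> borel_measurable (noise_law n)"
proof (cases "k \<in> {0..int n}")
  case True
  then show ?thesis unfolding observe_def if_P[OF True] by measurable
next
  case False
  show ?thesis unfolding observe_def if_not_P[OF False] by simp
qed

lemma sigma_level_pos: "0 < sigma_level n \<sigma> j"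
  using \<sigma> block_size_pos[of n j] by (simp add: sigma_level_eq)

text \<open>For fixed \<open>yl\<close> the first misplaced level \<open>jw\<close> is not random.
  As the stopping level lies \<open>K + 1\<close> levels beyond the start, a misplaced start means
  that the statistics at \<open>jw + 1\<close>, ..., \<open>jw + K\<close> all missed their
  thresholds.\<close>

lemma prob_start_misplaced:
  assumes \<alpha>: "0 < \<alpha>" "\<alpha> < 1"
  shows "measure (noise_law n) {w\<in>space (noise_law n).
    5 \<le> \<bar>start_index \<alpha> n \<sigma> yl (observe n \<sigma> f \<kappa> w) - istar (start_level \<alpha> (stop_level n \<sigma> yl (observe n \<sigma> f \<kappa> w)))\<bar>} \<le> \<alpha> / 4"
    (is "measure ?P ?E \<le> _")
proof -
  interpret P: prob_space ?P by (rule prob_space_noise_law)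
  define K where "K = nat (K_const (\<alpha> / 4))"
  have K: "int K = K_const (\<alpha> / 4)" "1 \<le> K" "Phi (-2) ^ K \<le> \<alpha> / 4"
    using K_const_bounds[of "\<alpha> / 4"] \<alpha> by (auto simp: K_def)
  let ?loc = "loc_index n yl"
  let ?off = "\<lambda>j. 5 \<le> \<bar>?loc j - istar j\<bar>"
  have E_off: "\<exists>j. ?off j \<and> j + K + 1 = stop_level n \<sigma> yl (observe n \<sigma> f \<kappa> w)" if w: "w \<in> ?E" for w
  proof -
    let ?st = "stop_level n \<sigma> yl (observe n \<sigma> f \<kappa> w)"
    let ?j = "start_level \<alpha> ?st"
    have o: "?off ?j" using w by (simp add: start_index_def)
    \<comment> \<open>At level 0 the localized index is 1 and \<open>istar\<close> is 1 or 2. Hence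
      the start was not cut off at level 0 and the distance to the stopping level is exactly
      \<open>K + 1\<close>.\<close>
    have "?j \<noteq> 0"
    proof
      assume 0: "?j = 0"
      have "?off 0" using o unfolding 0 .
      then show False using istar_0 by auto
    qed
    then have "?j + K + 1 = ?st" unfolding start_level_def K(1)[symmetric] by (simp add: max_def split: if_splits)
    then show ?thesis using o by metis
  qed
  show ?thesis
  proof (cases "\<exists>j. ?off j \<and> j + K < J")
    case False
    have "?E = {}"
    proof (rule ccontr)
      assume "?E \<noteq> {}"
      then obtain w where w: "w \<in> ?E" by blast
      then obtain j where "?off j" "j + K + 1 = stop_level n \<sigma> yl (observe n \<sigma> f \<kappa> w)" using E_off by blast
      then show False using False stop_level_le[of n \<sigma> yl "observe n \<sigma> f \<kappa> w"] by auto
    qed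
    then have "measure ?P ?E = 0" by (simp only: measure_empty)
    then show ?thesis using \<alpha> by simp
  next
    case True
    define jw where "jw = (LEAST j. ?off j)"
    obtain j0 where j0: "?off j0" "j0 + K < J" using True by blast
    have jw: "?off jw" "\<And>j. ?off j \<Longrightarrow> jw \<le> j" unfolding jw_def using j0 by (auto intro: LeastI Least_le)
    have jwJ: "jw + K < J" using jw(2)[OF j0(1)] j0(2) by simp
    let ?L = "{jw + 1..jw + K}"
    define s where "s j = (if istar j + 7 \<le> ?loc j then -1 else (1::int))" for j
    have off7: "istar j + 7 \<le> ?loc j \<or> ?loc j + 7 \<le> istar j" if j: "j \<in> ?L" for j
    proof -
      have "jw + (j - jw) \<le> J" "1 \<le> j - jw" "jw + (j - jw) = j" using j jwJ by auto
      moreover have "istar jw + 5 \<le> ?loc jw \<or> ?loc jw + 5 \<le> istar jw" using jw(1) by linarith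
      ultimately show ?thesis using misplaced_descendants[of jw "j - jw" yl] by auto
    qed
    have LJ: "j \<le> J" if "j \<in> ?L" for j using that jwJ by auto
    let ?G = "{w\<in>space ?P. \<forall>j\<in>?L. \<not> T_stat n yl (observe n \<sigma> f \<kappa> w) j \<le> ereal (2 * sigma_level n \<sigma> j)}"
    have "?E \<subseteq> ?G"
    proof
      fix w assume w: "w \<in> ?E"
      then obtain j where j: "?off j" "j + K + 1 = stop_level n \<sigma> yl (observe n \<sigma> f \<kappa> w)" using E_off by blast
      have "i < stop_level n \<sigma> yl (observe n \<sigma> f \<kappa> w)" if "i \<in> ?L" for i using jw(2)[OF j(1)] j(2) that by auto
      then show "w \<in> ?G" using less_stop_levelD w by auto
    qed
    moreover have "?G \<in> sets ?P"
    proof (intro sets.sets_Collect_finite_All)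
      fix j
      have "(\<lambda>w. T_stat n yl (observe n \<sigma> f \<kappa> w) j) \<in> borel_measurable ?P"
        by (rule measurable_T_stat) (simp_all add: measurable_observe)
      then show "{w \<in> space ?P. \<not> T_stat n yl (observe n \<sigma> f \<kappa> w) j \<le> ereal (2 * sigma_level n \<sigma> j)} \<in> sets ?P"
        by measurable
    qed auto
    ultimately have "measure ?P ?E \<le> measure ?P ?G" by (rule P.finite_measure_mono)
    also have "\<dots> \<le> Phi (0 - 2) ^ card ?L"
    proof (rule prob_all_T_stat_gt[OF \<sigma>, where s=s])
      fix j assume j: "j \<in> ?L"
      note ms = misplaced_side[OF LJ[OF j] off7[OF j], folded s_def]
      show "1 \<le> ?loc j + 6 * s j" "?loc j + 6 * s j \<le> num_blocks n j" using ms by auto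
      show "bsum n (\<lambda>k. f (design n k)) j (?loc j + 6 * s j) - bsum n (\<lambda>k. f (design n k)) j (?loc j + 5 * s j)
        \<le> 0 * sigma_level n \<sigma> j" using ms unfolding F_fun by simp
    qed (use LJ in \<open>auto simp: s_def\<close>)
    finally show ?thesis using K by simp
  qed
qed

lemma prob_observe_diff_le:
  assumes i: "i \<noteq> i'" "1 \<le> i" "i \<le> num_blocks n j" "1 \<le> i'" "i' \<le> num_blocks n j"
    and g: "g * sigma_level n \<sigma> j \<le> bsum n F j i - bsum n F j i'"
  shows "measure (noise_law n) {w\<in>space (noise_law n).
    bsum n (observe n \<sigma> f \<kappa> w) j i - bsum n (observe n \<sigma> f \<kappa> w) j i' \<le> t * sigma_level n \<sigma> j} \<le> Phi (t - g)"
proof -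
  interpret P: prob_space "noise_law n" by (rule prob_space_noise_law)
  define r where "r = sqrt (2 * real_of_int (block_size n j))"
  have sl: "sigma_level n \<sigma> j = sqrt 3 * \<sigma> * r" unfolding r_def by (rule sigma_level_eq[OF \<sigma>])
  note [measurable] = measurable_bsum[OF i(2,3)] measurable_bsum[OF i(4,5)]
  have "measure (noise_law n) {w\<in>space (noise_law n).
    bsum n (observe n \<sigma> f \<kappa> w) j i - bsum n (observe n \<sigma> f \<kappa> w) j i' \<le> t * sigma_level n \<sigma> j} \<le>
    measure (noise_law n) {w\<in>space (noise_law n). bsum n w j i - bsum n w j i' \<le> (t - g) * r}"
  proof (rule P.finite_measure_mono)
    show "{w\<in>space (noise_law n). bsum n (observe n \<sigma> f \<kappa> w) j i - bsum n (observe n \<sigma> f \<kappa> w) j i' \<le> t * sigma_level n \<sigma> j}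
      \<subseteq> {w\<in>space (noise_law n). bsum n w j i - bsum n w j i' \<le> (t - g) * r}"
    proof safe
      fix w assume w: "bsum n (observe n \<sigma> f \<kappa> w) j i - bsum n (observe n \<sigma> f \<kappa> w) j i' \<le> t * sigma_level n \<sigma> j"
      have "(sqrt 3 * \<sigma>) * (bsum n w j i - bsum n w j i') \<le> (sqrt 3 * \<sigma>) * ((t - g) * r)"
        using w g unfolding bsum_observe[OF i(2,3)] bsum_observe[OF i(4,5)] F_fun sl by (simp add: algebra_simps)
      then show "bsum n w j i - bsum n w j i' \<le> (t - g) * r" using \<sigma> by (simp add: mult_le_cancel_left_pos)
    qed
    show "{w\<in>space (noise_law n). bsum n w j i - bsum n w j i' \<le> (t - g) * r} \<in> sets (noise_law n)" by measurable
  qed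
  also have "\<dots> = Phi (t - g)" unfolding r_def by (rule prob_bsum_diff_le[OF i])
  finally show ?thesis .
qed

section \<open>Errors at levels much coarser than a bad level\<close>

definition coarse :: "real \<Rightarrow> nat \<Rightarrow> nat set" where
  "coarse \<alpha> l = {j. int j + Kt_const (\<alpha> / 4) \<le> int l}"

lemma coarse_less: "j \<in> coarse \<alpha> l \<Longrightarrow> j < l"
proof -
  have "4 \<le> Kt_const (\<alpha> / 4)" by (simp add: Kt_const_def)
  then show "j \<in> coarse \<alpha> l \<Longrightarrow> j < l" by (simp add: coarse_def)
qed

lemma finite_coarse: "finite (coarse \<alpha> l)"
  by (rule finite_subset[of _ "{..<l}"]) (auto dest: coarse_less)

text \<open>At distance \<open>d0 + i\<close> the growth is at least
  \<open>4 * (2 + z) * (1 + i)\<close>, so each term is \<alpha>/12 times an exponentially small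
  factor. The target \<alpha>/32 suits the 6 + 2 comparisons per level made by localization and
  stopping, which together then cost \<alpha>/4.\<close>

lemma sum_coarse_le:
  assumes \<alpha>: "0 < \<alpha>" "\<alpha> < 1"
  shows "(\<Sum>j\<in>coarse \<alpha> l. Phi (2 - growth (l - j))) \<le> \<alpha> / 32"
proof -
  define d0 where "d0 = nat (Kt_const (\<alpha> / 4))"
  define z where "z = z_upper (\<alpha> / 12)"
  have d0: "4 \<le> d0" "int d0 = Kt_const (\<alpha> / 4)" "4 * (2 + z) \<le> 2 ^ d0"
    using Kt_const_bounds[OF \<alpha>] by (auto simp: d0_def z_def)
  have z: "0 \<le> z" "Phi (- z) = \<alpha> / 12"
    unfolding z_def using \<alpha> by (auto simp: Phi_minus Phi_z_upper intro!: z_upper_nonneg)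
  have bnd: "Phi (2 - growth (d0 + i)) \<le> (1 / 2) ^ i * (\<alpha> / 768)" for i
  proof -
    have "growth (d0 + i) = (2 * sqrt 2) ^ (d0 - 1) * (2 * sqrt 2) ^ i"
    proof -
      have "d0 + i - 1 = (d0 - 1) + i" using d0 by simp
      then show ?thesis unfolding growth_def by (simp only: power_add)
    qed
    moreover have "2 * (2 + z) * 2 \<le> (2 * sqrt 2) ^ (d0 - 1)"
    proof -
      have "(2::real) ^ d0 = 2 * 2 ^ (d0 - 1)" using d0 by (metis Suc_diff_1 power_Suc zero_less_numeral order_less_le_trans)
      then have 1: "2 * (2 + z) \<le> 2 ^ (d0 - 1)" using d0(3) by simp
      have "(2::real) = sqrt 2 ^ 2" by simp
      also have "\<dots> \<le> sqrt 2 ^ (d0 - 1)" using d0 by (intro power_increasing) auto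
      finally have "2 * (2 + z) * 2 \<le> 2 ^ (d0 - 1) * sqrt 2 ^ (d0 - 1)"
        using 1 z by (intro mult_mono) auto
      then show ?thesis by (simp add: power_mult_distrib)
    qed
    moreover have "1 + real i \<le> (2 * sqrt 2) ^ i"
    proof -
      have "1 + real i \<le> (1 + 1) ^ i" using Bernoulli_inequality[of 1 i] by simp
      also have "\<dots> \<le> (2 * sqrt 2) ^ i" by (intro power_mono) auto
      finally show ?thesis .
    qed
    ultimately have "2 * (2 + z) * 2 * (1 + real i) \<le> growth (d0 + i)"
      using z by (auto intro!: mult_mono)
    \<comment> \<open>For \<open>z = 0\<close> and \<open>i = 0\<close> the right-hand side equals
      6. The resulting factor 1/64 explains 768 = 12 * 64.\<close>
    moreover have "z + (real (6 + i)) \<le> 2 * (2 + z) * 2 * (1 + real i) - 2"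
      using z mult_nonneg_nonneg[OF z(1), of "real i"] by (simp add: algebra_simps)
    ultimately have "Phi (2 - growth (d0 + i)) \<le> Phi (- (z + real (6 + i)))" by (intro Phi_mono) linarith
    also have "\<dots> \<le> exp (- (real (6 + i))\<^sup>2 / 2) * Phi (- z)" by (rule Phi_tail) (use z in auto)
    also have "\<dots> \<le> (1 / 2) ^ (6 + i) * Phi (- z)"
    proof (intro mult_right_mono Phi_nonneg)
      have "real (6 + i) * 2 \<le> real (6 + i) * real (6 + i)" by (intro mult_left_mono) auto
      then have "exp (- (real (6 + i))\<^sup>2 / 2) \<le> exp (real (6 + i) * (-1))" by (simp add: power2_eq_square)
      also have "\<dots> = exp (-1) ^ (6 + i)" by (rule exp_of_nat_mult)
      also have "\<dots> \<le> (1 / 2) ^ (6 + i)"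
      proof (rule power_mono)
        have "2 \<le> exp (1::real)" using exp_ge_add_one_self[of 1] by simp
        then show "exp (-1) \<le> (1 / 2 :: real)" by (simp add: exp_minus field_simps)
      qed simp
      finally show "exp (- (real (6 + i))\<^sup>2 / 2) \<le> (1 / 2) ^ (6 + i)" .
    qed
    also have "\<dots> = (1 / 2) ^ i * (\<alpha> / 768)" unfolding z(2) by (simp add: power_add power_one_over)
    finally show ?thesis .
  qed
  have "(\<Sum>j\<in>coarse \<alpha> l. Phi (2 - growth (l - j))) \<le> (\<Sum>j\<in>coarse \<alpha> l. (1 / 2) ^ (l - j - d0) * (\<alpha> / 768))"
  proof (rule sum_mono)
    fix j assume "j \<in> coarse \<alpha> l"
    then have "l - j = d0 + (l - j - d0)" using d0(2) by (auto simp: coarse_def)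
    then show "Phi (2 - growth (l - j)) \<le> (1 / 2) ^ (l - j - d0) * (\<alpha> / 768)" using bnd[of "l - j - d0"] by simp
  qed
  also have "\<dots> = (\<Sum>i\<in>(\<lambda>j. l - j - d0) ` coarse \<alpha> l. (1 / 2) ^ i * (\<alpha> / 768))"
    by (subst sum.reindex) (use d0(2) in \<open>auto simp: inj_on_def coarse_def\<close>)
  also have "\<dots> \<le> (\<Sum>i\<le>l. (1 / 2) ^ i * (\<alpha> / 768))"
    by (rule sum_mono2) (use \<alpha> in auto)
  also have "\<dots> = (\<Sum>i\<le>l. (1 / 2) ^ i) * (\<alpha> / 768)" by (simp add: sum_distrib_right)
  also have "\<dots> \<le> 2 * (\<alpha> / 768)"
  proof (intro mult_right_mono)
    have "(\<Sum>i\<le>l. (1 / 2 :: real) ^ i) = 2 - (1 / 2) ^ l" by (induction l) auto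
    then show "(\<Sum>i\<le>l. (1 / 2 :: real) ^ i) \<le> 2" by simp
  qed (use \<alpha> in simp)
  finally show ?thesis using \<alpha> by simp
qed


text \<open>Pure index arithmetic: if the parent is off by at most one, the chosen child is off by
  at most 4. The neighbour \<open>i + s\<close> on the same side is itself a candidate, and the
  child lies 1, 2 or 3 blocks beyond it.\<close>

lemma candidate_arith:
  fixes p q b i N :: int
  assumes "\<bar>p - q\<bar> \<le> 1" "b \<in> {max (2 * p - 2) 1..min (2 * p + 1) N}" "i = 2 * q - 1 \<or> i = 2 * q" "i \<le> N + 1" "1 \<le> i"
    "2 \<le> \<bar>b - i\<bar>"
  defines "s \<equiv> if i \<le> b then 1 else -1"
  shows "i + s \<in> {max (2 * p - 2) 1..min (2 * p + 1) N}" "i + s * (\<bar>b - i\<bar> - 1 + 1) = b" "\<bar>b - i\<bar> - 1 \<in> {1, 2, 3}"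
proof -
  show "i + s \<in> {max (2 * p - 2) 1..min (2 * p + 1) N}" using assms by (cases "i \<le> b") auto
  show "i + s * (\<bar>b - i\<bar> - 1 + 1) = b" using assms by (cases "i \<le> b") auto
  have "1 \<le> \<bar>b - i\<bar> - 1" "\<bar>b - i\<bar> - 1 \<le> 3" using assms(1-6) by auto
  then show "\<bar>b - i\<bar> - 1 \<in> {1, 2, 3}" by auto
qed

text \<open>The first level at which the localization leaves the neighbourhood of the minimizer: the
  chosen block beats the last neighbour that is still a candidate.\<close>

lemma misplaced_step:
  assumes j: "j < J" and near: "\<bar>loc_index n y j - istar j\<bar> \<le> 1" and off: "2 \<le> \<bar>loc_index n y (Suc j) - istar (Suc j)\<bar>"
  obtains s r where "s \<in> {-1, 1}" "r \<in> {1, 2, 3}"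
    "1 \<le> istar (Suc j) + s" "istar (Suc j) + s \<le> num_blocks n (Suc j)"
    "1 \<le> istar (Suc j) + s * (r + 1)" "istar (Suc j) + s * (r + 1) \<le> num_blocks n (Suc j)"
    "bsum n y (Suc j) (istar (Suc j) + s * (r + 1)) - bsum n y (Suc j) (istar (Suc j) + s) \<le> 0"
proof -
  let ?b = "loc_index n y (Suc j)" and ?i = "istar (Suc j)"
  have b: "?b \<in> {max (2 * loc_index n y j - 2) 1..min (2 * loc_index n y j + 1) (num_blocks n (Suc j))}"
    by (rule loc_index_Suc(1)[OF j])
  have i: "?i = 2 * istar j - 1 \<or> ?i = 2 * istar j" "?i \<le> num_blocks n (Suc j) + 1" "1 \<le> ?i"
    using istar_Suc[OF j] istar_le istar_pos by auto
  define s where "s = (if ?i \<le> ?b then 1 else (-1::int))"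
  note a = candidate_arith[OF near b i off, folded s_def]
  show thesis
  proof (rule that[of s "\<bar>?b - ?i\<bar> - 1"])
    show "bsum n y (Suc j) (?i + s * (\<bar>?b - ?i\<bar> - 1 + 1)) - bsum n y (Suc j) (?i + s) \<le> 0"
      unfolding a(2) using loc_index_Suc(2)[OF j a(1)] by (simp del: loc_index.simps)
    show "1 \<le> ?i + s" "?i + s \<le> num_blocks n (Suc j)" using a(1) by simp_all
    show "1 \<le> ?i + s * (\<bar>?b - ?i\<bar> - 1 + 1)" "?i + s * (\<bar>?b - ?i\<bar> - 1 + 1) \<le> num_blocks n (Suc j)"
      unfolding a(2) using b by (simp_all del: loc_index.simps)
    show "\<bar>?b - ?i\<bar> - 1 \<in> {1, 2, 3}" by (rule a(3))
  qed (simp add: s_def del: loc_index.simps)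
qed

text \<open>At the first misplaced level a block 1, 2 or 3 places beyond a neighbour of
  \<open>istar\<close> beats this neighbour, against a drift of at least \<open>growth\<close>
  standard deviations. The union runs over levels, 2 sides and 3 distances, hence 6 *
  \<alpha>/32.\<close>

lemma prob_coarse_misplaced:
  assumes \<alpha>: "0 < \<alpha>" "\<alpha> < 1" and bad: "bad l" "l \<le> J"
  shows "measure (noise_law n) {w\<in>space (noise_law n). \<exists>j\<in>coarse \<alpha> l. 2 \<le> \<bar>loc_index n (observe n \<sigma> f \<kappa> w) j - istar j\<bar>}
    \<le> 3 / 16 * \<alpha>" (is "measure ?P ?E \<le> _")
proof -
  interpret P: prob_space ?P by (rule prob_space_noise_law)
  let ?I = "coarse \<alpha> l \<times> {-1, 1 :: int} \<times> {1, 2, 3 :: int}"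
  let ?valid = "\<lambda>j s r. 1 \<le> istar j + s \<and> istar j + s \<le> num_blocks n j \<and>
    1 \<le> istar j + s * (r + 1) \<and> istar j + s * (r + 1) \<le> num_blocks n j"
  define B where "B = (\<lambda>(j, s, r). if ?valid j s r then {w\<in>space ?P. bsum n (observe n \<sigma> f \<kappa> w) j (istar j + s * (r + 1))
      - bsum n (observe n \<sigma> f \<kappa> w) j (istar j + s) \<le> 0 * sigma_level n \<sigma> j} else {})"
  have Bm: "B p \<in> sets ?P" if "p \<in> ?I" for p
  proof -
    obtain j s r where p: "p = (j, s, r)" by (cases p)
    show ?thesis
    proof (cases "?valid j s r")
      case True
      then have m: "(\<lambda>w. bsum n w j (istar j + s * (r + 1))) \<in> borel_measurable ?P"
        "(\<lambda>w. bsum n w j (istar j + s)) \<in> borel_measurable ?P" by (auto intro: measurable_bsum)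
      note [measurable] = m
      show ?thesis unfolding p B_def using True by (simp add: bsum_observe)
    next
      case False
      show ?thesis unfolding p B_def split if_not_P[OF False] by simp
    qed
  qed
  have Bp: "measure ?P (B p) \<le> Phi (2 - growth (l - fst p))" if "p \<in> ?I" for p
  proof -
    obtain j s r where p: "p = (j, s, r)" by (cases p)
    have j: "j < l" and s: "s \<in> {-1, 1}" "r \<in> {1, 2, 3}" using that p coarse_less by auto
    show ?thesis
    proof (cases "?valid j s r")
      case True
      have jl: "j + (l - j) = l" "1 \<le> l - j" using j by auto
      have "growth (l - j) * sigma_level n \<sigma> j \<le> bsum n F j (istar j + s * (r + 1)) - bsum n F j (istar j + s)"
      proof (cases "s = 1")
        case s1: True
        show ?thesis using bad_diff_right[of j "l - j"] bad jl True s1 s by auto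
      next
        case False
        then have "s = -1" using s by auto
        then show ?thesis using bad_diff_left[of j "l - j" "istar j - (r + 1)" "istar j - 1"] bad jl True s by auto
      qed
      then have "measure ?P (B p) \<le> Phi (0 - growth (l - j))"
        unfolding p B_def split if_P[OF True] using True s by (intro prob_observe_diff_le) auto
      \<comment> \<open>The threshold here is 0 instead of 2; weakening the bound lets
        \<open>sum_coarse_le\<close> serve both the localization and the stopping rule.\<close>
      also have "\<dots> \<le> Phi (2 - growth (l - fst p))" unfolding p by (intro Phi_mono) simp
      finally show ?thesis .
    next
      case False
      show ?thesis unfolding p B_def split if_not_P[OF False] by (simp add: Phi_nonneg)
    qed
  qed
  have "?E \<subseteq> (\<Union>p\<in>?I. B p)"
  proof
    fix w assume w: "w \<in> ?E"
    let ?y = "observe n \<sigma> f \<kappa> w"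
    define j where "j = (LEAST j. 2 \<le> \<bar>loc_index n ?y j - istar j\<bar>)"
    obtain j1 where j1: "j1 \<in> coarse \<alpha> l" "2 \<le> \<bar>loc_index n ?y j1 - istar j1\<bar>" using w by auto
    have j: "2 \<le> \<bar>loc_index n ?y j - istar j\<bar>" "j \<le> j1" "\<And>i. i < j \<Longrightarrow> \<not> 2 \<le> \<bar>loc_index n ?y i - istar i\<bar>"
      unfolding j_def using j1(2) by (auto intro: LeastI Least_le dest: not_less_Least)
    have jc: "j \<in> coarse \<alpha> l" using j(2) j1(1) by (auto simp: coarse_def)
    have "j \<noteq> 0" using j(1) istar_0 by (intro notI) auto
    then obtain i where i: "j = Suc i" by (cases j) auto
    have iJ: "i < J" using coarse_less[OF jc] bad i by simp
    have near: "\<bar>loc_index n ?y i - istar i\<bar> \<le> 1" using j(3)[of i] i by simp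
    obtain s r where sr: "s \<in> {-1, 1}" "r \<in> {1, 2, 3}" "?valid j s r"
      "bsum n ?y j (istar j + s * (r + 1)) - bsum n ?y j (istar j + s) \<le> 0"
      using misplaced_step[OF iJ near j(1)[unfolded i]] unfolding i by metis
    have "w \<in> B (j, s, r)" using sr(3,4) w unfolding B_def by simp
    moreover have "(j, s, r) \<in> ?I" using sr(1,2) jc by auto
    ultimately show "w \<in> (\<Union>p\<in>?I. B p)" by blast
  qed
  then have "measure ?P ?E \<le> measure ?P (\<Union>p\<in>?I. B p)"
    using Bm finite_coarse by (intro P.finite_measure_mono sets.finite_UN) auto
  also have "\<dots> \<le> (\<Sum>p\<in>?I. measure ?P (B p))"
    by (rule P.finite_measure_subadditive_finite) (use Bm finite_coarse in auto)
  also have "\<dots> \<le> (\<Sum>p\<in>?I. Phi (2 - growth (l - fst p)))"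
    by (rule sum_mono) (rule Bp)
  also have "\<dots> = (\<Sum>j\<in>coarse \<alpha> l. \<Sum>q\<in>{-1, 1 :: int} \<times> {1, 2, 3 :: int}. Phi (2 - growth (l - j)))"
    unfolding sum.cartesian_product by (simp only: split_def)
  also have "\<dots> = 6 * (\<Sum>j\<in>coarse \<alpha> l. Phi (2 - growth (l - j)))"
    by (simp add: sum_distrib_left card_cartesian_product)
  also have "\<dots> \<le> 6 * (\<alpha> / 32)" by (intro mult_left_mono sum_coarse_le \<alpha>) simp
  finally show ?thesis by simp
qed

text \<open>While the localization is off by at most one, the blocks at distances 5 and 6 lie on one
  side of \<open>istar\<close>, so a stop requires noise that makes up for a drift exceeding the
  threshold by \<open>growth - 2\<close> standard deviations. Two sides give 2 *
  \<alpha>/32.\<close>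

lemma prob_coarse_stop:
  assumes \<alpha>: "0 < \<alpha>" "\<alpha> < 1" and bad: "bad l" "l \<le> J"
    and near: "\<And>j. j \<in> coarse \<alpha> l \<Longrightarrow> \<bar>loc_index n yl j - istar j\<bar> \<le> 1"
  shows "measure (noise_law n) {w\<in>space (noise_law n). stop_level n \<sigma> yl (observe n \<sigma> f \<kappa> w) \<in> coarse \<alpha> l} \<le> \<alpha> / 16"
    (is "measure ?P ?E \<le> _")
proof -
  interpret P: prob_space ?P by (rule prob_space_noise_law)
  let ?I = "coarse \<alpha> l \<times> {-1, 1 :: int}"
  let ?loc = "loc_index n yl"
  let ?valid = "\<lambda>j s. 1 \<le> ?loc j + 6 * s \<and> ?loc j + 6 * s \<le> num_blocks n j"
  define B where "B = (\<lambda>(j, s). if ?valid j s then {w\<in>space ?P. bsum n (observe n \<sigma> f \<kappa> w) j (?loc j + 6 * s)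
      - bsum n (observe n \<sigma> f \<kappa> w) j (?loc j + 5 * s) \<le> 2 * sigma_level n \<sigma> j} else {})"
  have v5: "1 \<le> ?loc j + 5 * s \<and> ?loc j + 5 * s \<le> num_blocks n j" if "?valid j s" "s \<in> {-1, 1}" "j \<in> coarse \<alpha> l" for j s
    using that loc_index_bounds[of j n yl] coarse_less[OF that(3)] bad by auto
  have Bm: "B p \<in> sets ?P" if "p \<in> ?I" for p
  proof -
    obtain j s where p: "p = (j, s)" by (cases p)
    show ?thesis
    proof (cases "?valid j s")
      case True
      note v = v5[OF True]
      have m: "(\<lambda>w. bsum n w j (?loc j + 6 * s)) \<in> borel_measurable ?P"
        "(\<lambda>w. bsum n w j (?loc j + 5 * s)) \<in> borel_measurable ?P"
        using True v that p by (auto intro: measurable_bsum)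
      note [measurable] = m
      show ?thesis unfolding p B_def using True v that p by (simp add: bsum_observe)
    next
      case False
      show ?thesis unfolding p B_def split if_not_P[OF False] by simp
    qed
  qed
  have Bp: "measure ?P (B p) \<le> Phi (2 - growth (l - fst p))" if "p \<in> ?I" for p
  proof -
    obtain j s where p: "p = (j, s)" by (cases p)
    have j: "j < l" "j \<in> coarse \<alpha> l" and s: "s \<in> {-1, 1}" using that p coarse_less by auto
    show ?thesis
    proof (cases "?valid j s")
      case True
      have jl: "j + (l - j) = l" "1 \<le> l - j" using j by auto
      have "growth (l - j) * sigma_level n \<sigma> j \<le> bsum n F j (?loc j + 6 * s) - bsum n F j (?loc j + 5 * s)"
      proof (cases "s = 1")
        case s1: True
        show ?thesis using bad_diff_right[of j "l - j" "?loc j + 5" "?loc j + 6"] bad jl True s1 near[OF j(2)] by auto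
      next
        case False
        then have "s = -1" using s by auto
        then show ?thesis using bad_diff_left[of j "l - j" "?loc j - 6" "?loc j - 5"] bad jl True near[OF j(2)] by auto
      qed
      then have "measure ?P (B p) \<le> Phi (2 - growth (l - j))"
        unfolding p B_def split if_P[OF True] using True s v5[OF True s j(2)] by (intro prob_observe_diff_le) auto
      then show ?thesis by (simp add: p)
    next
      case False
      show ?thesis unfolding p B_def split if_not_P[OF False] by (simp add: Phi_nonneg)
    qed
  qed
  have "?E \<subseteq> (\<Union>p\<in>?I. B p)"
  proof
    fix w assume w: "w \<in> ?E"
    let ?y = "observe n \<sigma> f \<kappa> w"
    let ?j = "stop_level n \<sigma> yl ?y"
    have j: "?j \<in> coarse \<alpha> l" using w by simp
    then have jJ: "?j < J" using coarse_less bad by fastforce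
    obtain s where "s \<in> {-1, 1}" "?valid ?j s" "bsum n ?y ?j (?loc ?j + 6 * s) - bsum n ?y ?j (?loc ?j + 5 * s) \<le> 2 * sigma_level n \<sigma> ?j"
      using T_stat_le_cases[OF less_imp_le[OF jJ] stop_levelD[OF jJ]] by metis
    then have "w \<in> B (?j, s)" "(?j, s) \<in> ?I" using w j unfolding B_def by auto
    then show "w \<in> (\<Union>p\<in>?I. B p)" by blast
  qed
  then have "measure ?P ?E \<le> measure ?P (\<Union>p\<in>?I. B p)"
    using Bm finite_coarse by (intro P.finite_measure_mono sets.finite_UN) auto
  also have "\<dots> \<le> (\<Sum>p\<in>?I. measure ?P (B p))"
    by (rule P.finite_measure_subadditive_finite) (use Bm finite_coarse in auto)
  also have "\<dots> \<le> (\<Sum>p\<in>?I. Phi (2 - growth (l - fst p)))"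
    by (rule sum_mono) (rule Bp)
  also have "\<dots> = (\<Sum>j\<in>coarse \<alpha> l. \<Sum>q\<in>{-1, 1 :: int}. Phi (2 - growth (l - j)))"
    unfolding sum.cartesian_product by (simp only: split_def)
  also have "\<dots> = 2 * (\<Sum>j\<in>coarse \<alpha> l. Phi (2 - growth (l - j)))"
    by (simp add: sum_distrib_left)
  also have "\<dots> \<le> 2 * (\<alpha> / 32)" by (intro mult_left_mono sum_coarse_le \<alpha>) simp
  finally show ?thesis by simp
qed

end

section \<open>The endpoints\<close>

lemma cdf_max_std_normal:
  assumes k: "k \<ge> 1"
  shows "cdf (distr (\<Pi>\<^sub>M i\<in>{..<k}. std_normal_distribution) borel (\<lambda>x. Max (x ` {..<k}))) t = Phi t ^ k"
proof -
  let ?P = "\<Pi>\<^sub>M i\<in>{..<k}. std_normal_distribution"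
  interpret prod: product_sigma_finite "\<lambda>_::nat. std_normal_distribution" ..
  interpret P: prob_space ?P by (rule prob_space_PiM_std)
  have m: "(\<lambda>x. Max (x ` {..<k})) \<in> borel_measurable ?P"
    by (rule borel_measurable_Max) auto
  have "cdf (distr ?P borel (\<lambda>x. Max (x ` {..<k}))) t = measure ?P ((\<lambda>x. Max (x ` {..<k})) -` {..t} \<inter> space ?P)"
    unfolding cdf_def using m by (subst measure_distr) auto
  also have "(\<lambda>x. Max (x ` {..<k})) -` {..t} \<inter> space ?P = Pi\<^sub>E {..<k} (\<lambda>_. {..t})"
  proof -
    have ne: "{..<k} \<noteq> {}" using k by (simp add: lessThan_empty_iff)
    have "Max (x ` {..<k}) \<le> t \<longleftrightarrow> (\<forall>i\<in>{..<k}. x i \<le> t)" for x :: "nat \<Rightarrow> real"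
      using ne by (subst Max_le_iff) auto
    then have "x \<in> (\<lambda>x. Max (x ` {..<k})) -` {..t} \<inter> space ?P \<longleftrightarrow> x \<in> Pi\<^sub>E {..<k} (\<lambda>_. {..t})" for x
      by (simp only: Int_iff vimage_eq atMost_iff space_PiM PiE_iff) auto
    then show ?thesis by (rule set_eqI)
  qed
  also have "measure ?P \<dots> = Phi t ^ k"
    unfolding measure_def by (subst prod.emeasure_PiM)
      (auto simp: stdN.emeasure_eq_measure Phi_eq prod_constant ennreal_power enn2real_ennreal)
  finally show ?thesis .
qed

text \<open>\<open>S_quantile\<close> is an infimum; continuity of \<open>Phi\<close> makes the
  underlying set closed, so the infimum is attained. The quantile at
  \<open>1 - root k (1 - \<beta>)\<close> is both an element and a lower bound of the set.\<close>

lemma Phi_S_quantile: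
  assumes k: "k \<ge> 1" and \<beta>: "0 < \<beta>" "\<beta> < 1"
  shows "1 - \<beta> \<le> Phi (S_quantile k \<beta>) ^ k"
proof -
  let ?A = "{x. 1 - \<beta> \<le> Phi x ^ k}"
  have eq: "S_quantile k \<beta> = Inf ?A"
    unfolding S_quantile_def quantile_def by (simp only: cdf_max_std_normal[OF k])
  have cont: "continuous_on UNIV (\<lambda>x. Phi x ^ k)"
    by (intro continuous_on_power continuous_at_imp_continuous_on) (auto intro: isCont_Phi)
  have closed: "closed ?A" by (rule closed_Collect_le[OF continuous_on_const cont])
  have "root k (1 - \<beta>) < 1" "0 < root k (1 - \<beta>)" using \<beta> k by auto
  then have "Phi (z_upper (1 - root k (1 - \<beta>))) = root k (1 - \<beta>)" by (subst Phi_z_upper) auto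
  then have z: "Phi (z_upper (1 - root k (1 - \<beta>))) ^ k = 1 - \<beta>" using \<beta> k by simp
  then have ne: "?A \<noteq> {}" by (metis (mono_tags, lifting) empty_iff mem_Collect_eq order_refl)
  have "bdd_below ?A"
  proof (rule bdd_belowI)
    fix x assume "x \<in> ?A"
    then have "Phi (z_upper (1 - root k (1 - \<beta>))) ^ k \<le> Phi x ^ k" using z by simp
    then have "Phi (z_upper (1 - root k (1 - \<beta>))) \<le> Phi x" using k Phi_nonneg by (simp add: power_mono_iff)
    then show "z_upper (1 - root k (1 - \<beta>)) \<le> x" by (meson Phi_strict_mono linorder_not_less)
  qed
  then have "Inf ?A \<in> ?A" using closed ne by (intro closed_contains_Inf)
  then show ?thesis unfolding eq by simp
qed

lemma prob_bsum_bounded: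
  assumes W: "W \<subseteq> {1..num_blocks n j}" and c: "c \<in> {-1, 1 :: real}"
  shows "measure (noise_law n) {w\<in>space (noise_law n). \<forall>b\<in>W. c * bsum n w j b \<le> t * sqrt (real_of_int (block_size n j))} = Phi t ^ card W"
proof -
  have fin: "finite W" using W finite_subset by blast
  have "measure (noise_law n) {w\<in>space (noise_law n). \<forall>b\<in>W. (\<Sum>k\<in>block n j b. c * w k) / sqrt (\<Sum>k\<in>block n j b. c\<^sup>2) \<in> {..t}} =
    (\<Prod>b\<in>W. measure std_normal_distribution {..t})"
    unfolding noise_law_def
  proof (rule gauss_blocks)
    show "disjoint_family_on (block n j) W"
      unfolding disjoint_family_on_def by (metis disjoint_blocks inf_commute linorder_neqE)
  qed (use fin W block_subset_iff c in \<open>auto simp: block_nonempty\<close>)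
  moreover have "(\<Sum>k\<in>block n j b. c\<^sup>2) = real_of_int (block_size n j)" for b
    using c block_size_pos[of n j] by (auto simp: card_block)
  moreover have "0 < sqrt (real_of_int (block_size n j))" using block_size_pos[of n j] by simp
  ultimately show ?thesis by (simp add: Phi_eq divide_le_eq bsum_def sum_distrib_left)
qed

text \<open>The index of the quantile may exceed the number of complete blocks in the window; fewer
  variables only raise the probability.\<close>

lemma prob_bsum_bounded_S_quantile:
  assumes W: "W \<subseteq> {1..num_blocks n j}" "card W \<le> k" and k: "1 \<le> k" and c: "c \<in> {-1, 1 :: real}" and \<beta>: "0 < \<beta>" "\<beta> < 1"
  shows "1 - \<beta> \<le> measure (noise_law n)
    {w\<in>space (noise_law n). \<forall>b\<in>W. c * bsum n w j b \<le> S_quantile k \<beta> * sqrt (real_of_int (block_size n j))}"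
proof -
  have "1 - \<beta> \<le> Phi (S_quantile k \<beta>) ^ k" by (rule Phi_S_quantile[OF k \<beta>])
  also have "\<dots> \<le> Phi (S_quantile k \<beta>) ^ card W" by (intro power_decreasing W Phi_nonneg Phi_le_1)
  finally show ?thesis unfolding prob_bsum_bounded[OF W(1) c] .
qed

section \<open>The window of blocks around the starting block\<close>

lemma level_bounds:
  assumes "jh \<le> top_level n" "0 < \<alpha>" "\<alpha> < 1"
  shows "start_level \<alpha> jh \<le> jh" "jh \<le> end_level \<alpha> n jh" "end_level \<alpha> n jh \<le> top_level n"
proof -
  have K: "1 \<le> K_const (\<alpha> / 4)" "4 \<le> Kt_const (\<alpha> / 4)"
    using K_const_bounds(1)[of "\<alpha> / 4"] assms by (auto simp: Kt_const_def)
  show "start_level \<alpha> jh \<le> jh" using K by (simp add: start_level_def)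
  show "jh \<le> end_level \<alpha> n jh" "end_level \<alpha> n jh \<le> top_level n"
    using K assms by (auto simp: end_level_def)
qed

lemma ceiling_num_blocks:
  "num_blocks n j \<le> \<lceil>real (n + 1) / 2 ^ (top_level n - j)\<rceil>" "\<lceil>real (n + 1) / 2 ^ (top_level n - j)\<rceil> \<le> num_blocks n j + 1"
  unfolding num_blocks_floor[symmetric] by linarith+

text \<open>The block \<open>e * i\<close> at the end level is the last descendant of the starting
  block. It is complete, so every window contains a block with a finite average, even if the ceiling
  in \<open>window_hi\<close> also admits an incomplete one.\<close>

lemma window_props:
  assumes jh: "jh \<le> top_level n" and \<alpha>: "0 < \<alpha>" "\<alpha> < 1"
    and i: "1 \<le> i" "i \<le> num_blocks n (start_level \<alpha> jh)"
  defines "e \<equiv> 2 ^ (end_level \<alpha> n jh - start_level \<alpha> jh)" and "N \<equiv> num_blocks n (end_level \<alpha> n jh)"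
  shows "1 \<le> window_lo \<alpha> n jh i" "window_lo \<alpha> n jh i \<le> e * i" "e * i \<le> window_hi \<alpha> n jh i" "1 \<le> e * i" "e * i \<le> N"
    "window_hi \<alpha> n jh i - window_lo \<alpha> n jh i \<le> 9 * e + 1" "window_hi \<alpha> n jh i \<le> N + 1"
proof -
  note l = level_bounds[OF jh \<alpha>]
  have e: "1 \<le> e" by (simp add: e_def)
  have s: "start_level \<alpha> jh + (end_level \<alpha> n jh - start_level \<alpha> jh) = end_level \<alpha> n jh" using l by simp
  have "block_size n (start_level \<alpha> jh) = e * block_size n (end_level \<alpha> n jh)"
    using block_size_add[of "start_level \<alpha> jh" "end_level \<alpha> n jh - start_level \<alpha> jh" n] l unfolding s e_def by simp
  moreover have "i * block_size n (start_level \<alpha> jh) \<le> int n + 1" using i le_num_blocks_iff by blast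
  ultimately have "(e * i) * block_size n (end_level \<alpha> n jh) \<le> int n + 1" by (simp add: algebra_simps)
  then show eN: "e * i \<le> N" unfolding N_def le_num_blocks_iff .
  have "e * 1 \<le> e * i" using e i by (intro mult_left_mono) auto
  then show "1 \<le> e * i" using e by linarith
  have m: "e * (i - 5) = e * i - 5 * e" "e * (i + 4) = e * i + 4 * e" by (simp_all add: algebra_simps)
  show "1 \<le> window_lo \<alpha> n jh i" by (simp add: window_lo_def)
  show "window_lo \<alpha> n jh i \<le> e * i" unfolding window_lo_def e_def[symmetric] m using e \<open>1 \<le> e * i\<close> by simp
  show "e * i \<le> window_hi \<alpha> n jh i" unfolding window_hi_def e_def[symmetric] m
    using e eN ceiling_num_blocks(1)[of n "end_level \<alpha> n jh"] unfolding N_def by simp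
  show "window_hi \<alpha> n jh i - window_lo \<alpha> n jh i \<le> 9 * e + 1"
    unfolding window_hi_def window_lo_def e_def[symmetric] m by simp
  show "window_hi \<alpha> n jh i \<le> N + 1" unfolding window_hi_def N_def using ceiling_num_blocks(2)[of n "end_level \<alpha> n jh"] by simp
qed

context regression
begin

text \<open>With \<open>i\<close> off by at most 4, \<open>istar\<close> at the end level descends
  from one of the blocks \<open>i - 4\<close>, ..., \<open>i + 4\<close>. The window starts one
  block before their descendants and ends one block after them, as far as the sample reaches, so
  both neighbours of \<open>istar\<close> are covered too.\<close>

lemma window_contains:
  assumes jh: "jh \<le> J" and \<alpha>: "0 < \<alpha>" "\<alpha> < 1" and near: "\<bar>i - istar (start_level \<alpha> jh)\<bar> \<le> 4"
    and b: "\<bar>b - istar (end_level \<alpha> n jh)\<bar> \<le> 1" "1 \<le> b" "b \<le> num_blocks n (end_level \<alpha> n jh)"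
  shows "b \<in> {window_lo \<alpha> n jh i..window_hi \<alpha> n jh i}"
proof -
  note l = level_bounds[OF jh \<alpha>]
  define e :: int where "e = 2 ^ (end_level \<alpha> n jh - start_level \<alpha> jh)"
  have e: "1 \<le> e" by (simp add: e_def)
  let ?q = "istar (start_level \<alpha> jh)"
  have s: "start_level \<alpha> jh + (end_level \<alpha> n jh - start_level \<alpha> jh) = end_level \<alpha> n jh" using l by simp
  have q: "e * (?q - 1) + 1 \<le> istar (end_level \<alpha> n jh)" "istar (end_level \<alpha> n jh) \<le> e * ?q"
    using istar_descendants[of "start_level \<alpha> jh" "end_level \<alpha> n jh - start_level \<alpha> jh"] l unfolding s e_def by auto
  have "e * (i - 5) \<le> e * (?q - 1)" "e * ?q \<le> e * (i + 4)" using near e by (auto intro!: mult_left_mono)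
  then have "e * (i - 5) \<le> b" "b \<le> e * (i + 4) + 1" using q b by auto
  then show ?thesis
    unfolding window_lo_def window_hi_def e_def[symmetric] using b ceiling_num_blocks(1)[of n "end_level \<alpha> n jh"] by simp
qed

section \<open>Validity of the two endpoints\<close>

lemma bsum_F_ge:
  assumes "1 \<le> b" "b \<le> num_blocks n j"
  shows "real_of_int (block_size n j) * M \<le> bsum n F j b"
proof -
  have "(\<Sum>k\<in>block n j b. M) \<le> bsum n F j b"
    unfolding bsum_def using assms block_subset_iff[of n j b] by (intro sum_mono M_le_F) auto
  then show ?thesis using block_size_pos[of n j] by (simp add: card_block)
qed

lemma scaled_block_sum:
  "ereal (1 / 2 ^ (J - j)) * block_sum n y j b =
    (if 1 \<le> b \<and> b \<le> num_blocks n j then ereal (bsum n y j b / real_of_int (block_size n j)) else \<infinity>)"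
  by (simp add: block_sum_eq real_block_size)

lemma noise_scale_eq: "noise_scale \<alpha> n \<sigma> jh = sqrt 3 * \<sigma> / sqrt (real_of_int (block_size n (end_level \<alpha> n jh)))"
  by (simp add: noise_scale_def real_block_size)

lemma noise_scale_mult:
  assumes m: "m = real_of_int (block_size n (end_level \<alpha> n jh))"
  shows "sqrt 3 * \<sigma> * (t * sqrt m) / m = t * noise_scale \<alpha> n \<sigma> jh"
proof -
  have "0 < m" using block_size_pos unfolding m by simp
  then have "t * sqrt m / m = t / sqrt m" by (simp add: frac_eq_eq mult.assoc)
  then have "sqrt 3 * \<sigma> * (t * sqrt m / m) = sqrt 3 * \<sigma> * (t / sqrt m)" by simp
  then show ?thesis unfolding noise_scale_eq m[symmetric] by (simp add: mult.commute)
qed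

lemma upper_end_ge:
  assumes w: "\<And>b. b \<in> {window_lo \<alpha> n jh i..window_hi \<alpha> n jh i} \<Longrightarrow> 1 \<le> b \<Longrightarrow> b \<le> num_blocks n (end_level \<alpha> n jh) \<Longrightarrow>
      - bsum n w (end_level \<alpha> n jh) b \<le> S_quantile (window_card \<alpha> n jh i 1) (\<alpha> / 4) * sqrt (real_of_int (block_size n (end_level \<alpha> n jh)))"
    and ne: "window_lo \<alpha> n jh i \<le> window_hi \<alpha> n jh i"
  shows "ereal M \<le> upper_end \<alpha> n \<sigma> jh i (observe n \<sigma> f \<kappa> w)"
proof -
  define m where "m = real_of_int (block_size n (end_level \<alpha> n jh))"
  have m: "0 < m" using block_size_pos unfolding m_def by simp
  define S where "S = S_quantile (window_card \<alpha> n jh i 1) (\<alpha> / 4)"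
  define ns where "ns = noise_scale \<alpha> n \<sigma> jh"
  have "ereal (M - S * ns) \<le> min_average \<alpha> n jh i (observe n \<sigma> f \<kappa> w)"
    unfolding min_average_def
  proof (subst Min_ge_iff, simp, use ne in simp, clarify)
    fix b assume b: "b \<in> {window_lo \<alpha> n jh i..window_hi \<alpha> n jh i}"
    show "ereal (M - S * ns) \<le> ereal (1 / 2 ^ (J - end_level \<alpha> n jh)) * block_sum n (observe n \<sigma> f \<kappa> w) (end_level \<alpha> n jh) b"
    proof (cases "1 \<le> b \<and> b \<le> num_blocks n (end_level \<alpha> n jh)")
      case True
      have "sqrt 3 * \<sigma> * (- bsum n w (end_level \<alpha> n jh) b) \<le> sqrt 3 * \<sigma> * (S * sqrt m)"
        using w[OF b] True \<sigma> unfolding m_def[symmetric] S_def[symmetric] by (intro mult_left_mono) auto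
      moreover have "m * M \<le> bsum n F (end_level \<alpha> n jh) b" using bsum_F_ge[of b] True by (simp add: m_def)
      ultimately have "m * M - sqrt 3 * \<sigma> * (S * sqrt m) \<le> bsum n (observe n \<sigma> f \<kappa> w) (end_level \<alpha> n jh) b"
        using True by (simp add: bsum_observe F_fun)
      then have "(m * M - sqrt 3 * \<sigma> * (S * sqrt m)) / m \<le> bsum n (observe n \<sigma> f \<kappa> w) (end_level \<alpha> n jh) b / m"
        using m by (intro divide_right_mono) auto
      moreover have "(m * M - sqrt 3 * \<sigma> * (S * sqrt m)) / m = M - S * ns"
        unfolding diff_divide_distrib noise_scale_mult[OF m_def] ns_def using m by simp
      ultimately show ?thesis unfolding scaled_block_sum m_def[symmetric] using True by simp
    next
      case False
      show ?thesis unfolding scaled_block_sum if_not_P[OF False] by simp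
    qed
  qed
  then have "ereal (M - S * ns) + ereal (S * ns) \<le> upper_end \<alpha> n \<sigma> jh i (observe n \<sigma> f \<kappa> w)"
    unfolding upper_end_def S_def[symmetric] ns_def[symmetric] by (rule add_right_mono)
  then show ?thesis by simp
qed

lemma min_average_le:
  assumes b: "b \<in> {window_lo \<alpha> n jh i..window_hi \<alpha> n jh i}" "1 \<le> b" "b \<le> num_blocks n (end_level \<alpha> n jh)"
  shows "min_average \<alpha> n jh i y \<le> ereal (bsum n y (end_level \<alpha> n jh) b / real_of_int (block_size n (end_level \<alpha> n jh)))"
proof -
  have "min_average \<alpha> n jh i y \<le> ereal (1 / 2 ^ (J - end_level \<alpha> n jh)) * block_sum n y (end_level \<alpha> n jh) b"
    unfolding min_average_def using b(1) by (intro Min_le) auto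
  then show ?thesis unfolding scaled_block_sum using b by simp
qed

lemma lower_end_le_coarse:
  assumes c: "int jh + Kt_const (\<alpha> / 4) \<le> int J"
    and b: "b \<in> {window_lo \<alpha> n jh i..window_hi \<alpha> n jh i}" "1 \<le> b" "b \<le> num_blocks n (end_level \<alpha> n jh)"
    and F: "bsum n F (end_level \<alpha> n jh) b \<le> real_of_int (block_size n (end_level \<alpha> n jh)) * M
      + sqrt 3 * \<sigma> * sqrt (real_of_int (block_size n (end_level \<alpha> n jh)))"
    and w: "bsum n w (end_level \<alpha> n jh) b \<le> z_upper (\<alpha> / 4) * sqrt (real_of_int (block_size n (end_level \<alpha> n jh)))"
  shows "lower_end \<alpha> n \<sigma> jh i (observe n \<sigma> f \<kappa> w) \<le> ereal M"
proof -
  define m where "m = real_of_int (block_size n (end_level \<alpha> n jh))"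
  have m: "0 < m" using block_size_pos unfolding m_def by simp
  define z where "z = z_upper (\<alpha> / 4)"
  define ns where "ns = noise_scale \<alpha> n \<sigma> jh"
  have "sqrt 3 * \<sigma> * bsum n w (end_level \<alpha> n jh) b \<le> sqrt 3 * \<sigma> * (z * sqrt m)"
    using w \<sigma> unfolding m_def[symmetric] z_def[symmetric] by (intro mult_left_mono) auto
  then have "bsum n (observe n \<sigma> f \<kappa> w) (end_level \<alpha> n jh) b \<le> m * M + sqrt 3 * \<sigma> * ((z + 1) * sqrt m)"
    using F b unfolding m_def[symmetric] by (simp add: bsum_observe F_fun algebra_simps)
  then have "bsum n (observe n \<sigma> f \<kappa> w) (end_level \<alpha> n jh) b / m \<le> (m * M + sqrt 3 * \<sigma> * ((z + 1) * sqrt m)) / m"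
    using m by (intro divide_right_mono) auto
  also have "\<dots> = M + (z + 1) * ns"
    unfolding add_divide_distrib noise_scale_mult[OF m_def] ns_def using m by simp
  finally have "min_average \<alpha> n jh i (observe n \<sigma> f \<kappa> w) \<le> ereal (M + (z + 1) * ns)"
    using min_average_le[OF b, of "observe n \<sigma> f \<kappa> w"] unfolding m_def[symmetric] by (meson ereal_less_eq(3) order_trans)
  then have "min_average \<alpha> n jh i (observe n \<sigma> f \<kappa> w) - ereal ((z + 1) * ns) \<le> ereal (M + (z + 1) * ns) - ereal ((z + 1) * ns)"
    by (rule ereal_minus_mono) simp
  then show ?thesis unfolding lower_end_def z_def[symmetric] ns_def[symmetric] using c by simp
qed

text \<open>The corrections \<open>2 * H\<close> of the slope and \<open>H\<close> of the height
  dominate the noise of the two observations, so to the right of the grid point the noisy line stays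
  below the exact one.\<close>

lemma v_left_le:
  assumes "design n i \<le> t" "\<bar>y i - g i\<bar> \<le> H" "\<bar>y (i - 1) - g (i - 1)\<bar> \<le> H"
  shows "v_left n H y i t \<le> v_left n 0 g i t"
proof -
  have "(y i - y (i - 1) - 2 * H) * (real n * (t - design n i)) \<le> (g i - g (i - 1)) * (real n * (t - design n i))"
    using assms by (intro mult_right_mono) (auto simp: abs_le_iff)
  then show ?thesis using assms unfolding v_left_def by (simp add: algebra_simps abs_le_iff)
qed

lemma v_right_le:
  assumes "t \<le> design n (i + 1)" "\<bar>y (i + 1) - g (i + 1)\<bar> \<le> H" "\<bar>y (i + 2) - g (i + 2)\<bar> \<le> H"
  shows "v_right n H y i t \<le> v_right n 0 g i t"
proof -
  have "(y (i + 2) - y (i + 1) + 2 * H) * (real n * (t - design n (i + 1))) \<le> (g (i + 2) - g (i + 1)) * (real n * (t - design n (i + 1)))"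
    using assms by (intro mult_right_mono_neg) (auto simp: abs_le_iff mult_le_0_iff)
  then show ?thesis using assms unfolding v_right_def by (simp add: algebra_simps abs_le_iff)
qed

text \<open>Beyond its endpoints the extension of a chord stays below a convex function.\<close>

lemma v_left_F_le:
  assumes "1 \<le> i" "i \<le> int n" "design n i \<le> t" "t \<le> 1"
  shows "v_left n 0 F i t \<le> f t"
proof (cases "t = design n i")
  case False
  have "(f (design n i) - f (design n (i - 1))) / (design n i - design n (i - 1)) \<le> (f t - f (design n i)) / (t - design n i)"
    using assms False n design_mem'[of i] design_mem'[of "i - 1"]
    by (intro convex_on_chord_mono[OF convex_f]) (auto simp: design_less_iff design_le_iff)
  moreover have "design n i - design n (i - 1) = 1 / n" using n by (simp add: design_eq field_simps)
  ultimately have "real n * (F i - F (i - 1)) \<le> (f t - F i) / (t - design n i)" by (simp add: F_def mult.commute)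
  then show ?thesis using assms False unfolding v_left_def by (simp add: pos_le_divide_eq)
qed (simp add: v_left_def F_def)

lemma v_right_F_le:
  assumes "0 \<le> i" "i + 2 \<le> int n" "t \<le> design n (i + 1)" "0 \<le> t"
  shows "v_right n 0 F i t \<le> f t"
proof (cases "t = design n (i + 1)")
  case False
  have "(f (design n (i + 1)) - f t) / (design n (i + 1) - t) \<le> (f (design n (i + 2)) - f (design n (i + 1))) / (design n (i + 2) - design n (i + 1))"
    using assms False n design_mem'[of "i + 1"] design_mem'[of "i + 2"]
    by (intro convex_on_chord_mono[OF convex_f]) (auto simp: design_less_iff design_le_iff)
  moreover have "design n (i + 2) - design n (i + 1) = 1 / n" using n by (simp add: design_eq field_simps)
  ultimately have "(F (i + 1) - f t) / (design n (i + 1) - t) \<le> real n * (F (i + 2) - F (i + 1))" by (simp add: F_def mult.commute)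
  then have "F (i + 1) - f t \<le> real n * (F (i + 2) - F (i + 1)) * (design n (i + 1) - t)"
    using assms False by (simp add: pos_divide_le_eq)
  then show ?thesis unfolding v_right_def by (simp add: algebra_simps)
qed (simp add: v_right_def F_def)

text \<open>Unifies the cases of \<open>h_lower\<close>: each line needs a bound only in cells where
  it enters, and for \<open>n = 1\<close> the value is \<open>-\<infinity>\<close>.\<close>

lemma h_lower_le:
  assumes i: "0 \<le> i" "i < int n" and t: "design n i \<le> t" "t \<le> design n (i + 1)"
    and vl: "\<not> (lo = 1 \<and> i = 0) \<Longrightarrow> v_left n H y i t \<le> v"
    and vr: "\<not> (hi - 1 = int n \<and> i = int n - 1) \<Longrightarrow> v_right n H y i t \<le> v"
  shows "h_lower n H y lo hi i \<le> ereal v"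
proof -
  consider "n = 1" | "n \<noteq> 1" "lo = 1 \<and> i = 0" | "n \<noteq> 1" "\<not> (lo = 1 \<and> i = 0)" "hi - 1 = int n \<and> i = int n - 1" |
    "n \<noteq> 1" "\<not> (lo = 1 \<and> i = 0)" "\<not> (hi - 1 = int n \<and> i = int n - 1)" by blast
  then show ?thesis
  proof cases
    case 1
    then show ?thesis by (simp add: h_lower_def)
  next
    case 2
    have "t \<in> {0..1 / real n}" using t 2 by (simp add: design_eq)
    then have "(INF t\<in>{0..1 / real n}. ereal (v_right n H y 0 t)) \<le> ereal (v_right n H y 0 t)" by (rule INF_lower)
    also have "\<dots> \<le> ereal v" using vr 2 n by auto
    finally show ?thesis using 2 by (simp add: h_lower_def)
  next
    case 3
    have "t \<in> {(real n - 1) / real n..1}" using t 3 n by (simp add: design_eq)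
    then have "(INF t\<in>{(real n - 1) / real n..1}. ereal (v_left n H y (int n - 1) t)) \<le> ereal (v_left n H y (int n - 1) t)"
      by (rule INF_lower)
    also have "\<dots> \<le> ereal v" using vl 3 by auto
    finally show ?thesis using 3 by (auto simp: h_lower_def)
  next
    case 4
    have "t \<in> {design n i..design n (i + 1)}" using t by simp
    then have "(INF t\<in>{design n i..design n (i + 1)}. ereal (max (v_left n H y i t) (v_right n H y i t))) \<le>
      ereal (max (v_left n H y i t) (v_right n H y i t))" by (rule INF_lower)
    also have "\<dots> \<le> ereal v" using vl vr 4 by auto
    finally show ?thesis using 4 by (auto simp: h_lower_def)
  qed
qed

text \<open>The cell that contains the minimizer belongs to the window. There the exact
  extrapolations lie below \<open>f\<close> and the noisy ones below the exact ones, so the entry of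
  this cell is at most \<open>M\<close>.\<close>

lemma lower_end_le_fine:
  assumes jh: "jh \<le> J" and \<alpha>: "0 < \<alpha>" "\<alpha> < 1" and c: "\<not> int jh + Kt_const (\<alpha> / 4) \<le> int J"
    and i: "1 \<le> i" "i \<le> num_blocks n (start_level \<alpha> jh)"
    and near: "\<bar>i - istar (start_level \<alpha> jh)\<bar> \<le> 4"
    and w: "\<And>k. k \<in> {0..int n} \<Longrightarrow> window_lo \<alpha> n jh i - 2 \<le> k \<Longrightarrow> k \<le> window_hi \<alpha> n jh i \<Longrightarrow>
      \<bar>w k\<bar> \<le> S_quantile (window_card \<alpha> n jh i 3) (\<alpha> / 8)"
  shows "lower_end \<alpha> n \<sigma> jh i (observe n \<sigma> f \<kappa> w) \<le> ereal M"
proof -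
  let ?lo = "window_lo \<alpha> n jh i" and ?hi = "window_hi \<alpha> n jh i"
  have eJ: "end_level \<alpha> n jh = J" using c by (simp add: end_level_def)
  define e :: int where "e = 2 ^ (J - start_level \<alpha> jh)"
  have e: "1 \<le> e" by (simp add: e_def)
  note wp = window_props[OF jh \<alpha> i, unfolded eJ, folded e_def, unfolded num_blocks_top]
  note l = level_bounds[OF jh \<alpha>]
  define y where "y = observe n \<sigma> f \<kappa> w"
  define H where "H = fine_margin \<alpha> n \<sigma> jh i"
  have yF: "\<bar>y k - F k\<bar> \<le> H" if "k \<in> {0..int n}" "?lo - 2 \<le> k" "k \<le> ?hi" for k
  proof -
    have "\<bar>y k - F k\<bar> = sqrt 3 * \<sigma> * \<bar>w k\<bar>" using that(1) \<sigma> by (simp add: y_def observe_def F_def abs_mult)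
    also have "\<dots> \<le> sqrt 3 * \<sigma> * S_quantile (window_card \<alpha> n jh i 3) (\<alpha> / 8)"
      using w[OF that] \<sigma> by (intro mult_left_mono) auto
    finally show ?thesis by (simp add: H_def fine_margin_def mult_ac)
  qed
  have iJ: "istar J = kstar + 1" by (simp add: istar_def block_size_top)
  have q: "e * (istar (start_level \<alpha> jh) - 1) + 1 \<le> istar J" "istar J \<le> e * istar (start_level \<alpha> jh)"
    using istar_descendants[of "start_level \<alpha> jh" "J - start_level \<alpha> jh"] l jh unfolding e_def by auto
  have "e * (i - 5) \<le> e * (istar (start_level \<alpha> jh) - 1)" "e * istar (start_level \<alpha> jh) \<le> e * (i + 4)"
    using near e by (auto intro!: mult_left_mono)
  then have ks: "e * (i - 5) \<le> kstar" "kstar \<le> e * (i + 4) - 1" using q iJ by auto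
  have lo: "?lo = max 1 (e * (i - 5))" by (simp add: window_lo_def eJ e_def)
  have hi: "?hi = min (e * (i + 4) + 1) (int n + 1)"
    using ceiling_of_nat[of "n + 1", where 'a=real] by (simp add: window_hi_def eJ e_def)
  have ei: "e * (i - 5) = e * i - 5 * e" "e * (i + 4) = e * i + 4 * e" by (simp_all add: algebra_simps)
  \<comment> \<open>If the minimizer is 1, then \<open>kstar = n\<close> is not the left end of a
    cell, and the last cell is taken instead.\<close>
  define i0 where "i0 = min kstar (int n - 1)"
  have i0: "0 \<le> i0" "i0 < int n" using kstar_bounds n by (auto simp: i0_def)
  have lon: "?lo \<le> int n" using wp e n unfolding lo ei by auto
  have i0w: "?lo - 1 \<le> i0" "i0 \<le> ?hi - 2"
    using ks kstar_bounds lon n unfolding i0_def lo hi by auto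
  have Zi: "design n i0 \<le> Z" "Z \<le> design n (i0 + 1)"
  proof -
    show "design n i0 \<le> Z" by (rule design_le_Z) (simp add: i0_def)
    show "Z \<le> design n (i0 + 1)"
    proof (cases "kstar \<le> int n - 1")
      case True
      then show ?thesis using Z_less_design[of "kstar + 1"] by (simp add: i0_def)
    next
      case False
      then have "i0 + 1 = int n" by (simp add: i0_def)
      then show ?thesis using Z_mem n by (simp add: design_eq)
    qed
  qed
  have Z01: "0 \<le> Z" "Z \<le> 1" using Z_mem by auto
  have "h_lower n H y ?lo ?hi i0 \<le> ereal M"
  proof (rule h_lower_le[OF i0 Zi])
    assume nl: "\<not> (?lo = 1 \<and> i0 = 0)"
    have i1: "1 \<le> i0" using nl i0 i0w wp(1) by linarith
    have "?lo - 2 \<le> i0 - 1" using i0w by simp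
    then have "v_left n H y i0 Z \<le> v_left n 0 F i0 Z"
      using i0 i0w i1 by (intro v_left_le Zi yF) auto
    also have "\<dots> \<le> M" using v_left_F_le[of i0 Z] i1 i0 Zi Z01 by (simp add: f_Z)
    finally show "v_left n H y i0 Z \<le> M" .
  next
    assume nr: "\<not> (?hi - 1 = int n \<and> i0 = int n - 1)"
    have hn: "?hi \<le> int n + 1" by (simp add: hi)
    have i2: "i0 + 2 \<le> int n" using nr i0 i0w hn by linarith
    have "v_right n H y i0 Z \<le> v_right n 0 F i0 Z"
      using i0 i0w i2 by (intro v_right_le Zi yF) auto
    also have "\<dots> \<le> M" using v_right_F_le[of i0 Z] i2 i0 Zi Z01 by (simp add: f_Z)
    finally show "v_right n H y i0 Z \<le> M" .
  qed
  moreover have "Min (h_lower n H y ?lo ?hi ` {?lo - 1..?hi - 2}) \<le> h_lower n H y ?lo ?hi i0"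
    using i0w by (intro Min_le) auto
  ultimately have "Min (h_lower n H y ?lo ?hi ` {?lo - 1..?hi - 2}) \<le> ereal M" by (rule order_trans[rotated])
  then show ?thesis unfolding lower_end_def using c by (simp add: H_def y_def min_le_iff_disj)
qed

lemma prob_upper_end:
  assumes jh: "jh \<le> J" and \<alpha>: "0 < \<alpha>" "\<alpha> < 1" and i: "1 \<le> i" "i \<le> num_blocks n (start_level \<alpha> jh)"
  shows "measure (noise_law n) {w\<in>space (noise_law n). \<not> ereal M \<le> upper_end \<alpha> n \<sigma> jh i (observe n \<sigma> f \<kappa> w)} \<le> \<alpha> / 4"
    (is "measure ?P ?E \<le> _")
proof -
  interpret P: prob_space ?P by (rule prob_space_noise_law)
  note wp = window_props[OF jh \<alpha> i]
  let ?l = "end_level \<alpha> n jh" and ?lo = "window_lo \<alpha> n jh i" and ?hi = "window_hi \<alpha> n jh i"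
  let ?W = "{?lo..?hi} \<inter> {1..num_blocks n ?l}"
  let ?S = "S_quantile (window_card \<alpha> n jh i 1) (\<alpha> / 4) * sqrt (real_of_int (block_size n ?l))"
  let ?G = "{w\<in>space ?P. \<forall>b\<in>?W. (-1) * bsum n w ?l b \<le> ?S}"
  have "card ?W \<le> card {?lo..?hi}" by (rule card_mono) auto
  then have "1 - \<alpha> / 4 \<le> measure ?P ?G"
    using wp \<alpha> by (intro prob_bsum_bounded_S_quantile) (auto simp: window_card_def)
  moreover have "?E \<subseteq> space ?P - ?G"
  proof
    fix w assume w: "w \<in> ?E"
    show "w \<in> space ?P - ?G"
    proof (rule ccontr)
      assume "w \<notin> space ?P - ?G"
      then have "\<forall>b\<in>?W. - bsum n w ?l b \<le> ?S" using w by auto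
      then have "ereal M \<le> upper_end \<alpha> n \<sigma> jh i (observe n \<sigma> f \<kappa> w)"
        using wp by (intro upper_end_ge) auto
      then show False using w by simp
    qed
  qed
  moreover have "?G \<in> sets ?P"
  proof (intro sets.sets_Collect_finite_All)
    fix b assume "b \<in> ?W"
    then have [measurable]: "(\<lambda>w. bsum n w ?l b) \<in> borel_measurable ?P" by (intro measurable_bsum) auto
    show "{w \<in> space ?P. (-1) * bsum n w ?l b \<le> ?S} \<in> sets ?P" by measurable
  qed simp
  ultimately show ?thesis
    using P.finite_measure_mono[of ?E "space ?P - ?G"] P.prob_compl[of ?G] by auto
qed

lemma bsum_top: "bsum n w J b = w (b - 1)"
  by (simp add: bsum_def block_def block_size_top)

text \<open>At an intermediate level one good block, supplied by the negation of \<open>bad\<close>,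
  suffices together with a one-sided normal quantile. At the finest level the noise has to be
  bounded from both sides at all points used for extrapolation, which costs \<alpha>/8
  twice.\<close>

lemma prob_lower_end:
  assumes jh: "jh \<le> J" and \<alpha>: "0 < \<alpha>" "\<alpha> < 1" and i: "1 \<le> i" "i \<le> num_blocks n (start_level \<alpha> jh)"
    and near: "\<bar>i - istar (start_level \<alpha> jh)\<bar> \<le> 4"
    and nbad: "int jh + Kt_const (\<alpha> / 4) \<le> int J \<Longrightarrow> \<not> bad (end_level \<alpha> n jh)"
  shows "measure (noise_law n) {w\<in>space (noise_law n). \<not> lower_end \<alpha> n \<sigma> jh i (observe n \<sigma> f \<kappa> w) \<le> ereal M} \<le> \<alpha> / 4"
    (is "measure ?P ?E \<le> _")
proof -
  interpret P: prob_space ?P by (rule prob_space_noise_law)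
  note wp = window_props[OF jh \<alpha> i]
  let ?l = "end_level \<alpha> n jh" and ?lo = "window_lo \<alpha> n jh i" and ?hi = "window_hi \<alpha> n jh i"
  show ?thesis
  proof (cases "int jh + Kt_const (\<alpha> / 4) \<le> int J")
    case True
    then obtain b where b0: "b \<in> {istar ?l - 1..istar ?l + 1}" and b1: "1 \<le> b" "b \<le> num_blocks n ?l"
      "bsum n F ?l b \<le> real_of_int (block_size n ?l) * M + sqrt 3 * \<sigma> * sqrt (real_of_int (block_size n ?l))"
      using nbad unfolding bad_def by (auto simp: not_less)
    have "\<bar>b - istar ?l\<bar> \<le> 1" using b0 by auto
    note b = this b1
    have bw: "b \<in> {?lo..?hi}" by (rule window_contains[OF jh \<alpha> near b(1-3)])
    let ?G = "{w\<in>space ?P. \<forall>c\<in>{b}. 1 * bsum n w ?l c \<le> z_upper (\<alpha> / 4) * sqrt (real_of_int (block_size n ?l))}"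
    have "measure ?P ?G = 1 - \<alpha> / 4"
      using prob_bsum_bounded[of "{b}" n ?l 1 "z_upper (\<alpha> / 4)"] b \<alpha> by (simp add: Phi_z_upper)
    moreover have "?E \<subseteq> space ?P - ?G"
      using lower_end_le_coarse[OF True bw b(2,3,4)] by auto
    moreover have "?G \<in> sets ?P"
    proof -
      have [measurable]: "(\<lambda>w. bsum n w ?l b) \<in> borel_measurable ?P" using b by (intro measurable_bsum) auto
      have "{w\<in>space ?P. bsum n w ?l b \<le> z_upper (\<alpha> / 4) * sqrt (real_of_int (block_size n ?l))} \<in> sets ?P" by measurable
      then show ?thesis by simp
    qed
    ultimately show ?thesis
      using P.finite_measure_mono[of ?E "space ?P - ?G"] P.prob_compl[of ?G] by auto
  next
    case False
    \<comment> \<open>Block \<open>b\<close> at level \<open>J\<close> is the grid point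
      \<open>b - 1\<close>, so these are the grid points from \<open>lo - 2\<close> to
      \<open>hi\<close> inside the sample; their number explains the \<open>+ 3\<close> in the index
      of the quantile.\<close>
    let ?V = "{?lo - 1..?hi + 1} \<inter> {1..num_blocks n J}"
    let ?S = "S_quantile (window_card \<alpha> n jh i 3) (\<alpha> / 8) * sqrt (real_of_int (block_size n J))"
    let ?G1 = "{w\<in>space ?P. \<forall>b\<in>?V. 1 * bsum n w J b \<le> ?S}"
    let ?G2 = "{w\<in>space ?P. \<forall>b\<in>?V. (-1) * bsum n w J b \<le> ?S}"
    have "card ?V \<le> card {?lo - 1..?hi + 1}" by (rule card_mono) auto
    then have cV: "card ?V \<le> window_card \<alpha> n jh i 3" "1 \<le> window_card \<alpha> n jh i 3"
      using wp by (auto simp: window_card_def add.commute)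
    have G: "1 - \<alpha> / 8 \<le> measure ?P ?G1" "1 - \<alpha> / 8 \<le> measure ?P ?G2"
      using cV \<alpha> by (intro prob_bsum_bounded_S_quantile; auto)+
    have m: "?G1 \<in> sets ?P" "?G2 \<in> sets ?P"
    proof -
      have mb: "(\<lambda>w. bsum n w J b) \<in> borel_measurable ?P" if "b \<in> ?V" for b
        using that by (intro measurable_bsum) auto
      show "?G1 \<in> sets ?P"
        by (intro sets.sets_Collect_finite_All) (use mb in \<open>auto intro!: borel_measurable_le\<close>)
      show "?G2 \<in> sets ?P"
        by (intro sets.sets_Collect_finite_All) (use mb in \<open>auto intro!: borel_measurable_le\<close>)
    qed
    have "?E \<subseteq> (space ?P - ?G1) \<union> (space ?P - ?G2)"
    proof
      fix w assume w: "w \<in> ?E"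
      show "w \<in> (space ?P - ?G1) \<union> (space ?P - ?G2)"
      proof (rule ccontr)
        assume "w \<notin> (space ?P - ?G1) \<union> (space ?P - ?G2)"
        then have g: "w \<in> ?G1" "w \<in> ?G2" using w by auto
        have "lower_end \<alpha> n \<sigma> jh i (observe n \<sigma> f \<kappa> w) \<le> ereal M"
        proof (rule lower_end_le_fine[OF jh \<alpha> False i near])
          fix k assume "k \<in> {0..int n}" "?lo - 2 \<le> k" "k \<le> ?hi"
          then have "k + 1 \<in> ?V" by (auto simp: num_blocks_top)
          then have "1 * bsum n w J (k + 1) \<le> ?S" "(-1) * bsum n w J (k + 1) \<le> ?S" using g by blast+
          then show "\<bar>w k\<bar> \<le> S_quantile (window_card \<alpha> n jh i 3) (\<alpha> / 8)"
            by (simp add: bsum_top block_size_top)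
        qed
        then show False using w by simp
      qed
    qed
    then have "measure ?P ?E \<le> measure ?P ((space ?P - ?G1) \<union> (space ?P - ?G2))"
      using m by (intro P.finite_measure_mono) auto
    also have "\<dots> \<le> measure ?P (space ?P - ?G1) + measure ?P (space ?P - ?G2)"
      using m by (intro measure_Un_le) auto
    also have "\<dots> \<le> \<alpha> / 4" using G P.prob_compl[OF m(1)] P.prob_compl[OF m(2)] by simp
    finally show ?thesis .
  qed
qed

end

section \<open>Length of the interval\<close>

lemma nn_integral_abs_std_normal: "(\<integral>\<^sup>+x. ennreal \<bar>x\<bar> \<partial>std_normal_distribution) \<le> 1"
proof -
  have "(\<integral>\<^sup>+x. ennreal \<bar>x\<bar> \<partial>std_normal_distribution) = (\<integral>\<^sup>+x. ennreal (std_normal_density x * \<bar>x\<bar>) \<partial>lborel)"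
    by (subst nn_integral_density) (auto simp: ennreal_mult' intro!: nn_integral_cong)
  also have "\<dots> = ennreal (sqrt (2 / pi))"
    by (subst nn_integral_eq_integral)
       (use integrable_std_normal_moment_abs[of 1] integral_std_normal_moment_abs_odd[of 0] in auto)
  also have "\<dots> \<le> 1" using pi_gt3 by simp
  finally show ?thesis .
qed

lemma nn_integral_sum_abs_noise:
  assumes V: "V \<subseteq> {0..int n}"
  shows "(\<integral>\<^sup>+w. ennreal (\<Sum>k\<in>V. \<bar>w k\<bar>) \<partial>noise_law n) \<le> ennreal (real (card V))"
proof -
  have m: "(\<lambda>w. w k) \<in> noise_law n \<rightarrow>\<^sub>M std_normal_distribution" if "k \<in> V" for k
  proof -
    have "k \<in> {0..int n}" using V that by auto
    then show ?thesis unfolding noise_law_def by (rule measurable_component_singleton)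
  qed
  have "(\<integral>\<^sup>+w. ennreal (\<Sum>k\<in>V. \<bar>w k\<bar>) \<partial>noise_law n) = (\<Sum>k\<in>V. \<integral>\<^sup>+w. ennreal \<bar>w k\<bar> \<partial>noise_law n)"
  proof (subst nn_integral_sum[symmetric])
    show "(\<lambda>w. ennreal \<bar>w k\<bar>) \<in> borel_measurable (noise_law n)" if "k \<in> V" for k
      using measurable_compose[OF m[OF that], of "\<lambda>x. ennreal \<bar>x\<bar>" borel] by simp
  qed (simp add: sum_ennreal)
  also have "\<dots> \<le> (\<Sum>k\<in>V. 1)"
  proof (rule sum_mono)
    fix k assume k: "k \<in> V"
    have kI: "k \<in> {0..int n}" using V k by auto
    have "(\<integral>\<^sup>+w. ennreal \<bar>w k\<bar> \<partial>noise_law n) = (\<integral>\<^sup>+x. ennreal \<bar>x\<bar> \<partial>distr (noise_law n) std_normal_distribution (\<lambda>w. w k))"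
      by (rule nn_integral_distr[symmetric, OF m[OF k]]) auto
    also have "distr (noise_law n) std_normal_distribution (\<lambda>w. w k) = std_normal_distribution"
      unfolding noise_law_def using kI by (intro distr_PiM_component stdN.prob_space_axioms)
    finally show "(\<integral>\<^sup>+w. ennreal \<bar>w k\<bar> \<partial>noise_law n) \<le> 1" using nn_integral_abs_std_normal by simp
  qed
  also have "\<dots> = ennreal (real (card V))" by (simp add: ennreal_of_nat_eq_real_of_nat)
  finally show ?thesis .
qed

text \<open>The exponent bounds \<open>end_level - start_level\<close>, and the 4 accounts for the
  extra block of the window and for the cases \<open>d \<le> 3\<close> of
  \<open>window_card\<close>. The bound is free of the sample size.\<close>

definition max_window :: "real \<Rightarrow> nat" where
  "max_window \<alpha> = 9 * 2 ^ (nat (K_const (\<alpha> / 4)) + 1 + nat (Kt_const (\<alpha> / 4))) + 4"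

text \<open>Summing over all possible window sizes gives a common bound without any monotonicity of
  the quantile in its index.\<close>

definition max_quantile :: "real \<Rightarrow> real" where
  "max_quantile \<alpha> = (\<Sum>k\<le>max_window \<alpha>. \<bar>S_quantile k (\<alpha> / 4)\<bar> + \<bar>S_quantile k (\<alpha> / 8)\<bar>)"

definition length_factor :: "real \<Rightarrow> real" where
  "length_factor \<alpha> = sqrt 3 * sqrt (2 ^ nat (Kt_const (\<alpha> / 4))) *
     (4 * real (max_window \<alpha>) + 4 * max_quantile \<alpha> + \<bar>z_upper (\<alpha> / 4)\<bar> + 1)"

lemma window_card_le:
  assumes jh: "jh \<le> top_level n" and \<alpha>: "0 < \<alpha>" "\<alpha> < 1" and i: "1 \<le> i" "i \<le> num_blocks n (start_level \<alpha> jh)"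
    and d: "d \<le> 3"
  shows "window_card \<alpha> n jh i d \<le> max_window \<alpha>"
proof -
  have "end_level \<alpha> n jh - start_level \<alpha> jh \<le> nat (K_const (\<alpha> / 4)) + 1 + nat (Kt_const (\<alpha> / 4))"
    unfolding end_level_def start_level_def by linarith
  then have "(2::int) ^ (end_level \<alpha> n jh - start_level \<alpha> jh) \<le> 2 ^ (nat (K_const (\<alpha> / 4)) + 1 + nat (Kt_const (\<alpha> / 4)))"
    by (intro power_increasing) auto
  then have "window_hi \<alpha> n jh i - window_lo \<alpha> n jh i + int d \<le> int (max_window \<alpha>)"
    using window_props(6)[OF jh \<alpha> i] d unfolding max_window_def by simp
  then show ?thesis unfolding window_card_def by simp
qed

lemma S_quantile_le:
  assumes "k \<le> max_window \<alpha>"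
  shows "\<bar>S_quantile k (\<alpha> / 4)\<bar> \<le> max_quantile \<alpha>" "\<bar>S_quantile k (\<alpha> / 8)\<bar> \<le> max_quantile \<alpha>"
proof -
  have "\<bar>S_quantile k (\<alpha> / 4)\<bar> + \<bar>S_quantile k (\<alpha> / 8)\<bar> \<le> max_quantile \<alpha>"
    unfolding max_quantile_def using assms
    by (intro member_le_sum[where f="\<lambda>k. \<bar>S_quantile k (\<alpha> / 4)\<bar> + \<bar>S_quantile k (\<alpha> / 8)\<bar>"]) auto
  then show "\<bar>S_quantile k (\<alpha> / 4)\<bar> \<le> max_quantile \<alpha>" "\<bar>S_quantile k (\<alpha> / 8)\<bar> \<le> max_quantile \<alpha>" by auto
qed

lemma max_quantile_nonneg: "0 \<le> max_quantile \<alpha>"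
  unfolding max_quantile_def by (intro sum_nonneg) auto

lemma length_factor_pos: "0 < length_factor \<alpha>"
  unfolding length_factor_def using max_quantile_nonneg[of \<alpha>] by (intro mult_pos_pos) auto

context regression
begin

section \<open>Rates, extrapolation between grid points, and the length for given levels\<close>

definition rate :: "nat \<Rightarrow> real" where
  "rate j = \<sigma> / sqrt (real_of_int (block_size n j))"

lemma rate_pos: "0 < rate j"
  unfolding rate_def using \<sigma> block_size_pos[of n j] by simp

lemma rate_add: "j + d \<le> J \<Longrightarrow> rate (j + d) = sqrt 2 ^ d * rate j"
proof -
  assume "j + d \<le> J"
  then have "real_of_int (block_size n j) = 2 ^ d * real_of_int (block_size n (j + d))" using block_size_add by simp
  then have "sqrt (real_of_int (block_size n j)) = sqrt 2 ^ d * sqrt (real_of_int (block_size n (j + d)))"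
    by (simp add: real_sqrt_mult real_sqrt_power)
  moreover have "0 < sqrt (real_of_int (block_size n (j + d)))" using block_size_pos[of n "j + d"] by simp
  ultimately show ?thesis unfolding rate_def by (simp add: field_simps)
qed

lemma rate_top: "rate J = \<sigma>"
  by (simp add: rate_def block_size_top)

lemma rate_mono: "j \<le> j' \<Longrightarrow> j' \<le> J \<Longrightarrow> rate j \<le> rate j'"
proof -
  assume jj: "j \<le> j'" "j' \<le> J"
  have "1 \<le> sqrt 2 ^ (j' - j)" by (rule one_le_power) simp
  then have "1 * rate j \<le> sqrt 2 ^ (j' - j) * rate j" using rate_pos[of j] by (intro mult_right_mono) auto
  then show ?thesis using rate_add[of j "j' - j"] jj by simp
qed

lemma rate_near_end:
  assumes "j \<le> j'" "j' \<le> J" "j' \<le> j + nat (Kt_const (\<alpha> / 4))"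
  shows "rate j' \<le> sqrt (2 ^ nat (Kt_const (\<alpha> / 4))) * rate j"
proof -
  have "rate j' = sqrt 2 ^ (j' - j) * rate j" using rate_add[of j "j' - j"] assms by simp
  also have "\<dots> \<le> sqrt 2 ^ nat (Kt_const (\<alpha> / 4)) * rate j"
    using assms rate_pos[of j] by (intro mult_right_mono power_increasing) auto
  finally show ?thesis by (simp add: real_sqrt_power)
qed

text \<open>If the extrapolation drops below both grid values of the cell, the grid values decrease
  up to \<open>i\<close> and increase from \<open>i + 1\<close>, so the smaller of the two is the
  minimum over the grid. Then \<open>benchmark_ge_dip\<close> applies and limits the drop to ten
  times the benchmark.\<close>

lemma extrapolation_gap:
  assumes \<alpha>: "\<alpha> < 3 / 10" and B: "benchmark \<alpha> n \<sigma> f \<le> ennreal B" "0 \<le> B" and i: "0 \<le> i" "i < int n"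
    and t: "design n i < t" "t < design n (i + 1)"
    and vl: "i \<ge> 1 \<Longrightarrow> v_left n 0 F i t \<le> w" and vr: "i + 2 \<le> int n \<Longrightarrow> v_right n 0 F i t \<le> w"
  shows "min (F i) (F (i + 1)) - 10 * B \<le> w"
proof (cases "min (F i) (F (i + 1)) \<le> w")
  case False
  let ?m = "min (F i) (F (i + 1))"
  have "?m \<le> F k" if k: "k \<in> {0..int n}" for k
  proof (cases "k \<le> i")
    case True
    have "F i \<le> F k"
    proof (cases "k = i")
      case ki: False
      have "real n * (F i - F (i - 1)) * (t - design n i) + F i < F i"
        using vl True ki k False unfolding v_left_def by auto
      then have "real n * (F i - F (i - 1)) * (t - design n i) < 0" by simp
      then have neg: "F i - F (i - 1) < 0" using t n by (simp add: mult_less_0_iff)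
      have "(F i - F k) / real_of_int (i - k) \<le> (F i - F (i - 1)) / real_of_int (i - (i - 1))"
        unfolding F_def by (rule grid_chord_mono[OF convex_f n]) (use ki True k i in auto)
      then have "(F i - F k) / real_of_int (i - k) < 0" using neg by simp
      then show ?thesis using ki True by (simp add: divide_less_0_iff)
    qed simp
    then show ?thesis by simp
  next
    case ki: False
    have "F (i + 1) \<le> F k"
    proof (cases "k = i + 1")
      case ki1: False
      have "real n * (F (i + 2) - F (i + 1)) * (t - design n (i + 1)) + F (i + 1) < F (i + 1)"
        using vr ki ki1 k False unfolding v_right_def by auto
      then have "real n * (F (i + 2) - F (i + 1)) * (t - design n (i + 1)) < 0" by simp
      then have pos: "0 < F (i + 2) - F (i + 1)" using t n by (auto simp: mult_less_0_iff zero_less_mult_iff)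
      have "(F (i + 2) - F (i + 1)) / real_of_int (i + 2 - (i + 1)) \<le> (F k - F (i + 1)) / real_of_int (k - (i + 1))"
        unfolding F_def by (rule grid_chord_mono[OF convex_f n]) (use ki ki1 k i in auto)
      then have "0 < (F k - F (i + 1)) / real_of_int (k - (i + 1))" using pos by simp
      then show ?thesis using ki ki1 by (simp add: zero_less_divide_iff)
    qed simp
    then show ?thesis by simp
  qed
  then have "ennreal (1 / 10 * (?m - w)) \<le> benchmark \<alpha> n \<sigma> f"
    using False vl vr by (intro benchmark_ge_dip[OF \<alpha> \<sigma> f n i t]) (auto simp: F_fun F_def)
  also note B(1)
  finally show ?thesis using B(2) by simp
qed (use B in simp)

text \<open>With two observations no neighbouring cell constrains the extrapolation, so the dip can
  be made arbitrarily deep. This matches the value \<open>-\<infinity>\<close> of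
  \<open>h_lower\<close>.\<close>

lemma benchmark_two_points:
  assumes \<alpha>: "\<alpha> < 3 / 10" and n1: "n = 1"
  shows "benchmark \<alpha> n \<sigma> f = \<infinity>"
proof (rule ccontr)
  assume "benchmark \<alpha> n \<sigma> f \<noteq> \<infinity>"
  then obtain B where B: "benchmark \<alpha> n \<sigma> f = ennreal B" "0 \<le> B" by (cases "benchmark \<alpha> n \<sigma> f") auto
  have "min (F 0) (F (0 + 1)) - 10 * B \<le> min (F 0) (F (0 + 1)) - 10 * B - 1"
    by (rule extrapolation_gap[OF \<alpha> _ B(2), where t="1/2"]) (use B n1 in \<open>auto simp: design_def\<close>)
  then show False by simp
qed

text \<open>Continuity extends the bound to the ends of the cell. The function \<open>g\<close>
  stands for the line, or the maximum of two lines, that \<open>h_lower\<close> minimizes in the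
  cell; the choice differs at the boundary of the sample.\<close>

lemma extrapolation_gap_closed:
  assumes \<alpha>: "\<alpha> < 3 / 10" and B: "benchmark \<alpha> n \<sigma> f \<le> ennreal B" "0 \<le> B" and i: "0 \<le> i" "i < int n"
    and t: "t \<in> {design n i..design n (i + 1)}" and g: "continuous_on UNIV g"
    and vl: "\<And>t. i \<ge> 1 \<Longrightarrow> v_left n 0 F i t \<le> g t" and vr: "\<And>t. i + 2 \<le> int n \<Longrightarrow> v_right n 0 F i t \<le> g t"
  shows "min (F i) (F (i + 1)) - 10 * B \<le> g t"
proof (rule continuous_ge_on_closure[of "{design n i<..<design n (i + 1)}" g t])
  have "design n i < design n (i + 1)" using n by (simp add: design_less_iff)
  then show "t \<in> closure {design n i<..<design n (i + 1)}" using t by simp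
  show "continuous_on (closure {design n i<..<design n (i + 1)}) g" using g continuous_on_subset by blast
  show "min (F i) (F (i + 1)) - 10 * B \<le> g s" if "s \<in> {design n i<..<design n (i + 1)}" for s
    using that by (intro extrapolation_gap[OF \<alpha> B i _ _ vl vr]) auto
qed

text \<open>Converse of \<open>v_left_le\<close> up to an error: within a cell the slope acts over
  at most one grid step, so slope and height contribute 2 and 1 times
  \<open>E + \<bar>H\<bar>\<close>.\<close>

lemma v_left_ge:
  assumes t: "design n i \<le> t" "t \<le> design n (i + 1)" and "\<bar>y i - g i\<bar> \<le> E" "\<bar>y (i - 1) - g (i - 1)\<bar> \<le> E"
  shows "v_left n 0 g i t - 3 * (E + \<bar>H\<bar>) \<le> v_left n H y i t"
proof -
  define u where "u = real n * (t - design n i)"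
  have "u = real n * t - real_of_int i" using n by (simp add: u_def design_eq right_diff_distrib)
  moreover have "real_of_int i \<le> real n * t" "real n * t \<le> real_of_int i + 1"
    using t n by (simp_all add: design_eq pos_le_divide_eq pos_divide_le_eq mult.commute)
  ultimately have u: "0 \<le> u" "u \<le> 1" by auto
  have "(y i - y (i - 1) - 2 * H - (g i - g (i - 1))) * u \<ge> - (2 * E + 2 * \<bar>H\<bar>)"
  proof -
    have "\<bar>(y i - y (i - 1) - 2 * H - (g i - g (i - 1))) * u\<bar> \<le> (2 * E + 2 * \<bar>H\<bar>) * 1"
      unfolding abs_mult using assms u by (intro mult_mono) auto
    from abs_le_D2[OF this] show ?thesis by (simp only: mult_1_right minus_le_iff)
  qed
  moreover have "y i - H - g i \<ge> - E - \<bar>H\<bar>" using assms by linarith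
  ultimately have "- (2 * E + 2 * \<bar>H\<bar>) + (- E - \<bar>H\<bar>) \<le> (y i - y (i - 1) - 2 * H - (g i - g (i - 1))) * u + (y i - H - g i)" by (rule add_mono)
  also have "\<dots> = v_left n H y i t - v_left n 0 g i t" unfolding v_left_def u_def by (simp add: algebra_simps)
  finally show ?thesis by simp
qed

lemma v_right_ge:
  assumes t: "design n i \<le> t" "t \<le> design n (i + 1)" and "\<bar>y (i + 1) - g (i + 1)\<bar> \<le> E" "\<bar>y (i + 2) - g (i + 2)\<bar> \<le> E"
  shows "v_right n 0 g i t - 3 * (E + \<bar>H\<bar>) \<le> v_right n H y i t"
proof -
  define u where "u = real n * (t - design n (i + 1))"
  have "u = real n * t - (real_of_int i + 1)" using n by (simp add: u_def design_eq right_diff_distrib)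
  moreover have "real_of_int i \<le> real n * t" "real n * t \<le> real_of_int i + 1"
    using t n by (simp_all add: design_eq pos_le_divide_eq pos_divide_le_eq mult.commute)
  ultimately have u: "- 1 \<le> u" "u \<le> 0" by auto
  have "(y (i + 2) - y (i + 1) + 2 * H - (g (i + 2) - g (i + 1))) * u \<ge> - (2 * E + 2 * \<bar>H\<bar>)"
  proof -
    have "\<bar>(y (i + 2) - y (i + 1) + 2 * H - (g (i + 2) - g (i + 1))) * u\<bar> \<le> (2 * E + 2 * \<bar>H\<bar>) * 1"
      unfolding abs_mult using assms u by (intro mult_mono) auto
    from abs_le_D2[OF this] show ?thesis by (simp only: mult_1_right minus_le_iff)
  qed
  moreover have "y (i + 1) - H - g (i + 1) \<ge> - E - \<bar>H\<bar>" using assms by linarith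
  ultimately have "- (2 * E + 2 * \<bar>H\<bar>) + (- E - \<bar>H\<bar>) \<le> (y (i + 2) - y (i + 1) + 2 * H - (g (i + 2) - g (i + 1))) * u + (y (i + 1) - H - g (i + 1))" by (rule add_mono)
  also have "\<dots> = v_right n H y i t - v_right n 0 g i t" unfolding v_right_def u_def by (simp add: algebra_simps)
  finally show ?thesis by simp
qed

lemma h_lower_ge:
  assumes \<alpha>: "\<alpha> < 3 / 10" and B: "benchmark \<alpha> n \<sigma> f \<le> ennreal B" "0 \<le> B" and i: "0 \<le> i" "i < int n"
    and lo: "1 \<le> lo" "lo - 1 \<le> i" and hi: "hi \<le> int n + 1" "i + 2 \<le> hi"
    and y: "\<And>k. k \<in> {0..int n} \<Longrightarrow> lo - 2 \<le> k \<Longrightarrow> k \<le> hi \<Longrightarrow> \<bar>y k - F k\<bar> \<le> E"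
  shows "ereal (min (F i) (F (i + 1)) - 10 * B - 3 * (E + \<bar>H\<bar>)) \<le> h_lower n H y lo hi i"
proof -
  \<comment> \<open>For \<open>n = 1\<close> the benchmark is infinite, against the finite bound
    \<open>B\<close>.\<close>
  have n1: "n \<noteq> 1"
  proof
    assume "n = 1"
    then show False using benchmark_two_points[OF \<alpha>] B(1) by (simp add: top_unique)
  qed
  have cont: "continuous_on UNIV (\<lambda>t. v_left n 0 F i t)" "continuous_on UNIV (\<lambda>t. v_right n 0 F i t)"
    "continuous_on UNIV (\<lambda>t. max (v_left n 0 F i t) (v_right n 0 F i t))"
    unfolding v_left_def v_right_def by (intro continuous_intros)+
  note gap = extrapolation_gap_closed[OF \<alpha> B i]
  have L: "v_left n 0 F i t - 3 * (E + \<bar>H\<bar>) \<le> v_left n H y i t" if "t \<in> {design n i..design n (i + 1)}" "1 \<le> i" for t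
    using that i lo hi by (intro v_left_ge y) auto
  have R: "v_right n 0 F i t - 3 * (E + \<bar>H\<bar>) \<le> v_right n H y i t" if "t \<in> {design n i..design n (i + 1)}" "i + 2 \<le> int n" for t
    using that i lo hi by (intro v_right_ge y) auto
  consider "lo = 1 \<and> i = 0" | "\<not> (lo = 1 \<and> i = 0)" "hi - 1 = int n \<and> i = int n - 1" |
    "\<not> (lo = 1 \<and> i = 0)" "\<not> (hi - 1 = int n \<and> i = int n - 1)" by blast
  then show ?thesis
  proof cases
    case 1
    have i2: "i + 2 \<le> int n" using 1 n n1 by simp
    have "ereal (min (F i) (F (i + 1)) - 10 * B - 3 * (E + \<bar>H\<bar>)) \<le> (INF t\<in>{0..1 / real n}. ereal (v_right n H y 0 t))"
    proof (rule INF_greatest)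
      fix t assume "t \<in> {0..1 / real n}"
      then have t: "t \<in> {design n i..design n (i + 1)}" using 1 by (simp add: design_eq)
      have "min (F i) (F (i + 1)) - 10 * B \<le> v_right n 0 F i t"
        by (rule gap[OF t cont(2)]) (use 1 in auto)
      then show "ereal (min (F i) (F (i + 1)) - 10 * B - 3 * (E + \<bar>H\<bar>)) \<le> ereal (v_right n H y 0 t)"
        using R[OF t i2] 1 by simp
    qed
    then show ?thesis using 1 n1 by (simp add: h_lower_def)
  next
    case 2
    have i1: "1 \<le> i" using 2 i n n1 by simp
    have "ereal (min (F i) (F (i + 1)) - 10 * B - 3 * (E + \<bar>H\<bar>)) \<le>
      (INF t\<in>{(real n - 1) / real n..1}. ereal (v_left n H y (int n - 1) t))"
    proof (rule INF_greatest)
      fix t assume "t \<in> {(real n - 1) / real n..1}"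
      then have t: "t \<in> {design n i..design n (i + 1)}" using 2 n by (simp add: design_eq)
      have "min (F i) (F (i + 1)) - 10 * B \<le> v_left n 0 F i t"
        by (rule gap[OF t cont(1)]) (use 2 in auto)
      then show "ereal (min (F i) (F (i + 1)) - 10 * B - 3 * (E + \<bar>H\<bar>)) \<le> ereal (v_left n H y (int n - 1) t)"
        using L[OF t i1] 2 by simp
    qed
    then show ?thesis using 2 n1 by (auto simp: h_lower_def)
  next
    case 3
    have i1: "1 \<le> i" "i + 2 \<le> int n" using 3 i lo hi by auto
    have "ereal (min (F i) (F (i + 1)) - 10 * B - 3 * (E + \<bar>H\<bar>)) \<le>
      (INF t\<in>{design n i..design n (i + 1)}. ereal (max (v_left n H y i t) (v_right n H y i t)))"
    proof (rule INF_greatest)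
      fix t assume t: "t \<in> {design n i..design n (i + 1)}"
      have "min (F i) (F (i + 1)) - 10 * B \<le> max (v_left n 0 F i t) (v_right n 0 F i t)"
        by (rule gap[OF t cont(3)]) auto
      then have "min (F i) (F (i + 1)) - 10 * B - 3 * (E + \<bar>H\<bar>) \<le> max (v_left n H y i t) (v_right n H y i t)"
        using L[OF t i1(1)] R[OF t i1(2)] unfolding le_max_iff_disj by linarith
      then show "ereal (min (F i) (F (i + 1)) - 10 * B - 3 * (E + \<bar>H\<bar>)) \<le> ereal (max (v_left n H y i t) (v_right n H y i t))"
        by (simp only: ereal_less_eq)
    qed
    then show ?thesis using 3 n1 by (auto simp: h_lower_def)
  qed
qed

text \<open>Both ends are shifts of the same minimal average, so the length is deterministic once
  that average is known to be finite.\<close>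

lemma length_coarse:
  assumes jh: "jh \<le> J" and \<alpha>: "0 < \<alpha>" "\<alpha> < 1" and i: "1 \<le> i" "i \<le> num_blocks n (start_level \<alpha> jh)"
    and c: "int jh + Kt_const (\<alpha> / 4) \<le> int J"
  shows "upper_end \<alpha> n \<sigma> jh i y - lower_end \<alpha> n \<sigma> jh i y \<le> ereal (length_factor \<alpha> * rate jh)"
proof -
  let ?l = "end_level \<alpha> n jh"
  note wp = window_props[OF jh \<alpha> i]
  note lb = level_bounds[OF jh \<alpha>]
  let ?b = "2 ^ (?l - start_level \<alpha> jh) * i"
  have b: "?b \<in> {window_lo \<alpha> n jh i..window_hi \<alpha> n jh i}" "1 \<le> ?b" "?b \<le> num_blocks n ?l" using wp by auto
  define S where "S = S_quantile (window_card \<alpha> n jh i 1) (\<alpha> / 4)"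
  define z where "z = z_upper (\<alpha> / 4)"
  define ns where "ns = noise_scale \<alpha> n \<sigma> jh"
  define q where "q = sqrt (2 ^ nat (Kt_const (\<alpha> / 4)))"
  have "min_average \<alpha> n jh i y < \<infinity>"
    using min_average_le[OF b, of y] by (rule order_le_less_trans) simp
  moreover have "- \<infinity> < min_average \<alpha> n jh i y"
    unfolding min_average_def
    by (subst Min_gr_iff) (use b in \<open>auto simp: scaled_block_sum\<close>)
  ultimately obtain x where x: "min_average \<alpha> n jh i y = ereal x" by (cases "min_average \<alpha> n jh i y") auto
  have "upper_end \<alpha> n \<sigma> jh i y - lower_end \<alpha> n \<sigma> jh i y = ereal ((S + (z + 1)) * ns)"
    unfolding upper_end_def lower_end_def x S_def z_def ns_def using c by (simp add: algebra_simps)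
  also have "\<dots> \<le> ereal (length_factor \<alpha> * rate jh)"
  proof -
    have ns: "ns = sqrt 3 * rate ?l" unfolding ns_def noise_scale_eq rate_def by simp
    have Sle: "\<bar>S\<bar> \<le> max_quantile \<alpha>" unfolding S_def by (intro S_quantile_le window_card_le[OF jh \<alpha> i]) simp
    have r: "rate ?l \<le> q * rate jh"
      unfolding q_def using lb c by (intro rate_near_end) (auto simp: end_level_def)
    have "(S + (z + 1)) * ns \<le> (4 * real (max_window \<alpha>) + 4 * max_quantile \<alpha> + \<bar>z\<bar> + 1) * (sqrt 3 * (q * rate jh))"
      unfolding ns using Sle r rate_pos[of ?l] max_quantile_nonneg[of \<alpha>] by (intro mult_mono) auto
    also have "\<dots> = length_factor \<alpha> * rate jh" unfolding length_factor_def z_def q_def by (simp add: mult_ac)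
    finally show ?thesis by simp
  qed
  finally show ?thesis .
qed

text \<open>In every cell the smaller of the two grid values bounds the upper end from above and the
  entry of the cell in the lower end from below, up to noise and \<open>10 * B\<close>. It cancels
  cell by cell, so the unknown minimum of \<open>f\<close> does not enter.\<close>

lemma length_fine:
  assumes jh: "jh \<le> J" and \<alpha>: "0 < \<alpha>" "\<alpha> < 3 / 10" and i: "1 \<le> i" "i \<le> num_blocks n (start_level \<alpha> jh)"
    and c: "\<not> int jh + Kt_const (\<alpha> / 4) \<le> int J" and B: "benchmark \<alpha> n \<sigma> f \<le> ennreal B" "0 \<le> B"
  defines "V \<equiv> {window_lo \<alpha> n jh i - 2..window_hi \<alpha> n jh i} \<inter> {0..int n}"
  shows "upper_end \<alpha> n \<sigma> jh i (observe n \<sigma> f \<kappa> w) - lower_end \<alpha> n \<sigma> jh i (observe n \<sigma> f \<kappa> w) \<le>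
    ereal (10 * B + 4 * (sqrt 3 * \<sigma> * (\<Sum>k\<in>V. \<bar>w k\<bar>)) + 4 * max_quantile \<alpha> * (sqrt 3 * \<sigma>))"
proof -
  have \<alpha>1: "\<alpha> < 1" using \<alpha> by simp
  let ?lo = "window_lo \<alpha> n jh i" and ?hi = "window_hi \<alpha> n jh i"
  have eJ: "end_level \<alpha> n jh = J" using c by (simp add: end_level_def)
  define y where "y = observe n \<sigma> f \<kappa> w"
  define E where "E = sqrt 3 * \<sigma> * (\<Sum>k\<in>V. \<bar>w k\<bar>)"
  define H where "H = fine_margin \<alpha> n \<sigma> jh i"
  define S where "S = S_quantile (window_card \<alpha> n jh i 1) (\<alpha> / 4)"
  define R where "R = 10 * B + 4 * E + 4 * max_quantile \<alpha> * (sqrt 3 * \<sigma>)"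
  have E0: "0 \<le> E" unfolding E_def using \<sigma> by (intro mult_nonneg_nonneg sum_nonneg) auto
  have R0: "0 \<le> R" unfolding R_def using E0 B \<sigma> max_quantile_nonneg[of \<alpha>] by simp
  have yF: "\<bar>y k - F k\<bar> \<le> E" if "k \<in> {0..int n}" "?lo - 2 \<le> k" "k \<le> ?hi" for k
  proof -
    have "\<bar>y k - F k\<bar> = sqrt 3 * \<sigma> * \<bar>w k\<bar>" using that(1) \<sigma> by (simp add: y_def observe_def F_def abs_mult)
    also have "\<dots> \<le> sqrt 3 * \<sigma> * (\<Sum>k\<in>V. \<bar>w k\<bar>)"
      using that \<sigma> by (intro mult_left_mono member_le_sum) (auto simp: V_def)
    finally show ?thesis by (simp add: E_def)
  qed
  note wp = window_props[OF jh \<alpha>(1) \<alpha>1 i, unfolded eJ num_blocks_top]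
  have hi: "?hi \<le> int n + 1"
    using ceiling_of_nat[of "n + 1", where 'a=real] by (simp add: window_hi_def eJ)
  have lohi: "?lo \<le> ?hi" using wp by linarith
  have ns: "noise_scale \<alpha> n \<sigma> jh = sqrt 3 * \<sigma>" by (simp add: noise_scale_eq eJ block_size_top)
  have H_le: "\<bar>H\<bar> \<le> max_quantile \<alpha> * (sqrt 3 * \<sigma>)"
  proof -
    have "\<bar>H\<bar> = \<bar>S_quantile (window_card \<alpha> n jh i 3) (\<alpha> / 8)\<bar> * (sqrt 3 * \<sigma>)"
      using \<sigma> by (simp add: H_def fine_margin_def abs_mult)
    also have "\<dots> \<le> max_quantile \<alpha> * (sqrt 3 * \<sigma>)"
      using \<sigma> by (intro mult_right_mono S_quantile_le window_card_le[OF jh \<alpha>(1) \<alpha>1 i]) auto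
    finally show ?thesis .
  qed
  have S_le: "S * (sqrt 3 * \<sigma>) \<le> max_quantile \<alpha> * (sqrt 3 * \<sigma>)"
  proof (rule mult_right_mono)
    have "\<bar>S\<bar> \<le> max_quantile \<alpha>" unfolding S_def by (intro S_quantile_le window_card_le[OF jh \<alpha>(1) \<alpha>1 i]) simp
    then show "S \<le> max_quantile \<alpha>" by simp
  qed (use \<sigma> in simp)
  have up: "upper_end \<alpha> n \<sigma> jh i y \<le> ereal (F (b - 1) + E + S * (sqrt 3 * \<sigma>))" if b: "?lo \<le> b" "b \<le> ?hi" "b \<le> int n + 1" for b
  proof -
    have b1: "1 \<le> b" using b wp by linarith
    have "min_average \<alpha> n jh i y \<le> ereal (y (b - 1))"
      using min_average_le[of b \<alpha> jh i y] b b1 by (simp add: eJ num_blocks_top bsum_top block_size_top)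
    also have "y (b - 1) \<le> F (b - 1) + E" using yF[of "b - 1"] b b1 by auto
    finally have "min_average \<alpha> n jh i y \<le> ereal (F (b - 1) + E)" by simp
    then have "min_average \<alpha> n jh i y + ereal (S * (sqrt 3 * \<sigma>)) \<le> ereal (F (b - 1) + E) + ereal (S * (sqrt 3 * \<sigma>))"
      by (rule add_right_mono)
    then show ?thesis unfolding upper_end_def S_def[symmetric] ns by simp
  qed
  have h: "upper_end \<alpha> n \<sigma> jh i y - ereal R \<le> h_lower n H y ?lo ?hi k" if k: "k \<in> {?lo - 1..?hi - 2}" for k
  proof -
    have k0: "0 \<le> k" "k < int n" using k wp hi by auto
    have "upper_end \<alpha> n \<sigma> jh i y \<le> ereal (min (F k) (F (k + 1)) + E + S * (sqrt 3 * \<sigma>))"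
      using up[of "k + 1"] up[of "k + 2"] k k0 by (auto simp: min_def add.commute)
    then have "upper_end \<alpha> n \<sigma> jh i y - ereal R \<le> ereal (min (F k) (F (k + 1)) + E + S * (sqrt 3 * \<sigma>)) - ereal R"
      by (rule ereal_minus_mono) simp
    also have "\<dots> \<le> ereal (min (F k) (F (k + 1)) - 10 * B - 3 * (E + \<bar>H\<bar>))"
    proof -
      define P where "P = max_quantile \<alpha> * (sqrt 3 * \<sigma>)"
      define Q where "Q = S * (sqrt 3 * \<sigma>)"
      have "R = 10 * B + 4 * E + 4 * P" "\<bar>H\<bar> \<le> P" "Q \<le> P"
        using H_le S_le by (simp_all only: R_def P_def Q_def mult.assoc)
      then show ?thesis unfolding Q_def[symmetric] by simp
    qed
    also have "\<dots> \<le> h_lower n H y ?lo ?hi k"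
      by (rule h_lower_ge[OF \<alpha>(2) B k0]) (use k wp hi yF in auto)
    finally show ?thesis .
  qed
  have ne: "{?lo - 1..?hi - 2} \<noteq> {}"
  proof -
    \<comment> \<open>The window contains at least two grid points, so the minimum over cells is not
      taken over an empty set.\<close>
    have "?lo + 1 \<le> ?hi"
    proof -
      define e x :: int where "e = 2 ^ (J - start_level \<alpha> jh)" and "x = e * i"
      have x: "1 \<le> e" "1 \<le> x" "x \<le> int n + 1" using wp by (auto simp: e_def x_def)
      have "e * (i - 5) = x - 5 * e" "e * (i + 4) = x + 4 * e" by (simp_all add: x_def algebra_simps)
      moreover have "\<lceil>real (n + 1) / 2 ^ (J - J)\<rceil> = int n + 1" using ceiling_of_nat[of "n + 1", where 'a=real] by simp
      ultimately have "?lo = max 1 (x - 5 * e)" "?hi = min (x + 4 * e + 1) (int n + 1)"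
        by (simp_all only: window_lo_def window_hi_def eJ e_def)
      then show ?thesis using x n by (auto simp: max_def min_def)
    qed
    then show ?thesis by simp
  qed
  have "upper_end \<alpha> n \<sigma> jh i y - ereal R \<le> Min (h_lower n H y ?lo ?hi ` {?lo - 1..?hi - 2})"
    using h ne by (subst Min_ge_iff) auto
  moreover have upR: "upper_end \<alpha> n \<sigma> jh i y - ereal R \<le> upper_end \<alpha> n \<sigma> jh i y"
    using R0 by (cases "upper_end \<alpha> n \<sigma> jh i y") auto
  ultimately have "upper_end \<alpha> n \<sigma> jh i y - ereal R \<le> lower_end \<alpha> n \<sigma> jh i y"
    unfolding lower_end_def H_def using c by simp
  moreover have "\<bar>upper_end \<alpha> n \<sigma> jh i y\<bar> \<noteq> \<infinity>"
  proof -
    have "upper_end \<alpha> n \<sigma> jh i y < \<infinity>" using up[of ?lo] lohi hi by (auto intro: order_le_less_trans)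
    moreover have "- \<infinity> < min_average \<alpha> n jh i y"
      unfolding min_average_def
    proof (subst Min_gr_iff)
      show "(\<lambda>k. ereal (1 / 2 ^ (J - end_level \<alpha> n jh)) * block_sum n y (end_level \<alpha> n jh) k) ` {?lo..?hi} \<noteq> {}"
        using lohi by simp
    qed (auto simp: scaled_block_sum)
    then have "- \<infinity> < upper_end \<alpha> n \<sigma> jh i y"
      unfolding upper_end_def by (cases "min_average \<alpha> n jh i y") auto
    ultimately show ?thesis by auto
  qed
  ultimately have "upper_end \<alpha> n \<sigma> jh i y - lower_end \<alpha> n \<sigma> jh i y \<le> ereal R"
    by (cases "upper_end \<alpha> n \<sigma> jh i y"; cases "lower_end \<alpha> n \<sigma> jh i y") auto
  then show ?thesis unfolding R_def y_def E_def .
qed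

lemma expected_length_given_levels:
  assumes jh: "jh \<le> J" and \<alpha>: "0 < \<alpha>" "\<alpha> < 3 / 10" and i: "1 \<le> i" "i \<le> num_blocks n (start_level \<alpha> jh)"
    and B: "benchmark \<alpha> n \<sigma> f \<le> ennreal B" "0 \<le> B"
  shows "(\<integral>\<^sup>+w. e2ennreal (upper_end \<alpha> n \<sigma> jh i (observe n \<sigma> f \<kappa> w) - lower_end \<alpha> n \<sigma> jh i (observe n \<sigma> f \<kappa> w)) \<partial>noise_law n)
    \<le> ennreal (10 * B + length_factor \<alpha> * rate jh)"
proof -
  interpret P: prob_space "noise_law n" by (rule prob_space_noise_law)
  have \<alpha>1: "\<alpha> < 1" using \<alpha> by simp
  have lr: "0 \<le> length_factor \<alpha> * rate jh" using length_factor_pos[of \<alpha>] rate_pos[of jh] by simp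
  show ?thesis
  proof (cases "int jh + Kt_const (\<alpha> / 4) \<le> int J")
    case True
    have "(\<integral>\<^sup>+w. e2ennreal (upper_end \<alpha> n \<sigma> jh i (observe n \<sigma> f \<kappa> w) - lower_end \<alpha> n \<sigma> jh i (observe n \<sigma> f \<kappa> w)) \<partial>noise_law n)
      \<le> (\<integral>\<^sup>+w. ennreal (length_factor \<alpha> * rate jh) \<partial>noise_law n)"
      using e2ennreal_mono[OF length_coarse[OF jh \<alpha>(1) \<alpha>1 i True]] by (intro nn_integral_mono) (simp add: e2ennreal_ereal)
    also have "\<dots> = ennreal (length_factor \<alpha> * rate jh)" by (simp add: P.emeasure_space_1)
    also have "\<dots> \<le> ennreal (10 * B + length_factor \<alpha> * rate jh)" using B by (intro ennreal_leI) simp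
    finally show ?thesis .
  next
    case False
    let ?V = "{window_lo \<alpha> n jh i - 2..window_hi \<alpha> n jh i} \<inter> {0..int n}"
    let ?a = "4 * (sqrt 3 * \<sigma>)" and ?b = "10 * B + 4 * max_quantile \<alpha> * (sqrt 3 * \<sigma>)"
    have ab: "0 \<le> ?a" "0 \<le> ?b" using \<sigma> B max_quantile_nonneg[of \<alpha>] by auto
    have "(\<integral>\<^sup>+w. e2ennreal (upper_end \<alpha> n \<sigma> jh i (observe n \<sigma> f \<kappa> w) - lower_end \<alpha> n \<sigma> jh i (observe n \<sigma> f \<kappa> w)) \<partial>noise_law n)
      \<le> (\<integral>\<^sup>+w. ennreal ?b + ennreal ?a * ennreal (\<Sum>k\<in>?V. \<bar>w k\<bar>) \<partial>noise_law n)"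
    proof (rule nn_integral_mono)
      fix w :: "int \<Rightarrow> real"
      have s: "0 \<le> (\<Sum>k\<in>?V. \<bar>w k\<bar>)" by (intro sum_nonneg) auto
      have "e2ennreal (upper_end \<alpha> n \<sigma> jh i (observe n \<sigma> f \<kappa> w) - lower_end \<alpha> n \<sigma> jh i (observe n \<sigma> f \<kappa> w))
        \<le> e2ennreal (ereal (10 * B + 4 * (sqrt 3 * \<sigma> * (\<Sum>k\<in>?V. \<bar>w k\<bar>)) + 4 * max_quantile \<alpha> * (sqrt 3 * \<sigma>)))"
        by (rule e2ennreal_mono[OF length_fine[OF jh \<alpha> i False B]])
      also have "\<dots> = ennreal (?b + ?a * (\<Sum>k\<in>?V. \<bar>w k\<bar>))" by (simp add: e2ennreal_ereal algebra_simps)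
      also have "\<dots> = ennreal ?b + ennreal ?a * ennreal (\<Sum>k\<in>?V. \<bar>w k\<bar>)"
        using ab s by (simp add: ennreal_plus ennreal_mult' del: ennreal_plus[symmetric])
      finally show "e2ennreal (upper_end \<alpha> n \<sigma> jh i (observe n \<sigma> f \<kappa> w) - lower_end \<alpha> n \<sigma> jh i (observe n \<sigma> f \<kappa> w)) \<le> \<dots>" .
    qed
    also have "\<dots> = ennreal ?b + ennreal ?a * (\<integral>\<^sup>+w. ennreal (\<Sum>k\<in>?V. \<bar>w k\<bar>) \<partial>noise_law n)"
    proof -
      have mk: "(\<lambda>w. w k) \<in> borel_measurable (noise_law n)" if "k \<in> ?V" for k
      proof -
        have "k \<in> {0..int n}" using that by simp
        then show ?thesis by measurable
      qed
      have [measurable]: "(\<lambda>w. \<Sum>k\<in>?V. \<bar>w k\<bar>) \<in> borel_measurable (noise_law n)"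
        by (intro borel_measurable_sum borel_measurable_abs mk)
      show ?thesis by (subst nn_integral_add) (auto simp: nn_integral_cmult P.emeasure_space_1)
    qed
    also have "\<dots> \<le> ennreal ?b + ennreal ?a * ennreal (real (card ?V))"
      by (intro add_left_mono mult_left_mono nn_integral_sum_abs_noise) auto
    also have "\<dots> = ennreal (?b + ?a * real (card ?V))" using ab by (simp add: ennreal_plus ennreal_mult' del: ennreal_plus[symmetric])
    also have "\<dots> \<le> ennreal (10 * B + length_factor \<alpha> * rate jh)"
    proof (rule ennreal_leI)
      have "card ?V \<le> card {window_lo \<alpha> n jh i - 2..window_hi \<alpha> n jh i}" by (rule card_mono) auto
      also have "\<dots> = window_card \<alpha> n jh i 3" by (simp add: window_card_def algebra_simps)
      also have "\<dots> \<le> max_window \<alpha>" by (rule window_card_le[OF jh \<alpha>(1) \<alpha>1 i]) simp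
      finally have V: "real (card ?V) \<le> real (max_window \<alpha>)" by simp
      \<comment> \<open>In this case \<open>J\<close> lies fewer than
        \<open>Kt_const (\<alpha> / 4)\<close> levels beyond \<open>jh\<close>, and
        \<open>rate J = \<sigma>\<close>.\<close>
      have \<sigma>r: "\<sigma> \<le> sqrt (2 ^ nat (Kt_const (\<alpha> / 4))) * rate jh"
        using rate_near_end[of jh J \<alpha>] jh False rate_top by auto
      have "?a * real (card ?V) + 4 * max_quantile \<alpha> * (sqrt 3 * \<sigma>) \<le> sqrt 3 * \<sigma> * (4 * real (max_window \<alpha>) + 4 * max_quantile \<alpha>)"
        using V \<sigma> by (simp add: algebra_simps mult_left_mono)
      also have "\<dots> \<le> (sqrt 3 * (sqrt (2 ^ nat (Kt_const (\<alpha> / 4))) * rate jh)) * (4 * real (max_window \<alpha>) + 4 * max_quantile \<alpha> + \<bar>z_upper (\<alpha> / 4)\<bar> + 1)"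
        using \<sigma>r \<sigma> max_quantile_nonneg[of \<alpha>] rate_pos[of jh] by (intro mult_mono) auto
      also have "\<dots> = length_factor \<alpha> * rate jh" unfolding length_factor_def by (simp add: mult_ac)
      finally show "?b + ?a * real (card ?V) \<le> 10 * B + length_factor \<alpha> * rate jh" by simp
    qed
    finally show ?thesis .
  qed
qed

end

section \<open>The stopping level and the benchmark\<close>

context regression
begin

text \<open>At a sparse level the minimum can be raised by a multiple of the rate without the data
  noticing; at a level that is not sparse the function is so flat near the minimizer that the
  procedure stops with probability at least \<open>1/2\<close>.\<close>

definition sparse :: "nat \<Rightarrow> bool" where
  "sparse j \<longleftrightarrow> real (card {k\<in>{0..int n}. F k < M + rate j / 64}) \<le> 40 * real_of_int (block_size n j)"

lemma sparse_0: "sparse 0"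
proof -
  have "card {k\<in>{0..int n}. F k < M + rate 0 / 64} \<le> card {0..int n}" by (rule card_mono) auto
  then have "real (card {k\<in>{0..int n}. F k < M + rate 0 / 64}) \<le> real (n + 1)" by simp
  also have "real (n + 1) \<le> 40 * real_of_int (block_size n 0)"
    using block_size_0_bounds(2)[of n] by linarith
  finally show ?thesis unfolding sparse_def .
qed

lemma rate_sq: "real_of_int (block_size n j) * (rate j)\<^sup>2 = \<sigma>\<^sup>2"
  unfolding rate_def using block_size_pos[of n j] by (simp add: power_divide)

text \<open>The constants 40 and 64 of \<open>sparse\<close> are matched here: 40/4096 is at most
  1/100, as raising the minimum by \<open>rate j / 64\<close> requires, and 320 = 5 * 64.\<close>

lemma sparse_benchmark:
  assumes \<alpha>: "\<alpha> < 3 / 10" and j: "sparse j"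
  shows "ennreal (rate j / 320) \<le> benchmark \<alpha> n \<sigma> f"
proof -
  have "real (card {k\<in>{0..int n}. F k < M + rate j / 64}) * (rate j / 64)\<^sup>2 \<le> 40 * real_of_int (block_size n j) * (rate j / 64)\<^sup>2"
    using j unfolding sparse_def by (intro mult_right_mono) auto
  also have "\<dots> = 40 / 4096 * (real_of_int (block_size n j) * (rate j)\<^sup>2)" by (simp add: power_divide)
  also have "\<dots> \<le> \<sigma>\<^sup>2 / 100" unfolding rate_sq by simp
  finally show ?thesis
    using benchmark_ge_raise[OF \<alpha> \<sigma> f, of "rate j / 64" n] rate_pos[of j] by (simp add: F_def)
qed

text \<open>By pigeonhole, more than \<open>40 * m\<close> points of a sublevel set reach about
  \<open>20 * m\<close> away from \<open>kstar\<close> on one side, and monotonicity on that side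
  fills the gap.\<close>

lemma not_sparse_flat:
  assumes "\<not> sparse j"
  defines "m \<equiv> block_size n j"
  shows "(kstar + 20 * m \<le> int n \<and> (\<forall>k. kstar < k \<longrightarrow> k \<le> kstar + 20 * m \<longrightarrow> F k \<le> M + rate j / 64)) \<or>
    (0 \<le> kstar - 20 * m + 1 \<and> (\<forall>k. kstar - 20 * m < k \<longrightarrow> k \<le> kstar \<longrightarrow> F k \<le> M + rate j / 64))"
proof -
  let ?A = "{k\<in>{0..int n}. F k < M + rate j / 64}"
  have m: "0 < m" unfolding m_def by (rule block_size_pos)
  have "40 * real_of_int m < real (card ?A)" using assms by (simp add: sparse_def)
  then have A: "40 * m < int (card ?A)" by linarith
  consider (right) k where "k \<in> ?A" "kstar + 20 * m \<le> k" | (left) k where "k \<in> ?A" "k \<le> kstar - 20 * m + 1"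
  proof (rule ccontr)
    assume na: "\<not> thesis"
    have "?A \<subseteq> {kstar - 20 * m + 2..kstar + 20 * m - 1}"
    proof
      fix k assume k: "k \<in> ?A"
      show "k \<in> {kstar - 20 * m + 2..kstar + 20 * m - 1}"
        using na that(1)[OF k] that(2)[OF k] by fastforce
    qed
    then have "card ?A \<le> card {kstar - 20 * m + 2..kstar + 20 * m - 1}" by (intro card_mono) auto
    then show False using A m by simp
  qed
  then show ?thesis
  proof cases
    case right
    have "F k' \<le> M + rate j / 64" if "kstar < k'" "k' \<le> kstar + 20 * m" for k'
      using F_mono_right[of k' k] that right by auto
    then show ?thesis using right by auto
  next
    case left
    have "F k' \<le> M + rate j / 64" if "kstar - 20 * m < k'" "k' \<le> kstar" for k'
      using F_mono_left[of k k'] that left by auto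
    then show ?thesis using left by auto
  qed
qed

text \<open>Either the localized block is at least 7 blocks off in the flat direction, and the pair
  facing the minimizer has a nonpositive drift, or the pair in the flat direction ends within 13
  blocks of \<open>kstar\<close>, inside the 20 flat ones. There a shift by one block raises
  \<open>F\<close> by at most \<open>rate j1 / 64\<close>, and not at all while both points are
  still on the descending side.\<close>

lemma flat_side:
  assumes ns: "\<not> sparse j1" and j: "j1 \<le> j" "j \<le> J"
  obtains s where "s \<in> {-1, 1}" "1 \<le> loc_index n y j + 6 * s" "loc_index n y j + 6 * s \<le> num_blocks n j"
    "bsum n F j (loc_index n y j + 6 * s) - bsum n F j (loc_index n y j + 5 * s) \<le> 2 * sigma_level n \<sigma> j"
proof -
  note result = that
  let ?loc = "loc_index n y j"
  define m where "m = block_size n j"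
  have m: "0 < m" unfolding m_def by (rule block_size_pos)
  have mm: "m \<le> block_size n j1"
    using block_size_add[of j1 "j - j1" n] j block_size_pos[of n j] by (simp add: m_def)
  have loc: "1 \<le> ?loc" "?loc \<le> num_blocks n j" using loc_index_bounds[OF j(2), of y] by auto
  have ib: "(istar j - 1) * m \<le> kstar" "kstar < istar j * m" using istar_bounds[of j] by (auto simp: m_def)
  have ib': "istar j * m \<le> kstar + m" using ib by (simp add: algebra_simps)
  have small: "real_of_int m * (rate j1 / 64) \<le> 2 * sigma_level n \<sigma> j"
  proof -
    have "real_of_int m * rate j1 \<le> real_of_int m * rate j" using rate_mono[OF j] m by (intro mult_left_mono) auto
    also have "\<dots> = \<sigma> * sqrt (real_of_int m)"
    proof -
      have "real_of_int m / sqrt (real_of_int m) = sqrt (real_of_int m)" using m by (intro real_div_sqrt) auto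
      then show ?thesis unfolding rate_def m_def[symmetric] by (metis mult.commute times_divide_eq_right)
    qed
    also have "\<dots> \<le> sigma_level n \<sigma> j"
    proof -
      have "1 * (\<sigma> * (1 * sqrt (real_of_int m))) \<le> sqrt 3 * (\<sigma> * (sqrt 2 * sqrt (real_of_int m)))"
        using \<sigma> m by (intro mult_mono) auto
      then show ?thesis unfolding sigma_level_eq[OF \<sigma>] m_def[symmetric] real_sqrt_mult by (simp add: mult.assoc)
    qed
    finally have "real_of_int m * rate j1 \<le> sigma_level n \<sigma> j" .
    moreover have "0 \<le> real_of_int m * rate j1" using m rate_pos[of j1] by simp
    ultimately show ?thesis by simp
  qed
  have misplaced: thesis if "istar j + 7 \<le> ?loc \<or> ?loc + 7 \<le> istar j"
  proof -
    note ms = misplaced_side[OF j(2) that]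
    show thesis
      by (rule result[of "if istar j + 7 \<le> ?loc then -1 else 1"]) (use ms sigma_level_pos[of j] in auto)
  qed
  have finish: thesis if s: "s \<in> {-1, 1}" "1 \<le> ?loc + 6 * s" "?loc + 6 * s \<le> num_blocks n j"
    and inc: "\<And>k. k \<in> block n j (?loc + 5 * s) \<Longrightarrow> F (k + s * m) - F k \<le> rate j1 / 64" for s
  proof (rule result[OF s])
    have "bsum n F j (?loc + 6 * s) - bsum n F j (?loc + 5 * s) =
      (\<Sum>k\<in>block n j (?loc + 5 * s). F (k + (?loc + 6 * s - (?loc + 5 * s)) * block_size n j) - F k)"
      by (rule bsum_diff_shift)
    also have "\<dots> \<le> (\<Sum>k\<in>block n j (?loc + 5 * s). rate j1 / 64)"
      by (rule sum_mono) (use inc in \<open>simp add: m_def\<close>)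
    also have "\<dots> = real_of_int m * (rate j1 / 64)" using m by (simp add: card_block m_def[symmetric])
    also note small
    finally show "bsum n F j (?loc + 6 * s) - bsum n F j (?loc + 5 * s) \<le> 2 * sigma_level n \<sigma> j" .
  qed
  have r0: "0 \<le> rate j1 / 64" using rate_pos[of j1] by simp
  from not_sparse_flat[OF ns] show thesis
  proof
    assume R: "kstar + 20 * block_size n j1 \<le> int n \<and>
      (\<forall>k. kstar < k \<longrightarrow> k \<le> kstar + 20 * block_size n j1 \<longrightarrow> F k \<le> M + rate j1 / 64)"
    show thesis
    proof (cases "istar j + 7 \<le> ?loc")
      case False
      have "(?loc + 6) * m \<le> (istar j + 12) * m" using False m by (intro mult_right_mono) auto
      then have top: "(?loc + 6) * m \<le> kstar + 13 * m" using ib' by (simp add: algebra_simps)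
      have N: "?loc + 6 \<le> num_blocks n j" unfolding le_num_blocks_iff m_def[symmetric] using top R mm m by linarith
      show thesis
      proof (rule finish[of 1])
        fix k assume k: "k \<in> block n j (?loc + 5 * 1)"
        have k': "k + m \<le> (?loc + 6) * m - 1" "(?loc + 4) * m \<le> k" using k by (auto simp: block_def m_def[symmetric] algebra_simps)
        have "0 \<le> (?loc + 4) * m" using loc m by simp
        then have k0: "0 \<le> k" using k' by linarith
        have kn: "k + m \<le> int n" using k' top R mm m by linarith
        show "F (k + 1 * m) - F k \<le> rate j1 / 64"
        proof (cases "k + m \<le> kstar")
          case True
          then show ?thesis using F_mono_left[of k "k + m"] k0 m r0 by simp
        next
          case False
          have "k + m \<le> kstar + 20 * block_size n j1" using k' top mm m by linarith
          then have "F (k + m) \<le> M + rate j1 / 64" using R False by auto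
          moreover have "M \<le> F k" using k0 kn m by (intro M_le_F) auto
          ultimately show ?thesis by simp
        qed
      qed (use N loc in auto)
    qed (use misplaced in blast)
  next
    assume L: "0 \<le> kstar - 20 * block_size n j1 + 1 \<and>
      (\<forall>k. kstar - 20 * block_size n j1 < k \<longrightarrow> k \<le> kstar \<longrightarrow> F k \<le> M + rate j1 / 64)"
    show thesis
    proof (cases "?loc + 7 \<le> istar j")
      case False
      have "(istar j - 13) * m \<le> (?loc - 7) * m" using False m by (intro mult_right_mono) auto
      moreover have "(istar j - 13) * m = istar j * m - 13 * m" by (simp add: algebra_simps)
      ultimately have bot: "kstar - 13 * m < (?loc - 7) * m" using ib by linarith
      have "0 < (?loc - 7) * m" using bot L mm m by linarith
      then have N: "8 \<le> ?loc" using m by (simp add: zero_less_mult_iff)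
      have locn: "?loc * m \<le> int n + 1" using loc(2) unfolding le_num_blocks_iff m_def[symmetric] .
      show thesis
      proof (rule finish[of "-1"])
        fix k assume k: "k \<in> block n j (?loc + 5 * -1)"
        have k': "(?loc - 7) * m \<le> k - m" "k \<le> (?loc - 5) * m - 1" using k by (auto simp: block_def m_def[symmetric] algebra_simps)
        have "(?loc - 5) * m \<le> ?loc * m" using m by (intro mult_right_mono) auto
        then have kn: "k \<le> int n" using k' locn by linarith
        have k0: "0 < k - m" using k' \<open>0 < (?loc - 7) * m\<close> by linarith
        show "F (k + - 1 * m) - F k \<le> rate j1 / 64"
        proof (cases "kstar < k - m")
          case True
          then show ?thesis using F_mono_right[of "k - m" k] kn m r0 by simp
        next
          case False
          have "kstar - 20 * block_size n j1 < k - m" using k' bot mm m by linarith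
          then have "F (k - m) \<le> M + rate j1 / 64" using L False by auto
          moreover have "M \<le> F k" using k0 kn m by (intro M_le_F) auto
          ultimately show ?thesis by simp
        qed
      qed (use N loc in auto)
    qed (use misplaced in blast)
  qed
qed

lemma measurable_stop_level_observe:
  "(\<lambda>w. stop_level n \<sigma> yl (observe n \<sigma> f \<kappa> w)) \<in> noise_law n \<rightarrow>\<^sub>M count_space UNIV"
  by (rule measurable_stop_level) (simp_all add: measurable_observe)

text \<open>On the side given by \<open>flat_side\<close> the drift does not exceed the threshold,
  so for fixed \<open>yl\<close> each miss has probability at most \<open>Phi 0 = 1 / 2\<close>,
  independently over levels.\<close>

lemma prob_stop_level_gt:
  assumes ns: "\<not> sparse j1" and j: "j1 \<le> j" "j \<le> J"
  shows "measure (noise_law n) {w\<in>space (noise_law n). j < stop_level n \<sigma> yl (observe n \<sigma> f \<kappa> w)} \<le> (1 / 2) ^ (j - j1 + 1)"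
proof -
  interpret P: prob_space "noise_law n" by (rule prob_space_noise_law)
  have "\<exists>s. s \<in> {-1, 1} \<and> 1 \<le> loc_index n yl i + 6 * s \<and> loc_index n yl i + 6 * s \<le> num_blocks n i \<and>
    bsum n F i (loc_index n yl i + 6 * s) - bsum n F i (loc_index n yl i + 5 * s) \<le> 2 * sigma_level n \<sigma> i" if "i \<in> {j1..j}" for i
  proof -
    have i: "j1 \<le> i" "i \<le> J" using that j by auto
    show ?thesis by (rule flat_side[OF ns i, of yl]) blast
  qed
  then obtain s where s: "\<And>i. i \<in> {j1..j} \<Longrightarrow> s i \<in> {-1, 1} \<and> 1 \<le> loc_index n yl i + 6 * s i \<and> loc_index n yl i + 6 * s i \<le> num_blocks n i \<and>
    bsum n F i (loc_index n yl i + 6 * s i) - bsum n F i (loc_index n yl i + 5 * s i) \<le> 2 * sigma_level n \<sigma> i" by metis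
  let ?G = "{w\<in>space (noise_law n). \<forall>i\<in>{j1..j}. \<not> T_stat n yl (observe n \<sigma> f \<kappa> w) i \<le> ereal (2 * sigma_level n \<sigma> i)}"
  have "?G \<in> sets (noise_law n)"
  proof (intro sets.sets_Collect_finite_All)
    fix i
    have "(\<lambda>w. T_stat n yl (observe n \<sigma> f \<kappa> w) i) \<in> borel_measurable (noise_law n)"
      by (rule measurable_T_stat) (simp_all add: measurable_observe)
    then show "{w \<in> space (noise_law n). \<not> T_stat n yl (observe n \<sigma> f \<kappa> w) i \<le> ereal (2 * sigma_level n \<sigma> i)} \<in> sets (noise_law n)"
      by measurable
  qed auto
  moreover have "{w\<in>space (noise_law n). j < stop_level n \<sigma> yl (observe n \<sigma> f \<kappa> w)} \<subseteq> ?G"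
    using less_stop_levelD by fastforce
  ultimately have "measure (noise_law n) {w\<in>space (noise_law n). j < stop_level n \<sigma> yl (observe n \<sigma> f \<kappa> w)} \<le> measure (noise_law n) ?G"
    by (intro P.finite_measure_mono)
  also have "\<dots> \<le> Phi (2 - 2) ^ card {j1..j}"
    by (rule prob_all_T_stat_gt[OF \<sigma>, where s=s]) (use s j in \<open>auto simp: F_fun\<close>)
  also have "\<dots> = (1 / 2) ^ (j - j1 + 1)" using j by (simp add: Phi_0 Suc_diff_le)
  finally show ?thesis .
qed

text \<open>The rate grows by \<open>sqrt 2\<close> per level while the bound on the survival
  probability halves. Since \<open>sqrt 2 / 2 \<le> 3 / 4\<close>, the sum is dominated by a
  geometric series of value 3, which together with the first term gives 4.\<close>

lemma expected_rate_not_sparse: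
  assumes ns: "\<not> sparse j1" and j1: "j1 \<le> J"
  shows "(\<integral>\<^sup>+w. ennreal (rate (stop_level n \<sigma> yl (observe n \<sigma> f \<kappa> w))) \<partial>noise_law n) \<le> ennreal (4 * rate j1)"
proof -
  interpret P: prob_space "noise_law n" by (rule prob_space_noise_law)
  let ?st = "\<lambda>w. stop_level n \<sigma> yl (observe n \<sigma> f \<kappa> w)"
  let ?A = "\<lambda>j. {w\<in>space (noise_law n). j < ?st w}"
  have A: "?A j \<in> sets (noise_law n)" for j
    using measurable_stop_level_observe[of yl \<kappa>] by measurable
  have "(\<integral>\<^sup>+w. ennreal (rate (?st w)) \<partial>noise_law n) \<le>
    (\<integral>\<^sup>+w. ennreal (rate j1) + (\<Sum>j\<in>{j1..<J}. ennreal (rate (Suc j)) * indicator (?A j) w) \<partial>noise_law n)"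
  proof (rule nn_integral_mono)
    fix w assume w: "w \<in> space (noise_law n)"
    have J: "?st w \<le> J" by (rule stop_level_le)
    show "ennreal (rate (?st w)) \<le> ennreal (rate j1) + (\<Sum>j\<in>{j1..<J}. ennreal (rate (Suc j)) * indicator (?A j) w)"
    proof (cases "?st w \<le> j1")
      case True
      then have "ennreal (rate (?st w)) \<le> ennreal (rate j1)" using j1 by (intro ennreal_leI rate_mono)
      then show ?thesis by (rule add_increasing2[rotated]) simp
    next
      case False
      then obtain j where j: "?st w = Suc j" "j1 \<le> j" by (cases "?st w") auto
      have "ennreal (rate (Suc j)) * indicator (?A j) w \<le> (\<Sum>j\<in>{j1..<J}. ennreal (rate (Suc j)) * indicator (?A j) w)"
        by (rule member_le_sum) (use j J in auto)
      then show ?thesis using j w by (intro add_increasing) auto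
    qed
  qed
  also have "\<dots> = ennreal (rate j1) + (\<Sum>j\<in>{j1..<J}. ennreal (rate (Suc j)) * emeasure (noise_law n) (?A j))"
  proof -
    have "(\<integral>\<^sup>+w. (\<Sum>j\<in>{j1..<J}. ennreal (rate (Suc j)) * indicator (?A j) w) \<partial>noise_law n) =
      (\<Sum>j\<in>{j1..<J}. ennreal (rate (Suc j)) * emeasure (noise_law n) (?A j))"
      using A by (subst nn_integral_sum) (auto intro!: sum.cong nn_integral_cmult_indicator)
    moreover have "(\<lambda>w. \<Sum>j\<in>{j1..<J}. ennreal (rate (Suc j)) * indicator (?A j) w) \<in> borel_measurable (noise_law n)"
      using A by (intro borel_measurable_sum borel_measurable_times_ennreal borel_measurable_indicator) auto
    ultimately show ?thesis by (subst nn_integral_add) (auto simp: P.emeasure_space_1)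
  qed
  also have "\<dots> \<le> ennreal (rate j1) + (\<Sum>j\<in>{j1..<J}. ennreal (rate j1 * (3 / 4) ^ (j - j1 + 1)))"
  proof (intro add_left_mono sum_mono)
    fix j assume j: "j \<in> {j1..<J}"
    have "ennreal (rate (Suc j)) * emeasure (noise_law n) (?A j) \<le> ennreal (rate (Suc j)) * ennreal ((1 / 2) ^ (j - j1 + 1))"
      unfolding P.emeasure_eq_measure using prob_stop_level_gt[OF ns, of j yl \<kappa>] j
      by (intro mult_left_mono ennreal_leI) auto
    also have "\<dots> = ennreal (rate (Suc j) * (1 / 2) ^ (j - j1 + 1))" using rate_pos[of "Suc j"] by (intro ennreal_mult'[symmetric]) auto
    also have "\<dots> \<le> ennreal (rate j1 * (3 / 4) ^ (j - j1 + 1))"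
    proof (rule ennreal_leI)
      have "rate (Suc j) = sqrt 2 ^ (j - j1 + 1) * rate j1" using rate_add[of j1 "j - j1 + 1"] j by simp
      then have "rate (Suc j) * (1 / 2) ^ (j - j1 + 1) = rate j1 * (sqrt 2 * (1 / 2)) ^ (j - j1 + 1)"
        by (simp only: power_mult_distrib mult_ac)
      also have "\<dots> \<le> rate j1 * (3 / 4) ^ (j - j1 + 1)"
      proof (intro mult_left_mono power_mono)
        have "sqrt 2 \<le> 3 / 2" by (rule real_le_lsqrt) (auto simp: power2_eq_square)
        then show "sqrt 2 * (1 / 2) \<le> (3 / 4 :: real)" by simp
      qed (use rate_pos[of j1] in auto)
      finally show "rate (Suc j) * (1 / 2) ^ (j - j1 + 1) \<le> rate j1 * (3 / 4) ^ (j - j1 + 1)" .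
    qed
    finally show "ennreal (rate (Suc j)) * emeasure (noise_law n) (?A j) \<le> ennreal (rate j1 * (3 / 4) ^ (j - j1 + 1))" .
  qed
  also have "\<dots> = ennreal (rate j1 + (\<Sum>j\<in>{j1..<J}. rate j1 * (3 / 4) ^ (j - j1 + 1)))"
    using rate_pos[of j1] by (simp add: sum_ennreal sum_nonneg ennreal_plus[symmetric] del: ennreal_plus)
  also have "\<dots> \<le> ennreal (4 * rate j1)"
  proof (rule ennreal_leI)
    have geo: "(\<Sum>j\<in>{j1..<j1 + d}. (3 / 4 :: real) ^ (j - j1 + 1)) = 3 - 3 * (3 / 4) ^ d" for d
      by (induction d) auto
    have "(\<Sum>j\<in>{j1..<J}. (3 / 4 :: real) ^ (j - j1 + 1)) \<le> 3" using geo[of "J - j1"] j1 by simp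
    then have "rate j1 * (\<Sum>j\<in>{j1..<J}. (3 / 4) ^ (j - j1 + 1)) \<le> rate j1 * 3"
      using rate_pos[of j1] by (intro mult_left_mono) auto
    then show "rate j1 + (\<Sum>j\<in>{j1..<J}. rate j1 * (3 / 4) ^ (j - j1 + 1)) \<le> 4 * rate j1"
      by (simp add: sum_distrib_left)
  qed
  finally show ?thesis .
qed

text \<open>The level before the first one that is not sparse is sparse, and its rate is smaller by
  \<open>sqrt 2 \<le> 2\<close> only, so the constant is 4 * 2 * 320 = 2560. Level 0 is always
  sparse, and if all levels are sparse, the rate at \<open>J\<close> is the bound.\<close>

lemma expected_rate_le_benchmark:
  assumes \<alpha>: "\<alpha> < 3 / 10"
  shows "(\<integral>\<^sup>+w. ennreal (rate (stop_level n \<sigma> yl (observe n \<sigma> f \<kappa> w))) \<partial>noise_law n) \<le> 2560 * benchmark \<alpha> n \<sigma> f"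
proof -
  interpret P: prob_space "noise_law n" by (rule prob_space_noise_law)
  have "\<exists>j0. sparse j0 \<and> (\<integral>\<^sup>+w. ennreal (rate (stop_level n \<sigma> yl (observe n \<sigma> f \<kappa> w))) \<partial>noise_law n) \<le> ennreal (8 * rate j0)"
  proof (cases "\<forall>j\<le>J. sparse j")
    case True
    have "(\<integral>\<^sup>+w. ennreal (rate (stop_level n \<sigma> yl (observe n \<sigma> f \<kappa> w))) \<partial>noise_law n) \<le> (\<integral>\<^sup>+w. ennreal (8 * rate J) \<partial>noise_law n)"
    proof (intro nn_integral_mono ennreal_leI)
      fix w
      have "rate (stop_level n \<sigma> yl (observe n \<sigma> f \<kappa> w)) \<le> rate J" by (intro rate_mono stop_level_le) simp
      then show "rate (stop_level n \<sigma> yl (observe n \<sigma> f \<kappa> w)) \<le> 8 * rate J" using rate_pos[of J] by simp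
    qed
    also have "\<dots> = ennreal (8 * rate J)" by (simp add: P.emeasure_space_1)
    finally show ?thesis using True by blast
  next
    case False
    define j1 where "j1 = (LEAST j. \<not> sparse j)"
    from False obtain j where j: "\<not> sparse j" "j \<le> J" by blast
    have ns: "\<not> sparse j1" unfolding j1_def by (rule LeastI) (rule j(1))
    have j1J: "j1 \<le> J" using Least_le[of "\<lambda>j. \<not> sparse j" j] j by (simp add: j1_def)
    have "j1 \<noteq> 0" using ns sparse_0 by metis
    then obtain j0 where j0: "j1 = Suc j0" by (cases j1) auto
    have s0: "sparse j0" using not_less_Least[of j0 "\<lambda>j. \<not> sparse j"] j0 by (simp add: j1_def)
    have "rate j1 \<le> 2 * rate j0"
    proof -
      have "rate j1 = sqrt 2 * rate j0" using rate_add[of j0 1] j0 j1J by simp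
      moreover have "sqrt 2 \<le> (2::real)" by (rule real_le_lsqrt) auto
      ultimately show ?thesis using rate_pos[of j0] by (simp add: mult_right_mono)
    qed
    then have "ennreal (4 * rate j1) \<le> ennreal (8 * rate j0)" by (intro ennreal_leI) simp
    then show ?thesis using expected_rate_not_sparse[OF ns j1J, of yl \<kappa>] s0 by (meson order_trans)
  qed
  then obtain j0 where j0: "sparse j0" "(\<integral>\<^sup>+w. ennreal (rate (stop_level n \<sigma> yl (observe n \<sigma> f \<kappa> w))) \<partial>noise_law n) \<le> ennreal (8 * rate j0)" by blast
  note j0(2)
  also have "ennreal (8 * rate j0) = 2560 * ennreal (rate j0 / 320)"
    using rate_pos[of j0] by (simp add: ennreal_mult'[symmetric] ennreal_numeral[symmetric] del: ennreal_numeral)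
  also have "\<dots> \<le> 2560 * benchmark \<alpha> n \<sigma> f" by (intro mult_left_mono sparse_benchmark[OF \<alpha> j0(1)]) simp
  finally show ?thesis .
qed

end

section \<open>Coverage and expected length\<close>

text \<open>Outside \<open>I\<close> the evaluation is constantly \<open>undefined\<close> on the
  space, hence measurable as well; the construction does read such indices.\<close>

lemma measurable_component_any:
  assumes "sets M = sets (PiM I (\<lambda>_. borel))"
  shows "(\<lambda>x. x k) \<in> borel_measurable M"
proof (cases "k \<in> I")
  case True
  have "(\<lambda>x. x k) \<in> borel_measurable (PiM I (\<lambda>_. borel))" using True by measurable
  then show ?thesis by (simp only: measurable_cong_sets[OF assms refl])
next
  case False
  have sp: "space M = PiE I (\<lambda>_. UNIV)" using sets_eq_imp_space_eq[OF assms] by (simp add: space_PiM)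
  have "(\<lambda>x. undefined) \<in> borel_measurable M" by simp
  moreover have "x k = undefined" if "x \<in> space M" for x using that False unfolding sp by (auto simp: PiE_def extensional_def)
  ultimately show ?thesis by (subst measurable_cong[of M _ "\<lambda>_. undefined"]) auto
qed

lemma measurable_copies:
  shows "(\<lambda>\<omega>. copy_l \<sigma> (fst \<omega>) (fst (snd \<omega>)) (snd (snd \<omega>)) k) \<in> borel_measurable (joint_law n \<sigma> f)"
    and "(\<lambda>\<omega>. copy_s \<sigma> (fst \<omega>) (fst (snd \<omega>)) (snd (snd \<omega>)) k) \<in> borel_measurable (joint_law n \<sigma> f)"
    and "(\<lambda>\<omega>. copy_e \<sigma> (fst \<omega>) (fst (snd \<omega>)) k) \<in> borel_measurable (joint_law n \<sigma> f)"
proof -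
  have y: "(\<lambda>x. x k) \<in> borel_measurable (data_law n \<sigma> f)" by (rule measurable_component_any[OF sets_data_law])
  have z: "(\<lambda>x. x k) \<in> borel_measurable (noise_law n)" by (rule measurable_component_any[OF sets_noise_law])
  have [measurable]: "(\<lambda>\<omega>. fst \<omega> k) \<in> borel_measurable (joint_law n \<sigma> f)"
    "(\<lambda>\<omega>. fst (snd \<omega>) k) \<in> borel_measurable (joint_law n \<sigma> f)"
    "(\<lambda>\<omega>. snd (snd \<omega>) k) \<in> borel_measurable (joint_law n \<sigma> f)"
    unfolding joint_law_def
    by (rule measurable_compose[OF _ y] measurable_compose[OF _ z]; measurable)+
  show "(\<lambda>\<omega>. copy_l \<sigma> (fst \<omega>) (fst (snd \<omega>)) (snd (snd \<omega>)) k) \<in> borel_measurable (joint_law n \<sigma> f)"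
    "(\<lambda>\<omega>. copy_s \<sigma> (fst \<omega>) (fst (snd \<omega>)) (snd (snd \<omega>)) k) \<in> borel_measurable (joint_law n \<sigma> f)"
    "(\<lambda>\<omega>. copy_e \<sigma> (fst \<omega>) (fst (snd \<omega>)) k) \<in> borel_measurable (joint_law n \<sigma> f)"
    unfolding copy_l_def copy_s_def copy_e_def by measurable
qed

text \<open>If \<open>a > b\<close>, the interval is empty and any bound holds, so the order of the
  endpoints need not be known.\<close>

lemma emeasure_ereal_interval_le:
  "emeasure lborel {x. a \<le> ereal x \<and> ereal x \<le> b} \<le> e2ennreal (b - a)"
proof (cases "\<exists>x. a \<le> ereal x \<and> ereal x \<le> b")
  case False
  then have "{x. a \<le> ereal x \<and> ereal x \<le> b} = {}" by blast
  then show ?thesis by (simp only: emeasure_empty) simp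
next
  case True
  then obtain x where x: "a \<le> ereal x" "ereal x \<le> b" by blast
  show ?thesis
  proof (cases "a = - \<infinity> \<or> b = \<infinity>")
    case True
    then have "b - a = \<infinity>" using x by (cases a; cases b) auto
    then show ?thesis by simp
  next
    case False
    then obtain r s where rs: "a = ereal r" "b = ereal s" using x by (cases a; cases b) auto
    then have "{x. a \<le> ereal x \<and> ereal x \<le> b} = {r..s}" by auto
    moreover have "r \<le> s" using x rs by simp
    ultimately show ?thesis using rs by (simp add: e2ennreal_ereal)
  qed
qed

lemma is_interval_ereal: "is_interval {x :: real. a \<le> ereal x \<and> ereal x \<le> b}"
  unfolding is_interval_1
proof safe
  fix c d x :: real assume *: "a \<le> ereal c" "ereal d \<le> b" "c \<le> x" "x \<le> d"
  show "a \<le> ereal x" using * by (meson ereal_less_eq(3) order_trans)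
  show "ereal x \<le> b" using * by (meson ereal_less_eq(3) order_trans)
qed

lemma nn_integral_pred:
  assumes "Measurable.pred M Q"
  shows "(\<integral>\<^sup>+x. (if Q x then 1 else 0) \<partial>M) = emeasure M {x\<in>space M. Q x}"
proof -
  have "(\<integral>\<^sup>+x. (if Q x then 1 else 0) \<partial>M) = (\<integral>\<^sup>+x. indicator {x\<in>space M. Q x} x \<partial>M)"
    by (intro nn_integral_cong) (auto simp: indicator_def)
  then show ?thesis using assms by (simp add: pred_def)
qed

context regression
begin

lemma measurable_joint_endpoints:
  "(\<lambda>\<omega>. CI_endpoints \<alpha> n \<sigma> (copy_l \<sigma> (fst \<omega>) (fst (snd \<omega>)) (snd (snd \<omega>)))
     (copy_s \<sigma> (fst \<omega>) (fst (snd \<omega>)) (snd (snd \<omega>))) (copy_e \<sigma> (fst \<omega>) (fst (snd \<omega>)))) \<in> borel_measurable (joint_law n \<sigma> f)"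
  by (intro measurable_CI_endpoints n measurable_copies)

lemma measurable_observe_endpoints:
  "(\<lambda>\<omega>. CI_endpoints \<alpha> n \<sigma> (observe n \<sigma> f \<kappa>l (fst \<omega>)) (observe n \<sigma> f \<kappa>s (fst (snd \<omega>))) (observe n \<sigma> f \<kappa>e (snd (snd \<omega>))))
    \<in> borel_measurable (noise_law n \<Otimes>\<^sub>M (noise_law n \<Otimes>\<^sub>M noise_law n))"
  by (intro measurable_CI_endpoints n; rule measurable_compose[OF _ measurable_observe]; measurable)

text \<open>Transfers any functional of the endpoints to three independent noise vectors. The
  out-of-range constants are obtained existentially because the estimates hold for every choice of
  them.\<close>

lemma nn_integral_endpoints:
  fixes G :: "ereal \<times> ereal \<Rightarrow> ennreal"
  assumes G: "G \<in> borel_measurable borel"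
  obtains \<kappa>l \<kappa>s \<kappa>e where
    "(\<integral>\<^sup>+\<omega>. G (CI_endpoints \<alpha> n \<sigma> (copy_l \<sigma> (fst \<omega>) (fst (snd \<omega>)) (snd (snd \<omega>)))
     (copy_s \<sigma> (fst \<omega>) (fst (snd \<omega>)) (snd (snd \<omega>))) (copy_e \<sigma> (fst \<omega>) (fst (snd \<omega>)))) \<partial>joint_law n \<sigma> f) =
     (\<integral>\<^sup>+a. \<integral>\<^sup>+b. \<integral>\<^sup>+c. G (CI_endpoints \<alpha> n \<sigma> (observe n \<sigma> f \<kappa>l a) (observe n \<sigma> f \<kappa>s b) (observe n \<sigma> f \<kappa>e c))
       \<partial>noise_law n \<partial>noise_law n \<partial>noise_law n)"
proof -
  let ?G = "\<lambda>yl ys ye. G (CI_endpoints \<alpha> n \<sigma> yl ys ye)"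
  note result = that
  show thesis
    by (rule result, subst nn_integral_joint_law[OF n, of ?G, unfolded split_def, symmetric])
       (use measurable_compose[OF measurable_joint_endpoints G] measurable_compose[OF measurable_observe_endpoints G]
        in \<open>simp_all add: split_def\<close>)
qed

lemma start_index_bounds:
  assumes \<alpha>: "0 < \<alpha>" "\<alpha> < 1"
  shows "1 \<le> start_index \<alpha> n \<sigma> yl ys" "start_index \<alpha> n \<sigma> yl ys \<le> num_blocks n (start_level \<alpha> (stop_level n \<sigma> yl ys))"
proof -
  have "start_level \<alpha> (stop_level n \<sigma> yl ys) \<le> J"
    using level_bounds[OF stop_level_le \<alpha>, of n \<sigma> yl ys] stop_level_le[of n \<sigma> yl ys] by linarith
  then show "1 \<le> start_index \<alpha> n \<sigma> yl ys" "start_index \<alpha> n \<sigma> yl ys \<le> num_blocks n (start_level \<alpha> (stop_level n \<sigma> yl ys))"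
    using loc_index_bounds unfolding start_index_def by auto
qed

definition misses :: "ereal \<times> ereal \<Rightarrow> ennreal" where
  "misses e = (if fst e \<le> ereal M \<and> ereal M \<le> snd e then 0 else 1)"

lemma measurable_misses: "misses \<in> borel_measurable borel"
  unfolding misses_def[abs_def] borel_prod[symmetric] by measurable

definition wrong_start :: "real \<Rightarrow> (int \<Rightarrow> real) \<Rightarrow> (int \<Rightarrow> real) \<Rightarrow> bool" where
  "wrong_start \<alpha> yl ys \<longleftrightarrow> 5 \<le> \<bar>start_index \<alpha> n \<sigma> yl ys - istar (start_level \<alpha> (stop_level n \<sigma> yl ys))\<bar>"

definition early_stop :: "real \<Rightarrow> (int \<Rightarrow> real) \<Rightarrow> (int \<Rightarrow> real) \<Rightarrow> bool" where
  "early_stop \<alpha> yl ys \<longleftrightarrow> int (stop_level n \<sigma> yl ys) + Kt_const (\<alpha> / 4) \<le> int J \<and> bad (end_level \<alpha> n (stop_level n \<sigma> yl ys))"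

text \<open>For fixed first two copies, if neither the start nor the stop is wrong, only the noise
  of the third copy can cause a failure, with \<alpha>/4 for each end; otherwise the trivial bound 1
  is charged to the two error indicators.\<close>

lemma nn_integral_misses_inner:
  assumes \<alpha>: "0 < \<alpha>" "\<alpha> < 1"
  shows "(\<integral>\<^sup>+c. misses (CI_endpoints \<alpha> n \<sigma> yl ys (observe n \<sigma> f \<kappa> c)) \<partial>noise_law n) \<le>
    ennreal (\<alpha> / 2) + (if wrong_start \<alpha> yl ys then 1 else 0) + (if early_stop \<alpha> yl ys then 1 else 0)"
proof -
  interpret P: prob_space "noise_law n" by (rule prob_space_noise_law)
  show ?thesis
  proof (cases "wrong_start \<alpha> yl ys \<or> early_stop \<alpha> yl ys")
    case True
    have "(\<integral>\<^sup>+c. misses (CI_endpoints \<alpha> n \<sigma> yl ys (observe n \<sigma> f \<kappa> c)) \<partial>noise_law n) \<le> (\<integral>\<^sup>+c. 1 \<partial>noise_law n)"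
      by (intro nn_integral_mono) (simp add: misses_def)
    also have "\<dots> = 1" by (simp add: P.emeasure_space_1)
    also have "\<dots> \<le> ennreal (\<alpha> / 2) + (if wrong_start \<alpha> yl ys then 1 else 0) + (if early_stop \<alpha> yl ys then 1 else 0)"
      using True by (auto intro: add_increasing add_increasing2)
    finally show ?thesis .
  next
    case False
    let ?jh = "stop_level n \<sigma> yl ys" and ?i = "start_index \<alpha> n \<sigma> yl ys"
    let ?lo = "\<lambda>c. lower_end \<alpha> n \<sigma> ?jh ?i (observe n \<sigma> f \<kappa> c)" and ?hi = "\<lambda>c. upper_end \<alpha> n \<sigma> ?jh ?i (observe n \<sigma> f \<kappa> c)"
    let ?A = "{c\<in>space (noise_law n). \<not> ereal M \<le> ?hi c}" and ?B = "{c\<in>space (noise_law n). \<not> ?lo c \<le> ereal M}"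
    have A: "measure (noise_law n) ?A \<le> \<alpha> / 4"
      by (rule prob_upper_end[OF stop_level_le \<alpha> start_index_bounds[OF \<alpha>]])
    have B: "measure (noise_law n) ?B \<le> \<alpha> / 4"
      by (rule prob_lower_end[OF stop_level_le \<alpha> start_index_bounds[OF \<alpha>]])
         (use False in \<open>auto simp: wrong_start_def early_stop_def\<close>)
    have [measurable]: "?hi \<in> borel_measurable (noise_law n)" "?lo \<in> borel_measurable (noise_law n)"
      by (intro measurable_upper_end measurable_lower_end n measurable_observe)+
    have m: "?A \<in> sets (noise_law n)" "?B \<in> sets (noise_law n)" by measurable
    have "(\<integral>\<^sup>+c. misses (CI_endpoints \<alpha> n \<sigma> yl ys (observe n \<sigma> f \<kappa> c)) \<partial>noise_law n) \<le>
      (\<integral>\<^sup>+c. indicator ?A c + indicator ?B c \<partial>noise_law n)"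
      by (intro nn_integral_mono) (auto simp: misses_def CI_endpoints_eq indicator_def)
    also have "\<dots> = emeasure (noise_law n) ?A + emeasure (noise_law n) ?B"
      using m by (subst nn_integral_add) auto
    also have "\<dots> \<le> ennreal (\<alpha> / 4) + ennreal (\<alpha> / 4)"
      unfolding P.emeasure_eq_measure using A B by (intro add_mono ennreal_leI)
    also have "\<dots> = ennreal (\<alpha> / 2)" using \<alpha> by (subst ennreal_plus[symmetric]) auto
    finally show ?thesis using False by simp
  qed
qed

lemma measurable_levels_pred:
  "Measurable.pred (noise_law n) (\<lambda>b. Q (stop_level n \<sigma> yl (observe n \<sigma> f \<kappa> b)) (start_index \<alpha> n \<sigma> yl (observe n \<sigma> f \<kappa> b)))"
proof -
  have si: "(\<lambda>b. start_index \<alpha> n \<sigma> yl (observe n \<sigma> f \<kappa> b)) \<in> noise_law n \<rightarrow>\<^sub>M count_space UNIV"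
    by (rule measurable_start_index) (simp_all add: measurable_observe)
  have "Measurable.pred (noise_law n) (\<lambda>b. Q j (start_index \<alpha> n \<sigma> yl (observe n \<sigma> f \<kappa> b)))" for j
    using measurable_compose[OF si, of "Q j" "count_space UNIV"] by simp
  from measurable_compose_countable[OF this measurable_stop_level_observe] show ?thesis .
qed

lemma coverage_integral:
  assumes \<alpha>: "0 < \<alpha>" "\<alpha> < 1"
  shows "(\<integral>\<^sup>+a. \<integral>\<^sup>+b. \<integral>\<^sup>+c. misses (CI_endpoints \<alpha> n \<sigma> (observe n \<sigma> f \<kappa>l a) (observe n \<sigma> f \<kappa>s b) (observe n \<sigma> f \<kappa>e c))
       \<partial>noise_law n \<partial>noise_law n \<partial>noise_law n) \<le> ennreal \<alpha>"
proof -
  let ?P = "noise_law n"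
  interpret P: prob_space ?P by (rule prob_space_noise_law)
  \<comment> \<open>An early stop at \<open>j\<close> makes the estimation level
    \<open>j + Kt\<close> bad, hence at most \<open>l0\<close>, so \<open>j\<close> is coarse
    relative to this one deterministic level. The default 0 is harmless because every use is guarded
    by \<open>bad l0\<close>.\<close>
  define l0 where "l0 = (if \<exists>l\<le>J. bad l then Max {l. l \<le> J \<and> bad l} else 0)"
  have l0: "bad l0 \<and> l0 \<le> J \<and> l \<le> l0" if "bad l" "l \<le> J" for l
  proof -
    have "Max {l. l \<le> J \<and> bad l} \<in> {l. l \<le> J \<and> bad l}" using that by (intro Max_in) auto
    moreover have "l \<le> Max {l. l \<le> J \<and> bad l}" using that by (intro Max_ge) auto
    ultimately show ?thesis using that by (auto simp: l0_def)
  qed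
  define mis where "mis a \<longleftrightarrow> bad l0 \<and> l0 \<le> J \<and> (\<exists>j\<in>coarse \<alpha> l0. 2 \<le> \<bar>loc_index n (observe n \<sigma> f \<kappa>l a) j - istar j\<bar>)" for a
  have early: "bad l0 \<and> l0 \<le> J \<and> stop_level n \<sigma> yl ys \<in> coarse \<alpha> l0" if "early_stop \<alpha> yl ys" for yl ys
  proof -
    have e: "bad (end_level \<alpha> n (stop_level n \<sigma> yl ys))" "int (end_level \<alpha> n (stop_level n \<sigma> yl ys)) = int (stop_level n \<sigma> yl ys) + Kt_const (\<alpha> / 4)"
      using that by (auto simp: early_stop_def end_level_def Kt_const_def)
    from l0[OF e(1) level_bounds(3)[OF stop_level_le \<alpha>]] show ?thesis using e(2) by (simp add: coarse_def)
  qed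
  have middle: "(\<integral>\<^sup>+b. \<integral>\<^sup>+c. misses (CI_endpoints \<alpha> n \<sigma> (observe n \<sigma> f \<kappa>l a) (observe n \<sigma> f \<kappa>s b) (observe n \<sigma> f \<kappa>e c)) \<partial>?P \<partial>?P)
    \<le> ennreal (3 / 4 * \<alpha> + \<alpha> / 16) + (if mis a then 1 else 0)" for a
  proof -
    let ?yl = "observe n \<sigma> f \<kappa>l a" and ?ys = "observe n \<sigma> f \<kappa>s"
    have m1: "Measurable.pred ?P (\<lambda>b. wrong_start \<alpha> ?yl (?ys b))"
      unfolding wrong_start_def
      using measurable_levels_pred[of "\<lambda>j i. 5 \<le> \<bar>i - istar (start_level \<alpha> j)\<bar>"] by simp
    have m2: "Measurable.pred ?P (\<lambda>b. early_stop \<alpha> ?yl (?ys b))"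
      unfolding early_stop_def
      using measurable_levels_pred[of "\<lambda>j i. int j + Kt_const (\<alpha> / 4) \<le> int J \<and> bad (end_level \<alpha> n j)"] by simp
    have w: "emeasure ?P {b\<in>space ?P. wrong_start \<alpha> ?yl (?ys b)} \<le> ennreal (\<alpha> / 4)"
      unfolding P.emeasure_eq_measure wrong_start_def by (intro ennreal_leI prob_start_misplaced \<alpha>)
    have e: "emeasure ?P {b\<in>space ?P. early_stop \<alpha> ?yl (?ys b)} \<le> ennreal (\<alpha> / 16) + (if mis a then 1 else 0)"
    proof (cases "mis a \<or> \<not> (bad l0 \<and> l0 \<le> J)")
      case True
      then show ?thesis
      proof
        assume "mis a"
        then show ?thesis using P.emeasure_le_1 by (auto intro: add_increasing)
      next
        assume "\<not> (bad l0 \<and> l0 \<le> J)"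
        then have "{b\<in>space ?P. early_stop \<alpha> ?yl (?ys b)} = {}" using early by blast
        then show ?thesis by (simp only: emeasure_empty) simp
      qed
    next
      case False
      then have b: "bad l0" "l0 \<le> J" and near: "\<And>j. j \<in> coarse \<alpha> l0 \<Longrightarrow> \<bar>loc_index n ?yl j - istar j\<bar> \<le> 1"
        by (fastforce simp: mis_def)+
      have "measure ?P {b\<in>space ?P. early_stop \<alpha> ?yl (?ys b)} \<le> measure ?P {b\<in>space ?P. stop_level n \<sigma> ?yl (?ys b) \<in> coarse \<alpha> l0}"
      proof (rule P.finite_measure_mono)
        show "{b\<in>space ?P. early_stop \<alpha> ?yl (?ys b)} \<subseteq> {b\<in>space ?P. stop_level n \<sigma> ?yl (?ys b) \<in> coarse \<alpha> l0}"
          using early by blast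
        show "{b\<in>space ?P. stop_level n \<sigma> ?yl (?ys b) \<in> coarse \<alpha> l0} \<in> sets ?P"
          using measurable_levels_pred[of "\<lambda>j i. j \<in> coarse \<alpha> l0"] by (simp add: pred_def)
      qed
      also have "\<dots> \<le> \<alpha> / 16" by (rule prob_coarse_stop[OF \<alpha> b near])
      finally show ?thesis unfolding P.emeasure_eq_measure using False by (auto intro: ennreal_leI)
    qed
    have "(\<integral>\<^sup>+b. \<integral>\<^sup>+c. misses (CI_endpoints \<alpha> n \<sigma> ?yl (?ys b) (observe n \<sigma> f \<kappa>e c)) \<partial>?P \<partial>?P) \<le>
      (\<integral>\<^sup>+b. (ennreal (\<alpha> / 2) + (if wrong_start \<alpha> ?yl (?ys b) then 1 else 0)) + (if early_stop \<alpha> ?yl (?ys b) then 1 else 0) \<partial>?P)"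
      by (intro nn_integral_mono nn_integral_misses_inner \<alpha>)
    also have "\<dots> = ennreal (\<alpha> / 2) + emeasure ?P {b\<in>space ?P. wrong_start \<alpha> ?yl (?ys b)} + emeasure ?P {b\<in>space ?P. early_stop \<alpha> ?yl (?ys b)}"
    proof -
      note [measurable] = m1 m2
      show ?thesis
        unfolding nn_integral_pred[OF m1, symmetric] nn_integral_pred[OF m2, symmetric]
        by (subst nn_integral_add, measurable, subst nn_integral_add, measurable) (simp add: P.emeasure_space_1)
    qed
    also have "\<dots> \<le> ennreal (\<alpha> / 2) + ennreal (\<alpha> / 4) + (ennreal (\<alpha> / 16) + (if mis a then 1 else 0))"
      by (intro add_mono w e order_refl)
    also have "\<dots> = (ennreal (\<alpha> / 2) + ennreal (\<alpha> / 4) + ennreal (\<alpha> / 16)) + (if mis a then 1 else 0)" by (simp only: add.assoc)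
    also have "ennreal (\<alpha> / 2) + ennreal (\<alpha> / 4) + ennreal (\<alpha> / 16) = ennreal (\<alpha> / 2 + \<alpha> / 4 + \<alpha> / 16)"
      using \<alpha> by (simp only: ennreal_plus[symmetric] less_imp_le add_nonneg_nonneg divide_nonneg_pos zero_less_numeral)
    also have "\<alpha> / 2 + \<alpha> / 4 + \<alpha> / 16 = 3 / 4 * \<alpha> + \<alpha> / 16" by simp
    finally show ?thesis .
  qed
  have mm: "Measurable.pred ?P mis"
  proof -
    have [measurable]: "(\<lambda>a. loc_index n (observe n \<sigma> f \<kappa>l a) j) \<in> ?P \<rightarrow>\<^sub>M count_space UNIV" for j
      by (rule measurable_loc_index) (rule measurable_observe)
    have "Measurable.pred ?P (\<lambda>a. 2 \<le> \<bar>loc_index n (observe n \<sigma> f \<kappa>l a) j - istar j\<bar>)" for j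
      using measurable_compose[of "\<lambda>a. loc_index n (observe n \<sigma> f \<kappa>l a) j" ?P "count_space UNIV" "\<lambda>i. 2 \<le> \<bar>i - istar j\<bar>" "count_space UNIV"]
      by simp
    then show ?thesis unfolding mis_def[abs_def]
      by (intro pred_intros_logic pred_intros_finite finite_coarse) auto
  qed
  have mis: "emeasure ?P {a\<in>space ?P. mis a} \<le> ennreal (3 / 16 * \<alpha>)"
  proof (cases "bad l0 \<and> l0 \<le> J")
    case True
    then show ?thesis unfolding P.emeasure_eq_measure mis_def using prob_coarse_misplaced[OF \<alpha>, of l0 \<kappa>l]
      by (auto intro: ennreal_leI)
  next
    case False
    then have "{a\<in>space ?P. mis a} = {}" by (auto simp: mis_def)
    then show ?thesis by (simp only: emeasure_empty) simp
  qed
  have "(\<integral>\<^sup>+a. \<integral>\<^sup>+b. \<integral>\<^sup>+c. misses (CI_endpoints \<alpha> n \<sigma> (observe n \<sigma> f \<kappa>l a) (observe n \<sigma> f \<kappa>s b) (observe n \<sigma> f \<kappa>e c)) \<partial>?P \<partial>?P \<partial>?P)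
    \<le> (\<integral>\<^sup>+a. ennreal (3 / 4 * \<alpha> + \<alpha> / 16) + (if mis a then 1 else 0) \<partial>?P)"
    by (rule nn_integral_mono) (rule middle)
  also have "\<dots> = ennreal (3 / 4 * \<alpha> + \<alpha> / 16) + emeasure ?P {a\<in>space ?P. mis a}"
  proof -
    note [measurable] = mm
    show ?thesis unfolding nn_integral_pred[OF mm, symmetric]
      by (subst nn_integral_add, measurable) (simp add: P.emeasure_space_1)
  qed
  also have "\<dots> \<le> ennreal (3 / 4 * \<alpha> + \<alpha> / 16) + ennreal (3 / 16 * \<alpha>)" by (intro add_left_mono mis)
  also have "\<dots> = ennreal \<alpha>" using \<alpha> by (subst ennreal_plus[symmetric]) auto
  finally show ?thesis .
qed

lemma CI_min_eq:
  "CI_min \<alpha> n \<sigma> \<omega> = {x. fst (CI_endpoints \<alpha> n \<sigma> (copy_l \<sigma> (fst \<omega>) (fst (snd \<omega>)) (snd (snd \<omega>)))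
     (copy_s \<sigma> (fst \<omega>) (fst (snd \<omega>)) (snd (snd \<omega>))) (copy_e \<sigma> (fst \<omega>) (fst (snd \<omega>)))) \<le> ereal x \<and>
    ereal x \<le> snd (CI_endpoints \<alpha> n \<sigma> (copy_l \<sigma> (fst \<omega>) (fst (snd \<omega>)) (snd (snd \<omega>)))
     (copy_s \<sigma> (fst \<omega>) (fst (snd \<omega>)) (snd (snd \<omega>))) (copy_e \<sigma> (fst \<omega>) (fst (snd \<omega>))))}"
  by (simp add: CI_min_def split_def Let_def)

lemma prob_space_joint_law: "prob_space (joint_law n \<sigma> f)"
proof -
  interpret D: prob_space "data_law n \<sigma> f" by (rule prob_space_data_law)
  interpret P: prob_space "noise_law n" by (rule prob_space_noise_law)
  interpret PP: pair_prob_space "noise_law n" "noise_law n" ..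
  interpret DPP: pair_prob_space "data_law n \<sigma> f" "noise_law n \<Otimes>\<^sub>M noise_law n" ..
  show ?thesis unfolding joint_law_def by (rule DPP.prob_space_axioms)
qed

lemma confidence_interval_CI_min:
  assumes \<alpha>: "0 < \<alpha>" "\<alpha> < 1"
  shows "confidence_interval \<alpha> (joint_law n \<sigma> f) M (CI_min \<alpha> n \<sigma>)"
proof -
  let ?Q = "joint_law n \<sigma> f"
  interpret Q: prob_space ?Q by (rule prob_space_joint_law)
  let ?E = "\<lambda>\<omega>. CI_endpoints \<alpha> n \<sigma> (copy_l \<sigma> (fst \<omega>) (fst (snd \<omega>)) (snd (snd \<omega>)))
     (copy_s \<sigma> (fst \<omega>) (fst (snd \<omega>)) (snd (snd \<omega>))) (copy_e \<sigma> (fst \<omega>) (fst (snd \<omega>)))"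
  have E: "?E \<in> ?Q \<rightarrow>\<^sub>M borel \<Otimes>\<^sub>M borel"
    using measurable_joint_endpoints[of \<alpha>] by (simp add: borel_prod)
  have ev: "{\<omega>\<in>space ?Q. x \<in> CI_min \<alpha> n \<sigma> \<omega>} \<in> sets ?Q" for x
  proof -
    have [measurable]: "(\<lambda>\<omega>. fst (?E \<omega>)) \<in> borel_measurable ?Q" "(\<lambda>\<omega>. snd (?E \<omega>)) \<in> borel_measurable ?Q"
      using measurable_compose[OF E measurable_fst] measurable_compose[OF E measurable_snd] by auto
    show ?thesis unfolding CI_min_eq by measurable
  qed
  obtain \<kappa>l \<kappa>s \<kappa>e where "(\<integral>\<^sup>+\<omega>. misses (?E \<omega>) \<partial>?Q) =
     (\<integral>\<^sup>+a. \<integral>\<^sup>+b. \<integral>\<^sup>+c. misses (CI_endpoints \<alpha> n \<sigma> (observe n \<sigma> f \<kappa>l a) (observe n \<sigma> f \<kappa>s b) (observe n \<sigma> f \<kappa>e c))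
       \<partial>noise_law n \<partial>noise_law n \<partial>noise_law n)"
    by (rule nn_integral_endpoints[OF measurable_misses])
  then have "(\<integral>\<^sup>+\<omega>. misses (?E \<omega>) \<partial>?Q) \<le> ennreal \<alpha>" using coverage_integral[OF \<alpha>] by simp
  also have "(\<integral>\<^sup>+\<omega>. misses (?E \<omega>) \<partial>?Q) = (\<integral>\<^sup>+\<omega>. indicator (space ?Q - {\<omega>\<in>space ?Q. M \<in> CI_min \<alpha> n \<sigma> \<omega>}) \<omega> \<partial>?Q)"
    by (intro nn_integral_cong) (auto simp: misses_def CI_min_eq indicator_def)
  also have "\<dots> = ennreal (1 - measure ?Q {\<omega>\<in>space ?Q. M \<in> CI_min \<alpha> n \<sigma> \<omega>})"
    using ev by (subst nn_integral_indicator) (auto simp: Q.emeasure_eq_measure Q.prob_compl)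
  finally have "1 - \<alpha> \<le> measure ?Q {\<omega>\<in>space ?Q. M \<in> CI_min \<alpha> n \<sigma> \<omega>}" using \<alpha> by (simp add: ennreal_le_iff)
  moreover have "random_interval ?Q (CI_min \<alpha> n \<sigma>)"
    unfolding random_interval_def using ev is_interval_ereal by (auto simp: CI_min_eq)
  ultimately show ?thesis by (simp add: confidence_interval_def)
qed

text \<open>The constant combines the \<open>10 * B\<close> from extrapolation between grid points
  with 2560 times the factor of the rate at the stopping level; if the benchmark is infinite, there
  is nothing to show.\<close>

lemma expected_length_CI_min:
  assumes \<alpha>: "0 < \<alpha>" "\<alpha> < 3 / 10"
  shows "expected_length (joint_law n \<sigma> f) (CI_min \<alpha> n \<sigma>) \<le> ennreal (10 + 2560 * length_factor \<alpha>) * benchmark \<alpha> n \<sigma> f"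
proof (cases "benchmark \<alpha> n \<sigma> f")
  case top
  have "0 < 10 + 2560 * length_factor \<alpha>" using length_factor_pos[of \<alpha>] by simp
  then show ?thesis unfolding top by (simp add: ennreal_mult_top)
next
  case (real B)
  let ?Q = "joint_law n \<sigma> f" and ?P = "noise_law n"
  interpret P: prob_space ?P by (rule prob_space_noise_law)
  have \<alpha>1: "\<alpha> < 1" using \<alpha> by simp
  let ?E = "\<lambda>\<omega>. CI_endpoints \<alpha> n \<sigma> (copy_l \<sigma> (fst \<omega>) (fst (snd \<omega>)) (snd (snd \<omega>)))
     (copy_s \<sigma> (fst \<omega>) (fst (snd \<omega>)) (snd (snd \<omega>))) (copy_e \<sigma> (fst \<omega>) (fst (snd \<omega>)))"
  define G :: "ereal \<times> ereal \<Rightarrow> ennreal" where "G e = e2ennreal (snd e - fst e)" for e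
  have G: "G \<in> borel_measurable borel"
    unfolding G_def[abs_def] borel_prod[symmetric] by measurable
  have lf: "0 \<le> length_factor \<alpha>" using length_factor_pos[of \<alpha>] by simp
  have "expected_length ?Q (CI_min \<alpha> n \<sigma>) \<le> (\<integral>\<^sup>+\<omega>. G (?E \<omega>) \<partial>?Q)"
    unfolding expected_length_def CI_min_eq G_def by (intro nn_integral_mono emeasure_ereal_interval_le)
  moreover obtain \<kappa>l \<kappa>s \<kappa>e where "(\<integral>\<^sup>+\<omega>. G (?E \<omega>) \<partial>?Q) =
     (\<integral>\<^sup>+a. \<integral>\<^sup>+b. \<integral>\<^sup>+c. G (CI_endpoints \<alpha> n \<sigma> (observe n \<sigma> f \<kappa>l a) (observe n \<sigma> f \<kappa>s b) (observe n \<sigma> f \<kappa>e c)) \<partial>?P \<partial>?P \<partial>?P)"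
    by (rule nn_integral_endpoints[OF G])
  ultimately have "expected_length ?Q (CI_min \<alpha> n \<sigma>) \<le>
     (\<integral>\<^sup>+a. \<integral>\<^sup>+b. \<integral>\<^sup>+c. G (CI_endpoints \<alpha> n \<sigma> (observe n \<sigma> f \<kappa>l a) (observe n \<sigma> f \<kappa>s b) (observe n \<sigma> f \<kappa>e c)) \<partial>?P \<partial>?P \<partial>?P)"
    by simp
  also have "\<dots> \<le> (\<integral>\<^sup>+a. ennreal (10 * B) + ennreal (length_factor \<alpha>) * (2560 * benchmark \<alpha> n \<sigma> f) \<partial>?P)"
  proof (rule nn_integral_mono)
    fix a
    let ?yl = "observe n \<sigma> f \<kappa>l a" and ?ys = "observe n \<sigma> f \<kappa>s"
    have "(\<integral>\<^sup>+b. \<integral>\<^sup>+c. G (CI_endpoints \<alpha> n \<sigma> ?yl (?ys b) (observe n \<sigma> f \<kappa>e c)) \<partial>?P \<partial>?P) \<le>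
      (\<integral>\<^sup>+b. ennreal (10 * B) + ennreal (length_factor \<alpha>) * ennreal (rate (stop_level n \<sigma> ?yl (?ys b))) \<partial>?P)"
    proof (rule nn_integral_mono)
      fix b
      have "(\<integral>\<^sup>+c. G (CI_endpoints \<alpha> n \<sigma> ?yl (?ys b) (observe n \<sigma> f \<kappa>e c)) \<partial>?P) \<le>
        ennreal (10 * B + length_factor \<alpha> * rate (stop_level n \<sigma> ?yl (?ys b)))"
        unfolding CI_endpoints_eq G_def fst_conv snd_conv
        by (rule expected_length_given_levels[OF stop_level_le \<alpha> start_index_bounds[OF \<alpha>(1) \<alpha>1]]) (use real in auto)
      also have "\<dots> = ennreal (10 * B) + ennreal (length_factor \<alpha>) * ennreal (rate (stop_level n \<sigma> ?yl (?ys b)))"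
        using lf real(1) rate_pos[of "stop_level n \<sigma> ?yl (?ys b)"]
        by (subst ennreal_plus) (auto simp: ennreal_mult')
      finally show "(\<integral>\<^sup>+c. G (CI_endpoints \<alpha> n \<sigma> ?yl (?ys b) (observe n \<sigma> f \<kappa>e c)) \<partial>?P) \<le> \<dots>" .
    qed
    also have "\<dots> = ennreal (10 * B) + ennreal (length_factor \<alpha>) * (\<integral>\<^sup>+b. ennreal (rate (stop_level n \<sigma> ?yl (?ys b))) \<partial>?P)"
    proof -
      have m: "(\<lambda>b. ennreal (rate (stop_level n \<sigma> ?yl (?ys b)))) \<in> borel_measurable ?P"
        by (rule measurable_compose[OF measurable_stop_level_observe]) simp
      show ?thesis using m by (subst nn_integral_add) (auto simp: nn_integral_cmult P.emeasure_space_1)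
    qed
    also have "\<dots> \<le> ennreal (10 * B) + ennreal (length_factor \<alpha>) * (2560 * benchmark \<alpha> n \<sigma> f)"
      by (intro add_left_mono mult_left_mono expected_rate_le_benchmark \<alpha>) simp
    finally show "(\<integral>\<^sup>+b. \<integral>\<^sup>+c. G (CI_endpoints \<alpha> n \<sigma> ?yl (?ys b) (observe n \<sigma> f \<kappa>e c)) \<partial>?P \<partial>?P) \<le> \<dots>" .
  qed
  also have "\<dots> = ennreal (10 * B) + ennreal (length_factor \<alpha>) * (2560 * benchmark \<alpha> n \<sigma> f)" by (simp add: P.emeasure_space_1)
  also have "\<dots> = ennreal (10 + 2560 * length_factor \<alpha>) * benchmark \<alpha> n \<sigma> f"
  proof -
    have "ennreal (10 * B) + ennreal (length_factor \<alpha>) * (2560 * ennreal B) = ennreal (10 * B + length_factor \<alpha> * (2560 * B))"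
      using lf real(1) by (simp add: ennreal_plus ennreal_mult' ennreal_numeral[symmetric] del: ennreal_numeral)
    also have "10 * B + length_factor \<alpha> * (2560 * B) = (10 + 2560 * length_factor \<alpha>) * B" by (simp add: algebra_simps)
    also have "ennreal \<dots> = ennreal (10 + 2560 * length_factor \<alpha>) * ennreal B" using lf by (intro ennreal_mult') simp
    finally show ?thesis unfolding real(2) .
  qed
  finally show ?thesis .
qed

end

theorem theorem4p4:
  fixes \<alpha> :: real
  assumes "0 < \<alpha>" and "\<alpha> < 3 / 10"
  shows "(\<forall>n::nat. \<forall>\<sigma>::real. \<forall>f\<in>convex_class. n \<ge> 1 \<longrightarrow> \<sigma> > 0 \<longrightarrow>
            confidence_interval \<alpha> (joint_law n \<sigma> f) (minimum_value f) (CI_min \<alpha> n \<sigma>)) \<and>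
         (\<exists>C::real. C > 0 \<and> (\<forall>n::nat. \<forall>\<sigma>::real. \<forall>f\<in>convex_class. n \<ge> 1 \<longrightarrow> \<sigma> > 0 \<longrightarrow>
            expected_length (joint_law n \<sigma> f) (CI_min \<alpha> n \<sigma>) \<le> ennreal C * benchmark \<alpha> n \<sigma> f))"
proof (intro conjI allI ballI impI exI[of _ "10 + 2560 * length_factor \<alpha>"])
  show "0 < 10 + 2560 * length_factor \<alpha>" using length_factor_pos[of \<alpha>] by simp
  fix n :: nat and \<sigma> :: real and f assume *: "f \<in> convex_class" "n \<ge> 1" "\<sigma> > 0"
  interpret regression n \<sigma> f by unfold_locales (use * in auto)
  show "confidence_interval \<alpha> (joint_law n \<sigma> f) (minimum_value f) (CI_min \<alpha> n \<sigma>)"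
    using assms by (intro confidence_interval_CI_min) auto
  show "expected_length (joint_law n \<sigma> f) (CI_min \<alpha> n \<sigma>) \<le> ennreal (10 + 2560 * length_factor \<alpha>) * benchmark \<alpha> n \<sigma> f"
    using assms by (rule expected_length_CI_min)
qed

end
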